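(* Let $n\ge 2$ and let $\lambda=(\lambda_1>\lambda_2>\cdots>\lambda_n>0)$ be a partition with $n$ distinct nonzero parts (a regular dominant weight of type $C_n$). Then \[P_\lambda(x;t)=\sum_{\sigma\in\mathcal F(\lambda)} t^{N(\sigma)}\,(1-t)^{\mathrm{des}(\sigma)}\,x^{\mathrm{ct}(\sigma)},\] where $x^{(c_1,\ldots,c_n)}:=x_1^{c_1}\cdots x_n^{c_n}$.
   Context: Type $C_n$: in $\mathbb R^n$ with basis $\varepsilon_1,\dots,\varepsilon_n$ the positive roots are $\Phi^+=\{\varepsilon_i\pm\varepsilon_j:1\le i<j\le n\}\cup\{2\varepsilon_i\}$. The Weyl group is the group $B_n$ of signed permutations (below). For $\mu\in\mathbb Z^n$ write $x^\mu=x_1^{\mu_1}\cdots x_n^{\mu_n}$; $B_n$ acts on Laurent polynomials by $w(x_i)=x_{w(i)}$ with $x_{\bar\imath}:=x_i^{-1}$. For regular $\lambda$ the type $C_n$ Hall–Littlewood polynomial is $P_\lambda(x;t)=\sum_{w\in B_n} w\big(x^\lambda\prod_{\alpha\in\Phi^+}\frac{1-t x^{-\alpha}}{1-x^{-\alpha}}\big)$. Signed permutations. Let $[\bar n]=\{1<2<\cdots<n<\bar n<\overline{n-1}<\cdots<\bar 1\}$ (totally ordered as displayed), with $\bar{\bar\imath}=i$. $B_n$ is the set of bijections $w$ of $[\bar n]$ with $w(\bar\imath)=\overline{w(i)}$, written in window notation $w(1)\cdots w(n)$. For $1\le i<j\le n$, right multiplication by $(i,j)$ swaps the entries in positions $i,j$;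 by $(i,\bar\jmath)$ swaps the entries in positions $i,j$ and then changes the sign (bar) of both; by $(i,\bar\imath)$ changes the sign of the entry in position $i$. These operations are applied in the same way to any column (word) $C$ with entries in $[\bar n]$, e.g. $C(a,\bar b)$. For a word $w$, $\ell_+(w)=|\{(k,l):k<l,\ w(k)>w(l)\}|$ (order of $[\bar n]$). For a word $w$, $w[i,j]=w(i)w(i+1)\cdots w(j)$ (empty if $j<i$), and $N_{ab}(w)$ is the number of indices $i$ with $a<w(i)<b$. Intervals such as $(\bar b,a)$ are open intervals of the totally ordered set $[\bar n]$. Put $\sigma_{ab}=1$ if both $a,b\in\{\bar n,\ldots,\bar 1\}$, and $\sigma_{ab}=0$ otherwise. Fillings. Let $\lambda'_i=|\{k:\lambda_k\ge i\}|$ for $1\le i\le\lambda_1$ (so $\lambda'_1=n$, $\lambda'_{\lambda_1}=1$). A filling $\sigma$ is a left-to-right sequence of columns with entries in $[\bar n]$, top-aligned (row $r$ consists of the $r$-th entries of the columns of height $\ge r$): $\sigma=\mathcal C^{\lambda_1}\cdots\mathcal C^{1}$, where $\mathcal C^i=C'_{i2}\cdots C'_{i,\lambda'_i}C_{i1}\cdots C_{i,\lambda'_i}$ for $i>1$ and $\mathcal C^1=C'_{12}\cdots C'_{1,\lambda'_1}C_{11}$; all columns in $\mathcal C^i$ have height $\lambda'_i$ (there are no primed columns if $\lambda'_i=1$). Conventions: $C'_{i,\lambda'_i+1}:=C_{i1}$; for $i>1$, $C_{i,\lambda'_i+1}:=C'_{i-1,2}$ if $\lambda'_{i-1}>1$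 and $:=C_{i-1,1}$ if $\lambda'_{i-1}=1$ (so the column immediately to the right of $C_{ij}$ is $C_{i,j+1}$ and that of $C'_{ik}$ is $C'_{i,k+1}$). $\mathcal F(\lambda)$ is the set of such fillings satisfying: (1) rows weakly decrease from left to right; (2) no column contains two entries $a,b$ (in different positions) with $a=\pm b$; (3a) for each $i>1$ and $1\le j\le\lambda'_i$ there are $1\le r_1<\cdots<r_p<j$ ($p\ge0$) such that, with $D=C_{ij}(r_1,\bar\jmath)\cdots(r_p,\bar\jmath)$ and $E$ the first $\lambda'_i$ entries of $C_{i,j+1}$, one has $E(r)=D(r)$ for all $r\ne j$, $E(j)\notin\{\pm D(r):r\in[\lambda'_i]\setminus\{j\}\}$ and $E(j)\le D(j)$; (3b) for each $i$ and $2\le k\le\lambda'_i$ there are $1\le r_1<\cdots<r_p<k$ ($p\ge 0$) with $C'_{i,k+1}=C'_{ik}(r_1,\bar k)\cdots(r_p,\bar k)$. Content. The compressed filling is $\bar\sigma=\bar{\mathcal C}^{\lambda_1}\cdots\bar{\mathcal C}^{1}$ with $\bar{\mathcal C}^i=C'_{i2}C_{i1}$ (using the convention $C'_{i2}=C_{i1}$ when $\lambda'_i=1$). Then $\mathrm{ct}(\sigma)=\frac12\sum_{e}\varepsilon_{e}$, the sum over all entries $e$ of $\bar\sigma$, with $\varepsilon_{\bar\imath}:=-\varepsilon_i$; i.e. its $i$-th coordinate is half of (number of entries $i$ minus number of entries $\bar\imath$ in $\bar\sigma$). Statistics. For columns $D,C$ of the same height $d$ with $D\ge C$ entrywise define $N(D,C)$,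 $\mathrm{des}(D,C)$: Case 0: if $D=C$, both are $0$. Case 1: if $C=D(r,\bar\jmath)$ with $r<j$, let $a=D(r)$, $b=D(j)$; $N(D,C)=N_{\bar b a}(D[r+1,j-1])+|(\bar b,a)\setminus\{\pm D(i):1\le i\le j\}|+\sigma_{ab}$, $\mathrm{des}(D,C)=1$. Case 2: if $C=D(r_1,\bar\jmath)\cdots(r_p,\bar\jmath)$ with $1\le r_1<\cdots<r_p<j$, let $D_i=D(r_1,\bar\jmath)\cdots(r_i,\bar\jmath)$; $N(D,C)=\sum_{i=1}^pN(D_{i-1},D_i)$, $\mathrm{des}(D,C)=p$. Case 3: if $C$ differs from $D'=D(r_1,\bar\jmath)\cdots(r_p,\bar\jmath)$ ($1\le r_1<\cdots<r_p<j$, $p\ge0$) only in position $j$, with $C(j)\notin\{\pm D'(r):r\in[d]\setminus\{j\}\}$ and $C(j)<D'(j)$: $N(D,C)=N(D,D')+N_{C(j),D'(j)}(D[j+1,d])$, $\mathrm{des}(D,C)=p+1$. If $C$ has height $d+1$, set $N(D,C)=N(D,C[1,d])$, $\mathrm{des}(D,C)=\mathrm{des}(D,C[1,d])$. For $\sigma\in\mathcal F(\lambda)$ with columns $C_m,\dots,C_1$ from left to right, $N(\sigma)=\sum_{i=1}^{m-1}N(C_{i+1},C_i)+\ell_+(C_1)$ and $\mathrm{des}(\sigma)=\sum_{i=1}^{m-1}\mathrm{des}(C_{i+1},C_i)$. *)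

theory Defs
  imports
    "HOL-Library.Poly_Mapping"
    "HOL-Computational_Algebra.Polynomial"
    "HOL-Computational_Algebra.Fraction_Field"
    "HOL-Combinatorics.Permutations"
begin

text \<open>
  A letter \<open>i\<close> is encoded by the integer \<open>i\<close> and its barred version by \<open>-i\<close>, so the bar is
  negation and the absolute value forgets it. Columns and words are integer lists; rows and
  positions are counted from 1, as are the parts \<open>lam 1, \<dots>, lam n\<close> of the partition and the
  variables.
\<close>

definition alphabet :: "nat \<Rightarrow> int set" where
  "alphabet n = {a. a \<noteq> 0 \<and> \<bar>a\<bar> \<le> int n}"

text \<open>
  The order \<open>1 < 2 < \<dots> < n < -n < \<dots> < -1\<close>; it is the usual order of the integers within
  each sign.
\<close>

definition letter_less :: "int \<Rightarrow> int \<Rightarrow> bool" (infix "\<prec>" 50) where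
  "a \<prec> b \<longleftrightarrow> (0 < a \<and> b < 0) \<or> ((0 < a \<longleftrightarrow> 0 < b) \<and> a < b)"

definition letter_le :: "int \<Rightarrow> int \<Rightarrow> bool" (infix "\<preceq>" 50) where
  "a \<preceq> b \<longleftrightarrow> a \<prec> b \<or> a = b"

definition open_interval :: "nat \<Rightarrow> int \<Rightarrow> int \<Rightarrow> int set" where
  "open_interval n a b = {x \<in> alphabet n. a \<prec> x \<and> x \<prec> b}"


section \<open>Hall--Littlewood polynomials of type C\<close>

text \<open>
  \<open>permutes\<close> fixes all integers outside the alphabet, so each signed permutation is
  represented by exactly one function.
\<close>

definition signed_perms :: "nat \<Rightarrow> (int \<Rightarrow> int) set" where
  "signed_perms n = {w. w permutes alphabet n \<and> (\<forall>a \<in> alphabet n. w (- a) = - w a)}"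

definition eps :: "nat \<Rightarrow> nat \<Rightarrow> int" where
  "eps i = (\<lambda>k. if k = i then 1 else 0)"

definition pos_roots :: "nat \<Rightarrow> (nat \<Rightarrow> int) set" where
  "pos_roots n =
     {(\<lambda>k. eps i k + eps j k) | i j. 1 \<le> i \<and> i < j \<and> j \<le> n}
   \<union> {(\<lambda>k. eps i k - eps j k) | i j. 1 \<le> i \<and> i < j \<and> j \<le> n}
   \<union> {(\<lambda>k. 2 * eps i k) | i. 1 \<le> i \<and> i \<le> n}"

definition monomial :: "nat \<Rightarrow> (nat \<Rightarrow> 'k) \<Rightarrow> (nat \<Rightarrow> int) \<Rightarrow> 'k::field" where
  "monomial n x \<mu> = (\<Prod>i = 1..n. x i powi \<mu> i)"

definition signed_var :: "(nat \<Rightarrow> 'k) \<Rightarrow> int \<Rightarrow> 'k::field" where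
  "signed_var x a = (if 0 < a then x (nat a) else inverse (x (nat (- a))))"

definition hl_term :: "nat \<Rightarrow> (nat \<Rightarrow> nat) \<Rightarrow> (nat \<Rightarrow> 'k) \<Rightarrow> 'k \<Rightarrow> 'k::field" where
  "hl_term n lam x t =
     monomial n x (\<lambda>i. int (lam i)) *
     (\<Prod>\<alpha> \<in> pos_roots n.
        (1 - t * monomial n x (\<lambda>i. - \<alpha> i)) / (1 - monomial n x (\<lambda>i. - \<alpha> i)))"

text \<open>
  The action of \<open>w\<close> on a rational expression in the variables is the substitution of
  \<open>signed_var x (w i)\<close> for \<open>x i\<close>.
\<close>

definition hall_littlewood :: "nat \<Rightarrow> (nat \<Rightarrow> nat) \<Rightarrow> (nat \<Rightarrow> 'k) \<Rightarrow> 'k \<Rightarrow> 'k::field" where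
  "hall_littlewood n lam x t =
     (\<Sum>w \<in> signed_perms n. hl_term n lam (\<lambda>i. signed_var x (w (int i))) t)"

text \<open>
  Laurent polynomials over \<open>\<int>[t]\<close> in variables indexed by the natural numbers, as the group ring
  of the finitely supported exponent vectors, and their field of fractions. The summands of a
  Hall--Littlewood polynomial are rational functions, which is why the identity is stated there.
\<close>

type_synonym laurent = "(nat \<Rightarrow>\<^sub>0 int) \<Rightarrow>\<^sub>0 int poly"

definition var_x :: "nat \<Rightarrow> laurent fract" where
  "var_x i = Fract (Poly_Mapping.single (Poly_Mapping.single i 1) 1) 1"

definition var_t :: "laurent fract" where
  "var_t = Fract (Poly_Mapping.single 0 [:0, 1:]) 1"


section \<open>Operations on columns\<close>

abbreviation entry :: "int list \<Rightarrow> nat \<Rightarrow> int" where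
  "entry C r \<equiv> C ! (r - 1)"

definition segment :: "int list \<Rightarrow> nat \<Rightarrow> nat \<Rightarrow> int list" where
  "segment w i j = map (entry w) [i..<j + 1]"

definition count_between :: "int \<Rightarrow> int \<Rightarrow> int list \<Rightarrow> nat" where
  "count_between a b w = length (filter (\<lambda>x. a \<prec> x \<and> x \<prec> b) w)"

definition inversions :: "int list \<Rightarrow> nat" where
  "inversions w =
     card {(k, l). 1 \<le> k \<and> k < l \<and> l \<le> length w \<and> entry w l \<prec> entry w k}"

text \<open>Right multiplication by \<open>(r, -j)\<close> and by \<open>(r\<^sub>1, -j) \<cdots> (r\<^sub>p, -j)\<close>, applied from left to right.\<close>

definition bar_swap :: "nat \<Rightarrow> nat \<Rightarrow> int list \<Rightarrow> int list" where
  "bar_swap r j C = C[r - 1 := - entry C j, j - 1 := - entry C r]"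

definition bar_swaps :: "nat list \<Rightarrow> nat \<Rightarrow> int list \<Rightarrow> int list" where
  "bar_swaps rs j C = fold (\<lambda>r. bar_swap r j) rs C"

definition rows_above :: "nat list \<Rightarrow> nat \<Rightarrow> bool" where
  "rows_above rs j \<longleftrightarrow> sorted_wrt (<) rs \<and> set rs \<subseteq> {1..<j}"


section \<open>Fillings\<close>

definition conj_part :: "nat \<Rightarrow> (nat \<Rightarrow> nat) \<Rightarrow> nat \<Rightarrow> nat" where
  "conj_part n lam i = card {k \<in> {1..n}. i \<le> lam k}"

text \<open>\<open>Unprimed i j\<close> and \<open>Primed i k\<close> are the names of the columns \<open>C\<^sub>i\<^sub>j\<close> and \<open>C'\<^sub>i\<^sub>k\<close>.\<close>

datatype label = Unprimed nat nat | Primed nat nat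

fun block_of :: "label \<Rightarrow> nat" where
  "block_of (Unprimed i j) = i"
| "block_of (Primed i k) = i"

definition block :: "nat \<Rightarrow> (nat \<Rightarrow> nat) \<Rightarrow> nat \<Rightarrow> label list" where
  "block n lam i =
     map (Primed i) [2..<conj_part n lam i + 1] @
     map (Unprimed i) [1..<(if i = 1 then 1 else conj_part n lam i) + 1]"

definition labels :: "nat \<Rightarrow> (nat \<Rightarrow> nat) \<Rightarrow> label list" where
  "labels n lam = concat (map (block n lam) (rev [1..<lam 1 + 1]))"

text \<open>
  The two conditions relating a column \<open>C\<close> to the column immediately to its right, which is
  \<open>C'\<close> below; \<open>take (length C) C'\<close> matters only when \<open>C'\<close> starts a new, taller block.
\<close>

definition step_unprimed :: "nat \<Rightarrow> int list \<Rightarrow> int list \<Rightarrow> bool" where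
  "step_unprimed j C C' \<longleftrightarrow>
     (\<exists>rs. rows_above rs j \<and>
        (let D = bar_swaps rs j C; E = take (length C) C' in
           (\<forall>r \<in> {1..length C} - {j}. entry E r = entry D r) \<and>
           (\<forall>r \<in> {1..length C} - {j}. entry E j \<noteq> entry D r \<and> entry E j \<noteq> - entry D r) \<and>
           entry E j \<preceq> entry D j))"

definition step_primed :: "nat \<Rightarrow> int list \<Rightarrow> int list \<Rightarrow> bool" where
  "step_primed k C C' \<longleftrightarrow> (\<exists>rs. rows_above rs k \<and> C' = bar_swaps rs k C)"

fun step_ok :: "label \<Rightarrow> int list \<Rightarrow> int list \<Rightarrow> bool" where
  "step_ok (Unprimed i j) C C' = (1 < i \<longrightarrow> step_unprimed j C C')"
| "step_ok (Primed i k) C C' = step_primed k C C'"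

text \<open>A filling is the list of its columns from left to right, named by \<open>labels n lam\<close>.\<close>

definition fillings :: "nat \<Rightarrow> (nat \<Rightarrow> nat) \<Rightarrow> int list list set" where
  "fillings n lam = {\<sigma>.
     length \<sigma> = length (labels n lam) \<and>
     (\<forall>q < length \<sigma>. length (\<sigma> ! q) = conj_part n lam (block_of (labels n lam ! q))
                   \<and> set (\<sigma> ! q) \<subseteq> alphabet n) \<and>
     (\<forall>p q r. p < q \<and> q < length \<sigma> \<and> 1 \<le> r \<and> r \<le> length (\<sigma> ! p) \<and> r \<le> length (\<sigma> ! q)
        \<longrightarrow> entry (\<sigma> ! q) r \<preceq> entry (\<sigma> ! p) r) \<and>
     (\<forall>q < length \<sigma>. \<forall>r \<in> {1..length (\<sigma> ! q)}. \<forall>s \<in> {1..length (\<sigma> ! q)}. r \<noteq> s \<longrightarrow>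
        entry (\<sigma> ! q) r \<noteq> entry (\<sigma> ! q) s \<and> entry (\<sigma> ! q) r \<noteq> - entry (\<sigma> ! q) s) \<and>
     (\<forall>q. q + 1 < length \<sigma> \<longrightarrow> step_ok (labels n lam ! q) (\<sigma> ! q) (\<sigma> ! (q + 1)))}"


section \<open>Content\<close>

definition column :: "nat \<Rightarrow> (nat \<Rightarrow> nat) \<Rightarrow> int list list \<Rightarrow> label \<Rightarrow> int list" where
  "column n lam \<sigma> l = the (map_of (zip (labels n lam) \<sigma>) l)"

definition compressed :: "nat \<Rightarrow> (nat \<Rightarrow> nat) \<Rightarrow> int list list \<Rightarrow> int list list" where
  "compressed n lam \<sigma> = concat (map (\<lambda>i.
     [column n lam \<sigma> (if conj_part n lam i = 1 then Unprimed i 1 else Primed i 2),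
      column n lam \<sigma> (Unprimed i 1)]) (rev [1..<lam 1 + 1]))"

definition double_ct :: "nat \<Rightarrow> (nat \<Rightarrow> nat) \<Rightarrow> int list list \<Rightarrow> nat \<Rightarrow> int" where
  "double_ct n lam \<sigma> i =
     int (count_list (concat (compressed n lam \<sigma>)) (int i))
   - int (count_list (concat (compressed n lam \<sigma>)) (- int i))"

text \<open>The division is exact for every filling; see \<open>two_ct\<close>.\<close>

definition ct :: "nat \<Rightarrow> (nat \<Rightarrow> nat) \<Rightarrow> int list list \<Rightarrow> nat \<Rightarrow> int" where
  "ct n lam \<sigma> i = double_ct n lam \<sigma> i div 2"

lemma count_list_concat_pairs:
  "count_list (concat (concat (map (\<lambda>i. [f i, g i]) xs))) a
     = (\<Sum>i\<leftarrow>xs. count_list (f i) a + count_list (g i) a)"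
  by (induction xs) auto

lemma int_sum_list_map: "int (sum_list (map f xs)) = (\<Sum>x\<leftarrow>xs. int (f x))"
  by (induction xs) auto

lemma count_list_map_abs:
  "0 < (a::int) \<Longrightarrow> count_list (map abs c) a = count_list c a + count_list c (- a)"
  by (induction c) (auto simp: abs_if)

lemma mset_abs_bar_swap:
  assumes "1 \<le> r" "r < j" "j \<le> length C"
  shows "mset (map abs (bar_swap r j C)) = mset (map abs C)"
proof -
  have "map abs (bar_swap r j C) = (map abs C)[r - 1 := map abs C ! (j - 1), j - 1 := map abs C ! (r - 1)]"
    using assms by (simp add: bar_swap_def map_update)
  then show ?thesis
    using assms mset_swap[of "j - 1" "map abs C" "r - 1"] by simp
qed

lemma length_bar_swaps: "length (bar_swaps rs j C) = length C"
  unfolding bar_swaps_def by (induction rs arbitrary: C) (auto simp: bar_swap_def)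

lemma mset_abs_bar_swaps:
  assumes "rows_above rs j" "j \<le> length C"
  shows "mset (map abs (bar_swaps rs j C)) = mset (map abs C)"
proof -
  have "set rs \<subseteq> {1..<j}" using assms by (simp add: rows_above_def)
  then show ?thesis using assms(2)
  proof (induction rs arbitrary: C)
    case Nil then show ?case by (simp add: bar_swaps_def)
  next
    case (Cons r rs)
    have "mset (map abs (bar_swaps rs j (bar_swap r j C))) = mset (map abs (bar_swap r j C))"
      using Cons by (simp add: bar_swap_def)
    then show ?case using Cons.prems mset_abs_bar_swap[of r j C] by (simp add: bar_swaps_def)
  qed
qed

lemma set_block: "l \<in> set (block n lam i) \<Longrightarrow> block_of l = i"
  by (auto simp: block_def)

lemma distinct_block: "distinct (block n lam i)"
  by (auto simp: block_def distinct_map inj_on_def)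

lemma distinct_labels: "distinct (labels n lam)"
proof -
  have "distinct xs \<Longrightarrow> distinct (concat (map (block n lam) xs))" for xs
  proof (induction xs)
    case (Cons i xs)
    have "set (block n lam i) \<inter> (\<Union>x\<in>set xs. set (block n lam x)) = {}"
      using Cons.prems by (auto dest!: set_block)
    then show ?case using Cons distinct_block by simp
  qed simp
  then show ?thesis by (simp add: labels_def)
qed

lemma column_nth:
  assumes "length \<sigma> = length (labels n lam)" "q < length \<sigma>"
  shows "column n lam \<sigma> (labels n lam ! q) = \<sigma> ! q"
  using assms distinct_labels by (simp add: column_def map_of_zip_nth)

lemma mset_abs_compressed:
  assumes \<sigma>: "\<sigma> \<in> fillings n lam" and i: "1 \<le> i" "i \<le> lam 1" and h: "2 \<le> conj_part n lam i"
  shows "mset (map abs (column n lam \<sigma> (Primed i 2))) = mset (map abs (column n lam \<sigma> (Unprimed i 1)))"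
proof -
  define h where "h = conj_part n lam i"
  define L where "L = labels n lam"
  have "i \<in> set (rev [1..<lam 1 + 1])" using i by auto
  then obtain ys zs where "rev [1..<lam 1 + 1] = ys @ i # zs"
    by (meson split_list)
  then obtain A B where L: "L = A @ block n lam i @ B"
    by (simp add: L_def labels_def)
  define m where "m = length A"
  have bl: "h \<le> length (block n lam i)" using h unfolding block_def h_def by auto
  have nthL: "L ! (m + s) = block n lam i ! s" if "s < h" for s
    using that bl by (simp add: L m_def nth_append)
  have nP: "L ! (m + s) = Primed i (2 + s)" if "s < h - 1" for s
    using that by (subst nthL) (auto simp: block_def nth_append simp del: upt_Suc simp flip: h_def)
  have nU: "L ! (m + (h - 1)) = Unprimed i 1"
    using h by (subst nthL) (auto simp: block_def nth_append h_def simp del: upt_Suc)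
  have len: "m + h \<le> length \<sigma>" and lenL: "length \<sigma> = length L"
    using bl \<sigma> by (auto simp: fillings_def L m_def L_def[symmetric])
  have hgt: "length (\<sigma> ! (m + s)) = h" if "s < h - 1" for s
  proof -
    have "m + s < length \<sigma>" using that len by linarith
    then show ?thesis using \<sigma> nP[OF that] by (simp add: fillings_def L_def h_def)
  qed
  have "mset (map abs (\<sigma> ! (m + s))) = mset (map abs (\<sigma> ! m))" if "s \<le> h - 1" for s
    using that
  proof (induction s)
    case (Suc s)
    have "m + s + 1 < length \<sigma>" using Suc.prems len h by (simp add: h_def)
    then have "step_ok (L ! (m + s)) (\<sigma> ! (m + s)) (\<sigma> ! (m + s + 1))"
      using \<sigma> unfolding fillings_def L_def by blast
    then obtain rs where "rows_above rs (2 + s)" "\<sigma> ! (m + Suc s) = bar_swaps rs (2 + s) (\<sigma> ! (m + s))"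
      using nP[of s] Suc.prems by (auto simp: step_primed_def)
    then show ?case using Suc mset_abs_bar_swaps[of rs "2 + s" "\<sigma> ! (m + s)"] hgt[of s] by simp
  qed simp
  then have *: "mset (map abs (\<sigma> ! (m + (h - 1)))) = mset (map abs (\<sigma> ! m))" by blast
  have "column n lam \<sigma> (L ! m) = \<sigma> ! m" "column n lam \<sigma> (L ! (m + (h - 1))) = \<sigma> ! (m + (h - 1))"
    using column_nth[of \<sigma> n lam] len lenL h unfolding L_def h_def by simp_all
  then show ?thesis using * nU nP[of 0] h by (simp add: h_def)
qed

lemma int_swap_diff: "p + r = q + s \<Longrightarrow> p + q - (r + s) = 2 * (p - s)" for p q r s :: int
  by algebra

lemma two_ct:
  assumes "1 \<le> n" and \<sigma>: "\<sigma> \<in> fillings n lam"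
  shows "2 * ct n lam \<sigma> i = double_ct n lam \<sigma> i"
proof (cases "i = 0")
  case True then show ?thesis by (simp add: ct_def double_ct_def)
next
  case False
  define f where "f b = column n lam \<sigma> (if conj_part n lam b = 1 then Unprimed b 1 else Primed b 2)" for b
  define g where "g b = column n lam \<sigma> (Unprimed b 1)" for b
  define xs where "xs = rev [1..<lam 1 + 1]"
  have fg: "count_list (map abs (f b)) (int i) = count_list (map abs (g b)) (int i)" if "b \<in> set xs" for b
  proof -
    have b: "1 \<le> b" "b \<le> lam 1" using that by (auto simp: xs_def)
    then have "1 \<in> {k \<in> {1..n}. b \<le> lam k}" using assms by auto
    then have "conj_part n lam b \<noteq> 0" unfolding conj_part_def by (subst card_0_eq) auto
    then have "mset (map abs (f b)) = mset (map abs (g b))"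
      using mset_abs_compressed[OF \<sigma> b] by (cases "conj_part n lam b = 1") (auto simp: f_def g_def)
    then show ?thesis by (metis count_mset)
  qed
  have "even ((\<Sum>b\<leftarrow>xs. int (count_list (f b) (int i) + count_list (g b) (int i)))
            - (\<Sum>b\<leftarrow>xs. int (count_list (f b) (- int i) + count_list (g b) (- int i))))"
    using fg
  proof (induction xs)
    case (Cons b xs)
    have eq: "count_list (f b) (int i) + count_list (f b) (- int i)
        = count_list (g b) (int i) + count_list (g b) (- int i)"
      using Cons.prems[of b] False by (simp add: count_list_map_abs)
    from eq have "int (count_list (f b) (int i)) + int (count_list (f b) (- int i))
        = int (count_list (g b) (int i)) + int (count_list (g b) (- int i))"
      by (simp only: flip: of_nat_add)
    then have "int (count_list (f b) (int i) + count_list (g b) (int i))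
             - int (count_list (f b) (- int i) + count_list (g b) (- int i))
             = 2 * (int (count_list (f b) (int i)) - int (count_list (g b) (- int i)))"
      unfolding of_nat_add by (rule int_swap_diff)
    then have "even (int (count_list (f b) (int i) + count_list (g b) (int i))
                   - int (count_list (f b) (- int i) + count_list (g b) (- int i)))"
      by (metis dvd_triv_left)
    moreover have "even ((\<Sum>b\<leftarrow>xs. int (count_list (f b) (int i) + count_list (g b) (int i)))
            - (\<Sum>b\<leftarrow>xs. int (count_list (f b) (- int i) + count_list (g b) (- int i))))"
      using Cons by simp
    moreover have "even (p + u - (q + v))" if "even (p - q)" "even (u - v)" for p q u v :: int
      using that by presburger
    ultimately show ?case unfolding list.map sum_list.Cons by blast
  qed simp
  then have "even (double_ct n lam \<sigma> i)"
    unfolding double_ct_def compressed_def count_list_concat_pairs int_sum_list_map f_def g_def xs_def .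
  then show ?thesis by (simp add: ct_def)
qed


section \<open>Statistics\<close>

definition sigma_sign :: "int \<Rightarrow> int \<Rightarrow> nat" where
  "sigma_sign a b = (if a < 0 \<and> b < 0 then 1 else 0)"

definition N_swap :: "nat \<Rightarrow> int list \<Rightarrow> nat \<Rightarrow> nat \<Rightarrow> nat" where
  "N_swap n D r j =
     (let a = entry D r; b = entry D j in
        count_between (- b) a (segment D (r + 1) (j - 1))
      + card (open_interval n (- b) a - (\<Union>i \<in> {1..j}. {entry D i, - entry D i}))
      + sigma_sign a b)"

definition N_swaps :: "nat \<Rightarrow> int list \<Rightarrow> nat list \<Rightarrow> nat \<Rightarrow> nat" where
  "N_swaps n D rs j = (\<Sum>i < length rs. N_swap n (bar_swaps (take i rs) j D) (rs ! i) j)"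

text \<open>
  \<open>col_stat n D C v d\<close> says that \<open>N(D, C) = v\<close> and \<open>des(D, C) = d\<close>, for columns of equal height.
  In \<open>drop\<close>, the list \<open>rs\<close> may be empty.
\<close>

inductive col_stat :: "nat \<Rightarrow> int list \<Rightarrow> int list \<Rightarrow> nat \<Rightarrow> nat \<Rightarrow> bool" for n where
  same: "col_stat n D D 0 0"
| swap: "1 \<le> r \<Longrightarrow> r < j \<Longrightarrow> j \<le> length D \<Longrightarrow>
    col_stat n D (bar_swap r j D) (N_swap n D r j) 1"
| swaps: "rows_above rs j \<Longrightarrow> rs \<noteq> [] \<Longrightarrow> j \<le> length D \<Longrightarrow>
    col_stat n D (bar_swaps rs j D) (N_swaps n D rs j) (length rs)"
| drop: "rows_above rs j \<Longrightarrow> 1 \<le> j \<Longrightarrow> j \<le> length D \<Longrightarrow> D' = bar_swaps rs j D \<Longrightarrow>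
    length C = length D \<Longrightarrow>
    (\<forall>r \<in> {1..length D} - {j}. entry C r = entry D' r) \<Longrightarrow>
    (\<forall>r \<in> {1..length D} - {j}. entry C j \<noteq> entry D' r \<and> entry C j \<noteq> - entry D' r) \<Longrightarrow>
    entry C j \<prec> entry D' j \<Longrightarrow>
    col_stat n D C
      (N_swaps n D rs j
        + count_between (entry C j) (entry D' j) (segment D (j + 1) (length D)))
      (length rs + 1)"

definition distinct_column :: "int list \<Rightarrow> bool" where
  "distinct_column C \<longleftrightarrow> (\<forall>r \<in> {1..length C}. \<forall>s \<in> {1..length C}. r \<noteq> s \<longrightarrow>
     entry C r \<noteq> entry C s \<and> entry C r \<noteq> - entry C s)"

lemma entry_bar_swap:
  assumes "1 \<le> r" "r < j" "j \<le> length C" "1 \<le> s"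
  shows "entry (bar_swap r j C) s =
    (if s = j then - entry C r else if s = r then - entry C j else entry C s)"
  using assms by (auto simp: bar_swap_def nth_list_update)

lemma distinct_column_bar_swap:
  assumes "distinct_column C" "1 \<le> r" "r < j" "j \<le> length C"
  shows "distinct_column (bar_swap r j C)"
proof -
  define \<tau> where "\<tau> s = (if s = j then r else if s = r then j else s)" for s
  have l: "length (bar_swap r j C) = length C" by (simp add: bar_swap_def)
  have iff: "a \<noteq> b \<and> a \<noteq> - b \<longleftrightarrow> \<bar>a\<bar> \<noteq> \<bar>b\<bar>" for a b :: int
    by (auto simp: abs_eq_iff)
  have abs: "\<bar>entry (bar_swap r j C) s\<bar> = \<bar>entry C (\<tau> s)\<bar>" if "s \<in> {1..length C}" for s
    using that assms entry_bar_swap[of r j C s] by (simp add: \<tau>_def)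
  have \<tau>: "\<tau> s \<in> {1..length C}" if "s \<in> {1..length C}" for s
    using that assms by (simp add: \<tau>_def)
  have inj: "\<tau> s \<noteq> \<tau> u" if "s \<noteq> u" for s u
    using that by (simp add: \<tau>_def)
  have "\<bar>entry C a\<bar> \<noteq> \<bar>entry C b\<bar>" if "a \<in> {1..length C}" "b \<in> {1..length C}" "a \<noteq> b" for a b
    using assms(1) that unfolding distinct_column_def iff by blast
  then show ?thesis
    unfolding distinct_column_def l iff using abs \<tau> inj by metis
qed

lemma bar_swaps_changed:
  assumes "distinct rs" "set rs \<subseteq> {1..<j}" "j \<le> length D" "distinct_column D"
    "r \<in> {1..length D} - {j}"
  shows "entry (bar_swaps rs j D) r \<noteq> entry D r \<longleftrightarrow> r \<in> set rs"
    and "rs \<noteq> [] \<Longrightarrow> entry (bar_swaps rs j D) (hd rs) = - entry D j"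
  using assms
proof (induction rs arbitrary: D r)
  case Nil
  { case 1 then show ?case by (simp add: bar_swaps_def) }
  { case 2 then show ?case by simp }
next
  case (Cons q rs)
  have step: "bar_swaps (q # rs) j D = bar_swaps rs j (bar_swap q j D)" for D
    by (simp add: bar_swaps_def)
  have IH: "entry (bar_swaps rs j (bar_swap q j D)) r \<noteq> entry (bar_swap q j D) r \<longleftrightarrow> r \<in> set rs"
    if "distinct (q # rs)" "set (q # rs) \<subseteq> {1..<j}" "j \<le> length D" "distinct_column D"
      "r \<in> {1..length D} - {j}" for D r
    using Cons.IH(1)[of "bar_swap q j D" r] that distinct_column_bar_swap[of D q j]
    by (simp add: bar_swap_def)
  { case 1
    have "q \<in> {1..length D}" "j \<in> {1..length D}" "q \<noteq> j" using 1 by auto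
    then have "entry D q \<noteq> - entry D j" using 1(4) unfolding distinct_column_def by blast
    then have "- entry D j \<noteq> entry D q" by simp
    moreover have "entry (bar_swap q j D) r = (if r = q then - entry D j else entry D r)"
      using 1 entry_bar_swap[of q j D r] by simp
    moreover have "q \<notin> set rs" using 1 by simp
    ultimately show ?case using IH[OF 1] unfolding step by (cases "r = q") simp_all }
  { case 2
    have q: "q \<in> {1..length D} - {j}" using 2 by auto
    have "entry (bar_swap q j D) q = - entry D j"
      using 2 q entry_bar_swap[of q j D q] by simp
    moreover have "q \<notin> set rs" using 2 by simp
    ultimately show ?case using IH[OF 2(2-5) q] unfolding step by simp }
qed

lemma distinct_column_bar_swaps:
  assumes "set rs \<subseteq> {1..<j}" "j \<le> length D" "distinct_column D"
  shows "distinct_column (bar_swaps rs j D)"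
  using assms
proof (induction rs arbitrary: D)
  case (Cons r rs)
  then show ?case using Cons.IH[of "bar_swap r j D"] distinct_column_bar_swap[of D r j]
    by (auto simp: bar_swaps_def bar_swap_def)
qed (simp add: bar_swaps_def)

definition changed :: "int list \<Rightarrow> int list \<Rightarrow> nat set" where
  "changed D C = {r \<in> {1..length D}. entry C r \<noteq> entry D r}"


lemma changed_bar_swaps:
  assumes rs: "rows_above rs j" and j: "1 \<le> j" "j \<le> length D" and D: "distinct_column D"
    and D': "D' = bar_swaps rs j D"
    and C: "\<forall>r \<in> {1..length D} - {j}. entry C r = entry D' r"
      "\<forall>r \<in> {1..length D} - {j}. entry C j \<noteq> entry D' r \<and> entry C j \<noteq> - entry D' r"
    and ne: "rs = [] \<Longrightarrow> entry C j \<noteq> entry D j"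
  shows "changed D C = insert j (set rs)"
proof -
  have rs': "distinct rs" "set rs \<subseteq> {1..<j}" using rs by (auto simp: rows_above_def strict_sorted_iff)
  note ch = bar_swaps_changed[OF rs' j(2) D, folded D']
  have "entry C j \<noteq> entry D j"
  proof (cases "rs = []")
    case False
    then have "hd rs \<in> {1..length D} - {j}" using rs'(2) j by (cases rs) auto
    then show ?thesis using bspec[OF C(2), of "hd rs"] ch(2)[of "hd rs"] False by simp
  qed (use ne in blast)
  moreover have "entry C r \<noteq> entry D r \<longleftrightarrow> r \<in> set rs" if "r \<in> {1..length D} - {j}" for r
    using ch(1)[OF that] bspec[OF C(1) that] by simp
  ultimately have "r \<in> changed D C \<longleftrightarrow> r \<in> insert j (set rs)" for r
    using rs'(2) j unfolding changed_def by (cases "r = j") fastforce+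
  then show ?thesis by blast
qed

lemma col_stat_cases_pivot:
  assumes "col_stat n D C v d" and D: "distinct_column D"
  obtains (refl) "C = D" "v = 0" "d = 0"
  | (pivot) rs j D' where "rows_above rs j" "D' = bar_swaps rs j D" "changed D C = insert j (set rs)"
    "(C = D' \<and> v = N_swaps n D rs j \<and> d = length rs) \<or>
     (entry C j \<prec> entry D' j \<and>
      v = N_swaps n D rs j + count_between (entry C j) (entry D' j) (segment D (j + 1) (length D)) \<and>
      d = length rs + 1)"
proof -
  have exact: thesis
    if rs: "rows_above rs j" "rs \<noteq> []" "j \<le> length D" and C: "C = bar_swaps rs j D"
      and v: "v = N_swaps n D rs j" "d = length rs" for rs j
  proof -
    have sub: "set rs \<subseteq> {1..<j}" using rs(1) by (simp add: rows_above_def)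
    have "hd rs \<in> {1..<j}" using sub rs(2) hd_in_set by blast
    then have "1 \<le> j" by simp
    have "distinct_column C" using distinct_column_bar_swaps[OF sub rs(3) D] C by simp
    moreover have "length C = length D" using C by (simp add: length_bar_swaps)
    ultimately have "\<forall>r \<in> {1..length D} - {j}. entry C j \<noteq> entry C r \<and> entry C j \<noteq> - entry C r"
      using \<open>1 \<le> j\<close> rs(3) by (auto simp: distinct_column_def)
    then have "changed D C = insert j (set rs)"
      using rs(2) by (intro changed_bar_swaps[OF rs(1) \<open>1 \<le> j\<close> rs(3) D C]) simp_all
    then show thesis using v C by (intro pivot[OF rs(1) C]) simp_all
  qed
  show thesis
    using assms(1)
  proof cases
    case same then show thesis by (rule refl)
  next
    case (swap r j)
    then show thesis using exact[of "[r]" j]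
      by (simp add: rows_above_def bar_swaps_def N_swaps_def)
  next
    case (swaps rs j)
    then show thesis using exact[of rs j] by blast
  next
    case (drop rs j D')
    have "rs = [] \<Longrightarrow> entry C j \<noteq> entry D j"
      using drop by (auto simp: bar_swaps_def letter_less_def)
    then have "changed D C = insert j (set rs)"
      using drop D by (intro changed_bar_swaps[of rs j D D' C])
    then show thesis using drop by (intro pivot[of rs j D'] disjI2 conjI)
  qed
qed

lemma changed_refl: "changed D D = {}"
  by (simp add: changed_def)

text \<open>
  The rows in which two columns differ determine \<open>j\<close> (the last one) and \<open>rs\<close> (the others), so
  \<open>N_col\<close> and \<open>des_col\<close> are well defined.
\<close>

lemma col_stat_unique:
  assumes st: "col_stat n D C v d" "col_stat n D C v' d'" and D: "distinct_column D"
  shows "v = v' \<and> d = d'"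
proof (cases "C = D")
  case True
  have "v = 0 \<and> d = 0" if "col_stat n D C v d" for v d
    using that D
  proof (cases rule: col_stat_cases_pivot)
    case (pivot rs j D')
    then show ?thesis using True by (simp add: changed_refl)
  qed simp
  then show ?thesis using st by blast
next
  case False
  obtain rs j D' where 1: "rows_above rs j" "D' = bar_swaps rs j D" "changed D C = insert j (set rs)"
    "(C = D' \<and> v = N_swaps n D rs j \<and> d = length rs) \<or>
     (entry C j \<prec> entry D' j \<and>
      v = N_swaps n D rs j + count_between (entry C j) (entry D' j) (segment D (j + 1) (length D)) \<and>
      d = length rs + 1)"
    using False by (blast intro: col_stat_cases_pivot[OF st(1) D])
  obtain rs' j' D'' where 2: "rows_above rs' j'" "D'' = bar_swaps rs' j' D"
    "changed D C = insert j' (set rs')"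
    "(C = D'' \<and> v' = N_swaps n D rs' j' \<and> d' = length rs') \<or>
     (entry C j' \<prec> entry D'' j' \<and>
      v' = N_swaps n D rs' j' + count_between (entry C j') (entry D'' j') (segment D (j' + 1) (length D)) \<and>
      d' = length rs' + 1)"
    using False by (blast intro: col_stat_cases_pivot[OF st(2) D])
  have pivot: "Max (insert j (set rs)) = j" "insert j (set rs) - {j} = set rs"
    if "rows_above rs j" for rs and j :: nat
    using that by (auto simp: rows_above_def intro!: Max_eqI)
  have "j = j'" using pivot(1)[OF 1(1)] pivot(1)[OF 2(1)] 1(3) 2(3) by simp
  moreover from this have "set rs = set rs'"
    by (metis pivot(2)[OF 1(1)] pivot(2)[OF 2(1)] 1(3) 2(3))
  then have "rs = rs'"
    using 1(1) 2(1) by (intro sorted_distinct_set_unique) (auto simp: rows_above_def strict_sorted_iff)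
  ultimately have eq: "rs' = rs" "j' = j" "D'' = D'" using 1(2) 2(2) by simp_all
  have "\<not> a \<prec> a" for a by (simp add: letter_less_def)
  then show ?thesis using 1(4) 2(4) unfolding eq by (elim disjE conjE) simp_all
qed

definition N_col :: "nat \<Rightarrow> int list \<Rightarrow> int list \<Rightarrow> nat" where
  "N_col n D C = (THE v. \<exists>d. col_stat n D (take (length D) C) v d)"

definition des_col :: "nat \<Rightarrow> int list \<Rightarrow> int list \<Rightarrow> nat" where
  "des_col n D C = (THE d. \<exists>v. col_stat n D (take (length D) C) v d)"

definition N_fill :: "nat \<Rightarrow> int list list \<Rightarrow> nat" where
  "N_fill n \<sigma> = (\<Sum>q < length \<sigma> - 1. N_col n (\<sigma> ! q) (\<sigma> ! (q + 1))) + inversions (last \<sigma>)"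

definition des_fill :: "nat \<Rightarrow> int list list \<Rightarrow> nat" where
  "des_fill n \<sigma> = (\<Sum>q < length \<sigma> - 1. des_col n (\<sigma> ! q) (\<sigma> ! (q + 1)))"

end

theory Submission
  imports Defs
begin

text \<open>
  Let \<open>y\<close> assign a value to every letter, with \<open>y (- a) = inverse (y a)\<close>. Call a family \<open>F\<close> of
  functions of \<open>y\<close>, indexed by the words of a fixed height, equivariant if the Demazure--Lusztig
  operators, acting through \<open>y\<close>, agree with a left action of the Hecke algebra on words. This
  action commutes with operators acting on the right, namely exchanging neighbouring letters,
  changing the sign of the last letter and summing it out. Up to a power of \<open>t\<close>, a run of unprimed
  or primed columns is a product of such operators, and both together with the two monomials of a
  block form a translation, so every block of columns preserves equivariance. At the word
  \<open>1 2 \<dots> k\<close> no column can change, and the block merely multiplies by \<open>y 1 \<cdots> y k\<close>. When the height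
  drops by one, equivariance turns the sum over the lost entry into a symmetrization with the factors
  \<open>(1 - t x\<^sup>-\<^sup>\<alpha>) / (1 - x\<^sup>-\<^sup>\<alpha>)\<close>. After the last block all entries have been summed out, and the result
  is the Hall--Littlewood polynomial.
\<close>

section \<open>Letters, words and simple reflections\<close>

text \<open>The two columns that carry the content of a block have the same absolute values. Half of
  their joint content therefore counts the positive letters of the unprimed column and, negatively,
  the negative letters of the primed one. So the monomial of a block comes in two factors, one on
  either side of the primed run. A single factor is half a translation and is incompatible with
  \<open>T_n\<close>, because the sign change of \<open>n\<close> moves a letter from one factor to
  the other; between the two factors a modified action has to be used. The statistic
  \<open>N\<close> is an exponent: the right operators are modelled on \<open>t\<close> times the
  inverse Hecke generators, and \<open>N\<close> is what remains of the powers of \<open>t\<close>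
  that they produce after a potential has been divided out. The rightmost block lacks the unprimed
  run. The inversions of its last column replace it, because these operators fix the function that
  raises \<open>t\<close> to the length. Distinct parts make neighbouring blocks differ in height by
  at most one, so that entries are lost one at a time.\<close>

lemma letter_less_irrefl [simp]: "\<not> a \<prec> a"
  by (simp add: letter_less_def)

lemma letter_less_trans: "a \<prec> b \<Longrightarrow> b \<prec> c \<Longrightarrow> c \<noteq> 0 \<Longrightarrow> a \<prec> c"
  by (auto simp: letter_less_def)

lemma letter_less_asym: "a \<prec> b \<Longrightarrow> \<not> b \<prec> a"
  by (auto simp: letter_less_def)

lemma letter_less_total: "a \<noteq> b \<Longrightarrow> a \<noteq> 0 \<Longrightarrow> b \<noteq> 0 \<Longrightarrow> a \<prec> b \<or> b \<prec> a"
  by (auto simp: letter_less_def)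

lemma not_letter_less: "a \<noteq> b \<Longrightarrow> a \<noteq> 0 \<Longrightarrow> b \<noteq> 0 \<Longrightarrow> \<not> a \<prec> b \<longleftrightarrow> b \<prec> a"
  using letter_less_total letter_less_asym by blast

lemma uminus_letter_less: "a \<noteq> 0 \<Longrightarrow> b \<noteq> 0 \<Longrightarrow> - a \<prec> - b \<longleftrightarrow> b \<prec> a"
  by (auto simp: letter_less_def)

lemma finite_alphabet [simp]: "finite (alphabet n)"
proof -
  have "alphabet n \<subseteq> {- int n..int n}" by (auto simp: alphabet_def)
  then show ?thesis by (rule finite_subset) simp
qed

lemma uminus_alphabet [simp]: "- a \<in> alphabet n \<longleftrightarrow> a \<in> alphabet n"
  by (simp add: alphabet_def)

lemma alphabet_nonzero: "a \<in> alphabet n \<Longrightarrow> a \<noteq> 0"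
  by (simp add: alphabet_def)

definition words :: "nat \<Rightarrow> nat \<Rightarrow> int list set" where
  "words n k = {w. length w = k \<and> set w \<subseteq> alphabet n \<and> distinct (map abs w)}"

lemma finite_words [simp]: "finite (words n k)"
  by (rule finite_subset[OF _ finite_lists_length_eq[of "alphabet n" k]]) (auto simp: words_def)

definition reflect :: "nat \<Rightarrow> int \<Rightarrow> int \<Rightarrow> int" where
  "reflect n i a =
     (if i = int n then (if \<bar>a\<bar> = i then - a else a)
      else if a = i then i + 1 else if a = i + 1 then i
      else if a = - i then - (i + 1) else if a = - (i + 1) then - i else a)"

lemma reflect_cases:
  assumes "i \<in> {1..int n}"
  obtains "i = int n" "\<And>a. reflect n i a = (if \<bar>a\<bar> = i then - a else a)"
  | "1 \<le> i" "i < int n"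
    "\<And>a. reflect n i a = (if a = i then i + 1 else if a = i + 1 then i
      else if a = - i then - (i + 1) else if a = - (i + 1) then - i else a)"
  using assms by (cases "i = int n") (auto simp: reflect_def)

lemma reflect_reflect [simp]: "i \<in> {1..int n} \<Longrightarrow> reflect n i (reflect n i a) = a"
  by (erule reflect_cases) auto

lemma reflect_uminus [simp]: "i \<in> {1..int n} \<Longrightarrow> reflect n i (- a) = - reflect n i a"
  by (erule reflect_cases) auto

lemma reflect_alphabet [simp]: "i \<in> {1..int n} \<Longrightarrow> reflect n i a \<in> alphabet n \<longleftrightarrow> a \<in> alphabet n"
  by (erule reflect_cases) (auto simp: alphabet_def)

lemma reflect_eq_iff [simp]: "i \<in> {1..int n} \<Longrightarrow> reflect n i a = reflect n i b \<longleftrightarrow> a = b"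
  by (metis reflect_reflect)

lemma reflect_eq_0_iff [simp]: "i \<in> {1..int n} \<Longrightarrow> reflect n i a = 0 \<longleftrightarrow> a = 0"
  using reflect_eq_iff[of i n a 0] by (auto simp: reflect_def)

lemma reflect_abs_eq_iff [simp]: "i \<in> {1..int n} \<Longrightarrow> \<bar>reflect n i a\<bar> = \<bar>reflect n i b\<bar> \<longleftrightarrow> \<bar>a\<bar> = \<bar>b\<bar>"
  by (metis abs_eq_iff reflect_eq_iff reflect_uminus)

lemma reflect_inj: "i \<in> {1..int n} \<Longrightarrow> inj (reflect n i)"
  by (rule injI) simp

text \<open>A simple reflection exchanges only letters that are neighbours in the order:
  \<open>i\<close> and \<open>i + 1\<close>, their negatives, or \<open>n\<close> and
  \<open>- n\<close>. Hence it can reverse a comparison only between two letters that it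
  exchanges.\<close>

lemma reflect_less_iff:
  assumes i: "i \<in> {1..int n}" and a: "a \<in> alphabet n" "b \<in> alphabet n" "b \<noteq> reflect n i a"
  shows "reflect n i a \<prec> reflect n i b \<longleftrightarrow> a \<prec> b"
  using i
proof (rule reflect_cases)
  assume r: "i = int n" "\<And>a. reflect n i a = (if \<bar>a\<bar> = i then - a else a)"
  show ?thesis using a unfolding r(2) alphabet_def letter_less_def mem_Collect_eq
    by (smt (verit) r(1))
next
  assume r: "1 \<le> i" "i < int n" "\<And>a. reflect n i a = (if a = i then i + 1 else if a = i + 1 then i
      else if a = - i then - (i + 1) else if a = - (i + 1) then - i else a)"
  show ?thesis using a r(1,2) unfolding r(3) alphabet_def letter_less_def mem_Collect_eq
    by (smt (verit))
qed

text \<open>A letter and its image are neighbours, so a third letter lies on the same side of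
  both.\<close>

lemma less_reflect_iff:
  assumes i: "i \<in> {1..int n}" and a: "a \<in> alphabet n" "e \<in> alphabet n" "e \<noteq> a" "e \<noteq> reflect n i a"
  shows "e \<prec> reflect n i a \<longleftrightarrow> e \<prec> a"
  using i
proof (rule reflect_cases)
  assume r: "i = int n" "\<And>a. reflect n i a = (if \<bar>a\<bar> = i then - a else a)"
  show ?thesis using a unfolding r(2) alphabet_def letter_less_def mem_Collect_eq
    by (smt (verit) r(1))
next
  assume r: "1 \<le> i" "i < int n" "\<And>a. reflect n i a = (if a = i then i + 1 else if a = i + 1 then i
      else if a = - i then - (i + 1) else if a = - (i + 1) then - i else a)"
  show ?thesis using a r(1,2) unfolding r(3) alphabet_def letter_less_def mem_Collect_eq
    by (smt (verit))
qed

lemma reflect_less_cases: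
  assumes "i \<in> {1..int n}" "a \<in> alphabet n"
  obtains "reflect n i a = a" | "a \<prec> reflect n i a" | "reflect n i a \<prec> a"
proof -
  have "a \<noteq> 0" "reflect n i a \<noteq> 0"
    using alphabet_nonzero[of a n] alphabet_nonzero[of "reflect n i a" n] assms by simp_all
  then have "reflect n i a = a \<or> a \<prec> reflect n i a \<or> reflect n i a \<prec> a"
    using letter_less_total[of a "reflect n i a"] by auto
  then show thesis using that by blast
qed

lemma map_reflect_words [simp]:
  assumes "i \<in> {1..int n}"
  shows "map (reflect n i) w \<in> words n k \<longleftrightarrow> w \<in> words n k"
proof -
  have "distinct (map (\<lambda>a. \<bar>reflect n i a\<bar>) w) = distinct (map abs w)"
    using assms by (simp add: distinct_map inj_on_def) 
  then show ?thesis using assms by (auto simp: words_def o_def subset_iff)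
qed

text \<open>The terms cancel in pairs. Splitting the letters into ascending and descending ones
  avoids a division by two, so the argument is valid in every characteristic.\<close>

lemma sum_involution:
  assumes fin: "finite A" and i: "i \<in> {1..int n}" and A: "A \<subseteq> alphabet n"
    and st: "\<And>e. e \<in> A \<Longrightarrow> reflect n i e \<in> A"
    and fixd: "\<And>e. e \<in> A \<Longrightarrow> reflect n i e = e \<Longrightarrow> d e = 0"
    and anti: "\<And>e. e \<in> A \<Longrightarrow> e \<prec> reflect n i e \<Longrightarrow> d (reflect n i e) = - d e"
  shows "sum d A = (0 :: 'k :: comm_ring_1)"
proof -
  define U where "U = {e \<in> A. e \<prec> reflect n i e}"
  define V where "V = {e \<in> A. reflect n i e \<prec> e}"
  have "sum d A = sum d (U \<union> V)"
  proof (rule sum.mono_neutral_right)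
    show "\<forall>e\<in>A - (U \<union> V). d e = 0"
    proof
      fix e assume "e \<in> A - (U \<union> V)"
      then have "e \<in> A" "\<not> e \<prec> reflect n i e" "\<not> reflect n i e \<prec> e" by (auto simp: U_def V_def)
      then show "d e = 0" using reflect_less_cases[OF i, of e] A fixd by blast
    qed
  qed (use fin in \<open>auto simp: U_def V_def\<close>)
  also have "\<dots> = sum d U + sum d V"
    by (rule sum.union_disjoint) (use fin letter_less_asym in \<open>auto simp: U_def V_def\<close>)
  also have "sum d V = (\<Sum>e\<in>U. d (reflect n i e))"
    by (rule sum.reindex_bij_witness[of _ "reflect n i" "reflect n i"]) (use i st in \<open>auto simp: U_def V_def\<close>)
  also have "\<dots> = (\<Sum>e\<in>U. - d e)"
    by (rule sum.cong) (auto simp: U_def intro: anti)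
  finally show ?thesis by (simp add: sum_negf)
qed


section \<open>Left action on functions of words\<close>

text \<open>
  The generator \<open>T\<^sub>i\<close> of the Hecke algebra of type \<open>C\<close>, read on a parabolic quotient: a word of
  height less than \<open>n\<close> stands for the coset of its extensions, and if \<open>s\<^sub>i\<close> fixes all its letters
  then \<open>T\<^sub>i\<close> acts by \<open>t\<close>.
\<close>

definition left_act :: "nat \<Rightarrow> 'k::field \<Rightarrow> int \<Rightarrow> (int list \<Rightarrow> 'k) \<Rightarrow> int list \<Rightarrow> 'k" where
  "left_act n t i f w =
     (case find (\<lambda>a. reflect n i a \<noteq> a) w of
        None \<Rightarrow> t * f w
      | Some a \<Rightarrow> if a \<prec> reflect n i a then f (map (reflect n i) w)
                  else (t - 1) * f w + t * f (map (reflect n i) w))"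

lemma find_append: "find P (u @ v) = (case find P u of None \<Rightarrow> find P v | Some a \<Rightarrow> Some a)"
  by (induction u) auto

lemma find_SomeD: "find P u = Some a \<Longrightarrow> a \<in> set u \<and> P a"
  by (induction u) (auto split: if_splits)

lemma moved_abs:
  assumes i: "i \<in> {1..int n}" and a: "reflect n i a \<noteq> a" "reflect n i b \<noteq> b"
  shows "\<bar>b\<bar> = \<bar>a\<bar> \<or> \<bar>b\<bar> = \<bar>reflect n i a\<bar>"
  using i
proof (rule reflect_cases)
  assume r: "1 \<le> i" "i < int n" "\<And>a. reflect n i a = (if a = i then i + 1 else if a = i + 1 then i
      else if a = - i then - (i + 1) else if a = - (i + 1) then - i else a)"
  show ?thesis using a r(1,2) unfolding r(3) by (smt (verit))
qed (use a in \<open>auto split: if_splits\<close>)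

text \<open>A simple reflection moves two absolute values, or just one if \<open>i = n\<close>. This
  is what limits a word to two moved letters.\<close>

lemma moved_abs3:
  assumes "i \<in> {1..int n}" "reflect n i a \<noteq> a" "\<bar>b\<bar> \<noteq> \<bar>a\<bar>" "reflect n i b \<noteq> b" "reflect n i c \<noteq> c"
  shows "\<bar>c\<bar> = \<bar>a\<bar> \<or> \<bar>c\<bar> = \<bar>b\<bar>"
  using assms unfolding reflect_def by (smt (verit))

text \<open>This is \<open>t\<close> times the inverse of the Hecke generator acting on the right,
  that is, the generator plus \<open>1 - t\<close>. In this normalization powers of \<open>t\<close>
  given by the length are fixed; see \<open>swap_op_word_len\<close>.\<close>

definition swap_op :: "'k::field \<Rightarrow> nat \<Rightarrow> (int list \<Rightarrow> 'k) \<Rightarrow> int list \<Rightarrow> 'k" where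
  "swap_op t p f w =
     (let w' = w[p := w ! (p + 1), p + 1 := w ! p] in
      if w ! p \<prec> w ! (p + 1) then f w' + (1 - t) * f w else t * f w')"

lemma swap_op_append:
  "swap_op t (length u) f (u @ c # d # v) =
    (if c \<prec> d then f (u @ d # c # v) + (1 - t) * f (u @ c # d # v) else t * f (u @ d # c # v))"
  by (simp add: swap_op_def nth_append list_update_append)

text \<open>Left and right multiplication commute. They interact only if
  \<open>d = reflect n i c\<close> and no earlier letter moves: then reflecting the letters and
  exchanging the positions give the same word, and on these two words both operators come from one
  generator.\<close>

lemma left_act_swap_op:
  assumes i: "i \<in> {1..int n}" and w: "w \<in> words n k" and p: "p + 1 < k"
  shows "left_act n t i (swap_op t p f) w = swap_op t p (left_act n t i f) w"
proof -
  define s where "s = reflect n i"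
  note lr = reflect_less_iff[OF i, folded s_def]
  note rr [simp] = reflect_reflect[OF i, folded s_def]
  have pl: "p < length w" "Suc p < length w" using w p by (auto simp: words_def)
  define u c d v where "u = take p w" and "c = w ! p" and "d = w ! Suc p" and "v = drop (Suc (Suc p)) w"
  have weq: "w = u @ c # d # v"
    unfolding u_def c_def d_def v_def using pl by (simp add: Cons_nth_drop_Suc)
  have u: "length u = p" using pl by (simp add: u_def)
  have al: "c \<in> alphabet n" "d \<in> alphabet n" and cd: "\<bar>c\<bar> \<noteq> \<bar>d\<bar>"
    and ab: "\<And>a. a \<in> set u \<union> set v \<Longrightarrow> \<bar>a\<bar> \<noteq> \<bar>c\<bar> \<and> \<bar>a\<bar> \<noteq> \<bar>d\<bar>"
  proof -
    have "set w \<subseteq> alphabet n" "distinct (map abs w)" using w by (simp_all add: words_def)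
    then have al: "set (u @ c # d # v) \<subseteq> alphabet n" and di: "distinct (map abs (u @ c # d # v))"
      using weq by simp_all
    show "c \<in> alphabet n" "d \<in> alphabet n" using al by simp_all
    show "\<bar>c\<bar> \<noteq> \<bar>d\<bar>" using di by simp
    fix a assume "a \<in> set u \<union> set v"
    then have "\<bar>a\<bar> \<in> abs ` set u \<union> abs ` set v" by auto
    then show "\<bar>a\<bar> \<noteq> \<bar>c\<bar> \<and> \<bar>a\<bar> \<noteq> \<bar>d\<bar>" using di by (auto simp del: abs_eq_iff)
  qed
  have so: "swap_op t p g (u @ x # y # z) =
      (if x \<prec> y then g (u @ y # x # z) + (1 - t) * g (u @ x # y # z) else t * g (u @ y # x # z))"
    for g :: "int list \<Rightarrow> 'a" and x y z
    using swap_op_append[of t u g x y z] u by simp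
  have so2: "swap_op t p g (map s u @ x # y # z) =
      (if x \<prec> y then g (map s u @ y # x # z) + (1 - t) * g (map s u @ x # y # z)
       else t * g (map s u @ y # x # z))"
    for g :: "int list \<Rightarrow> 'a" and x y z
    using swap_op_append[of t "map s u" g x y z] u by simp
  show ?thesis
  proof (cases "find (\<lambda>a. s a \<noteq> a) u")
    case (Some a)
    then have a: "a \<in> set u" "s a \<noteq> a" using find_SomeD[OF Some] by simp_all
    \<comment> \<open>Otherwise three absolute values would be moved, those of \<open>a\<close>,
      \<open>c\<close> and \<open>d\<close>.\<close>
    have "d \<noteq> s c"
    proof
      assume "d = s c"
      then have "s c \<noteq> c" "s d \<noteq> d" using cd by auto
      then show False using moved_abs3[OF i, of c d a] a ab cd by (auto simp: s_def)
    qed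
    then have "s c \<prec> s d \<longleftrightarrow> c \<prec> d" using lr al by blast
    then show ?thesis using Some
      by (simp add: weq left_act_def find_append so so2 algebra_simps flip: s_def)
  next
    case None
    note N = this
    have su: "map s u = u" using None by (auto simp: find_None_iff intro: map_idI)
    show ?thesis
    proof (cases "s c = c \<or> s d = d")
      case True
      then have "d \<noteq> s c" using cd by auto
      then have "s c \<prec> s d \<longleftrightarrow> c \<prec> d" using lr al by blast
      then show ?thesis using True N
        by (auto simp: weq left_act_def find_append so so2 algebra_simps simp flip: s_def split: option.split)
    next
      case False
      show ?thesis
      proof (cases "d = s c")
        case True
        then have "c \<prec> s c \<or> s c \<prec> c" "\<not> (c \<prec> s c \<and> s c \<prec> c)"
          using cd al letter_less_total[of c d] letter_less_asym alphabet_nonzero by auto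
        moreover have "map s v = v"
        proof (rule map_idI)
          fix x assume "x \<in> set v"
          then have "\<bar>x\<bar> \<noteq> \<bar>c\<bar>" "\<bar>x\<bar> \<noteq> \<bar>d\<bar>" using ab by auto
          then show "s x = x" using moved_abs3[OF i, of c d x] False cd by (auto simp: s_def)
        qed
        ultimately show ?thesis using False True N su
          by (auto simp: weq left_act_def find_append so so2 algebra_simps simp flip: s_def)
      next
        case dn: False
        have "d = - s c" 
        proof -
          have "\<bar>d\<bar> = \<bar>s c\<bar>" using moved_abs[OF i, of c d] False cd by (auto simp: s_def)
          then show ?thesis using dn by (auto simp: abs_eq_iff)
        qed
        then have "s d = - c" using i by (simp add: s_def)
        have e1: "s c \<prec> s d \<longleftrightarrow> c \<prec> d" using lr al dn by blast
        have nz: "c \<noteq> 0" "d \<noteq> 0" "s c \<noteq> 0" using al i by (simp_all add: alphabet_nonzero s_def)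
        \<comment> \<open>After the exchange of positions \<open>d\<close> is the first moved
          letter. It selects the same branch of \<open>left_act\<close> as \<open>c\<close>
          did.\<close>
        have e2: "d \<prec> s d \<longleftrightarrow> c \<prec> s c" 
          unfolding \<open>s d = - c\<close> unfolding \<open>d = - s c\<close> using nz uminus_letter_less[of "s c" c] by simp
        show ?thesis using e1 e2 False N su
          by (auto simp: weq left_act_def find_append so so2 algebra_simps simp flip: s_def)
      qed
    qed
  qed
qed


section \<open>Changing and summing out the last letter\<close>

definition below_set :: "nat \<Rightarrow> int list \<Rightarrow> int \<Rightarrow> int set" where
  "below_set n A v = {e \<in> alphabet n. e \<prec> v \<and> \<bar>e\<bar> \<notin> abs ` set A}"

text \<open>
  The sign change of the last letter, as an operator on words of any height. Taking \<open>d = 1 - t\<close>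
  commutes with \<open>left_act\<close>, taking \<open>d = 0\<close> with \<open>left_act_half\<close>; these are the unprimed and the
  primed columns.
\<close>

definition flip_op :: "nat \<Rightarrow> 'k::field \<Rightarrow> 'k \<Rightarrow> (int list \<Rightarrow> 'k) \<Rightarrow> int list \<Rightarrow> 'k" where
  "flip_op n t d f w =
     t ^ card (below_set n (butlast w) (last w)) *
     (f (butlast w @ [- last w]) + d * (\<Sum>e\<in>below_set n (butlast w) (- last w). f (butlast w @ [e])))"

definition extend_op :: "nat \<Rightarrow> (int list \<Rightarrow> 'k::field) \<Rightarrow> int list \<Rightarrow> 'k" where
  "extend_op n f w = (\<Sum>e | e \<in> alphabet n \<and> \<bar>e\<bar> \<notin> abs ` set w. f (w @ [e]))"

lemma finite_below_set [simp]: "finite (below_set n A v)"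
  by (simp add: below_set_def)

lemma flip_op_append: "flip_op n t d f (A @ [b]) =
   t ^ card (below_set n A b) * (f (A @ [- b]) + d * (\<Sum>e\<in>below_set n A (- b). f (A @ [e])))"
  by (simp add: flip_op_def)

lemma reflect_abs_image:
  assumes i: "i \<in> {1..int n}"
  shows "\<bar>reflect n i e\<bar> \<in> abs ` set (map (reflect n i) A) \<longleftrightarrow> \<bar>e\<bar> \<in> abs ` set A"
  using i by (auto simp: image_iff)

text \<open>The last hypothesis excludes the only letter whose comparison with \<open>v\<close>
  could be reversed: the image of \<open>v\<close> either is \<open>v\<close> or has an absolute
  value that already occurs in \<open>A\<close>.\<close>

lemma below_set_reflect:
  assumes i: "i \<in> {1..int n}" and v: "v \<in> alphabet n"
    and mv: "reflect n i v = v \<or> \<bar>reflect n i v\<bar> \<in> abs ` set A"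
  shows "below_set n (map (reflect n i) A) (reflect n i v) = reflect n i ` below_set n A v"
proof -
  have *: "reflect n i e \<in> below_set n (map (reflect n i) A) (reflect n i v) \<longleftrightarrow> e \<in> below_set n A v" for e
  proof (cases "e \<in> alphabet n \<and> \<bar>e\<bar> \<notin> abs ` set A")
    case True
    have "reflect n i e \<prec> reflect n i v \<longleftrightarrow> e \<prec> v"
    proof (cases "v = reflect n i e")
      case False
      then show ?thesis using reflect_less_iff[OF i _ v] True by blast
    next
      case eq: True
      then have "reflect n i v = e" using i by simp
      then show ?thesis using mv True eq by auto
    qed
    then show ?thesis using True reflect_abs_image[OF i, of e A] i by (simp add: below_set_def)
  next
    case False
    then show ?thesis using reflect_abs_image[OF i, of e A] i by (auto simp: below_set_def)
  qed
  show ?thesis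
  proof (intro equalityI subsetI)
    fix x assume x: "x \<in> below_set n (map (reflect n i) A) (reflect n i v)"
    have "x = reflect n i (reflect n i x)" using i by simp
    then show "x \<in> reflect n i ` below_set n A v" using *[of "reflect n i x"] x by (metis imageI)
  qed (use * in auto)
qed

lemma card_below_set_reflect:
  assumes "i \<in> {1..int n}" "v \<in> alphabet n" "reflect n i v = v \<or> \<bar>reflect n i v\<bar> \<in> abs ` set A"
  shows "card (below_set n (map (reflect n i) A) (reflect n i v)) = card (below_set n A v)"
  unfolding below_set_reflect[OF assms] by (rule card_image) (use assms(1) in \<open>simp add: inj_on_def\<close>)

lemma sum_below_set_reflect:
  assumes "i \<in> {1..int n}" "v \<in> alphabet n" "reflect n i v = v \<or> \<bar>reflect n i v\<bar> \<in> abs ` set A"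
  shows "sum g (below_set n (map (reflect n i) A) (reflect n i v)) = (\<Sum>e\<in>below_set n A v. g (reflect n i e))"
  unfolding below_set_reflect[OF assms] by (subst sum.reindex) (use assms(1) in \<open>simp_all add: inj_on_def\<close>)

text \<open>Since \<open>v\<close> and its image are neighbours, \<open>v\<close> is the only letter
  gained between them. This single letter is the source of the factor \<open>t\<close> in the
  commutation with \<open>flip_op\<close>.\<close>

lemma below_set_reflect_step:
  assumes i: "i \<in> {1..int n}" and v: "v \<in> alphabet n" "v \<prec> reflect n i v" "\<bar>v\<bar> \<notin> abs ` set A"
    and A: "map (reflect n i) A = A"
  shows "below_set n A (reflect n i v) = insert v (below_set n A v)" "v \<notin> below_set n A v"
proof -
  have "e \<prec> reflect n i v \<longleftrightarrow> e = v \<or> e \<prec> v" if "e \<in> alphabet n" for e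
    using less_reflect_iff[OF i v(1) that] v(2) letter_less_asym by (cases "e = v"; cases "e = reflect n i v") auto
  then show "below_set n A (reflect n i v) = insert v (below_set n A v)"
    using v by (auto simp: below_set_def)
qed (simp add: below_set_def)

lemma below_set_stable:
  assumes i: "i \<in> {1..int n}" and v: "v \<in> alphabet n" "reflect n i v = v \<or> v \<prec> reflect n i v"
    and A: "map (reflect n i) A = A" and e: "e \<in> below_set n A v"
  shows "reflect n i e \<in> below_set n A v"
proof -
  have ea: "e \<in> alphabet n" "e \<prec> v" "\<bar>e\<bar> \<notin> abs ` set A" using e by (auto simp: below_set_def)
  have "reflect n i e \<prec> v"
  proof (cases "reflect n i v = v")
    case True
    then show ?thesis using reflect_less_iff[OF i ea(1) v(1)] ea(2) i
      by (metis letter_less_irrefl reflect_reflect)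
  next
    case False
    then have "v \<noteq> reflect n i e" using v(2) ea(2) letter_less_asym i by auto
    moreover have "reflect n i e \<noteq> v" using calculation by simp
    ultimately have "reflect n i e \<prec> reflect n i v" using reflect_less_iff[OF i ea(1) v(1)] ea(2) by simp
    moreover have "reflect n i e \<noteq> reflect n i v" using ea i by auto
    ultimately show ?thesis
      using less_reflect_iff[OF i v(1), of "reflect n i e"] \<open>reflect n i e \<noteq> v\<close> i ea(1) by simp
  qed
  moreover have "\<bar>reflect n i e\<bar> \<notin> abs ` set A"
    using reflect_abs_image[OF i, of e A] A ea(3) by simp
  ultimately show ?thesis using i ea(1) by (simp add: below_set_def)
qed

lemma left_act_append_moved:
  assumes "find (\<lambda>a. reflect n i a \<noteq> a) A = Some a"
  shows "left_act n t i f (A @ v) =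
    (if a \<prec> reflect n i a then f (map (reflect n i) A @ map (reflect n i) v)
     else (t - 1) * f (A @ v) + t * f (map (reflect n i) A @ map (reflect n i) v))"
  using assms by (simp add: left_act_def find_append)

lemma left_act_append_fixed:
  assumes "find (\<lambda>a. reflect n i a \<noteq> a) A = None"
  shows "left_act n t i f (A @ [e]) =
    (if reflect n i e = e then t * f (A @ [e]) else if e \<prec> reflect n i e then f (A @ [reflect n i e])
     else (t - 1) * f (A @ [e]) + t * f (A @ [reflect n i e]))"
proof -
  have "map (reflect n i) A = A" using assms by (intro map_idI) (auto simp: find_None_iff)
  then show ?thesis using assms by (simp add: left_act_def find_append)
qed

text \<open>On two words exchanged by the reflection, the values of \<open>left_act\<close> add up
  to \<open>t\<close> times the sum of the values of \<open>f\<close>; a fixed word is multiplied by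
  \<open>t\<close> directly.\<close>

lemma sum_left_act:
  assumes i: "i \<in> {1..int n}" and N: "find (\<lambda>a. reflect n i a \<noteq> a) A = None"
    and B: "finite B" "B \<subseteq> alphabet n" "\<And>e. e \<in> B \<Longrightarrow> reflect n i e \<in> B"
  shows "(\<Sum>e\<in>B. left_act n t i f (A @ [e])) = t * (\<Sum>e\<in>B. f (A @ [e]))"
proof -
  have "(\<Sum>e\<in>B. left_act n t i f (A @ [e]) - t * f (A @ [e])) = 0"
  proof (rule sum_involution[OF B(1) i B(2,3)])
    fix e assume "e \<in> B" "e \<prec> reflect n i e"
    moreover from this have "\<not> reflect n i e \<prec> e" "reflect n i e \<noteq> e" using letter_less_asym by auto
    ultimately show "left_act n t i f (A @ [reflect n i e]) - t * f (A @ [reflect n i e]) =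
        - (left_act n t i f (A @ [e]) - t * f (A @ [e]))"
      using i by (auto simp: left_act_append_fixed[OF N] algebra_simps)
  qed (simp_all add: left_act_append_fixed[OF N])
  then show ?thesis by (simp add: sum_subtractf sum_distrib_left)
qed

lemma words_snoc: "A @ [b] \<in> words n (Suc k) \<longleftrightarrow> A \<in> words n k \<and> b \<in> alphabet n \<and> \<bar>b\<bar> \<notin> abs ` set A"
  by (auto simp: words_def)

text \<open>The first moved letter lies in \<open>A\<close> and selects one branch of
  \<open>left_act\<close> for all words that \<open>flip_op\<close> brings together. The image of
  \<open>b\<close> is \<open>b\<close> itself or is blocked by \<open>A\<close>, so the counts and
  the ranges of summation are carried along.\<close>

lemma left_act_flip_moved:
  assumes i: "i \<in> {1..int n}" and w: "A @ [b] \<in> words n k"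
    and S: "find (\<lambda>a. reflect n i a \<noteq> a) A = Some a"
  shows "left_act n t i (flip_op n t d f) (A @ [b]) = flip_op n t d (left_act n t i f) (A @ [b])"
proof -
  define s where "s = reflect n i"
  have a: "a \<in> set A" "reflect n i a \<noteq> a" using find_SomeD[OF S] by simp_all
  have b: "b \<in> alphabet n" "\<bar>b\<bar> \<notin> abs ` set A" using w by (auto simp: words_def)
  have ab: "\<bar>a\<bar> \<noteq> \<bar>b\<bar>" using a(1) b(2) by (metis imageI)
  have mv: "reflect n i b = b \<or> \<bar>reflect n i b\<bar> \<in> abs ` set A"
    using moved_abs[OF i, of b a] a ab by (metis imageI)
  then have mv': "reflect n i (- b) = - b \<or> \<bar>reflect n i (- b)\<bar> \<in> abs ` set A" using i by simp
  have nb: "- b \<in> alphabet n" "- reflect n i b = reflect n i (- b)" using b i by simp_all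
  note c = card_below_set_reflect[OF i b(1) mv] sum_below_set_reflect[OF i nb(1) mv']
  have f1: "flip_op n t d f (map (reflect n i) A @ [reflect n i b]) =
    t ^ card (below_set n A b) * (f (map (reflect n i) A @ [reflect n i (- b)]) +
      d * (\<Sum>e\<in>below_set n A (- b). f (map (reflect n i) A @ [reflect n i e])))"
    unfolding flip_op_append nb(2) c ..
  show ?thesis
    unfolding left_act_append_moved[OF S] list.map unfolding f1 unfolding flip_op_append
    by (simp add: left_act_append_moved[OF S] sum.distrib sum_subtractf sum_distrib_left algebra_simps)
qed

text \<open>If no letter of \<open>A\<close> moves, the last letter selects the branch. When it
  ascends or descends, the exponent of \<open>t\<close> in \<open>flip_op\<close> changes by one,
  and this has to match the factor \<open>t\<close> of the descending branch at the negated
  letter.\<close>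

lemma left_act_flip_op:
  assumes i: "i \<in> {1..int n}" and w: "w \<in> words n k" "w \<noteq> []"
  shows "left_act n t i (flip_op n t (1 - t) f) w = flip_op n t (1 - t) (left_act n t i f) w"
proof -
  obtain A b where weq: "w = A @ [b]" using w(2) by (metis append_butlast_last_id)
  have b: "b \<in> alphabet n" "\<bar>b\<bar> \<notin> abs ` set A" using w(1) by (auto simp: words_def weq)
  show ?thesis
  proof (cases "find (\<lambda>a. reflect n i a \<noteq> a) A")
    case (Some a)
    then show ?thesis using left_act_flip_moved[OF i] w(1) weq by blast
  next
    case None
    note F = left_act_append_fixed[OF None]
    have sA: "map (reflect n i) A = A" using None by (intro map_idI) (auto simp: find_None_iff)
    have absA: "\<bar>reflect n i b\<bar> \<notin> abs ` set A" using reflect_abs_image[OF i, of b A] sA b by simp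
    have sub: "below_set n A v \<subseteq> alphabet n" for v by (auto simp: below_set_def)
    have SL: "(\<Sum>e\<in>below_set n A v. left_act n t i f (A @ [e])) = t * (\<Sum>e\<in>below_set n A v. f (A @ [e]))"
      if "v \<in> alphabet n" "reflect n i v = v \<or> v \<prec> reflect n i v" for v
      by (rule sum_left_act[OF i None _ sub below_set_stable[OF i that sA]]) simp_all
    have fl: "left_act n t i f (A @ [- c]) + (1 - t) * (\<Sum>e\<in>below_set n A (- c). left_act n t i f (A @ [e]))
       = f (A @ [- reflect n i c]) + t * (1 - t) * (\<Sum>e\<in>below_set n A (- c). f (A @ [e]))"
      if c: "c \<in> alphabet n" "\<bar>c\<bar> \<notin> abs ` set A" "reflect n i c \<prec> c" for c
    proof -
      have "- c \<prec> reflect n i (- c)" using c i by (simp add: uminus_letter_less alphabet_nonzero)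
      then show ?thesis
        using SL[of "- c"] F[of t f "- c"] c i by (auto simp: algebra_simps)
    qed
    consider "reflect n i b = b" | "b \<prec> reflect n i b" | "reflect n i b \<prec> b"
      using reflect_less_cases[OF i b(1)] by blast
    then show ?thesis
    proof cases
      case 1
      then have m: "reflect n i (- b) = - b" using i by simp
      show ?thesis
        using SL[of "- b"] F[of t "flip_op n t (1 - t) f" b] F[of t f "- b"] b m 1
        by (simp add: weq flip_op_append algebra_simps)
    next
      case 2
      define c where "c = reflect n i b"
      have c: "c \<in> alphabet n" "\<bar>c\<bar> \<notin> abs ` set A" "reflect n i c \<prec> c" "reflect n i c = b"
        using 2 b absA i by (simp_all add: c_def)
      have ne: "c \<noteq> b" using 2 c_def by auto
      have st: "- c \<prec> reflect n i (- c)" using 2 c i b by (simp add: uminus_letter_less alphabet_nonzero c_def)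
      have b1: "below_set n A c = insert b (below_set n A b)" "b \<notin> below_set n A b"
        using below_set_reflect_step[OF i b(1) 2 b(2) sA] by (simp_all add: c_def)
      have b2: "below_set n A (- b) = insert (- c) (below_set n A (- c))" "- c \<notin> below_set n A (- c)"
        using below_set_reflect_step[OF i _ st _ sA] c i by simp_all
      have e1: "left_act n t i f (A @ [- b]) = (t - 1) * f (A @ [- b]) + t * f (A @ [- c])"
        using st ne i letter_less_asym[OF st] by (auto simp: F c_def)
      have "left_act n t i (flip_op n t (1 - t) f) w = flip_op n t (1 - t) f (A @ [c])"
        using 2 by (auto simp: weq F c_def)
      also have "\<dots> = t ^ card (below_set n A b) *
         (t * f (A @ [- c]) + t * (1 - t) * (\<Sum>e\<in>below_set n A (- c). f (A @ [e])))"
        by (simp add: flip_op_append b1 algebra_simps)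
      \<comment> \<open>Here the coefficient \<open>1 - t\<close> matters: it cancels the value of
        \<open>f\<close> at \<open>A @ [- b]\<close> that the descending branch produces.\<close>
      also have "\<dots> = t ^ card (below_set n A b) * (left_act n t i f (A @ [- b]) +
         (1 - t) * (left_act n t i f (A @ [- c]) + (\<Sum>e\<in>below_set n A (- c). left_act n t i f (A @ [e]))))"
      proof -
        have e2: "left_act n t i f (A @ [- c]) = f (A @ [- b])"
          using st ne c(4) i by (auto simp: F)
        have e3: "(\<Sum>e\<in>below_set n A (- c). left_act n t i f (A @ [e])) = t * (\<Sum>e\<in>below_set n A (- c). f (A @ [e]))"
          by (rule SL) (use c st in simp_all)
        show ?thesis unfolding e1 e2 e3 by (simp add: algebra_simps)
      qed
      also have "\<dots> = flip_op n t (1 - t) (left_act n t i f) w"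
        by (simp add: weq flip_op_append b2)
      finally show ?thesis .
    next
      case 3
      define c where "c = reflect n i b"
      have ne: "c \<noteq> b" using 3 c_def by auto
      have c: "c \<in> alphabet n" "\<bar>c\<bar> \<notin> abs ` set A" "c \<prec> b" "reflect n i c = b"
        using 3 b absA i by (simp_all add: c_def)
      have st: "- b \<prec> reflect n i (- b)" using 3 b i by (simp add: uminus_letter_less alphabet_nonzero)
      have b1: "below_set n A b = insert c (below_set n A c)" "c \<notin> below_set n A c"
        using below_set_reflect_step[OF i c(1) _ c(2) sA] c by simp_all
      have b2: "below_set n A (- c) = insert (- b) (below_set n A (- b))" "- b \<notin> below_set n A (- b)"
        using below_set_reflect_step[OF i _ st _ sA] b i by (simp_all add: c_def)
      have "left_act n t i (flip_op n t (1 - t) f) w =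
         (t - 1) * flip_op n t (1 - t) f (A @ [b]) + t * flip_op n t (1 - t) f (A @ [c])"
        using 3 ne letter_less_asym[OF 3] by (simp add: weq F c_def)
      also have "\<dots> = t ^ card (below_set n A b) *
        (f (A @ [- c]) + t * (1 - t) * (\<Sum>e\<in>below_set n A (- b). f (A @ [e])))"
        by (simp add: flip_op_append b1 b2 algebra_simps)
      also have "\<dots> = flip_op n t (1 - t) (left_act n t i f) w"
        using fl[OF b 3] by (simp add: weq flip_op_append c_def)
      finally show ?thesis .
    qed
  qed
qed

text \<open>A moved letter of \<open>w\<close> selects the branch for all summands, and the
  reflection permutes the appended letters. If \<open>w\<close> is fixed, the range of the sum is
  stable and \<open>sum_left_act\<close> applies.\<close>

lemma left_act_extend_op:
  assumes i: "i \<in> {1..int n}" and w: "w \<in> words n k"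
  shows "left_act n t i (extend_op n f) w = extend_op n (left_act n t i f) w"
proof -
  define B where "B A = {e \<in> alphabet n. \<bar>e\<bar> \<notin> abs ` set A}" for A :: "int list"
  have ext: "extend_op n g A = (\<Sum>e\<in>B A. g (A @ [e]))" for g :: "int list \<Rightarrow> 'a" and A
    by (simp add: extend_op_def B_def)
  have st: "reflect n i e \<in> B (map (reflect n i) w) \<longleftrightarrow> e \<in> B w" for e
    using i reflect_abs_image[OF i, of e w] by (simp add: B_def)
  have st2: "reflect n i e \<in> B w" if "e \<in> B (map (reflect n i) w)" for e
    using st[of "reflect n i e"] i that by simp
  show ?thesis
  proof (cases "find (\<lambda>a. reflect n i a \<noteq> a) w")
    case (Some a)
    have "extend_op n f (map (reflect n i) w) = (\<Sum>e\<in>B w. f (map (reflect n i) w @ [reflect n i e]))"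
      unfolding ext
      by (rule sum.reindex_bij_witness[of _ "reflect n i" "reflect n i"]) (use i st st2 in simp_all)
    then show ?thesis
      using left_act_append_moved[OF Some, of t _ "[_]"] left_act_append_moved[OF Some, of t _ "[]"]
      by (simp add: ext sum.distrib sum_distrib_left)
  next
    case None
    have sA: "map (reflect n i) w = w" using None by (intro map_idI) (auto simp: find_None_iff)
    have "(\<Sum>e\<in>B w. left_act n t i f (w @ [e])) = t * (\<Sum>e\<in>B w. f (w @ [e]))"
      by (rule sum_left_act[OF i None]) (use st sA in \<open>simp_all add: B_def subset_iff\<close>)
    then show ?thesis using None by (simp add: ext left_act_def)
  qed
qed


section \<open>Half translations and the Demazure--Lusztig operators\<close>

definition moved :: "nat \<Rightarrow> int \<Rightarrow> int list \<Rightarrow> int list" where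
  "moved n i w = filter (\<lambda>a. reflect n i a \<noteq> a) w"

lemma find_moved: "find (\<lambda>a. reflect n i a \<noteq> a) w = (case moved n i w of [] \<Rightarrow> None | a # _ \<Rightarrow> Some a)"
  by (induction w) (auto simp: moved_def)

lemma moved_append [simp]: "moved n i (u @ v) = moved n i u @ moved n i v"
  by (simp add: moved_def)

lemma moved_Nil [simp]: "moved n i [] = []"
  by (simp add: moved_def)

lemma moved_Cons: "moved n i (a # v) = (if reflect n i a = a then moved n i v else a # moved n i v)"
  by (simp add: moved_def)

lemma moved_empty_map: "moved n i w = [] \<Longrightarrow> map (reflect n i) w = w"
  by (intro map_idI) (auto simp: moved_def filter_empty_conv)

lemma left_act_moved:
  "left_act n t i f w = (case moved n i w of [] \<Rightarrow> t * f w
      | a # _ \<Rightarrow> if a \<prec> reflect n i a then f (map (reflect n i) w)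
                  else (t - 1) * f w + t * f (map (reflect n i) w))"
  by (simp add: left_act_def find_moved split: list.split)

text \<open>
  The action that replaces \<open>left_act\<close> once a family has been multiplied by the positive letters of
  the column but not yet by the negative ones.
\<close>

definition left_act_half :: "nat \<Rightarrow> 'k::field \<Rightarrow> int \<Rightarrow> (int list \<Rightarrow> 'k) \<Rightarrow> int list \<Rightarrow> 'k" where
  "left_act_half n t i f w =
     (case moved n i w of
        [a] \<Rightarrow> if a = i then f (map (reflect n i) w)
               else if a = - i then t * f (map (reflect n i) w)
               else if a = i + 1 then (t - 1) * f w + t * f (map (reflect n i) w)
               else (t - 1) * f w + f (map (reflect n i) w)
      | _ \<Rightarrow> left_act n t i f w)"

lemma left_act_half_single:
  "moved n i w = [a] \<Longrightarrow> left_act_half n t i f w =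
     (if a = i then f (map (reflect n i) w)
               else if a = - i then t * f (map (reflect n i) w)
               else if a = i + 1 then (t - 1) * f w + t * f (map (reflect n i) w)
               else (t - 1) * f w + f (map (reflect n i) w))"
  by (simp add: left_act_half_def)

lemma left_act_half_other: "length (moved n i w) \<noteq> 1 \<Longrightarrow> left_act_half n t i f w = left_act n t i f w"
  by (cases "moved n i w"; cases "tl (moved n i w)") (simp_all add: left_act_half_def)

lemma swap_op_cong:
  assumes "p + 1 < length w" "f w = g w"
    "f (w[p := w ! (p + 1), p + 1 := w ! p]) = g (w[p := w ! (p + 1), p + 1 := w ! p])"
  shows "swap_op t p f w = swap_op t p g w"
  using assms by (simp add: swap_op_def Let_def)

text \<open>With a single moved letter the branch of \<open>left_act_half\<close> depends on that
  letter and not on its position, and the reflection does not reverse the comparison of the two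
  exchanged letters. All other words fall under \<open>left_act_swap_op\<close>.\<close>

lemma left_act_half_swap_op:
  assumes i: "i \<in> {1..int n}" and w: "w \<in> words n k" and p: "p + 1 < k"
  shows "left_act_half n t i (swap_op t p f) w = swap_op t p (left_act_half n t i f) w"
proof -
  have pl: "p < length w" "Suc p < length w" using w p by (auto simp: words_def)
  define u c d v where "u = take p w" and "c = w ! p" and "d = w ! Suc p" and "v = drop (Suc (Suc p)) w"
  have weq: "w = u @ c # d # v"
    unfolding u_def c_def d_def v_def using pl by (simp add: Cons_nth_drop_Suc)
  have u: "length u = p" using pl by (simp add: u_def)
  have w': "w[p := w ! (p + 1), p + 1 := w ! p] = u @ d # c # v"
    using u by (simp add: weq nth_append list_update_append)
  have so: "swap_op t p g (u @ x # y # z) =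
      (if x \<prec> y then g (u @ y # x # z) + (1 - t) * g (u @ x # y # z) else t * g (u @ y # x # z))"
    for g :: "int list \<Rightarrow> 'a" and x y z
    using swap_op_append[of t u g x y z] u by simp
  have so2: "swap_op t p g (map (reflect n i) u @ x # y # z) =
      (if x \<prec> y then g (map (reflect n i) u @ y # x # z) + (1 - t) * g (map (reflect n i) u @ x # y # z)
       else t * g (map (reflect n i) u @ y # x # z))"
    for g :: "int list \<Rightarrow> 'a" and x y z
    using swap_op_append[of t "map (reflect n i) u" g x y z] u by simp
  have al: "c \<in> alphabet n" "d \<in> alphabet n" "c \<noteq> d" using w by (auto simp: weq words_def)
  show ?thesis
  proof (cases "length (moved n i w) = 1")
    case True
    then obtain a where a: "moved n i w = [a]" by (auto simp: length_Suc_conv)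
    have a': "moved n i (u @ d # c # v) = [a]"
      using a by (auto simp: weq moved_Cons append_eq_Cons_conv split: if_splits)
    have "d \<noteq> reflect n i c"
    proof
      assume d: "d = reflect n i c"
      then have "reflect n i d = c" using i by simp
      then have "moved n i w = moved n i u @ c # d # moved n i v"
        using d al(3) by (simp add: weq moved_Cons)
      then show False using a by (auto simp: append_eq_Cons_conv)
    qed
    then have r: "reflect n i c \<prec> reflect n i d \<longleftrightarrow> c \<prec> d" using reflect_less_iff[OF i al(1,2)] by blast
    note L = left_act_half_single[OF a, unfolded weq] left_act_half_single[OF a']
    show ?thesis unfolding weq so L by (simp add: so so2 r algebra_simps)
  next
    case False
    then have F: "length (moved n i (u @ d # c # v)) \<noteq> 1" by (auto simp: weq moved_Cons split: if_splits)
    show ?thesis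
      unfolding left_act_half_other[OF False] left_act_swap_op[OF i w p]
      by (rule swap_op_cong[symmetric]) (use p w F False in \<open>simp_all add: words_def w' left_act_half_other del: One_nat_def add_Suc_right\<close>)
  qed
qed

text \<open>The new case is that only the last letter moves. Negating it exchanges the branches of
  \<open>i\<close> and \<open>- i\<close>, and those of \<open>i + 1\<close> and
  \<open>- (i + 1)\<close>. The coefficients in the two branches of a pair differ by a factor
  \<open>t\<close> in front of the reflected word, and this is the change of the power of
  \<open>t\<close> in \<open>flip_op\<close>.\<close>

lemma left_act_half_flip_op:
  assumes i: "i \<in> {1..int n}" and w: "w \<in> words n k" "w \<noteq> []"
  shows "left_act_half n t i (flip_op n t 0 f) w = flip_op n t 0 (left_act_half n t i f) w"
proof -
  obtain A b where weq: "w = A @ [b]" using w(2) by (metis append_butlast_last_id)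
  have b: "b \<in> alphabet n" "\<bar>b\<bar> \<notin> abs ` set A" using w(1) by (auto simp: words_def weq)
  have fl: "flip_op n t 0 g (B @ [c]) = t ^ card (below_set n B c) * g (B @ [- c])"
    for g :: "int list \<Rightarrow> 'a" and B c by (simp add: flip_op_append)
  show ?thesis
  proof (cases "reflect n i b = b")
    case True
    then have nb: "reflect n i (- b) = - b" using i by simp
    note c = card_below_set_reflect[OF i b(1) disjI1[OF True]]
    show ?thesis
    proof (cases "length (moved n i A) = 1")
      case l1: True
      then obtain a where a: "moved n i A = [a]" by (auto simp: length_Suc_conv)
      have m: "moved n i (A @ [b]) = [a]" "moved n i (A @ [- b]) = [a]"
        using a True nb by (simp_all add: moved_Cons)
      show ?thesis
        unfolding weq fl left_act_half_single[OF m(1)] left_act_half_single[OF m(2)]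
        using c True i by (simp add: fl algebra_simps)
    next
      case False
      then have m: "length (moved n i (A @ [b])) \<noteq> 1" "length (moved n i (A @ [- b])) \<noteq> 1"
        using True nb by (simp_all add: moved_Cons)
      show ?thesis
      proof (cases "moved n i A")
        case Nil
        then show ?thesis unfolding weq fl left_act_half_other[OF m(1)] left_act_half_other[OF m(2)]
          using True nb by (simp add: left_act_moved moved_Cons fl algebra_simps)
      next
        case (Cons a as)
        then have "find (\<lambda>a. reflect n i a \<noteq> a) A = Some a" by (simp add: find_moved)
        from left_act_flip_moved[OF i _ this, of b k t 0 f] w(1)
        show ?thesis unfolding weq fl left_act_half_other[OF m(1)] left_act_half_other[OF m(2)] by simp
      qed
    qed
  next
    case False
    then have nb: "reflect n i (- b) \<noteq> - b" using i by simp
    show ?thesis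
    proof (cases "moved n i A")
      case (Cons a as)
      then have m: "length (moved n i (A @ [b])) \<noteq> 1" "length (moved n i (A @ [- b])) \<noteq> 1"
        using False nb by (simp_all add: moved_Cons)
      have "find (\<lambda>a. reflect n i a \<noteq> a) A = Some a" using Cons by (simp add: find_moved)
      from left_act_flip_moved[OF i _ this, of b k t 0 f] w(1)
      show ?thesis unfolding weq fl left_act_half_other[OF m(1)] left_act_half_other[OF m(2)] by simp
    next
      case Nil
      then have sA: "map (reflect n i) A = A" by (rule moved_empty_map)
      have m: "moved n i (A @ [b]) = [b]" "moved n i (A @ [- b]) = [- b]"
        using Nil False nb by (simp_all add: moved_Cons)
      define c where "c = reflect n i b"
      have c: "c \<in> alphabet n" "\<bar>c\<bar> \<notin> abs ` set A" "reflect n i c = b" "reflect n i (- b) = - c"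
        using b i reflect_abs_image[OF i, of b A] sA by (simp_all add: c_def)
      note L = left_act_half_single[OF m(1)] left_act_half_single[OF m(2)]
      have up: "card (below_set n A c) = Suc (card (below_set n A b))" if "b \<prec> c"
        using below_set_reflect_step[OF i b(1) _ b(2) sA] that by (simp add: c_def)
      have dn: "card (below_set n A b) = Suc (card (below_set n A c))" if "c \<prec> b"
        using below_set_reflect_step[OF i c(1) _ c(2) sA] that c(3) by simp
      have cases: "b = i \<or> b = - i \<or> b = i + 1 \<or> b = - (i + 1)"
        using i False by (rule_tac reflect_cases[OF i]) (auto split: if_splits)
      have order: "(b = i \<longrightarrow> b \<prec> c) \<and> (b = - i \<longrightarrow> c \<prec> b) \<and> (b = i + 1 \<longrightarrow> c \<prec> b) \<and> (b = - (i + 1) \<longrightarrow> b \<prec> c)"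
        unfolding c_def letter_less_def using False
        by (rule_tac reflect_cases[OF i]) (auto split: if_splits)
      have i0: "1 \<le> i" using i by simp
      consider "b = i" | "b = - i" | "b = i + 1" | "b = - (i + 1)" using cases by blast
      then show ?thesis
        unfolding weq fl L map_append list.map sA c(4) c_def[symmetric]
        by cases (use order i0 up dn in \<open>auto simp: fl algebra_simps\<close>)
    qed
  qed
qed

text \<open>Injectivity keeps the denominators of the operators and of the root factors away from
  zero. The condition is stable under reflections, which the operators require since they evaluate
  at \<open>y\<close> and at its reflection.\<close>

definition generic :: "nat \<Rightarrow> (int \<Rightarrow> 'k::field) \<Rightarrow> bool" where
  "generic n y \<longleftrightarrow> (\<forall>a\<in>alphabet n. y a \<noteq> 0 \<and> y (- a) = inverse (y a)) \<and> inj_on y (alphabet n)"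

lemma generic_reflect: "i \<in> {1..int n} \<Longrightarrow> generic n y \<Longrightarrow> generic n (y \<circ> reflect n i)"
proof -
  assume i: "i \<in> {1..int n}" and y: "generic n y"
  have "inj_on (y \<circ> reflect n i) (alphabet n)"
  proof (rule inj_onI)
    fix a b assume "a \<in> alphabet n" "b \<in> alphabet n" "(y \<circ> reflect n i) a = (y \<circ> reflect n i) b"
    then show "a = b" using i y reflect_alphabet[OF i] reflect_eq_iff[OF i] by (auto simp: generic_def inj_on_eq_iff)
  qed
  then show "generic n (y \<circ> reflect n i)" using i y by (simp add: generic_def)
qed

text \<open>Division by \<open>y i\<close> exhibits the simple root:
  \<open>y (reflect n i i) / y i\<close> is \<open>x^-alpha\<close> for the \<open>i\<close>-th
  simple root, also for \<open>i = n\<close>, where \<open>y (- n)\<close> is the inverse of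
  \<open>y n\<close>. The normalization multiplies functions invariant under the reflection by
  \<open>t\<close>.\<close>

definition dl_op :: "nat \<Rightarrow> 'k::field \<Rightarrow> int \<Rightarrow> ((int \<Rightarrow> 'k) \<Rightarrow> 'k) \<Rightarrow> (int \<Rightarrow> 'k) \<Rightarrow> 'k" where
  "dl_op n t i g y = ((1 - t) * y (reflect n i i) * g y
     + (t * y i - y (reflect n i i)) * g (y \<circ> reflect n i)) / (y i - y (reflect n i i))"

lemma dl_op_add: "dl_op n t i (\<lambda>y. g y + h y) y = dl_op n t i g y + dl_op n t i h y"
  by (simp add: dl_op_def algebra_simps flip: add_divide_distrib)

lemma dl_op_scale: "dl_op n t i (\<lambda>y. c * g y) y = c * dl_op n t i g y"
  by (simp add: dl_op_def algebra_simps)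

lemma dl_op_zero: "dl_op n t i (\<lambda>y. 0) y = 0"
  by (simp add: dl_op_def)

lemma dl_op_sum: "finite A \<Longrightarrow> dl_op n t i (\<lambda>y. \<Sum>e\<in>A. g e y) y = (\<Sum>e\<in>A. dl_op n t i (g e) y)"
  by (induction A rule: finite_induct) (simp_all add: dl_op_zero dl_op_add)

text \<open>A twisted product rule. For a monomial \<open>h\<close> it is the Bernstein relation
  between Hecke generators and translations.\<close>

lemma dl_op_mult:
  "dl_op n t i (\<lambda>y. h y * g y) y = h (y \<circ> reflect n i) * dl_op n t i g y
     + (1 - t) * y (reflect n i i) * (h y - h (y \<circ> reflect n i)) / (y i - y (reflect n i i)) * g y"
  by (simp add: dl_op_def add_divide_distrib diff_divide_distrib algebra_simps)

lemma generic_neq: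
  assumes "i \<in> {1..int n}" "generic n y"
  shows "y i \<noteq> y (reflect n i i)" "y i \<noteq> 0" "y (reflect n i i) \<noteq> 0"
proof -
  have "i \<in> alphabet n" using assms(1) by (simp add: alphabet_def)
  moreover from this have "reflect n i i \<in> alphabet n" using assms(1) by simp
  moreover have "reflect n i i \<noteq> i" using assms(1) by (auto simp: reflect_def)
  ultimately show "y i \<noteq> y (reflect n i i)" "y i \<noteq> 0" "y (reflect n i i) \<noteq> 0"
    using assms(2) by (auto simp: generic_def inj_on_def)
qed

definition equivariant :: "nat \<Rightarrow> 'k::field \<Rightarrow> nat \<Rightarrow> (int list \<Rightarrow> (int \<Rightarrow> 'k) \<Rightarrow> 'k) \<Rightarrow> bool" where
  "equivariant n t k F \<longleftrightarrow> (\<forall>w\<in>words n k. \<forall>i\<in>{1..int n}. \<forall>y. generic n y \<longrightarrow>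
     dl_op n t i (F w) y = left_act n t i (\<lambda>w. F w y) w)"

text \<open>
  For \<open>i = n\<close> multiplication by the positive letters alone is not compatible with the
  Demazure--Lusztig operator; the factor \<open>y i\<close> compensates for the missing half of the translation.
\<close>

definition dl_half :: "nat \<Rightarrow> 'k::field \<Rightarrow> int \<Rightarrow> int list \<Rightarrow> ((int \<Rightarrow> 'k) \<Rightarrow> 'k) \<Rightarrow> (int \<Rightarrow> 'k) \<Rightarrow> 'k" where
  "dl_half n t i w g y = (if i = int n \<and> moved n i w \<noteq> [] then y i else 1) * dl_op n t i g y"

definition equivariant_half :: "nat \<Rightarrow> 'k::field \<Rightarrow> nat \<Rightarrow> (int list \<Rightarrow> (int \<Rightarrow> 'k) \<Rightarrow> 'k) \<Rightarrow> bool" where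
  "equivariant_half n t k F \<longleftrightarrow> (\<forall>w\<in>words n k. \<forall>i\<in>{1..int n}. \<forall>y. generic n y \<longrightarrow>
     dl_half n t i w (F w) y = left_act_half n t i (\<lambda>w. F w y) w)"

section \<open>Right operators preserve equivariance\<close>

lemma swap_word:
  assumes "w \<in> words n k" "p + 1 < k"
  shows "w[p := w ! (p + 1), p + 1 := w ! p] \<in> words n k"
proof -
  have m: "mset (w[p := w ! (p + 1), p + 1 := w ! p]) = mset w"
    using assms mset_swap[of "p + 1" w p] by (simp add: words_def)
  have "mset (map abs (w[p := w ! (p + 1), p + 1 := w ! p])) = mset (map abs w)"
    unfolding mset_map m ..
  then have "distinct (map abs (w[p := w ! (p + 1), p + 1 := w ! p])) = distinct (map abs w)"
    by (rule mset_eq_imp_distinct_iff)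
  then show ?thesis using assms mset_eq_setD[OF m] by (simp add: words_def)
qed

text \<open>The right operators combine values at different words with coefficients that do not
  involve \<open>y\<close>, and \<open>dl_op\<close> is linear over such coefficients.\<close>

lemma dl_op_swap_op: "dl_op n t i (\<lambda>y. swap_op t p (\<lambda>w. F w y) w) y = swap_op t p (\<lambda>w. dl_op n t i (F w) y) w"
  by (simp add: swap_op_def Let_def dl_op_add dl_op_scale)

lemma dl_op_flip_op: "dl_op n t i (\<lambda>y. flip_op n t d (\<lambda>w. F w y) w) y = flip_op n t d (\<lambda>w. dl_op n t i (F w) y) w"
  by (simp add: flip_op_def dl_op_add dl_op_scale dl_op_sum)

lemma dl_op_extend_op: "dl_op n t i (\<lambda>y. extend_op n (\<lambda>w. F w y) w) y = extend_op n (\<lambda>w. dl_op n t i (F w) y) w"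
  by (simp add: extend_op_def dl_op_sum)

lemma equivariant_swap_op:
  assumes F: "equivariant n t k F" and p: "p + 1 < k"
  shows "equivariant n t k (\<lambda>w y. swap_op t p (\<lambda>w. F w y) w)"
  unfolding equivariant_def
proof (intro ballI allI impI)
  fix w i and y :: "int \<Rightarrow> 'a" assume w: "w \<in> words n k" and i: "i \<in> {1..int n}" and y: "generic n y"
  show "dl_op n t i (\<lambda>y. swap_op t p (\<lambda>w. F w y) w) y = left_act n t i (swap_op t p (\<lambda>w. F w y)) w"
    unfolding dl_op_swap_op left_act_swap_op[OF i w p]
    by (rule swap_op_cong) (use w p i y F swap_word[OF w p] in \<open>simp_all add: equivariant_def words_def\<close>)
qed

lemma equivariant_half_swap_op:
  assumes F: "equivariant_half n t k F" and p: "p + 1 < k"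
  shows "equivariant_half n t k (\<lambda>w y. swap_op t p (\<lambda>w. F w y) w)"
  unfolding equivariant_half_def
proof (intro ballI allI impI)
  fix w i and y :: "int \<Rightarrow> 'a" assume w: "w \<in> words n k" and i: "i \<in> {1..int n}" and y: "generic n y"
  define w' where "w' = w[p := w ! (p + 1), p + 1 := w ! p]"
  have "set w' = set w" using w p unfolding w'_def by (simp add: words_def set_swap)
  \<comment> \<open>The factor in \<open>dl_half\<close> depends on the word, but only through the
    existence of a moved letter; so it is common to both words and can be pulled through
    \<open>swap_op\<close>.\<close>
  then have m: "moved n i w' \<noteq> [] \<longleftrightarrow> moved n i w \<noteq> []" by (simp add: moved_def filter_empty_conv)
  define q where "q = (if i = int n \<and> moved n i w \<noteq> [] then y i else 1)"
  have "dl_half n t i w (\<lambda>y. swap_op t p (\<lambda>w. F w y) w) y = swap_op t p (\<lambda>v. q * dl_op n t i (F v) y) w"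
    unfolding dl_half_def dl_op_swap_op q_def[symmetric] by (simp add: swap_op_def Let_def algebra_simps)
  also have "\<dots> = swap_op t p (left_act_half n t i (\<lambda>w. F w y)) w"
  proof (rule swap_op_cong)
    have F': "dl_half n t i v (F v) y = left_act_half n t i (\<lambda>w. F w y) v" if "v \<in> words n k" for v
      using F i y that by (simp add: equivariant_half_def)
    show "q * dl_op n t i (F w) y = left_act_half n t i (\<lambda>w. F w y) w"
      using F'[OF w] by (simp add: dl_half_def q_def)
    show "q * dl_op n t i (F (w[p := w ! (p + 1), p + 1 := w ! p])) y
      = left_act_half n t i (\<lambda>w. F w y) (w[p := w ! (p + 1), p + 1 := w ! p])"
      using F'[OF swap_word[OF w p]] unfolding w'_def[symmetric] dl_half_def q_def m .
  qed (use w p in \<open>simp add: words_def\<close>)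
  finally show "dl_half n t i w (\<lambda>y. swap_op t p (\<lambda>w. F w y) w) y = left_act_half n t i (swap_op t p (\<lambda>w. F w y)) w"
    by (simp add: left_act_half_swap_op[OF i w p])
qed

lemma flip_op_cong:
  assumes "w \<in> words n k" "0 < k" "\<And>v. v \<in> words n k \<Longrightarrow> f v = g v"
  shows "flip_op n t d f w = flip_op n t d g w"
proof -
  obtain A b where weq: "w = A @ [b]" using assms(1,2) by (cases w rule: rev_cases) (auto simp: words_def)
  obtain k' where k: "k = Suc k'" using assms(2) by (cases k) auto
  have "A \<in> words n k'" "A @ [- b] \<in> words n k" using assms(1) by (auto simp: weq k words_snoc)
  moreover have "A @ [e] \<in> words n k" if "e \<in> below_set n A v" for e v
    using that \<open>A \<in> words n k'\<close> by (auto simp: k words_snoc below_set_def)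
  ultimately show ?thesis using assms(3) by (simp add: weq flip_op_append)
qed

lemma equivariant_flip_op:
  assumes F: "equivariant n t k F" and k: "0 < k"
  shows "equivariant n t k (\<lambda>w y. flip_op n t (1 - t) (\<lambda>w. F w y) w)"
  unfolding equivariant_def
proof (intro ballI allI impI)
  fix w i and y :: "int \<Rightarrow> 'a" assume w: "w \<in> words n k" and i: "i \<in> {1..int n}" and y: "generic n y"
  have "w \<noteq> []" using w k by (auto simp: words_def)
  show "dl_op n t i (\<lambda>y. flip_op n t (1 - t) (\<lambda>w. F w y) w) y = left_act n t i (flip_op n t (1 - t) (\<lambda>w. F w y)) w"
    unfolding dl_op_flip_op left_act_flip_op[OF i w \<open>w \<noteq> []\<close>]
    by (rule flip_op_cong[OF w k]) (use i y F in \<open>simp add: equivariant_def\<close>)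
qed

lemma equivariant_half_flip_op:
  assumes F: "equivariant_half n t k F" and k: "0 < k"
  shows "equivariant_half n t k (\<lambda>w y. flip_op n t 0 (\<lambda>w. F w y) w)"
  unfolding equivariant_half_def
proof (intro ballI allI impI)
  fix w i and y :: "int \<Rightarrow> 'a" assume w: "w \<in> words n k" and i: "i \<in> {1..int n}" and y: "generic n y"
  obtain A b where weq: "w = A @ [b]" using w k by (cases w rule: rev_cases) (auto simp: words_def)
  \<comment> \<open>Negating the last letter does not change whether some letter moves, and with
    \<open>d = 0\<close> no further word enters. So the factor in \<open>dl_half\<close> is common
    here as well.\<close>
  have m: "moved n i (A @ [- b]) \<noteq> [] \<longleftrightarrow> moved n i (A @ [b]) \<noteq> []" using i by (simp add: moved_Cons)
  have "A @ [- b] \<in> words n k" using w by (auto simp: weq words_def)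
  then have "dl_half n t i (A @ [- b]) (F (A @ [- b])) y = left_act_half n t i (\<lambda>w. F w y) (A @ [- b])"
    using F i y by (simp add: equivariant_half_def)
  moreover have "w \<noteq> []" using weq by simp
  ultimately show "dl_half n t i w (\<lambda>y. flip_op n t 0 (\<lambda>w. F w y) w) y = left_act_half n t i (flip_op n t 0 (\<lambda>w. F w y)) w"
    unfolding left_act_half_flip_op[OF i w \<open>w \<noteq> []\<close>] dl_half_def dl_op_flip_op
    using m by (simp add: weq flip_op_append dl_half_def algebra_simps)
qed

lemma equivariant_extend_op:
  assumes F: "equivariant n t (Suc k) F"
  shows "equivariant n t k (\<lambda>w y. extend_op n (\<lambda>w. F w y) w)"
  unfolding equivariant_def
proof (intro ballI allI impI)
  fix w i and y :: "int \<Rightarrow> 'a" assume w: "w \<in> words n k" and i: "i \<in> {1..int n}" and y: "generic n y"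
  show "dl_op n t i (\<lambda>y. extend_op n (\<lambda>w. F w y) w) y = left_act n t i (extend_op n (\<lambda>w. F w y)) w"
    unfolding dl_op_extend_op left_act_extend_op[OF i w] unfolding extend_op_def
    by (rule sum.cong) (use w i y F in \<open>auto simp: equivariant_def words_snoc\<close>)
qed


section \<open>Potentials\<close>

text \<open>The starting word of a run of right operators: if each letter in turn slides to the end
  and is negated there, \<open>rev_neg D\<close> turns back into \<open>D\<close>.\<close>

definition rev_neg :: "int list \<Rightarrow> int list" where
  "rev_neg D = map uminus (rev D)"

lemma rev_neg_append [simp]: "rev_neg (u @ v) = rev_neg v @ rev_neg u"
  and rev_neg_Cons [simp]: "rev_neg (a # v) = rev_neg v @ [- a]"
  and rev_neg_Nil [simp]: "rev_neg [] = []"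
  and length_rev_neg [simp]: "length (rev_neg v) = length v"
  by (simp_all add: rev_neg_def)

lemma rev_neg_words: "rev_neg D \<in> words n k \<longleftrightarrow> D \<in> words n k"
proof -
  have "map abs (rev_neg D) = rev (map abs D)" by (simp add: rev_neg_def rev_map)
  moreover have "set (rev_neg D) \<subseteq> alphabet n \<longleftrightarrow> set D \<subseteq> alphabet n"
    by (auto simp: rev_neg_def subset_iff)
  ultimately show ?thesis by (simp add: words_def)
qed

lemma rev_neg_reflect: "i \<in> {1..int n} \<Longrightarrow> rev_neg (map (reflect n i) D) = map (reflect n i) (rev_neg D)"
  by (simp add: rev_neg_def rev_map)

lemma moved_rev_neg: "i \<in> {1..int n} \<Longrightarrow> moved n i (rev_neg D) = rev_neg (moved n i D)"
  by (simp add: rev_neg_def moved_def filter_map o_def rev_filter)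

definition count_below :: "int list \<Rightarrow> int \<Rightarrow> nat" where
  "count_below X v = length (filter (\<lambda>x. x \<prec> v) X)"

text \<open>
  The exponent of \<open>t\<close> by which a product of right operators at \<open>rev_neg D\<close> exceeds the sum over
  column steps weighted by \<open>N\<close>; see \<open>flips_op_steps_sum\<close>.
\<close>

fun pot :: "nat \<Rightarrow> int list \<Rightarrow> int list \<Rightarrow> nat" where
  "pot n X [] = 0"
| "pot n X (z # Z) = count_below X (- z) + card (below_set n (X @ Z) (- z)) + pot n (X @ [z]) Z"

text \<open>The change of one summand of \<open>pot\<close> under a reflection, at
  \<open>v = - z\<close>. The sign tells whether the image of \<open>v\<close> is below or above
  \<open>v\<close>; the two indicators correspond to the two places where the image can be counted,
  among the free letters and among those of \<open>X\<close>.\<close>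

definition pot_shift :: "nat \<Rightarrow> int \<Rightarrow> int list \<Rightarrow> int list \<Rightarrow> int \<Rightarrow> int" where
  "pot_shift n i X Z v =
     (if reflect n i v = v then 0 else if reflect n i v \<prec> v then 1 else - 1) *
        (of_bool (\<bar>reflect n i v\<bar> \<notin> abs ` set (X @ Z)) + of_bool (reflect n i v \<in> set X))"

fun pot_shifts :: "nat \<Rightarrow> int \<Rightarrow> int list \<Rightarrow> int list \<Rightarrow> int" where
  "pot_shifts n i X [] = 0"
| "pot_shifts n i X (z # Z) = pot_shift n i X Z (- z) + pot_shifts n i (X @ [z]) Z"

lemma count_below_reflect:
  assumes i: "i \<in> {1..int n}" and X: "set X \<subseteq> alphabet n" "distinct X" "v \<in> alphabet n"
  shows "int (count_below X v) = int (count_below (map (reflect n i) X) (reflect n i v)) +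
    (if reflect n i v = v then 0 else if reflect n i v \<prec> v then 1 else - 1) * of_bool (reflect n i v \<in> set X)"
  using X
proof (induction X)
  case (Cons x X)
  have one: "of_bool (x \<prec> v) = of_bool (reflect n i x \<prec> reflect n i v) +
    (if reflect n i v = v then 0 else if reflect n i v \<prec> v then 1 else - 1) * (of_bool (reflect n i v = x) :: int)"
  proof (cases "v = reflect n i x")
    case True
    then have "reflect n i v = x" "reflect n i x = v" using i by simp_all
    moreover have "x = v \<or> x \<prec> v \<and> \<not> v \<prec> x \<or> v \<prec> x \<and> \<not> x \<prec> v"
      using Cons.prems letter_less_total[of x v] letter_less_asym[of x v] letter_less_asym[of v x]
      by (auto simp: alphabet_nonzero)
    ultimately show ?thesis by auto
  next
    case False
    then have "reflect n i v \<noteq> x" using i by auto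
    then show ?thesis using reflect_less_iff[OF i _ _ False] Cons.prems by simp
  qed
  have "int (count_below (x # X) u) = of_bool (x \<prec> u) + int (count_below X u)" for x u X
    by (simp add: count_below_def)
  moreover have "of_bool (reflect n i v \<in> set (x # X)) =
      of_bool (reflect n i v = x) + (of_bool (reflect n i v \<in> set X) :: int)"
    using Cons.prems by auto
  moreover have "int (count_below X v) = int (count_below (map (reflect n i) X) (reflect n i v)) +
    (if reflect n i v = v then 0 else if reflect n i v \<prec> v then 1 else - 1) * of_bool (reflect n i v \<in> set X)"
    using Cons by simp
  ultimately show ?case using one unfolding list.map by (simp only: distrib_left)
qed (simp add: count_below_def)

text \<open>Apart from the pair formed by \<open>v\<close> and its image, the reflection preserves
  comparisons. After removal of one letter from each of the two sets they correspond, and only the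
  removed letters have to be accounted for.\<close>

lemma card_below_set_shift:
  assumes i: "i \<in> {1..int n}" and v: "v \<in> alphabet n"
  shows "int (card (below_set n X v)) = int (card (below_set n (map (reflect n i) X) (reflect n i v))) +
    (if reflect n i v = v then 0 else if reflect n i v \<prec> v then 1 else - 1) * of_bool (\<bar>reflect n i v\<bar> \<notin> abs ` set X)"
proof (cases "reflect n i v = v \<or> \<bar>reflect n i v\<bar> \<in> abs ` set X")
  case True
  then show ?thesis using card_below_set_reflect[OF i v True] by auto
next
  case False
  define X' where "X' = map (reflect n i) X"
  define s where "s = reflect n i"
  have ss: "s (s a) = a" for a using i by (simp add: s_def)
  have absX: "\<bar>s e\<bar> \<in> abs ` set X' \<longleftrightarrow> \<bar>e\<bar> \<in> abs ` set X" for e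
    using reflect_abs_image[OF i, of e X] by (simp add: X'_def s_def)
  have img: "s ` (below_set n X v - {s v}) = below_set n X' (s v) - {v}"
  proof -
    have *: "s e \<in> below_set n X' (s v) - {v} \<longleftrightarrow> e \<in> below_set n X v - {s v}" for e
    proof (cases "e \<in> alphabet n \<and> e \<noteq> s v")
      case True
      then have "v \<noteq> s e" using ss by metis
      then have "s e \<prec> s v \<longleftrightarrow> e \<prec> v" using True reflect_less_iff[OF i _ v] by (simp add: s_def)
      then show ?thesis using True absX i ss by (auto simp: below_set_def s_def)
    next
      case False
      then show ?thesis using i ss by (auto simp: below_set_def s_def)
    qed
    show ?thesis
    proof (intro equalityI subsetI)
      fix x assume "x \<in> below_set n X' (s v) - {v}"
      then have "s x \<in> below_set n X v - {s v}" using *[of "s x"] ss by simp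
      then have "s (s x) \<in> s ` (below_set n X v - {s v})" by (rule imageI)
      then show "x \<in> s ` (below_set n X v - {s v})" using ss by simp
    qed (use * in auto)
  qed
  have c: "card (below_set n X v - {s v}) = card (below_set n X' (s v) - {v})"
    unfolding img[symmetric] by (rule card_image[symmetric]) (use i in \<open>simp add: s_def inj_on_def\<close>)
  have sv: "s v \<in> alphabet n" "s v \<noteq> v" "\<bar>s v\<bar> \<notin> abs ` set X" using False i v by (simp_all add: s_def)
  have vX: "\<bar>v\<bar> \<notin> abs ` set X'" using absX[of "s v"] ss sv(3) by simp
  have m: "s v \<in> below_set n X v \<longleftrightarrow> s v \<prec> v" "v \<in> below_set n X' (s v) \<longleftrightarrow> v \<prec> s v"
    using sv v vX by (auto simp: below_set_def)
  have d: "card (B - {x}) = card B - (if x \<in> B then 1 else 0)" if "finite B" for B and x :: int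
    using that by simp
  have pos: "x \<in> B \<Longrightarrow> finite B \<Longrightarrow> card B > 0" for B and x :: int by (auto simp: card_gt_0_iff)
  have "s v \<prec> v \<or> v \<prec> s v" "\<not> (s v \<prec> v \<and> v \<prec> s v)"
    using reflect_less_cases[OF i v] sv(2) letter_less_asym by (auto simp: s_def)
  then have "int (card (below_set n X v)) = int (card (below_set n X' (s v))) + (if s v \<prec> v then 1 else - 1)"
    using c m pos[of "s v" "below_set n X v"] pos[of v "below_set n X' (s v)"] by (auto simp: d of_nat_diff)
  then show ?thesis using False by (simp add: s_def X'_def)
qed

lemma pot_reflect:
  assumes i: "i \<in> {1..int n}" and w: "X @ Z \<in> words n k"
  shows "int (pot n X Z) = int (pot n (map (reflect n i) X) (map (reflect n i) Z)) + pot_shifts n i X Z"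
  using w
proof (induction Z arbitrary: X)
  case (Cons z Z)
  have IH: "int (pot n (X @ [z]) Z) = int (pot n (map (reflect n i) (X @ [z])) (map (reflect n i) Z)) + pot_shifts n i (X @ [z]) Z"
    using Cons.prems by (intro Cons.IH) simp
  have X: "set X \<subseteq> alphabet n" "distinct X" "- z \<in> alphabet n"
    using Cons.prems by (auto simp: words_def distinct_map)
  show ?case
    using IH count_below_reflect[OF i X] card_below_set_shift[OF i X(3), of "X @ Z"] i
    by (auto simp: pot_shift_def algebra_simps)
qed simp

lemma pot_shifts_moved_Nil: "i \<in> {1..int n} \<Longrightarrow> moved n i Z = [] \<Longrightarrow> pot_shifts n i X Z = 0"
  by (induction Z arbitrary: X) (auto simp: moved_Cons pot_shift_def split: if_splits)

lemma pot_shifts_append: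
  "i \<in> {1..int n} \<Longrightarrow> moved n i U = [] \<Longrightarrow> pot_shifts n i X (U @ Z) = pot_shifts n i (X @ U) Z"
  by (induction U arbitrary: X) (auto simp: moved_Cons pot_shift_def split: if_splits)

lemma moved_Nil_abs:
  assumes i: "i \<in> {1..int n}" and "moved n i U = []" "reflect n i a \<noteq> a"
  shows "\<bar>a\<bar> \<notin> abs ` set U"
proof
  assume "\<bar>a\<bar> \<in> abs ` set U"
  then obtain u where "u \<in> set U" "\<bar>u\<bar> = \<bar>a\<bar>" by auto
  then have "reflect n i u \<noteq> u" using assms(3) i by (auto simp: abs_eq_iff)
  then show False using assms(2) \<open>u \<in> set U\<close> by (auto simp: moved_def filter_empty_conv)
qed

text \<open>Two moved letters exhaust the two absolute values that the reflection moves, so up to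
  sign the second is the image of the first, and a third cannot occur.\<close>

lemma moved_words_cases:
  assumes i: "i \<in> {1..int n}" and w: "D \<in> words n k"
  obtains (none) "moved n i D = []"
  | (one) U a V where "D = U @ a # V" "moved n i D = [a]" "moved n i U = []" "moved n i V = []" "reflect n i a \<noteq> a"
  | (two) U a V b W where "D = U @ a # V @ b # W" "moved n i D = [a, b]" "moved n i U = []" "moved n i V = []"
      "moved n i W = []" "reflect n i a \<noteq> a" "reflect n i b \<noteq> b" "b = reflect n i a \<or> b = - reflect n i a"
      "\<bar>b\<bar> \<noteq> \<bar>a\<bar>"
proof -
  show thesis
  proof (cases "moved n i D")
    case Nil then show thesis by (rule none)
  next
    case (Cons a as)
    then obtain U V where UV: "D = U @ a # V" "moved n i U = []" "reflect n i a \<noteq> a" "moved n i V = as"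
      using filter_eq_ConsD[of "\<lambda>a. reflect n i a \<noteq> a" D a as]
      unfolding moved_def by (auto simp: filter_empty_conv)
    show thesis
    proof (cases as)
      case Nil then show thesis using one UV Cons by blast
    next
      case (Cons b bs)
      then obtain V1 W where VW: "V = V1 @ b # W" "moved n i V1 = []" "reflect n i b \<noteq> b" "moved n i W = bs"
        using filter_eq_ConsD[of "\<lambda>a. reflect n i a \<noteq> a" V b bs] UV(4)
        unfolding moved_def by (auto simp: filter_empty_conv)
      have ab: "\<bar>b\<bar> \<noteq> \<bar>a\<bar>" using w by (auto simp: UV(1) VW(1) words_def)
      have "bs = []"
      proof (rule ccontr)
        assume "bs \<noteq> []"
        then obtain c where "c \<in> set (moved n i W)" using VW(4) by (cases bs) auto
        then have c: "c \<in> set W" "reflect n i c \<noteq> c" by (auto simp: moved_def)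
        then have "\<bar>c\<bar> \<in> abs ` set W" by blast
        then have "\<bar>c\<bar> \<noteq> \<bar>a\<bar>" "\<bar>c\<bar> \<noteq> \<bar>b\<bar>" using w by (auto simp: UV(1) VW(1) words_def)
        then show False using moved_abs3[OF i, of a b c] UV(3) VW(3) c(2) ab by auto
      qed
      moreover have "b = reflect n i a \<or> b = - reflect n i a"
        using moved_abs[OF i UV(3) VW(3)] ab by (auto simp: abs_eq_iff)
      ultimately show thesis using two UV VW Cons \<open>moved n i D = a # as\<close> ab by simp
    qed
  qed
qed

text \<open>No letter of \<open>U\<close> or \<open>V\<close> has the absolute value of the image of
  \<open>a\<close>. So the image is counted among the free letters only, and this count changes by
  one.\<close>

lemma pot_one:
  assumes i: "i \<in> {1..int n}" and w: "D \<in> words n k" and D: "D = U @ a # V" "moved n i U = []" "moved n i V = []"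
    and a: "reflect n i a \<noteq> a"
  shows "a \<prec> reflect n i a \<Longrightarrow> pot n [] D = Suc (pot n [] (map (reflect n i) D))"
    and "reflect n i a \<prec> a \<Longrightarrow> pot n [] (map (reflect n i) D) = Suc (pot n [] D)"
proof -
  have s: "reflect n i (reflect n i a) \<noteq> reflect n i a" using a i by simp
  have "\<bar>reflect n i a\<bar> \<notin> abs ` set U" "\<bar>reflect n i a\<bar> \<notin> abs ` set V"
    using moved_Nil_abs[OF i D(2) s] moved_Nil_abs[OF i D(3) s] by auto
  moreover from this have "- reflect n i a \<notin> set U" by (metis abs_minus imageI)
  ultimately have "pot_shifts n i [] D = (if - reflect n i a \<prec> - a then 1 else - 1)"
    using a i pot_shifts_moved_Nil[OF i D(3)] by (simp add: D(1) pot_shifts_append[OF i D(2)] pot_shift_def image_Un)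
  moreover have "- reflect n i a \<prec> - a \<longleftrightarrow> a \<prec> reflect n i a"
    using w i by (intro uminus_letter_less) (auto simp: D(1) words_def alphabet_def)
  moreover have "int (pot n [] D) = int (pot n [] (map (reflect n i) D)) + pot_shifts n i [] D"
    using pot_reflect[OF i, of "[]" D k] w by simp
  ultimately show "a \<prec> reflect n i a \<Longrightarrow> pot n [] D = Suc (pot n [] (map (reflect n i) D))"
    and "reflect n i a \<prec> a \<Longrightarrow> pot n [] (map (reflect n i) D) = Suc (pot n [] D)"
    using letter_less_asym by auto
qed

text \<open>Both absolute values occur in the column, so only letters already passed can contribute.
  If \<open>b = - reflect n i a\<close>, the second letter meets \<open>a\<close> as the image of
  \<open>- b\<close> among them; if \<open>b = reflect n i a\<close>, neither letter meets such an
  image.\<close>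

lemma pot_two:
  assumes i: "i \<in> {1..int n}" and w: "D \<in> words n k"
    and D: "D = U @ a # V @ b # W" "moved n i U = []" "moved n i V = []" "moved n i W = []"
    and ab: "reflect n i a \<noteq> a" "reflect n i b \<noteq> b" "\<bar>b\<bar> \<noteq> \<bar>a\<bar>"
  shows "b = reflect n i a \<Longrightarrow> pot n [] (map (reflect n i) D) = pot n [] D"
    and "b = - reflect n i a \<Longrightarrow> a \<prec> reflect n i a \<Longrightarrow> pot n [] D = Suc (pot n [] (map (reflect n i) D))"
    and "b = - reflect n i a \<Longrightarrow> reflect n i a \<prec> a \<Longrightarrow> pot n [] (map (reflect n i) D) = Suc (pot n [] D)"
proof -
  have nz: "a \<noteq> 0" "reflect n i a \<noteq> 0" using ab(1) i by auto
  have sa: "reflect n i (reflect n i a) \<noteq> reflect n i a" using ab(1) i by simp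
  have "\<bar>reflect n i a\<bar> \<notin> abs ` set U" "\<bar>a\<bar> \<notin> abs ` set U" "\<bar>a\<bar> \<notin> abs ` set V"
    using moved_Nil_abs[OF i D(2) sa] moved_Nil_abs[OF i D(2) ab(1)] moved_Nil_abs[OF i D(3) ab(1)] by auto
  then have U: "- reflect n i a \<notin> set U" "a \<notin> set U" "- a \<notin> set U" "a \<notin> set V" "- a \<notin> set V"
    by (metis abs_minus imageI)+
  have sh: "pot_shifts n i [] D = pot_shift n i U (V @ b # W) (- a) + pot_shift n i (U @ a # V) W (- b)"
    by (simp add: D(1) pot_shifts_append[OF i D(2)] pot_shifts_append[OF i D(3)] pot_shifts_moved_Nil[OF i D(4)])
  have P: "int (pot n [] D) = int (pot n [] (map (reflect n i) D)) + pot_shifts n i [] D"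
    using pot_reflect[OF i, of "[]" D k] w by simp
  { assume b: "b = reflect n i a"
    then have "reflect n i b = a" using i by simp
    then have "pot_shifts n i [] D = 0" using b i U nz by (simp add: sh pot_shift_def)
    then show "pot n [] (map (reflect n i) D) = pot n [] D" using P by simp }
  { assume b: "b = - reflect n i a"
    then have b': "reflect n i b = - a" using i by simp
    have "pot_shifts n i [] D = (if a \<prec> reflect n i a then 1 else - 1)"
      using b b' i U nz ab(1) by (simp add: sh pot_shift_def)
    then show "a \<prec> reflect n i a \<Longrightarrow> pot n [] D = Suc (pot n [] (map (reflect n i) D))"
      "reflect n i a \<prec> a \<Longrightarrow> pot n [] (map (reflect n i) D) = Suc (pot n [] D)"
      using P letter_less_asym by auto }
qed


section \<open>Multiplication by the letters of a column\<close>

definition pos_part :: "int list \<Rightarrow> (int \<Rightarrow> 'k::field) \<Rightarrow> 'k" where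
  "pos_part D y = prod_list (map (\<lambda>a. if 0 < a then y a else 1) D)"

definition neg_part :: "int list \<Rightarrow> (int \<Rightarrow> 'k::field) \<Rightarrow> 'k" where
  "neg_part D y = prod_list (map (\<lambda>a. if a < 0 then y a else 1) D)"

lemma pos_part_append [simp]: "pos_part (u @ v) y = pos_part u y * pos_part v y"
  and pos_part_Cons [simp]: "pos_part (a # v) y = (if 0 < a then y a else 1) * pos_part v y"
  and pos_part_Nil [simp]: "pos_part [] y = 1"
  by (simp_all add: pos_part_def)

lemma neg_part_append [simp]: "neg_part (u @ v) y = neg_part u y * neg_part v y"
  and neg_part_Cons [simp]: "neg_part (a # v) y = (if a < 0 then y a else 1) * neg_part v y"
  and neg_part_Nil [simp]: "neg_part [] y = 1"
  by (simp_all add: neg_part_def)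

lemma part_fixed:
  assumes "moved n i U = []"
  shows "pos_part U (y \<circ> reflect n i) = pos_part U y" "neg_part U (y \<circ> reflect n i) = neg_part U y"
proof -
  have "reflect n i u = u" if "u \<in> set U" for u
    using assms that by (auto simp: moved_def filter_empty_conv)
  then show "pos_part U (y \<circ> reflect n i) = pos_part U y" "neg_part U (y \<circ> reflect n i) = neg_part U y"
    unfolding pos_part_def neg_part_def by (auto intro!: arg_cong[of _ _ prod_list])
qed

lemma dl_op_weight:
  "dl_op n t i (\<lambda>y. h y * g y / c) y = (h (y \<circ> reflect n i) * dl_op n t i g y
     + (1 - t) * y (reflect n i i) * (h y - h (y \<circ> reflect n i)) / (y i - y (reflect n i i)) * g y) / c"
proof -
  have "dl_op n t i (\<lambda>y. h y * g y / c) y = dl_op n t i (\<lambda>y. inverse c * (h y * g y)) y"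
    by (simp add: field_simps)
  then show ?thesis unfolding dl_op_scale dl_op_mult by (simp add: divide_inverse mult.commute)
qed

text \<open>The correction term of \<open>dl_op_mult\<close> for the weights that moved letters can
  produce: the values \<open>Y\<close> at \<open>i\<close> and \<open>Z\<close> at its image, and
  their inverses, which come from negative letters.\<close>

lemma exchange_quotients:
  fixes Y Z K t :: "'k::field"
  assumes "Y \<noteq> Z"
  shows "(1 - t) * Z * (Y * K - Z * K) / (Y - Z) = (1 - t) * Z * K"
    and "(1 - t) * Z * (Z * K - Y * K) / (Y - Z) = - ((1 - t) * Z * K)"
    and "Y \<noteq> 0 \<Longrightarrow> Z \<noteq> 0 \<Longrightarrow> (1 - t) * Z * (inverse Y * K - inverse Z * K) / (Y - Z) = - ((1 - t) * inverse Y * K)"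
    and "Y \<noteq> 0 \<Longrightarrow> Z \<noteq> 0 \<Longrightarrow> (1 - t) * Z * (inverse Z * K - inverse Y * K) / (Y - Z) = (1 - t) * inverse Y * K"
proof -
  have n: "Y - Z \<noteq> 0" using assms by simp
  show "(1 - t) * Z * (Y * K - Z * K) / (Y - Z) = (1 - t) * Z * K"
    using n by (simp add: divide_eq_eq) (simp add: algebra_simps)
  show "(1 - t) * Z * (Z * K - Y * K) / (Y - Z) = - ((1 - t) * Z * K)"
    using n by (simp add: divide_eq_eq) (simp add: algebra_simps)
  show "(1 - t) * Z * (inverse Y * K - inverse Z * K) / (Y - Z) = - ((1 - t) * inverse Y * K)"
    if "Y \<noteq> 0" "Z \<noteq> 0"
    using n that by (simp add: field_simps)
  show "(1 - t) * Z * (inverse Z * K - inverse Y * K) / (Y - Z) = (1 - t) * inverse Y * K"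
    if "Y \<noteq> 0" "Z \<noteq> 0"
    using n that by (simp add: field_simps)
qed

lemma moved_letter_cases:
  assumes i: "i \<in> {1..int n}" and a: "reflect n i a \<noteq> a"
  obtains (pos) "a = i" "reflect n i a = reflect n i i" "a \<prec> reflect n i a"
  | (neg) "a = - i" "reflect n i a = - reflect n i i" "reflect n i a \<prec> a"
  | (pos') "i < int n" "a = i + 1" "reflect n i a = i" "reflect n i i = i + 1" "reflect n i a \<prec> a"
  | (neg') "i < int n" "a = - (i + 1)" "reflect n i a = - i" "reflect n i i = i + 1" "a \<prec> reflect n i a"
  using i
proof (rule reflect_cases)
  assume r: "i = int n" "\<And>a. reflect n i a = (if \<bar>a\<bar> = i then - a else a)"
  then have "a = i \<or> a = - i" using a by (auto split: if_splits)
  then show thesis using pos neg i r by (auto simp: letter_less_def)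
next
  assume r: "1 \<le> i" "i < int n" "\<And>a. reflect n i a = (if a = i then i + 1 else if a = i + 1 then i
      else if a = - i then - (i + 1) else if a = - (i + 1) then - i else a)"
  then have "a = i \<or> a = - i \<or> a = i + 1 \<or> a = - (i + 1)" using a by (auto split: if_splits)
  then show thesis using pos neg pos' neg' r by (auto simp: letter_less_def)
qed

lemma generic_uminus: "generic n y \<Longrightarrow> a \<in> alphabet n \<Longrightarrow> y (- a) = inverse (y a)"
  by (simp add: generic_def)

lemma reflect_top: "i = int n \<Longrightarrow> 1 \<le> i \<Longrightarrow> reflect n i i = - i"
  by (simp add: reflect_def)

lemma reflect_low: "i \<noteq> int n \<Longrightarrow> reflect n i i = i + 1"
  by (simp add: reflect_def)

lemma moved_two_lt:
  assumes i: "i \<in> {1..int n}" and "reflect n i a \<noteq> a" "reflect n i b \<noteq> b" "\<bar>b\<bar> \<noteq> \<bar>a\<bar>"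
  shows "i \<noteq> int n"
  using assms by (auto simp: reflect_def split: if_splits)

text \<open>Negation reverses ascents, so \<open>left_act\<close> at \<open>rev_neg D\<close> takes
  the branch opposite to the one at \<open>D\<close>. Where the positive weight changes under the
  reflection, the correction term of the product rule turns one branch into the other, and the
  change of \<open>pot\<close> supplies the missing power of \<open>t\<close>. Where it does not
  change, the coefficients of \<open>left_act_half\<close> record what is left.\<close>

lemma equivariant_half_pos_part:
  assumes t: "t \<noteq> 0" and F: "equivariant n t k F"
  shows "equivariant_half n t k (\<lambda>D y. pos_part D y * F (rev_neg D) y / t ^ pot n [] D)"
  unfolding equivariant_half_def
proof (intro ballI allI impI)
  fix D i and y :: "int \<Rightarrow> 'a" assume D: "D \<in> words n k" and i: "i \<in> {1..int n}" and y: "generic n y"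
  define G where "G = (\<lambda>D y. pos_part D y * F (rev_neg D) y / t ^ pot n [] D)"
  define s where "s = reflect n i"
  define Y Z where "Y = y i" and "Z = y (s i)"
  have YZ: "Y \<noteq> Z" "Y \<noteq> 0" "Z \<noteq> 0" using generic_neq[OF i y] by (auto simp: Y_def Z_def s_def)
  define \<phi> \<phi>' where "\<phi> = F (rev_neg D) y" and "\<phi>' = F (map s (rev_neg D)) y"
  define A where "A = dl_op n t i (F (rev_neg D)) y"
  have "rev_neg D \<in> words n k" using D by (simp add: rev_neg_words)
  then have A: "A = left_act n t i (\<lambda>w. F w y) (rev_neg D)"
    using F i y unfolding A_def equivariant_def by blast
  have Gy: "G D y = pos_part D y * \<phi> / t ^ pot n [] D" by (simp add: G_def \<phi>_def)
  have Gs: "G (map s D) y = pos_part (map s D) y * \<phi>' / t ^ pot n [] (map s D)"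
    by (simp add: G_def \<phi>'_def s_def rev_neg_reflect[OF i])
  have dl: "dl_op n t i (G D) y = (pos_part D (y \<circ> s) * A
      + (1 - t) * Z * (pos_part D y - pos_part D (y \<circ> s)) / (Y - Z) * \<phi>) / t ^ pot n [] D"
    unfolding G_def dl_op_weight by (simp add: A_def \<phi>_def Y_def Z_def s_def)
  have m: "moved n i (rev_neg D) = rev_neg (moved n i D)" by (rule moved_rev_neg[OF i])
  have ul: "- a \<prec> s (- a) \<longleftrightarrow> s a \<prec> a" if "a \<in> set D" for a
  proof -
    have "a \<noteq> 0" "s a \<noteq> 0" using that D i by (auto simp: words_def s_def alphabet_def)
    then show ?thesis using i by (simp add: uminus_letter_less s_def)
  qed
  have yneg: "y (- i) = inverse Y" "y (- s i) = inverse Z"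
  proof -
    have "i \<in> alphabet n" using i by (simp add: alphabet_def)
    moreover from this have "s i \<in> alphabet n" using i by (simp add: s_def)
    ultimately show "y (- i) = inverse Y" "y (- s i) = inverse Z"
      using generic_uminus[OF y] by (simp_all add: Y_def Z_def)
  qed
  show "dl_half n t i D (G D) y = left_act_half n t i (\<lambda>D. G D y) D"
    using i D
  proof (cases rule: moved_words_cases)
    case none
    have "A = t * \<phi>" using none m by (simp add: A left_act_moved \<phi>_def)
    then show ?thesis using none part_fixed(1)[OF none, of y, folded s_def]
      by (simp add: dl_half_def dl left_act_half_other left_act_moved Gy)
  next
    case (one U a V)
    define K where "K = pos_part U y * pos_part V y"
    have pD: "pos_part D y = (if 0 < a then y a else 1) * K"
      "pos_part D (y \<circ> s) = (if 0 < a then y (s a) else 1) * K"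
      "pos_part (map s D) y = (if 0 < s a then y (s a) else 1) * K"
      using one part_fixed[of n i _ y, folded s_def] moved_empty_map[of n i, folded s_def]
      by (simp_all add: K_def)
    have aD: "a \<in> set D" using one by simp
    have A': "A = (if s a \<prec> a then \<phi>' else (t - 1) * \<phi> + t * \<phi>')"
      using m one(2) ul[OF aD] by (simp add: A left_act_moved \<phi>_def \<phi>'_def s_def)
    note po = pot_one[OF i D one(1,3,4,5), folded s_def]
    note L = left_act_half_single[OF one(2), of t "\<lambda>D. G D y", folded s_def]
    have mne: "moved n i D \<noteq> []" using one(2) by simp
    have i0: "0 < i" using i by simp
    show ?thesis
      using i one(5)
    proof (cases rule: moved_letter_cases)
      case pos
      have na: "\<not> s a \<prec> a" using pos(3) letter_less_asym by (simp add: s_def)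
      have p: "pot n [] D = Suc (pot n [] (map s D))" using po pos(3) by (simp add: s_def)
      show ?thesis
      proof (cases "i = int n")
        case True
        then have si: "s i = - i" using i0 reflect_top[of i n] by (simp add: s_def)
        then have ZY: "Z = inverse Y" using yneg by (simp add: Z_def)
        have pD': "pos_part D y = Y * K" "pos_part D (y \<circ> s) = Z * K" "pos_part (map s D) y = K"
          using pD i0 si by (simp_all add: pos(1) Y_def Z_def)
        \<comment> \<open>The reflected column has lost the positive letter \<open>n\<close>. The
          extra \<open>y i\<close> of \<open>dl_half\<close> cancels the reflected weight
          \<open>Z\<close>, which is the inverse of \<open>Y\<close>.\<close>
        have "y i * dl_op n t i (G D) y = G (map s D) y"
          unfolding dl Gs p A' pD' exchange_quotients[OF YZ(1)] using na t YZ
          by (simp add: ZY Y_def[symmetric] field_simps)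
        then show ?thesis using True mne L pos(1) by (simp add: dl_half_def)
      next
        case False
        then have si: "s i = i + 1" using reflect_low by (simp add: s_def)
        have pD': "pos_part D y = Y * K" "pos_part D (y \<circ> s) = Z * K" "pos_part (map s D) y = Z * K"
          using pD i0 si by (simp_all add: pos(1) Y_def Z_def)
        have "dl_op n t i (G D) y = G (map s D) y"
          unfolding dl Gs p A' pD' exchange_quotients[OF YZ(1)] using na t YZ
          by (simp add: field_simps)
        then show ?thesis using False L pos(1) by (simp add: dl_half_def)
      qed
    next
      case neg
      have p: "pot n [] (map s D) = Suc (pot n [] D)" using po neg(3) by (simp add: s_def)
      have na: "s a \<prec> a" using neg(3) by (simp add: s_def)
      show ?thesis
      proof (cases "i = int n")
        case True
        then have si: "s i = - i" "s a = i" using i0 neg reflect_top[of i n] by (simp_all add: s_def)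
        have pD': "pos_part D y = K" "pos_part D (y \<circ> s) = K" "pos_part (map s D) y = Y * K"
          using pD i0 si by (simp_all add: neg(1) Y_def)
        \<comment> \<open>Conversely the reflected column gains the positive letter
          \<open>n\<close>, and \<open>y i\<close> is its weight.\<close>
        have "y i * dl_op n t i (G D) y = t * G (map s D) y"
          unfolding dl Gs p A' pD' using na t by (simp add: Y_def field_simps)
        then show ?thesis using True mne L neg(1) i0 by (simp add: dl_half_def)
      next
        case False
        then have si: "s i = i + 1" "s a = - (i + 1)" using neg reflect_low by (simp_all add: s_def)
        have pD': "pos_part D y = K" "pos_part D (y \<circ> s) = K" "pos_part (map s D) y = K"
          using pD i0 si by (simp_all add: neg(1))
        have "dl_op n t i (G D) y = t * G (map s D) y"
          unfolding dl Gs p A' pD' using na t by (simp add: field_simps)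
        then show ?thesis using False L neg(1) i0 by (simp add: dl_half_def)
      qed
    next
      case pos'
      have p: "pot n [] (map s D) = Suc (pot n [] D)" using po pos'(5) by (simp add: s_def)
      have na: "s a \<prec> a" using pos'(5) by (simp add: s_def)
      have pD': "pos_part D y = Z * K" "pos_part D (y \<circ> s) = Y * K" "pos_part (map s D) y = Y * K"
        using pD i0 pos' by (simp_all add: Y_def Z_def s_def)
      have "dl_op n t i (G D) y = (t - 1) * G D y + t * G (map s D) y"
        unfolding dl Gs Gy p A' pD' exchange_quotients[OF YZ(1)] using na t YZ
        by (simp add: field_simps)
      then show ?thesis using L pos' i0 by (simp add: dl_half_def)
    next
      case neg'
      have p: "pot n [] D = Suc (pot n [] (map s D))" using po neg'(5) by (simp add: s_def)
      have na: "\<not> s a \<prec> a" using neg'(5) letter_less_asym by (simp add: s_def)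
      have pD': "pos_part D y = K" "pos_part D (y \<circ> s) = K" "pos_part (map s D) y = K"
        using pD i0 neg' by (simp_all add: s_def)
      have "dl_op n t i (G D) y = (t - 1) * G D y + G (map s D) y"
        unfolding dl Gs Gy p A' pD' using na t by (simp add: field_simps)
      then show ?thesis using L neg' i0 by (simp add: dl_half_def)
    qed
  next
    case (two U a V b W)
    \<comment> \<open>Two moved letters exclude \<open>i = n\<close>, so the half action and
      \<open>dl_half\<close> reduce to the ordinary ones in this case.\<close>
    have in': "i \<noteq> int n" using moved_two_lt[OF i two(6,7,9)] .
    have si: "s i = i + 1" using in' reflect_low by (simp add: s_def)
    have i0: "0 < i" using i by simp
    define K where "K = pos_part U y * pos_part V y * pos_part W y"
    have pD: "pos_part D y = (if 0 < a then y a else 1) * (if 0 < b then y b else 1) * K"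
      "pos_part D (y \<circ> s) = (if 0 < a then y (s a) else 1) * (if 0 < b then y (s b) else 1) * K"
      "pos_part (map s D) y = (if 0 < s a then y (s a) else 1) * (if 0 < s b then y (s b) else 1) * K"
      using two part_fixed[of n i _ y, folded s_def] moved_empty_map[of n i, folded s_def]
      by (simp_all add: K_def)
    have bD: "a \<in> set D" "b \<in> set D" using two by simp_all
    \<comment> \<open>In \<open>rev_neg D\<close> the negative of the later letter comes first, so
      \<open>b\<close> selects the branch there, while \<open>a\<close> selects it in
      \<open>D\<close>.\<close>
    have A': "A = (if s b \<prec> b then \<phi>' else (t - 1) * \<phi> + t * \<phi>')"
      using m two(2) ul[OF bD(2)] by (simp add: A left_act_moved \<phi>_def \<phi>'_def s_def)
    note po = pot_two[OF i D two(1,3,4,5,6,7,9), folded s_def]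
    have L: "left_act_half n t i (\<lambda>D. G D y) D =
      (if a \<prec> s a then G (map s D) y else (t - 1) * G D y + t * G (map s D) y)"
      using two(2) by (simp add: left_act_half_other left_act_moved s_def)
    have dh: "dl_half n t i D (G D) y = dl_op n t i (G D) y" using in' by (simp add: dl_half_def)
    have ss: "s (s a) = a" "s (- a) = - s a" for a using i by (simp_all add: s_def)
    from two(8)[folded s_def] show ?thesis
    proof
      assume b: "b = s a"
      have sb: "s b = a" using b ss by simp
      have p: "pot n [] (map s D) = pot n [] D" using po(1) b by simp
      have sg: "0 < s a \<longleftrightarrow> 0 < a" using i two(6) in'
        by (cases rule: moved_letter_cases) (use si i0 in \<open>auto simp: s_def\<close>)
      have pD': "pos_part D (y \<circ> s) = pos_part D y" "pos_part (map s D) y = pos_part D y"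
        using pD sg b sb by simp_all
      have "s b \<prec> b \<longleftrightarrow> a \<prec> s a" using b sb by simp
      then show ?thesis unfolding dh dl L Gs Gy p A' pD'
        by (simp add: add_divide_distrib diff_divide_distrib algebra_simps)
    next
      assume b: "b = - s a"
      have sb: "s b = - a" using b ss by simp
      have nz: "a \<noteq> 0" "s a \<noteq> 0" using bD D i by (auto simp: words_def s_def alphabet_def)
      have ord: "s b \<prec> b \<longleftrightarrow> s a \<prec> a" using nz by (simp add: b ss uminus_letter_less)
      show ?thesis
      proof (cases "a \<prec> s a")
        case True
        then have na: "\<not> s b \<prec> b" using ord letter_less_asym by blast
        have p: "pot n [] D = Suc (pot n [] (map s D))" using po(2) b True by simp
        have pD': "pos_part D y = Y * K" "pos_part D (y \<circ> s) = Z * K" "pos_part (map s D) y = Z * K"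
          using i two(6)
          by (cases rule: moved_letter_cases;
            use True pD b sb i0 si letter_less_asym ss in \<open>auto simp: Y_def Z_def s_def\<close>)+
        show ?thesis unfolding dh dl L Gs Gy p A' pD' exchange_quotients[OF YZ(1)] using na True t YZ
          by (simp add: field_simps)
      next
        case False
        then have sa: "s a \<prec> a" using reflect_less_cases[OF i, of a] two(6) bD D
          by (auto simp: words_def s_def)
        then have na: "s b \<prec> b" using ord by blast
        have p: "pot n [] (map s D) = Suc (pot n [] D)" using po(3) b sa by simp
        have pD': "pos_part D y = Z * K" "pos_part D (y \<circ> s) = Y * K" "pos_part (map s D) y = Y * K"
          using i two(6)
          by (cases rule: moved_letter_cases;
            use False pD b sb i0 si letter_less_asym ss in \<open>auto simp: Y_def Z_def s_def\<close>)+
        show ?thesis unfolding dh dl L Gs Gy p A' pD' exchange_quotients[OF YZ(1)] using na False t YZ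
          by (simp add: field_simps)
      qed
    qed
  qed
qed

text \<open>The second half of the translation. The negative weight now converts the branches of
  \<open>left_act_half\<close> at \<open>rev_neg D\<close> into those of \<open>left_act\<close> at
  \<open>D\<close>, and the factor \<open>y n\<close> that \<open>dl_half\<close> had introduced is
  divided out again.\<close>

lemma equivariant_neg_part:
  assumes t: "t \<noteq> 0" and F: "equivariant_half n t k F"
  shows "equivariant n t k (\<lambda>D y. neg_part D y * F (rev_neg D) y / t ^ pot n [] D)"
  unfolding equivariant_def
proof (intro ballI allI impI)
  fix D i and y :: "int \<Rightarrow> 'a" assume D: "D \<in> words n k" and i: "i \<in> {1..int n}" and y: "generic n y"
  define G where "G = (\<lambda>D y. neg_part D y * F (rev_neg D) y / t ^ pot n [] D)"
  define s where "s = reflect n i"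
  define Y Z where "Y = y i" and "Z = y (s i)"
  have YZ: "Y \<noteq> Z" "Y \<noteq> 0" "Z \<noteq> 0" using generic_neq[OF i y] by (auto simp: Y_def Z_def s_def)
  define \<phi> \<phi>' where "\<phi> = F (rev_neg D) y" and "\<phi>' = F (map s (rev_neg D)) y"
  define A where "A = dl_op n t i (F (rev_neg D)) y"
  have "rev_neg D \<in> words n k" using D by (simp add: rev_neg_words)
  then have A: "dl_half n t i (rev_neg D) (F (rev_neg D)) y = left_act_half n t i (\<lambda>w. F w y) (rev_neg D)"
    using F i y unfolding equivariant_half_def by blast
  have Gy: "G D y = neg_part D y * \<phi> / t ^ pot n [] D" by (simp add: G_def \<phi>_def)
  have Gs: "G (map s D) y = neg_part (map s D) y * \<phi>' / t ^ pot n [] (map s D)"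
    by (simp add: G_def \<phi>'_def s_def rev_neg_reflect[OF i])
  have dl: "dl_op n t i (G D) y = (neg_part D (y \<circ> s) * A
      + (1 - t) * Z * (neg_part D y - neg_part D (y \<circ> s)) / (Y - Z) * \<phi>) / t ^ pot n [] D"
    unfolding G_def dl_op_weight by (simp add: A_def \<phi>_def Y_def Z_def s_def)
  have m: "moved n i (rev_neg D) = rev_neg (moved n i D)" by (rule moved_rev_neg[OF i])
  have ul: "- a \<prec> s (- a) \<longleftrightarrow> s a \<prec> a" if "a \<in> set D" for a
  proof -
    have "a \<noteq> 0" "s a \<noteq> 0" using that D i by (auto simp: words_def s_def alphabet_def)
    then show ?thesis using i by (simp add: uminus_letter_less s_def)
  qed
  have yneg: "y (- i) = inverse Y" "y (- s i) = inverse Z"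
  proof -
    have "i \<in> alphabet n" using i by (simp add: alphabet_def)
    moreover from this have "s i \<in> alphabet n" using i by (simp add: s_def)
    ultimately show "y (- i) = inverse Y" "y (- s i) = inverse Z"
      using generic_uminus[OF y] by (simp_all add: Y_def Z_def)
  qed
  show "dl_op n t i (G D) y = left_act n t i (\<lambda>D. G D y) D"
    using i D
  proof (cases rule: moved_words_cases)
    case none
    have "A = t * \<phi>" using none m A by (simp add: A_def dl_half_def left_act_half_other left_act_moved \<phi>_def)
    then show ?thesis using none part_fixed(2)[OF none, of y, folded s_def]
      by (simp add: dl left_act_moved Gy)
  next
    case (one U a V)
    define K where "K = neg_part U y * neg_part V y"
    have pD: "neg_part D y = (if a < 0 then y a else 1) * K"
      "neg_part D (y \<circ> s) = (if a < 0 then y (s a) else 1) * K"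
      "neg_part (map s D) y = (if s a < 0 then y (s a) else 1) * K"
      using one part_fixed[of n i _ y, folded s_def] moved_empty_map[of n i, folded s_def]
      by (simp_all add: K_def)
    have mr: "moved n i (rev_neg D) = [- a]" using m one(2) by simp
    have A1: "(if i = int n then Y else 1) * A = left_act_half n t i (\<lambda>w. F w y) (rev_neg D)"
      using A mr by (cases "i = int n") (simp_all add: A_def dl_half_def Y_def)
    note A' = A1[unfolded left_act_half_single[OF mr] s_def[symmetric], folded \<phi>_def \<phi>'_def]
    note po = pot_one[OF i D one(1,3,4,5), folded s_def]
    have L: "left_act n t i (\<lambda>D. G D y) D =
      (if a \<prec> s a then G (map s D) y else (t - 1) * G D y + t * G (map s D) y)"
      using one(2) by (simp add: left_act_moved s_def)
    have i0: "0 < i" using i by simp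
    show ?thesis
      using i one(5)
    proof (cases rule: moved_letter_cases)
      case pos
      have p: "pot n [] D = Suc (pot n [] (map s D))" using po pos(3) by (simp add: s_def)
      show ?thesis
      proof (cases "i = int n")
        case True
        then have si: "s i = - i" using i0 reflect_top[of i n] by (simp add: s_def)
        then have ZY: "Z = inverse Y" using yneg by (simp add: Z_def)
        have pD': "neg_part D y = K" "neg_part D (y \<circ> s) = K" "neg_part (map s D) y = Z * K"
          using pD i0 si by (simp_all add: pos(1) Y_def Z_def)
        have "A = t * \<phi>' / Y" using A' True YZ i0 by (simp add: pos(1) field_simps)
        then have "dl_op n t i (G D) y = G (map s D) y"
          unfolding dl Gs p pD' using t YZ by (simp add: ZY field_simps)
        then show ?thesis using pos(3) by (simp add: L s_def)
      next
        case False
        then have si: "s i = i + 1" using reflect_low by (simp add: s_def)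
        have pD': "neg_part D y = K" "neg_part D (y \<circ> s) = K" "neg_part (map s D) y = K"
          using pD i0 si by (simp_all add: pos(1))
        have "A = t * \<phi>'" using A' False i0 by (simp add: pos(1))
        then have "dl_op n t i (G D) y = G (map s D) y"
          unfolding dl Gs p pD' using t by (simp add: field_simps)
        then show ?thesis using pos(3) by (simp add: L s_def)
      qed
    next
      case neg
      have p: "pot n [] (map s D) = Suc (pot n [] D)" using po neg(3) by (simp add: s_def)
      have na: "\<not> a \<prec> s a" using neg(3) letter_less_asym by (simp add: s_def)
      show ?thesis
      proof (cases "i = int n")
        case True
        then have si: "s i = - i" "s a = i" using i0 neg reflect_top[of i n] by (simp_all add: s_def)
        then have ZY: "Z = inverse Y" using yneg by (simp add: Z_def)
        have pD': "neg_part D y = inverse Y * K" "neg_part D (y \<circ> s) = inverse Z * K" "neg_part (map s D) y = K"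
          using pD i0 si yneg by (simp_all add: neg(1) Y_def ZY)
        have "A = \<phi>' / Y" using A' True YZ i0 by (simp add: neg(1) field_simps)
        then have "dl_op n t i (G D) y = (t - 1) * G D y + t * G (map s D) y"
          unfolding dl Gs Gy p pD' exchange_quotients(3)[OF YZ] using t YZ
          by (simp add: ZY field_simps)
        then show ?thesis using na by (simp add: L)
      next
        case False
        then have si: "s i = i + 1" "s a = - (i + 1)" using neg reflect_low by (simp_all add: s_def)
        have pD': "neg_part D y = inverse Y * K" "neg_part D (y \<circ> s) = inverse Z * K"
            "neg_part (map s D) y = inverse Z * K"
          using pD i0 si yneg by (simp_all add: neg(1))
        have "A = \<phi>'" using A' False i0 by (simp add: neg(1))
        then have "dl_op n t i (G D) y = (t - 1) * G D y + t * G (map s D) y"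
          unfolding dl Gs Gy p pD' exchange_quotients(3)[OF YZ] using t YZ by (simp add: field_simps)
        then show ?thesis using na by (simp add: L)
      qed
    next
      case pos'
      have p: "pot n [] (map s D) = Suc (pot n [] D)" using po pos'(5) by (simp add: s_def)
      have na: "\<not> a \<prec> s a" using pos'(5) letter_less_asym by (simp add: s_def)
      have pD': "neg_part D y = K" "neg_part D (y \<circ> s) = K" "neg_part (map s D) y = K"
        using pD i0 pos' by (simp_all add: s_def)
      have AA: "A = (t - 1) * \<phi> + \<phi>'" using A' pos'(1,2) i0 by simp
      have "dl_op n t i (G D) y = (t - 1) * G D y + t * G (map s D) y"
        unfolding dl Gs Gy p pD' AA using t by (simp add: field_simps)
      then show ?thesis using na by (simp add: L)
    next
      case neg'
      have p: "pot n [] D = Suc (pot n [] (map s D))" using po neg'(5) by (simp add: s_def)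
      have si: "s i = i + 1" "s a = - i" using neg' by (simp_all add: s_def)
      have pD': "neg_part D y = inverse Z * K" "neg_part D (y \<circ> s) = inverse Y * K"
          "neg_part (map s D) y = inverse Y * K"
        using pD i0 si yneg neg'(2) by simp_all
      have AA: "A = (t - 1) * \<phi> + t * \<phi>'" using A' neg'(1,2) i0 by simp
      have "dl_op n t i (G D) y = G (map s D) y"
        unfolding dl Gs p pD' AA exchange_quotients(4)[OF YZ] using t YZ by (simp add: field_simps)
      then show ?thesis using neg'(5) by (simp add: L s_def)
    qed
  next
    case (two U a V b W)
    have in': "i \<noteq> int n" using moved_two_lt[OF i two(6,7,9)] .
    have si: "s i = i + 1" using in' reflect_low by (simp add: s_def)
    have i0: "0 < i" using i by simp
    define K where "K = neg_part U y * neg_part V y * neg_part W y"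
    have pD: "neg_part D y = (if a < 0 then y a else 1) * (if b < 0 then y b else 1) * K"
      "neg_part D (y \<circ> s) = (if a < 0 then y (s a) else 1) * (if b < 0 then y (s b) else 1) * K"
      "neg_part (map s D) y = (if s a < 0 then y (s a) else 1) * (if s b < 0 then y (s b) else 1) * K"
      using two part_fixed[of n i _ y, folded s_def] moved_empty_map[of n i, folded s_def]
      by (simp_all add: K_def)
    have bD: "a \<in> set D" "b \<in> set D" using two by simp_all
    have A': "A = (if s b \<prec> b then \<phi>' else (t - 1) * \<phi> + t * \<phi>')"
      using A m two(2) ul[OF bD(2)] in'
      by (simp add: A_def dl_half_def left_act_half_other left_act_moved \<phi>_def \<phi>'_def s_def)
    note po = pot_two[OF i D two(1,3,4,5,6,7,9), folded s_def]
    have L: "left_act n t i (\<lambda>D. G D y) D =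
      (if a \<prec> s a then G (map s D) y else (t - 1) * G D y + t * G (map s D) y)"
      using two(2) by (simp add: left_act_moved s_def)
    have ss: "s (s a) = a" "s (- a) = - s a" for a using i by (simp_all add: s_def)
    from two(8)[folded s_def] show ?thesis
    proof
      assume b: "b = s a"
      have sb: "s b = a" using b ss by simp
      have p: "pot n [] (map s D) = pot n [] D" using po(1) b by simp
      have sg: "s a < 0 \<longleftrightarrow> a < 0" using i two(6) in'
        by (cases rule: moved_letter_cases) (use si i0 in \<open>auto simp: s_def\<close>)
      have pD': "neg_part D (y \<circ> s) = neg_part D y" "neg_part (map s D) y = neg_part D y"
        using pD sg b sb by simp_all
      have "s b \<prec> b \<longleftrightarrow> a \<prec> s a" using b sb by simp
      then show ?thesis unfolding dl L Gs Gy p A' pD'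
        by (simp add: add_divide_distrib diff_divide_distrib algebra_simps)
    next
      assume b: "b = - s a"
      have sb: "s b = - a" using b ss by simp
      have nz: "a \<noteq> 0" "s a \<noteq> 0" using bD D i by (auto simp: words_def s_def alphabet_def)
      have ord: "s b \<prec> b \<longleftrightarrow> s a \<prec> a" using nz by (simp add: b ss uminus_letter_less)
      show ?thesis
      proof (cases "a \<prec> s a")
        case True
        then have na: "\<not> s b \<prec> b" using ord letter_less_asym by blast
        have p: "pot n [] D = Suc (pot n [] (map s D))" using po(2) b True by simp
        have pD': "neg_part D y = inverse Z * K" "neg_part D (y \<circ> s) = inverse Y * K"
            "neg_part (map s D) y = inverse Y * K"
          using i two(6)
          by (cases rule: moved_letter_cases;
            use True pD b sb i0 si letter_less_asym ss yneg in \<open>auto simp: s_def\<close>)+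
        show ?thesis unfolding dl L Gs Gy p A' pD' exchange_quotients(4)[OF YZ] using na True t YZ
          by (simp add: field_simps)
      next
        case False
        then have sa: "s a \<prec> a" using reflect_less_cases[OF i, of a] two(6) bD D
          by (auto simp: words_def s_def)
        then have na: "s b \<prec> b" using ord by blast
        have p: "pot n [] (map s D) = Suc (pot n [] D)" using po(3) b sa by simp
        have pD': "neg_part D y = inverse Y * K" "neg_part D (y \<circ> s) = inverse Z * K"
            "neg_part (map s D) y = inverse Z * K"
          using i two(6)
          by (cases rule: moved_letter_cases;
            use False pD b sb i0 si letter_less_asym ss yneg in \<open>auto simp: s_def\<close>)+
        show ?thesis unfolding dl L Gs Gy p A' pD' exchange_quotients(3)[OF YZ] using na False t YZ
          by (simp add: field_simps)
      qed
    qed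
  qed
qed


section \<open>Column sums\<close>

primrec slide_op :: "'k::field \<Rightarrow> nat \<Rightarrow> nat \<Rightarrow> (int list \<Rightarrow> 'k) \<Rightarrow> int list \<Rightarrow> 'k" where
  "slide_op t q 0 f = f"
| "slide_op t q (Suc m) f = swap_op t q (slide_op t (Suc q) m f)"

text \<open>Each round slides the letter at position \<open>r\<close>, counted from 0, to the end of
  the word and changes its sign; the rounds run down to position 0. Started at
  \<open>rev_neg D\<close>, they treat the rows of \<open>D\<close> from top to bottom.\<close>

primrec flips_op :: "nat \<Rightarrow> 'k::field \<Rightarrow> 'k \<Rightarrow> nat \<Rightarrow> nat \<Rightarrow> (int list \<Rightarrow> 'k) \<Rightarrow> int list \<Rightarrow> 'k" where
  "flips_op n t d k 0 f = f"
| "flips_op n t d k (Suc r) f = slide_op t r (k - 1 - r) (flip_op n t d (flips_op n t d k r f))"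

lemma equivariant_slide_op:
  assumes "equivariant n t k F" "q + m < k"
  shows "equivariant n t k (\<lambda>w y. slide_op t q m (\<lambda>w. F w y) w)"
  using assms(2)
proof (induction m arbitrary: q)
  case (Suc m)
  then show ?case using equivariant_swap_op[OF Suc.IH[of "Suc q"], of q] by simp
qed (use assms in simp)

lemma equivariant_half_slide_op:
  assumes "equivariant_half n t k F" "q + m < k"
  shows "equivariant_half n t k (\<lambda>w y. slide_op t q m (\<lambda>w. F w y) w)"
  using assms(2)
proof (induction m arbitrary: q)
  case (Suc m)
  then show ?case using equivariant_half_swap_op[OF Suc.IH[of "Suc q"], of q] by simp
qed (use assms in simp)

lemma equivariant_flips_op:
  assumes "equivariant n t k F" "r \<le> k"
  shows "equivariant n t k (\<lambda>w y. flips_op n t (1 - t) k r (\<lambda>w. F w y) w)"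
  using assms(2)
proof (induction r)
  case (Suc r)
  then show ?case
    using equivariant_slide_op[OF equivariant_flip_op[OF Suc.IH], of r "k - 1 - r"] by simp
qed (use assms in simp)

lemma equivariant_half_flips_op:
  assumes "equivariant_half n t k F" "r \<le> k"
  shows "equivariant_half n t k (\<lambda>w y. flips_op n t 0 k r (\<lambda>w. F w y) w)"
  using assms(2)
proof (induction r)
  case (Suc r)
  then show ?case
    using equivariant_half_slide_op[OF equivariant_half_flip_op[OF Suc.IH], of r "k - 1 - r"] by simp
qed (use assms in simp)

text \<open>The value of \<open>N_swap\<close> for a column that is cut at the two rows involved,
  with the pivot written as \<open>- c\<close>; see \<open>N_swap_append\<close>.\<close>

definition swap_weight :: "nat \<Rightarrow> int list \<Rightarrow> int \<Rightarrow> int list \<Rightarrow> int \<Rightarrow> nat" where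
  "swap_weight n P a A c = count_between c a A
     + card {e \<in> open_interval n c a. \<bar>e\<bar> \<notin> abs ` set (P @ a # A @ [c])} + sigma_sign a (- c)"

text \<open>
  In the column \<open>P @ A @ [- c] @ Z\<close> the rows of \<open>P\<close> have been processed. The pivot is stored
  negated, so that a bar swap of the row of \<open>a\<close> with the pivot exchanges \<open>a\<close> and \<open>c\<close>.
\<close>

fun swap_sum :: "nat \<Rightarrow> 'k::field \<Rightarrow> (int list \<Rightarrow> 'k) \<Rightarrow> int list \<Rightarrow> int list \<Rightarrow> int \<Rightarrow> int list \<Rightarrow> 'k" where
  "swap_sum n t g P [] c Z = g (P @ - c # Z)"
| "swap_sum n t g P (a # A) c Z = swap_sum n t g (P @ [a]) A c Z +
     (if c \<prec> a then (1 - t) * t ^ swap_weight n P a A c * swap_sum n t g (P @ [c]) A a Z else 0)"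

text \<open>The optional drop of the pivot after its bar swaps. Its coefficient \<open>d\<close> is
  \<open>1 - t\<close> for unprimed columns, where a drop is one more descent, and \<open>0\<close>
  for primed columns, which do not allow it.\<close>

definition drop_sum :: "nat \<Rightarrow> 'k::field \<Rightarrow> 'k \<Rightarrow> (int list \<Rightarrow> 'k) \<Rightarrow> nat \<Rightarrow> int list \<Rightarrow> 'k" where
  "drop_sum n t d f j D = f D + d * (\<Sum>e\<in>below_set n (take (j - 1) D @ drop j D) (D ! (j - 1)).
     t ^ count_between e (D ! (j - 1)) (drop j D) * f (D[j - 1 := e]))"

definition step_sum :: "nat \<Rightarrow> 'k::field \<Rightarrow> 'k \<Rightarrow> nat \<Rightarrow> (int list \<Rightarrow> 'k) \<Rightarrow> int list \<Rightarrow> 'k" where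
  "step_sum n t d j f D = swap_sum n t (drop_sum n t d f j) [] (take (j - 1) D) (- (D ! (j - 1))) (drop j D)"

primrec steps_sum :: "nat \<Rightarrow> 'k::field \<Rightarrow> 'k \<Rightarrow> nat \<Rightarrow> nat \<Rightarrow> (int list \<Rightarrow> 'k) \<Rightarrow> int list \<Rightarrow> 'k" where
  "steps_sum n t d k 0 f = f"
| "steps_sum n t d k (Suc r) f = step_sum n t d (k - r) (steps_sum n t d k r f)"

section \<open>Powers of \<open>t\<close> along one column step\<close>

lemma below_set_cong: "abs ` set X = abs ` set Y \<Longrightarrow> below_set n X v = below_set n Y v"
  by (simp add: below_set_def)

lemma count_between_Cons: "count_between a b (z # Z) = of_bool (a \<prec> z \<and> z \<prec> b) + count_between a b Z"
  by (simp add: count_between_def)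

lemma count_below_append: "count_below (Y @ Z) v = count_below Y v + count_below Z v"
  by (simp add: count_below_def)

lemma count_below_Cons: "count_below (a # Z) v = of_bool (a \<prec> v) + count_below Z v"
  by (simp add: count_below_def)

lemma count_below_Nil: "count_below [] v = 0"
  by (simp add: count_below_def)

lemma of_bool_between:
  assumes "c \<prec> a" "x \<noteq> a" "x \<noteq> c" "x \<noteq> 0" "a \<noteq> 0" "c \<noteq> 0"
  shows "of_bool (x \<prec> a) = (of_bool (x \<prec> c) + of_bool (c \<prec> x \<and> x \<prec> a) :: nat)"
    and "of_bool (c \<prec> x) = (of_bool (a \<prec> x) + of_bool (c \<prec> x \<and> x \<prec> a) :: nat)"
proof -
  have "x \<prec> a \<longleftrightarrow> x \<prec> c \<or> (c \<prec> x \<and> x \<prec> a)"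
    using assms letter_less_trans[of x c a] letter_less_total[of x c] by auto
  moreover have "\<not> (x \<prec> c \<and> c \<prec> x)" using letter_less_asym[of x c] by blast
  ultimately show "of_bool (x \<prec> a) = (of_bool (x \<prec> c) + of_bool (c \<prec> x \<and> x \<prec> a) :: nat)"
    by (cases "x \<prec> c") simp_all
  have "c \<prec> x \<longleftrightarrow> a \<prec> x \<or> (c \<prec> x \<and> x \<prec> a)"
    using assms letter_less_trans[of c a x] letter_less_total[of x a] by auto
  moreover have "\<not> (x \<prec> a \<and> a \<prec> x)" using letter_less_asym[of x a] by blast
  ultimately show "of_bool (c \<prec> x) = (of_bool (a \<prec> x) + of_bool (c \<prec> x \<and> x \<prec> a) :: nat)"
    by (cases "a \<prec> x") simp_all
qed

lemma count_below_between:
  assumes "c \<prec> a" "a \<notin> set A" "c \<notin> set A" "0 \<notin> set A" "a \<noteq> 0" "c \<noteq> 0"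
  shows "count_below A a = count_below A c + count_between c a A"
  using assms
proof (induction A)
  case (Cons x A)
  have "of_bool (x \<prec> a) = (of_bool (x \<prec> c) + of_bool (c \<prec> x \<and> x \<prec> a) :: nat)"
    using Cons.prems by (intro of_bool_between) auto
  then show ?case using Cons by (simp add: count_below_Cons count_between_Cons)
qed (simp add: count_below_def count_between_def)

lemma below_set_insert:
  assumes "e \<in> alphabet n" "\<bar>e\<bar> \<notin> abs ` set R"
  shows "card (below_set n R v) = card (below_set n (e # R) v) + of_bool (e \<prec> v) + of_bool (- e \<prec> v)"
proof -
  have e: "e \<noteq> - e" using assms(1) by (simp add: alphabet_def)
  have "below_set n R v = below_set n (e # R) v \<union> {x \<in> {e, - e}. x \<prec> v}"
    using assms by (auto simp: below_set_def abs_eq_iff)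
  then have "card (below_set n R v) = card (below_set n (e # R) v) + card {x \<in> {e, - e}. x \<prec> v}"
    by (simp only:, subst card_Un_disjoint) (auto simp: below_set_def)
  moreover have "{x \<in> {e, - e}. x \<prec> v} = (if e \<prec> v then {e} else {}) \<union> (if - e \<prec> v then {- e} else {})"
    by auto
  ultimately show ?thesis using e by simp
qed

lemma words_Cons_middle:
  assumes "X @ a # Y \<in> words n k"
  shows "a \<in> alphabet n" "a \<noteq> 0" "\<bar>a\<bar> \<notin> abs ` set (X @ Y)"
  using assms by (auto simp: words_def alphabet_def)

text \<open>For a later entry \<open>z\<close>, the comparison of \<open>- z\<close> with the
  altered entry occurs once among the passed letters and once, with the opposite effect, among the
  free ones, and cancels. What remains is whether \<open>z\<close> lies between \<open>e\<close> and
  \<open>a\<close>, the count that \<open>N\<close> assigns to a drop.\<close>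

lemma pot_drop:
  assumes "X @ e # Y @ Z \<in> words n k" "X @ a # Y @ Z \<in> words n k" "e \<prec> a"
  shows "pot n (X @ e # Y) Z = pot n (X @ a # Y) Z + count_between e a Z"
  using assms
proof (induction Z arbitrary: Y)
  case (Cons z Z)
  have IH: "pot n (X @ e # Y @ [z]) Z = pot n (X @ a # Y @ [z]) Z + count_between e a Z"
    using Cons.IH[of "Y @ [z]"] Cons.prems by simp
  note we = words_Cons_middle[OF Cons.prems(1)] and wa = words_Cons_middle[OF Cons.prems(2)]
  have z: "z \<noteq> 0" "\<bar>z\<bar> \<noteq> \<bar>e\<bar>" "\<bar>z\<bar> \<noteq> \<bar>a\<bar>"
    using words_Cons_middle[of "X @ e # Y" z Z n k] Cons.prems we wa by auto
  define R where "R = X @ Y @ Z"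
  have "below_set n (X @ e # Y @ Z) (- z) = below_set n (e # R) (- z)"
    "below_set n (X @ a # Y @ Z) (- z) = below_set n (a # R) (- z)"
    by (auto intro!: below_set_cong simp: R_def)
  moreover have "card (below_set n R (- z)) = card (below_set n (e # R) (- z)) + of_bool (e \<prec> - z) + of_bool (- e \<prec> - z)"
    using we by (intro below_set_insert) (auto simp: R_def)
  moreover have "card (below_set n R (- z)) = card (below_set n (a # R) (- z)) + of_bool (a \<prec> - z) + of_bool (- a \<prec> - z)"
    using wa by (intro below_set_insert) (auto simp: R_def)
  moreover have "of_bool (- e \<prec> - z) + of_bool (e \<prec> z \<and> z \<prec> a) = (of_bool (- a \<prec> - z) :: nat)"
    using z we(2) wa(2) Cons.prems(3) by (auto simp: letter_less_def)
  ultimately show ?case using IH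
    by (simp add: count_between_Cons count_below_append count_below_Cons)
qed (simp add: count_between_def)

text \<open>The absolute values stay the same, so no free letter is gained or lost. A later entry
  \<open>z\<close> notices the exchange through the passed letters alone, once if \<open>z\<close>
  and once if \<open>- z\<close> lies between \<open>c\<close> and \<open>a\<close>.\<close>

lemma pot_exchange:
  assumes "P @ a # A @ - c # Y @ Z \<in> words n k" "c \<prec> a"
  shows "pot n (P @ c # A @ - a # Y) Z =
    pot n (P @ a # A @ - c # Y) Z + count_between c a Z + count_between c a (map uminus Z)"
  using assms
proof (induction Z arbitrary: Y)
  case (Cons z Z)
  have IH: "pot n (P @ c # A @ - a # Y @ [z]) Z = pot n (P @ a # A @ - c # Y @ [z]) Z
      + count_between c a Z + count_between c a (map uminus Z)"
    using Cons.IH[of "Y @ [z]"] Cons.prems by simp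
  have z: "z \<noteq> 0" "\<bar>z\<bar> \<noteq> \<bar>c\<bar>" "\<bar>z\<bar> \<noteq> \<bar>a\<bar>" "a \<noteq> 0" "c \<noteq> 0"
    using Cons.prems by (auto simp: words_def alphabet_def)
  have "below_set n (P @ c # A @ - a # Y @ Z) (- z) = below_set n (P @ a # A @ - c # Y @ Z) (- z)"
    by (rule below_set_cong) auto
  moreover have "of_bool (c \<prec> - z) + of_bool (- a \<prec> - z) = (of_bool (a \<prec> - z) + of_bool (- c \<prec> - z)
     + of_bool (c \<prec> z \<and> z \<prec> a) + of_bool (c \<prec> - z \<and> - z \<prec> a) :: nat)"
  proof -
    have nz: "- z \<noteq> a" "- z \<noteq> c" "z \<noteq> a" "z \<noteq> c" "- z \<noteq> 0" using z by auto
    have "- a \<prec> - z \<longleftrightarrow> z \<prec> a" "- c \<prec> - z \<longleftrightarrow> z \<prec> c" using z by (simp_all add: uminus_letter_less)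
    then show ?thesis
      using of_bool_between(2)[OF Cons.prems(2) nz(1,2,5) z(4,5)] of_bool_between(1)[OF Cons.prems(2) nz(3,4) z(1,4,5)]
      by simp
  qed
  ultimately show ?case using IH
    by (simp add: count_between_Cons count_below_append count_below_Cons)
qed (simp add: count_between_def)

lemma count_between_distinct: "distinct Z \<Longrightarrow> count_between c a Z = card {z \<in> set Z. c \<prec> z \<and> z \<prec> a}"
proof (induction Z)
  case (Cons x Z)
  have "{z \<in> set (x # Z). c \<prec> z \<and> z \<prec> a} = (if c \<prec> x \<and> x \<prec> a then {x} else {}) \<union> {z \<in> set Z. c \<prec> z \<and> z \<prec> a}"
    by auto
  moreover have "x \<notin> {z \<in> set Z. c \<prec> z \<and> z \<prec> a}" using Cons.prems by simp
  ultimately show ?case using Cons by (simp add: count_between_Cons)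
qed (simp add: count_between_def)

text \<open>The balance that explains the statistic \<open>N\<close>. Free letters between
  \<open>c\<close> and \<open>a\<close> enlarge the set below the sliding letter, letters of
  \<open>Z\<close> of either sign change the remaining potential, and letters of \<open>A\<close>
  change the number of smaller letters to be passed. Together these changes are the weight of a bar
  swap.\<close>

lemma pot_swap:
  assumes w: "P @ a # A @ - c # Z \<in> words n k" and ca: "c \<prec> a"
  shows "count_below A c + card (below_set n (P @ a # A @ Z) c) + pot n (P @ a # A @ [- c]) Z + swap_weight n P a A c
    = count_below A a + card (below_set n (P @ c # A @ Z) a) + pot n (P @ c # A @ [- a]) Z"
proof -
  have ac: "a \<in> alphabet n" "c \<in> alphabet n" "a \<noteq> 0" "c \<noteq> 0" "\<bar>a\<bar> \<noteq> \<bar>c\<bar>"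
    "\<bar>a\<bar> \<notin> abs ` set (P @ A @ Z)" "\<bar>c\<bar> \<notin> abs ` set (P @ A @ Z)"
    using w by (auto simp: words_def alphabet_def)
  have dZ: "distinct Z" "distinct (map uminus Z)" "\<And>z. z \<in> set Z \<Longrightarrow> - z \<notin> set Z" "set Z \<subseteq> alphabet n"
  proof -
    have d: "distinct (map abs Z)" using w by (simp add: words_def)
    then show "distinct Z" by (simp add: distinct_map)
    then show "distinct (map uminus Z)" by (simp add: distinct_map)
    show aZ: "set Z \<subseteq> alphabet n" using w by (simp add: words_def)
    fix z assume z: "z \<in> set Z"
    show "- z \<notin> set Z"
    proof
      assume "- z \<in> set Z"
      then have "z = - z" using d z inj_onD[of abs "set Z" z "- z"] by (simp add: distinct_map)
      then show False using aZ z by (auto simp: alphabet_def)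
    qed
  qed
  define T where "T = {e \<in> alphabet n. \<bar>e\<bar> \<notin> abs ` set (P @ a # A @ c # Z)}"
  have finT: "finite T" by (simp add: T_def)
  define lo mid where "lo = {e \<in> T. e \<prec> c}" and "mid = {e \<in> T. c \<prec> e \<and> e \<prec> a}"
  define zs where "zs = {z \<in> set Z \<union> uminus ` set Z. c \<prec> z \<and> z \<prec> a}"
  have below_c: "below_set n (P @ a # A @ Z) c = lo \<union> (if - c \<prec> c then {- c} else {})"
    using ac by (auto simp: below_set_def lo_def T_def abs_eq_iff)
  have Tac: "e \<noteq> a \<and> e \<noteq> - a \<and> e \<noteq> c \<and> e \<noteq> - c \<and> e \<noteq> 0" if "e \<in> T" for e
    using that by (auto simp: T_def alphabet_def)
  have tri: "e \<prec> a \<longleftrightarrow> e \<prec> c \<or> (c \<prec> e \<and> e \<prec> a)" if "e \<in> T" for e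
    using Tac[OF that] ca ac letter_less_trans[of e c a] letter_less_total[of e c] by auto
  have "e \<in> below_set n (P @ c # A @ Z) a \<longleftrightarrow> e \<in> lo \<union> mid \<union> (if - a \<prec> a then {- a} else {})" for e
  proof (cases "e \<in> T")
    case True
    then show ?thesis using tri[OF True] Tac[OF True] by (auto simp: below_set_def lo_def mid_def T_def)
  next
    case False
    then show ?thesis using ac by (auto simp: below_set_def lo_def mid_def T_def abs_eq_iff)
  qed
  then have below_a: "below_set n (P @ c # A @ Z) a = lo \<union> mid \<union> (if - a \<prec> a then {- a} else {})" by blast
  have disj: "lo \<inter> mid = {}" "- c \<notin> lo" "- a \<notin> lo" "- a \<notin> mid"
    using Tac letter_less_asym by (auto simp: lo_def mid_def)
  have fin: "finite lo" "finite mid" "finite zs" using finT by (auto simp: lo_def mid_def zs_def)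
  have c1: "card (below_set n (P @ a # A @ Z) c) = card lo + of_bool (- c \<prec> c)"
    using disj fin by (simp add: below_c)
  have c2: "card (below_set n (P @ c # A @ Z) a) = card lo + card mid + of_bool (- a \<prec> a)"
    using disj fin by (auto simp: below_a card_Un_disjoint)
  \<comment> \<open>The interval in \<open>N\<close> leaves out the rows down to the pivot only. So
    it consists of the free letters and of the letters of \<open>Z\<close> with both signs.\<close>
  have "{e \<in> open_interval n c a. \<bar>e\<bar> \<notin> abs ` set (P @ a # A @ [c])} = mid \<union> zs"
    (is "?L = _")
  proof (intro equalityI subsetI)
    fix e assume "e \<in> ?L"
    then show "e \<in> mid \<union> zs"
      by (auto simp: open_interval_def mid_def zs_def T_def abs_eq_iff image_iff)
  next
    fix e assume e: "e \<in> mid \<union> zs"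
    show "e \<in> ?L"
    proof (cases "e \<in> mid")
      case True then show ?thesis by (auto simp: open_interval_def mid_def T_def)
    next
      case False
      then have z: "\<bar>e\<bar> \<in> abs ` set Z" "c \<prec> e" "e \<prec> a" "e \<in> alphabet n"
        using e dZ(4) by (auto simp: zs_def)
      have "distinct (map abs (P @ a # A @ [c]) @ map abs Z)" using w by (simp add: words_def)
      then have "set (map abs (P @ a # A @ [c])) \<inter> set (map abs Z) = {}"
        unfolding distinct_append by blast
      then have "\<bar>e\<bar> \<notin> abs ` set (P @ a # A @ [c])" using z(1) unfolding set_map by blast
      then show ?thesis using z by (simp add: open_interval_def)
    qed
  qed
  moreover have "mid \<inter> zs = {}" by (auto simp: mid_def zs_def T_def)
  ultimately have c3: "card {e \<in> open_interval n c a. \<bar>e\<bar> \<notin> abs ` set (P @ a # A @ [c])} = card mid + card zs"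
    using fin by (simp add: card_Un_disjoint)
  have "zs = {z \<in> set Z. c \<prec> z \<and> z \<prec> a} \<union> {z \<in> set (map uminus Z). c \<prec> z \<and> z \<prec> a}"
    by (auto simp: zs_def)
  then have "card zs = count_between c a Z + count_between c a (map uminus Z)"
    unfolding count_between_distinct[OF dZ(1)] count_between_distinct[OF dZ(2)]
    by (simp only:, subst card_Un_disjoint) (use dZ(3) in auto)
  moreover have "count_below A a = count_below A c + count_between c a A"
    using w by (intro count_below_between ca) (auto simp: words_def alphabet_def)
  moreover have "pot n (P @ c # A @ [- a]) Z = pot n (P @ a # A @ [- c]) Z + count_between c a Z + count_between c a (map uminus Z)"
    using pot_exchange[of P a A c "[]" Z n k] w ca by simp
  \<comment> \<open>The set below the sliding letter may contain the negative of that letter. The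
    term \<open>sigma_sign\<close> records when an exchange of \<open>c\<close> and \<open>a\<close>
    changes this.\<close>
  moreover have "of_bool (- c \<prec> c) + sigma_sign a (- c) = (of_bool (- a \<prec> a) :: nat)"
    using ca ac by (auto simp: sigma_sign_def letter_less_def)
  ultimately show ?thesis using c1 c2 c3 by (simp add: swap_weight_def)
qed

lemma words_exchange:
  assumes "P @ a # A @ - c # Z \<in> words n k"
  shows "P @ c # A @ - a # Z \<in> words n k"
proof -
  have "mset (map abs (P @ c # A @ - a # Z)) = mset (map abs (P @ a # A @ - c # Z))" by simp
  then have "distinct (map abs (P @ c # A @ - a # Z)) = distinct (map abs (P @ a # A @ - c # Z))"
    by (rule mset_eq_imp_distinct_iff)
  then show ?thesis using assms unfolding words_def by simp
qed

text \<open>At each row the sliding letter \<open>c\<close> either passes \<open>a\<close>, which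
  leaves the row alone, or stops while \<open>a\<close> slides on, which is a bar swap of the
  column. Passing a smaller letter costs a factor \<open>t\<close>, collected by
  \<open>count_below\<close>; the exponents of the two branches are compared by
  \<open>pot_swap\<close>.\<close>

lemma slide_op_swap_sum:
  assumes base: "\<And>P' c'. P' @ - c' # Z \<in> words n k \<Longrightarrow>
      G (Q @ P' @ [c']) = t ^ (card (below_set n (P' @ Z) c') + pot n (P' @ [- c']) Z) * g (P' @ - c' # Z)"
    and w: "P @ A @ - c # Z \<in> words n k"
  shows "slide_op t (length Q + length P) (length A) G (Q @ P @ c # A) =
    t ^ (count_below A c + card (below_set n (P @ A @ Z) c) + pot n (P @ A @ [- c]) Z) * swap_sum n t g P A c Z"
  using w
proof (induction A arbitrary: P c)
  case Nil
  then show ?case using base[of P c] by (simp add: count_below_def)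
next
  case (Cons a A)
  have w': "P @ a # A @ - c # Z \<in> words n k" using Cons.prems by simp
  have ac: "a \<noteq> c" "a \<noteq> 0" "c \<noteq> 0" using w' by (auto simp: words_def alphabet_def)
  have 1: "slide_op t (Suc (length Q + length P)) (length A) G (Q @ P @ a # c # A) =
    t ^ (count_below A c + card (below_set n (P @ a # A @ Z) c) + pot n (P @ a # A @ [- c]) Z) * swap_sum n t g (P @ [a]) A c Z"
    using Cons.IH[of "P @ [a]" c] w' by simp
  have 2: "slide_op t (Suc (length Q + length P)) (length A) G (Q @ P @ c # a # A) =
    t ^ (count_below A a + card (below_set n (P @ c # A @ Z) a) + pot n (P @ c # A @ [- a]) Z) * swap_sum n t g (P @ [c]) A a Z"
    using Cons.IH[of "P @ [c]" a] words_exchange[OF w'] by simp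
  define E where "E = count_below A c + card (below_set n (P @ a # A @ Z) c) + pot n (P @ a # A @ [- c]) Z"
  have L: "slide_op t (length Q + length P) (length (a # A)) G (Q @ P @ c # a # A) =
    (if c \<prec> a
     then slide_op t (Suc (length Q + length P)) (length A) G (Q @ P @ a # c # A)
       + (1 - t) * slide_op t (Suc (length Q + length P)) (length A) G (Q @ P @ c # a # A)
     else t * slide_op t (Suc (length Q + length P)) (length A) G (Q @ P @ a # c # A))"
    using swap_op_append[of t "Q @ P" "slide_op t (Suc (length Q + length P)) (length A) G" c a A]
    by simp
  show ?case
  proof (cases "c \<prec> a")
    case True
    then have "\<not> a \<prec> c" using letter_less_asym by blast
    then have cb: "count_below (a # A) c = count_below A c" by (simp add: count_below_Cons)
    have E2: "count_below A a + card (below_set n (P @ c # A @ Z) a) + pot n (P @ c # A @ [- a]) Z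
        = E + swap_weight n P a A c"
      using pot_swap[OF w' True] by (simp add: E_def)
    have "slide_op t (length Q + length P) (length (a # A)) G (Q @ P @ c # a # A) =
        t ^ E * swap_sum n t g P (a # A) c Z"
      using True by (simp only: L 1 2 E2 E_def[symmetric] if_True swap_sum.simps)
        (simp add: power_add algebra_simps)
    then show ?thesis by (simp add: E_def cb)
  next
    case False
    then have "a \<prec> c" using ac not_letter_less[of c a] by auto
    then have cb: "count_below (a # A) c = Suc (count_below A c)" by (simp add: count_below_Cons)
    have "slide_op t (length Q + length P) (length (a # A)) G (Q @ P @ c # a # A) =
        t * (t ^ E * swap_sum n t g P (a # A) c Z)"
      using False by (simp only: L 1 E_def[symmetric] if_False swap_sum.simps) simp
    then show ?thesis by (simp add: E_def cb)
  qed
qed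

text \<open>At an intermediate stage the rows that have not been pivots stand reversed and negated
  at the front of the word, with the treated rows in order behind them. So one round of
  \<open>flips_op\<close> is one column step, up to the power of \<open>t\<close> that
  \<open>pot\<close> records.\<close>

lemma flips_op_steps_sum:
  assumes "D \<in> words n k" "r \<le> k"
  shows "flips_op n t d k r f (rev_neg (drop (k - r) D) @ take (k - r) D) =
    t ^ pot n (take (k - r) D) (drop (k - r) D) * steps_sum n t d k r f D"
  using assms
proof (induction r arbitrary: D)
  case 0
  then show ?case by (simp add: words_def)
next
  case (Suc r)
  define j where "j = k - r"
  have j: "1 \<le> j" "j \<le> k" "k - Suc r = j - 1" "k - 1 - r = j - 1" using Suc.prems by (auto simp: j_def)
  have lD: "length D = k" using Suc.prems by (simp add: words_def)
  define X a Z where "X = take (j - 1) D" and "a = D ! (j - 1)" and "Z = drop j D"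
  have dr: "drop (j - 1) D = a # Z" using Cons_nth_drop_Suc[of "j - 1" D] j lD by (simp add: a_def Z_def)
  have D: "D = X @ a # Z" unfolding X_def using append_take_drop_id[of "j - 1" D, unfolded dr] by (rule sym)
  have lens: "length X = j - 1" "length Z = r" using lD j(1,2) Suc.prems(2) by (simp_all add: X_def Z_def j_def)
  define g where "g = drop_sum n t d (steps_sum n t d k r f) j"
  \<comment> \<open>Once the sliding letter has reached the end, negating it restores the pivot, and
    replacing it by a smaller free letter is a drop. The exponents of the two outcomes differ by
    \<open>pot_drop\<close>.\<close>
  have base: "flip_op n t d (flips_op n t d k r f) (rev_neg Z @ P' @ [c']) =
      t ^ (card (below_set n (P' @ Z) c') + pot n (P' @ [- c']) Z) * g (P' @ - c' # Z)"
    if w: "P' @ - c' # Z \<in> words n k" for P' c'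
  proof -
    have "length P' + Suc r = k" using w lens(2) by (simp add: words_def)
    then have lP: "length P' = j - 1" by (simp add: j_def)
    have IH: "flips_op n t d k r f (rev_neg Z @ P' @ [e]) =
        t ^ pot n (P' @ [e]) Z * steps_sum n t d k r f (P' @ e # Z)"
      if "P' @ e # Z \<in> words n k" for e
    proof -
      have "take (k - r) (P' @ e # Z) = P' @ [e]" "drop (k - r) (P' @ e # Z) = Z"
        using lP j(1) unfolding j_def[symmetric] by simp_all
      then show ?thesis using Suc.IH[OF that] Suc.prems(2) by simp
    qed
    have bs: "below_set n (rev_neg Z @ P') v = below_set n (P' @ Z) v" for v
      by (rule below_set_cong) (simp add: rev_neg_def image_Un image_image Un_commute)
    have dd: "take (j - 1) (P' @ - c' # Z) = P'" "drop j (P' @ - c' # Z) = Z" "(P' @ - c' # Z) ! (j - 1) = - c'"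
      "(P' @ - c' # Z)[j - 1 := e] = P' @ e # Z" for e
      using lP j(1) by (simp_all add: nth_append list_update_append)
    have e: "flips_op n t d k r f (rev_neg Z @ P' @ [e]) =
        t ^ pot n (P' @ [- c']) Z * (t ^ count_between e (- c') Z * steps_sum n t d k r f (P' @ e # Z))"
      if "e \<in> below_set n (P' @ Z) (- c')" for e
    proof -
      have we: "P' @ e # Z \<in> words n k" using that w by (auto simp: below_set_def words_def)
      have "pot n (P' @ [e]) Z = pot n (P' @ [- c']) Z + count_between e (- c') Z"
        using pot_drop[of P' e "[]" Z n k "- c'"] we w that by (simp add: below_set_def)
      then show ?thesis using IH[OF we] by (simp add: power_add algebra_simps)
    qed
    have "(\<Sum>e\<in>below_set n (P' @ Z) (- c'). flips_op n t d k r f (rev_neg Z @ P' @ [e])) =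
        t ^ pot n (P' @ [- c']) Z * (\<Sum>e\<in>below_set n (P' @ Z) (- c').
          t ^ count_between e (- c') Z * steps_sum n t d k r f (P' @ e # Z))"
      unfolding sum_distrib_left by (rule sum.cong[OF HOL.refl e])
    moreover have "g (P' @ - c' # Z) = steps_sum n t d k r f (P' @ - c' # Z) + d *
        (\<Sum>e\<in>below_set n (P' @ Z) (- c'). t ^ count_between e (- c') Z * steps_sum n t d k r f (P' @ e # Z))"
      unfolding g_def drop_sum_def dd ..
    ultimately have "flip_op n t d (flips_op n t d k r f) (rev_neg Z @ P' @ [c']) =
      t ^ card (below_set n (P' @ Z) c') * (t ^ pot n (P' @ [- c']) Z * g (P' @ - c' # Z))"
      using IH[OF w] flip_op_append[of n t d "flips_op n t d k r f" "rev_neg Z @ P'" c']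
      by (simp add: bs algebra_simps)
    then show ?thesis by (simp add: power_add)
  qed
  have "flips_op n t d k (Suc r) f (rev_neg (drop (k - Suc r) D) @ take (k - Suc r) D) =
      slide_op t r (j - 1) (flip_op n t d (flips_op n t d k r f)) (rev_neg Z @ [] @ - a # X)"
    by (simp only: flips_op.simps j dr rev_neg_Cons append_assoc append_Cons append_Nil X_def[symmetric])
  also have "\<dots> = t ^ (count_below X (- a) + card (below_set n (X @ Z) (- a)) + pot n (X @ [a]) Z)
      * swap_sum n t g [] X (- a) Z"
    using slide_op_swap_sum[OF base, where P="[]" and A=X and c="- a"] Suc.prems(1)
    by (simp add: lens D[symmetric])
  also have "swap_sum n t g [] X (- a) Z = steps_sum n t d k (Suc r) f D"
    by (simp add: step_sum_def j_def[symmetric] g_def X_def a_def Z_def)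
  also have "count_below X (- a) + card (below_set n (X @ Z) (- a)) + pot n (X @ [a]) Z
      = pot n (take (k - Suc r) D) (drop (k - Suc r) D)"
    unfolding j(3) dr X_def[symmetric] by simp
  finally show ?case .
qed

section \<open>One block of columns as a translation\<close>

lemma equivariant_cong:
  assumes "\<And>w. w \<in> words n k \<Longrightarrow> F w = G w"
  shows "equivariant n t k F \<longleftrightarrow> equivariant n t k G"
proof -
  have "left_act n t i (\<lambda>w. F w y) w = left_act n t i (\<lambda>w. G w y) w"
    if "w \<in> words n k" "i \<in> {1..int n}" for w i y
    using assms that by (simp add: left_act_moved split: list.split)
  then show ?thesis using assms unfolding equivariant_def by (intro ball_cong) auto
qed

lemma equivariant_half_cong:
  assumes "\<And>w. w \<in> words n k \<Longrightarrow> F w = G w"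
  shows "equivariant_half n t k F \<longleftrightarrow> equivariant_half n t k G"
proof -
  have "left_act_half n t i (\<lambda>w. F w y) w = left_act_half n t i (\<lambda>w. G w y) w"
    if "w \<in> words n k" "i \<in> {1..int n}" for w i y
  proof -
    have e: "F w = G w" "F (map (reflect n i) w) = G (map (reflect n i) w)" using assms that by simp_all
    have la: "left_act n t i (\<lambda>w. F w y) w = left_act n t i (\<lambda>w. G w y) w"
      unfolding left_act_moved e ..
    show ?thesis unfolding left_act_half_def la e ..
  qed
  then show ?thesis using assms unfolding equivariant_half_def by (intro ball_cong) auto
qed

definition translate_sum :: "nat \<Rightarrow> 'k::field \<Rightarrow> nat \<Rightarrow> (int list \<Rightarrow> (int \<Rightarrow> 'k) \<Rightarrow> 'k) \<Rightarrow> int list \<Rightarrow> (int \<Rightarrow> 'k) \<Rightarrow> 'k" where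
  "translate_sum n t k F D y = neg_part D y * steps_sum n t 0 k k (\<lambda>D. pos_part D y * F D y) D"

text \<open>Each run of columns is read at \<open>rev_neg D\<close> and divided by its power of
  \<open>t\<close>; the two half weights then lead from \<open>left_act\<close> to
  \<open>left_act_half\<close> and back. \<open>A\<close> enters through an equation because in the
  rightmost block it is \<open>t ^ inversions D\<close>, which only takes the value of such a run;
  see \<open>steps_sum_word_len\<close>.\<close>

lemma equivariant_translate_sum:
  assumes t: "t \<noteq> 0" and F: "equivariant n t k F"
    and A: "\<And>D y. D \<in> words n k \<Longrightarrow> A D y = steps_sum n t (1 - t) k k (\<lambda>w. F w y) D"
  shows "equivariant n t k (translate_sum n t k A)"
proof -
  define \<Psi> where "\<Psi> = (\<lambda>w y. flips_op n t (1 - t) k k (\<lambda>w. F w y) w)"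
  have A': "A D y = \<Psi> (rev_neg D) y / t ^ pot n [] D" if "D \<in> words n k" for D y
    using flips_op_steps_sum[OF that, of k t "1 - t" "\<lambda>w. F w y"] t A[OF that] that
    by (simp add: \<Psi>_def words_def)
  have "equivariant n t k \<Psi>" unfolding \<Psi>_def by (rule equivariant_flips_op[OF F]) simp
  then have "equivariant_half n t k (\<lambda>D y. pos_part D y * \<Psi> (rev_neg D) y / t ^ pot n [] D)"
    by (rule equivariant_half_pos_part[OF t])
  then have B: "equivariant_half n t k (\<lambda>D y. pos_part D y * A D y)"
    by (rule equivariant_half_cong[THEN iffD1, rotated]) (simp add: A')
  define \<Phi> where "\<Phi> = (\<lambda>w y. flips_op n t 0 k k (\<lambda>D. pos_part D y * A D y) w)"
  have "equivariant_half n t k \<Phi>" unfolding \<Phi>_def by (rule equivariant_half_flips_op[OF B]) simp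
  then have "equivariant n t k (\<lambda>D y. neg_part D y * \<Phi> (rev_neg D) y / t ^ pot n [] D)"
    by (rule equivariant_neg_part[OF t])
  moreover have "steps_sum n t 0 k k (\<lambda>D. pos_part D y * A D y) D = \<Phi> (rev_neg D) y / t ^ pot n [] D"
    if "D \<in> words n k" for D y
    using flips_op_steps_sum[OF that, of k t 0 "\<lambda>D. pos_part D y * A D y"] t that
    by (simp add: \<Phi>_def words_def)
  ultimately show ?thesis
    by (subst equivariant_cong[where G="\<lambda>D y. neg_part D y * \<Phi> (rev_neg D) y / t ^ pot n [] D"])
      (simp_all add: translate_sum_def fun_eq_iff)
qed

section \<open>The word \<open>1 2 ... k\<close>\<close>

definition id_word :: "nat \<Rightarrow> int list" where
  "id_word k = map int [1..<k + 1]"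

lemma length_id_word [simp]: "length (id_word k) = k"
  by (simp add: id_word_def)

lemma id_word_Suc: "id_word (Suc k) = id_word k @ [int (Suc k)]"
  by (simp add: id_word_def)

lemma nth_id_word: "r < k \<Longrightarrow> id_word k ! r = int (Suc r)"
  by (simp add: id_word_def del: upt_Suc)

lemma set_id_word: "set (id_word k) = {1..int k}"
proof -
  have "set (id_word k) = int ` {1..<k + 1}" by (simp only: id_word_def set_map set_upt)
  also have "\<dots> = {1..int k}" unfolding image_int_atLeastLessThan by auto
  finally show ?thesis .
qed

lemma id_word_words: "k \<le> n \<Longrightarrow> id_word k \<in> words n k"
  unfolding words_def using set_id_word[of k]
  by (auto simp: alphabet_def) (auto simp: id_word_def distinct_map inj_on_def)

lemma swap_sum_pos:
  assumes "c < 0" "\<forall>a\<in>set A. 0 < a"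
  shows "swap_sum n t g P A c Z = g (P @ A @ - c # Z)"
  using assms(2)
proof (induction A arbitrary: P)
  case (Cons a A)
  have "\<not> c \<prec> a" using assms(1) Cons.prems by (auto simp: letter_less_def)
  then show ?case using Cons by simp
qed simp

text \<open>The negated pivot \<open>- j\<close> lies above all positive letters, so no bar swap
  occurs. All letters below \<open>j\<close> are already present, so the pivot cannot drop.\<close>

lemma step_sum_id_word:
  assumes "1 \<le> j" "j \<le> k"
  shows "step_sum n t d j f (id_word k) = f (id_word k)"
proof -
  have tk: "take (j - 1) (id_word k) = id_word (j - 1)" using assms
    by (simp add: id_word_def take_map)
  have a: "id_word k ! (j - 1) = int j" using assms by (simp add: nth_id_word)
  have dr: "id_word (j - 1) @ int j # drop j (id_word k) = id_word k"
    using id_take_nth_drop[of "j - 1" "id_word k"] assms unfolding tk a by simp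
  have be: "below_set n (id_word (j - 1) @ drop j (id_word k)) (int j) = {}"
    using assms by (auto simp: below_set_def set_id_word image_Un alphabet_def letter_less_def image_iff)
  have "drop_sum n t d f j (id_word k) = f (id_word k)"
    unfolding drop_sum_def tk a be by simp
  moreover have "step_sum n t d j f (id_word k) = drop_sum n t d f j (id_word k)"
    unfolding step_sum_def tk a using assms dr by (subst swap_sum_pos) (auto simp: set_id_word)
  ultimately show ?thesis by simp
qed

lemma steps_sum_id_word: "r \<le> k \<Longrightarrow> steps_sum n t d k r f (id_word k) = f (id_word k)"
  by (induction r) (simp_all add: step_sum_id_word)

lemma neg_part_id_word: "neg_part (id_word k) y = 1"
proof -
  have "map (\<lambda>a. if a < 0 then y a else 1) (id_word k) = map (\<lambda>a. 1) (id_word k)"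
    by (rule map_cong) (auto simp: set_id_word)
  then show ?thesis unfolding neg_part_def by (simp add: map_replicate_const)
qed

lemma pos_part_id_word: "pos_part (id_word k) y = (\<Prod>i = 1..k. y (int i))"
  by (induction k) (simp_all add: id_word_Suc, simp add: id_word_def)

lemma translate_sum_id_word:
  "translate_sum n t k F (id_word k) y = (\<Prod>i = 1..k. y (int i)) * F (id_word k) y"
  by (simp add: translate_sum_def steps_sum_id_word neg_part_id_word pos_part_id_word)


section \<open>The length function\<close>

text \<open>The Coxeter length of the signed permutation with this window: inversions, pairs that
  become inversions when the later letter is negated, and negative letters.\<close>

fun word_len :: "int list \<Rightarrow> nat" where
  "word_len [] = 0"
| "word_len (a # w) = count_below w a + count_below (map uminus w) a + of_bool (- a \<prec> a) + word_len w"

fun word_len_shift :: "nat \<Rightarrow> int \<Rightarrow> int list \<Rightarrow> int" where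
  "word_len_shift n i [] = 0"
| "word_len_shift n i (a # w) = (if reflect n i a = a then 0 else if reflect n i a \<prec> a then 1 else - 1) *
     (of_bool (reflect n i a \<in> set w) + of_bool (- reflect n i a \<in> set w) + of_bool (reflect n i a = - a))
     + word_len_shift n i w"

lemma neg_less_reflect:
  assumes i: "i \<in> {1..int n}" and a: "a \<in> alphabet n"
  shows "of_bool (- a \<prec> a) = of_bool (- reflect n i a \<prec> reflect n i a) +
    (if reflect n i a = a then 0 else if reflect n i a \<prec> a then 1 else - 1) * (of_bool (reflect n i a = - a) :: int)"
proof (cases "reflect n i a = - a")
  case True
  have "a \<noteq> 0" using a by (simp add: alphabet_def)
  then have "- a \<prec> a \<and> \<not> a \<prec> - a \<or> a \<prec> - a \<and> \<not> - a \<prec> a" by (auto simp: letter_less_def)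
  then show ?thesis using True \<open>a \<noteq> 0\<close> by auto
next
  case False
  then have "a \<noteq> reflect n i (- a)" using i by auto
  then have "reflect n i (- a) \<prec> reflect n i a \<longleftrightarrow> - a \<prec> a" using reflect_less_iff[OF i _ a, of "- a"] a by simp
  then show ?thesis using False i by simp
qed

lemma word_len_reflect:
  assumes i: "i \<in> {1..int n}" and w: "w \<in> words n k"
  shows "int (word_len w) = int (word_len (map (reflect n i) w)) + word_len_shift n i w"
  using w
proof (induction w arbitrary: k)
  case (Cons a w)
  obtain k' where k: "k = Suc k'" using Cons.prems by (cases k) (auto simp: words_def)
  have w: "w \<in> words n k'" using Cons.prems by (simp add: words_def k)
  have a: "a \<in> alphabet n" and sw: "set w \<subseteq> alphabet n" "distinct w" using Cons.prems
    by (auto simp: words_def distinct_map)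
  then have sw': "set (map uminus w) \<subseteq> alphabet n" "distinct (map uminus w)"
    by (auto simp: distinct_map)
  have m: "map (reflect n i) (map uminus w) = map uminus (map (reflect n i) w)" using i by simp
  have n: "reflect n i a \<in> set (map uminus w) \<longleftrightarrow> - reflect n i a \<in> set w"
    by (metis (no_types, lifting) image_eqI list.set_map minus_minus imageE)
  show ?case
    using Cons.IH[OF w] count_below_reflect[OF i sw a] count_below_reflect[OF i sw' a, unfolded m n] neg_less_reflect[OF i a]
    by (simp only: word_len.simps list.map word_len_shift.simps of_nat_add of_nat_of_bool distrib_left)
qed simp

lemma word_len_shift_moved_Nil: "moved n i w = [] \<Longrightarrow> word_len_shift n i w = 0"
  by (induction w) (auto simp: moved_Cons split: if_splits)

lemma word_len_shift_append: "moved n i u = [] \<Longrightarrow> word_len_shift n i (u @ w) = word_len_shift n i w"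
  by (induction u) (auto simp: moved_Cons split: if_splits)

lemma abs_set_words:
  assumes "w \<in> words n n"
  shows "abs ` set w = {1..int n}"
proof (rule card_subset_eq)
  show "abs ` set w \<subseteq> {1..int n}" using assms by (auto simp: words_def alphabet_def)
  have "distinct (map abs w)" "length w = n" using assms by (simp_all add: words_def)
  then have "card (set (map abs w)) = n" by (simp only: distinct_card length_map)
  then show "card (abs ` set w) = card {1..int n}" by simp
qed simp

text \<open>At full height no absolute value is missing. So the image of the first moved letter is
  its own negative or occurs later up to sign: exactly one of the three indicators at this letter is
  1, and a second moved letter contributes nothing.\<close>

lemma word_len_shift_words:
  assumes i: "i \<in> {1..int n}" and w: "w \<in> words n n"
  obtains a where "find (\<lambda>a. reflect n i a \<noteq> a) w = Some a" "a \<in> alphabet n"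
    "word_len_shift n i w = (if reflect n i a \<prec> a then 1 else - 1)"
  using i w
proof (cases rule: moved_words_cases)
  case none
  have "i \<in> abs ` set w" using abs_set_words[OF w] i by simp
  then obtain a where a: "a \<in> set w" "\<bar>a\<bar> = i" by auto
  then have "reflect n i a \<noteq> a" using i by (auto simp: reflect_def)
  then have "a \<in> set (moved n i w)" using a by (simp add: moved_def)
  then show thesis using none by simp
next
  case (one U a V)
  have f: "find (\<lambda>a. reflect n i a \<noteq> a) w = Some a" using one by (simp add: find_moved)
  have a: "a \<in> alphabet n" using w one by (simp add: words_def)
  have sa: "reflect n i (reflect n i a) \<noteq> reflect n i a" using one i by simp
  have nUV: "\<bar>reflect n i a\<bar> \<notin> abs ` set U" "\<bar>reflect n i a\<bar> \<notin> abs ` set V"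
    using moved_Nil_abs[OF i one(3) sa] moved_Nil_abs[OF i one(4) sa] by auto
  have "reflect n i a \<in> alphabet n" using a i by simp
  then have "\<bar>reflect n i a\<bar> \<in> abs ` set w" unfolding abs_set_words[OF w] by (simp add: alphabet_def int_one_le_iff_zero_less)
  then have "\<bar>reflect n i a\<bar> = \<bar>a\<bar>" using nUV one(1) by auto
  then have e: "reflect n i a = - a" using one(5) by (auto simp: abs_eq_iff)
  have "\<bar>a\<bar> \<notin> abs ` set V" using nUV(2) e by simp
  then have "- a \<notin> set V" "a \<notin> set V" by (metis abs_minus imageI)+
  then show thesis using that[OF f a] one e
    by (simp add: word_len_shift_append word_len_shift_moved_Nil)
next
  case (two U a V b W)
  have f: "find (\<lambda>a. reflect n i a \<noteq> a) w = Some a" using two by (simp add: find_moved)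
  have a: "a \<in> alphabet n" using w two by (simp add: words_def)
  have d: "\<bar>b\<bar> \<notin> abs ` set V" "\<bar>b\<bar> \<notin> abs ` set W" "\<bar>a\<bar> \<notin> abs ` set W" "b \<noteq> 0" "a \<noteq> 0"
    using w two(1) by (auto simp: words_def alphabet_def)
  have d': "b \<notin> set V" "- b \<notin> set V" "b \<notin> set W" "- b \<notin> set W" "a \<notin> set W" "- a \<notin> set W"
    using d by (metis abs_minus imageI)+
  have bn: "b \<noteq> - b" using d by simp
  have sb: "reflect n i b = a \<or> reflect n i b = - a" using two(8) i by auto
  have "\<bar>a\<bar> \<noteq> \<bar>b\<bar>" using two(9) by simp
  then have ab: "a \<noteq> b" "a \<noteq> - b" "- a \<noteq> b" by auto
  have s2: "word_len_shift n i (b # W) = 0"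
    using sb d' two(5) ab by (auto simp: word_len_shift_moved_Nil)
  have "word_len_shift n i w = (if reflect n i a \<prec> a then 1 else - 1)"
    using two(8,6) d' bn s2 ab
    by (auto simp: two(1) word_len_shift_append[OF two(3)] word_len_shift_append[OF two(4)])
  then show thesis using that[OF f a] by blast
qed

text \<open>The function \<open>t ^ word_len w\<close> spans the one-dimensional representation in
  which every generator acts by \<open>t\<close>. This matches \<open>dl_op\<close>, which
  multiplies constants by \<open>t\<close>, and gives the family from which the induction over the
  blocks starts.\<close>

lemma left_act_word_len:
  assumes i: "i \<in> {1..int n}" and w: "w \<in> words n n"
  shows "left_act n t i (\<lambda>w. t ^ word_len w) w = t * t ^ word_len w"
proof -
  obtain a where a: "find (\<lambda>a. reflect n i a \<noteq> a) w = Some a" "a \<in> alphabet n"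
    "word_len_shift n i w = (if reflect n i a \<prec> a then 1 else - 1)"
    using word_len_shift_words[OF i w] .
  have ne: "reflect n i a \<noteq> a" using find_SomeD[OF a(1)] by simp
  show ?thesis
  proof (cases "a \<prec> reflect n i a")
    case True
    then have "word_len (map (reflect n i) w) = Suc (word_len w)"
      using word_len_reflect[OF i w] a(3) letter_less_asym[OF True] by simp
    then show ?thesis using True by (simp add: left_act_def a(1))
  next
    case False
    then have "reflect n i a \<prec> a" using reflect_less_cases[OF i a(2)] ne by blast
    then have "word_len w = Suc (word_len (map (reflect n i) w))"
      using word_len_reflect[OF i w] a(3) by simp
    then show ?thesis using False by (simp add: left_act_def a(1) algebra_simps)
  qed
qed

lemma equivariant_word_len: "equivariant n t n (\<lambda>w y. t ^ word_len w)"
  unfolding equivariant_def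
proof (intro ballI allI impI)
  fix w i and y :: "int \<Rightarrow> 'a" assume w: "w \<in> words n n" and i: "i \<in> {1..int n}" and y: "generic n y"
  have "y i - y (reflect n i i) \<noteq> 0" using generic_neq[OF i y] by simp
  then have "dl_op n t i (\<lambda>y. t ^ word_len w) y = t * t ^ word_len w"
    by (simp add: dl_op_def divide_eq_eq) (simp add: algebra_simps)
  then show "dl_op n t i (\<lambda>y. t ^ word_len w) y = left_act n t i (\<lambda>w. t ^ word_len w) w"
    using left_act_word_len[OF i w, of t] by simp
qed

section \<open>Right operators fix powers of \<open>t\<close> given by the length\<close>

lemma word_len_swap:
  assumes "c \<prec> d" "c \<noteq> 0" "d \<noteq> 0"
  shows "word_len (u @ d # c # v) = Suc (word_len (u @ c # d # v))"
proof (induction u)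
  case Nil
  have "- d \<prec> c \<longleftrightarrow> - c \<prec> d" using uminus_letter_less[of d "- c"] assms by simp
  then show ?case using assms(1) letter_less_asym[OF assms(1)] by (simp add: count_below_Cons)
qed (simp add: count_below_append count_below_Cons)

lemma word_len_flip:
  "word_len (A @ [- b]) + of_bool (- b \<prec> b) = word_len (A @ [b]) + of_bool (b \<prec> - b)"
  by (induction A) (simp_all add: count_below_append count_below_Cons count_below_Nil)

text \<open>On this function the right generator also acts by \<open>t\<close>, and \<open>t\<close>
  times its inverse is the identity.\<close>

lemma swap_op_word_len:
  assumes w: "w \<in> words n k" and p: "p + 1 < k" and f: "\<And>w. w \<in> words n k \<Longrightarrow> f w = t ^ word_len w"
  shows "swap_op t p f w = t ^ word_len w"
proof -
  have pl: "p < length w" "Suc p < length w" using w p by (auto simp: words_def)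
  define u c d v where "u = take p w" and "c = w ! p" and "d = w ! Suc p" and "v = drop (Suc (Suc p)) w"
  have weq: "w = u @ c # d # v"
    unfolding u_def c_def d_def v_def using pl by (simp add: Cons_nth_drop_Suc)
  have u: "length u = p" using pl by (simp add: u_def)
  have w': "w[p := w ! (p + 1), p + 1 := w ! p] = u @ d # c # v"
    using u by (simp add: weq nth_append list_update_append)
  have fw: "f (u @ d # c # v) = t ^ word_len (u @ d # c # v)" "f w = t ^ word_len w"
    using f[OF swap_word[OF w p]] f[OF w] unfolding w' by simp_all
  have cd: "c \<noteq> 0" "d \<noteq> 0" "c \<noteq> d" using w by (auto simp: weq words_def alphabet_def)
  have so: "swap_op t p f w = (if c \<prec> d then f (u @ d # c # v) + (1 - t) * f w else t * f (u @ d # c # v))"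
    using swap_op_append[of t u f c d v] u by (simp add: weq)
  show ?thesis
  proof (cases "c \<prec> d")
    case True
    then show ?thesis using word_len_swap[OF True cd(1,2), of u v]
      by (simp add: so fw) (simp add: weq algebra_simps)
  next
    case False
    then have "d \<prec> c" using cd not_letter_less by blast
    then show ?thesis using False word_len_swap[of d c u v] cd by (simp add: so fw) (simp add: weq)
  qed
qed

lemma slide_op_word_len:
  assumes "q + m < k" "\<And>w. w \<in> words n k \<Longrightarrow> f w = t ^ word_len w" "w \<in> words n k"
  shows "slide_op t q m f w = t ^ word_len w"
  using assms(1,3)
proof (induction m arbitrary: q w)
  case (Suc m)
  show ?case unfolding slide_op.simps
    by (rule swap_op_word_len[OF Suc.prems(2)]) (use Suc in simp_all)
qed (use assms(2) in simp)

text \<open>Taking one letter out of a word of full height frees a single absolute value, hence just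
  that letter and its negative.\<close>

lemma below_set_full:
  assumes "X @ z # Z \<in> words n n"
  shows "card (below_set n (X @ Z) v) = of_bool (z \<prec> v) + of_bool (- z \<prec> v)"
proof -
  have z: "z \<in> alphabet n" "\<bar>z\<bar> \<notin> abs ` set (X @ Z)" using words_Cons_middle[OF assms] by auto
  have "abs ` set (z # X @ Z) = {1..int n}" using abs_set_words[OF assms] by auto
  then have "below_set n (z # X @ Z) v = {}" unfolding below_set_def by (auto simp: alphabet_def)
  then show ?thesis using below_set_insert[OF z, of v] by simp
qed

lemma flips_op_word_len:
  assumes "r \<le> n" "w \<in> words n n"
  shows "flips_op n t (1 - t) n r (\<lambda>w. t ^ word_len w) w = t ^ word_len w"
  using assms
proof (induction r arbitrary: w)
  case (Suc r)
  have fl: "flip_op n t (1 - t) (flips_op n t (1 - t) n r (\<lambda>w. t ^ word_len w)) w = t ^ word_len w"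
    if w: "w \<in> words n n" for w
  proof -
    obtain A b where weq: "w = A @ [b]" using w Suc.prems by (cases w rule: rev_cases) (auto simp: words_def)
    have IH: "flips_op n t (1 - t) n r (\<lambda>w. t ^ word_len w) v = t ^ word_len v" if "v \<in> words n n" for v
      using Suc.IH that Suc.prems by simp
    have "flip_op n t (1 - t) (flips_op n t (1 - t) n r (\<lambda>w. t ^ word_len w)) w
        = flip_op n t (1 - t) (\<lambda>w. t ^ word_len w) w"
      by (rule flip_op_cong[OF w _ IH]) (use Suc.prems in simp_all)
    also have "\<dots> = t ^ word_len w"
    proof -
      have b0: "b \<in> alphabet n" "b \<noteq> 0" using w by (auto simp: weq words_def alphabet_def)
      have bA: "\<bar>b\<bar> \<notin> abs ` set A" using w by (auto simp: weq words_def)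
      have ab: "abs ` set (A @ [b]) = {1..int n}" using abs_set_words w weq by blast
      have bs: "below_set n A v = {e \<in> {b, - b}. e \<prec> v}" for v
      proof (intro equalityI subsetI)
        fix e assume e: "e \<in> below_set n A v"
        then have "\<bar>e\<bar> \<in> abs ` set (A @ [b])" unfolding ab by (auto simp: below_set_def alphabet_def)
        then have "\<bar>e\<bar> = \<bar>b\<bar>" using e by (auto simp: below_set_def)
        then show "e \<in> {e \<in> {b, - b}. e \<prec> v}" using e by (auto simp: below_set_def abs_eq_iff)
      next
        fix e assume "e \<in> {e \<in> {b, - b}. e \<prec> v}"
        then show "e \<in> below_set n A v" using b0 bA by (auto simp: below_set_def)
      qed
      show ?thesis
      proof (cases "b \<prec> - b")
        case True
        then have n: "\<not> - b \<prec> b" using letter_less_asym by blast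
        have "below_set n A b = {}" "below_set n A (- b) = {b}" using True n unfolding bs by auto
        then show ?thesis using True n word_len_flip[of A b]
          by (simp add: weq flip_op_append algebra_simps)
      next
        case False
        then have n: "- b \<prec> b" using not_letter_less[of b "- b"] b0 by auto
        have "below_set n A b = {- b}" "below_set n A (- b) = {}" using False n unfolding bs by auto
        then show ?thesis using False n word_len_flip[of A b]
          by (simp add: weq flip_op_append flip: power_Suc)
      qed
    qed
    finally show ?thesis .
  qed
  show ?case unfolding flips_op.simps
    by (rule slide_op_word_len[OF _ fl Suc.prems(2)]) (use Suc.prems in simp_all)
qed simp

fun inv_count :: "int list \<Rightarrow> nat" where
  "inv_count [] = 0"
| "inv_count (a # w) = count_below w a + inv_count w"

lemma inv_count_snoc: "inv_count (D @ [z]) = inv_count D + length (filter (\<lambda>x. z \<prec> x) D)"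
  by (induction D) (simp_all add: count_below_append count_below_Cons count_below_Nil)

lemma inversions_eq: "inversions w = inv_count w"
proof (induction w)
  case Nil
  have e: "{(k, l). 1 \<le> k \<and> k < l \<and> l \<le> length ([] :: int list) \<and> entry [] l \<prec> entry [] k} = {}" by auto
  show ?case unfolding inversions_def e by simp
next
  case (Cons a w)
  define I where "I w = {(k, l). 1 \<le> k \<and> k < l \<and> l \<le> length w \<and> entry w l \<prec> entry w k}" for w
  define B where "B = {l. l < length w \<and> w ! l \<prec> a}"
  have fin: "finite (I v)" for v
    by (rule finite_subset[of _ "{..length v} \<times> {..length v}"]) (auto simp: I_def)
  have split: "I (a # w) = (\<lambda>l. (1, l + 2)) ` B \<union> (\<lambda>(k, l). (Suc k, Suc l)) ` I w"
  proof (intro equalityI subsetI)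
    fix p assume "p \<in> I (a # w)"
    then obtain k l where p: "p = (k, l)" "1 \<le> k" "k < l" "l \<le> Suc (length w)" "(a # w) ! (l - 1) \<prec> (a # w) ! (k - 1)"
      by (auto simp: I_def)
    obtain l' where l': "l = Suc (Suc l')" using p(2,3) by (cases l; cases "l - 1") auto
    show "p \<in> (\<lambda>l. (1, l + 2)) ` B \<union> (\<lambda>(k, l). (Suc k, Suc l)) ` I w"
    proof (cases "k = 1")
      case True
      then have "l' \<in> B" using p l' by (simp add: B_def)
      then show ?thesis using True p l' by auto
    next
      case False
      then obtain k' where k': "k = Suc (Suc k')" using p(2) by (cases k; cases "k - 1") auto
      then have "(Suc k', Suc l') \<in> I w" using p l' by (simp add: I_def)
      then show ?thesis using p k' l' by force
    qed
  next
    fix p assume "p \<in> (\<lambda>l. (1, l + 2)) ` B \<union> (\<lambda>(k, l). (Suc k, Suc l)) ` I w"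
    then show "p \<in> I (a # w)" by (auto simp: I_def B_def nth_Cons')
  qed
  have "card (I (a # w)) = card B + card (I w)"
    unfolding split using fin[of w]
    by (subst card_Un_disjoint) (auto simp: B_def I_def card_image inj_on_def)
  moreover have "card B = count_below w a"
    by (simp add: B_def count_below_def length_filter_conv_card)
  ultimately show ?case using Cons by (simp add: inversions_def I_def)
qed

text \<open>The form of \<open>pot\<close> at full height, where the only candidates below
  \<open>- z\<close> are \<open>z\<close> and \<open>- z\<close>, and \<open>- z\<close> is not
  below itself.\<close>

fun pot_full :: "int list \<Rightarrow> int list \<Rightarrow> nat" where
  "pot_full X [] = 0"
| "pot_full X (z # Z) = count_below X (- z) + of_bool (z \<prec> - z) + pot_full (X @ [z]) Z"

lemma pot_full_snoc: "pot_full X (Z @ [z]) = pot_full X Z + count_below (X @ Z) (- z) + of_bool (z \<prec> - z)"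
  by (induction Z arbitrary: X) simp_all

lemma pot_eq_pot_full: "X @ Z \<in> words n n \<Longrightarrow> pot n X Z = pot_full X Z"
proof (induction Z arbitrary: X)
  case (Cons z Z)
  then show ?case using below_set_full[OF Cons.prems, of "- z"] by simp
qed simp

lemma word_len_rev_neg:
  assumes "0 \<notin> set D"
  shows "word_len (rev_neg D) = inv_count D + pot_full [] D"
  using assms
proof (induction D rule: rev_induct)
  case (snoc z D)
  have 1: "count_below (rev_neg D) (- z) = length (filter (\<lambda>x. z \<prec> x) D)"
  proof -
    have "count_below (rev_neg D) (- z) = length (filter (\<lambda>x. - x \<prec> - z) D)"
      by (simp add: count_below_def rev_neg_def filter_map o_def rev_filter[symmetric])
    also have "filter (\<lambda>x. - x \<prec> - z) D = filter (\<lambda>x. z \<prec> x) D"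
    proof (rule filter_cong)
      fix x assume "x \<in> set D"
      then have "x \<noteq> 0" "z \<noteq> 0" using snoc.prems by auto
      then show "- x \<prec> - z \<longleftrightarrow> z \<prec> x" by (rule uminus_letter_less)
    qed simp
    finally show ?thesis .
  qed
  have 2: "count_below (map uminus (rev_neg D)) (- z) = count_below D (- z)"
    by (simp add: count_below_def rev_neg_def o_def rev_filter[symmetric])
  show ?case using snoc by (simp add: 1 2 inv_count_snoc pot_full_snoc)
qed simp

text \<open>The inversions of the last column act like a run of unprimed columns that the rightmost
  block does not have. The right operators fix the power of the length, so such a run gives
  \<open>t\<close> to the length of \<open>rev_neg D\<close> minus the potential of
  \<open>D\<close>, and this difference is the number of inversions.\<close>

lemma steps_sum_word_len:
  assumes t: "t \<noteq> 0" and D: "D \<in> words n n"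
  shows "t ^ inversions D = steps_sum n t (1 - t) n n (\<lambda>w. t ^ word_len w) D"
proof -
  have "t ^ pot n [] D * steps_sum n t (1 - t) n n (\<lambda>w. t ^ word_len w) D = t ^ word_len (rev_neg D)"
    using flips_op_steps_sum[OF D, of n t "1 - t" "\<lambda>w. t ^ word_len w"]
      flips_op_word_len[of n n "rev_neg D" t] D by (simp add: rev_neg_words)
  moreover have "0 \<notin> set D" using D by (auto simp: words_def alphabet_def)
  ultimately show ?thesis using t pot_eq_pot_full[of "[]" D n] D
    by (simp add: word_len_rev_neg inversions_eq power_add)
qed


section \<open>Steps between adjacent columns\<close>

definition row_le :: "int list \<Rightarrow> int list \<Rightarrow> bool" where
  "row_le D C \<longleftrightarrow> (\<forall>r\<in>{1..min (length D) (length C)}. entry C r \<preceq> entry D r)"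

lemma words_distinct_column:
  assumes "D \<in> words n k"
  shows "distinct_column D"
  unfolding distinct_column_def
proof (intro ballI impI)
  fix r s assume rs: "r \<in> {1..length D}" "s \<in> {1..length D}" "r \<noteq> s"
  have "distinct (map abs D)" using assms by (simp add: words_def)
  then have "map abs D ! (r - 1) \<noteq> map abs D ! (s - 1)"
    using rs by (subst nth_eq_iff_index_eq) auto
  moreover have "r - 1 < length D" "s - 1 < length D" using rs by auto
  ultimately have "\<bar>entry D r\<bar> \<noteq> \<bar>entry D s\<bar>" by simp
  then show "entry D r \<noteq> entry D s \<and> entry D r \<noteq> - entry D s" by auto
qed

lemma distinct_column_words:
  assumes "distinct_column D" "set D \<subseteq> alphabet n" "length D = k"
  shows "D \<in> words n k"
proof -
  have "distinct (map abs D)"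
  proof (unfold distinct_conv_nth, intro allI impI)
    fix i j assume ij: "i < length (map abs D)" "j < length (map abs D)" "i \<noteq> j"
    then have "entry D (Suc i) \<noteq> entry D (Suc j) \<and> entry D (Suc i) \<noteq> - entry D (Suc j)"
      using assms(1) unfolding distinct_column_def by (metis Suc_inject Suc_leI atLeastAtMost_iff le_add1 length_map plus_1_eq_Suc)
    then show "map abs D ! i \<noteq> map abs D ! j" using ij by (auto simp: abs_eq_iff)
  qed
  then show ?thesis using assms by (simp add: words_def)
qed

lemma bar_swap_append:
  "bar_swap (Suc (length P)) (Suc (length P + Suc (length A))) (P @ a # A @ - c # Z) = P @ c # A @ - a # Z"
  by (simp add: bar_swap_def nth_append list_update_append)

lemma bar_swap_words:
  assumes D: "D \<in> words n k" and r: "1 \<le> r" "r < j" "j \<le> k"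
  shows "bar_swap r j D \<in> words n k"
proof (rule distinct_column_words)
  have l: "length D = k" using D by (simp add: words_def)
  show "distinct_column (bar_swap r j D)" using words_distinct_column[OF D] r l by (intro distinct_column_bar_swap) auto
  have "set D \<subseteq> alphabet n" using D by (simp add: words_def)
  moreover have "D ! (j - 1) \<in> set D" "D ! (r - 1) \<in> set D" using r l by (auto intro!: nth_mem)
  ultimately show "set (bar_swap r j D) \<subseteq> alphabet n"
    unfolding bar_swap_def by (intro subsetI) (auto dest!: subsetD[OF set_update_subset_insert])
qed (use D in \<open>simp add: bar_swap_def words_def\<close>)

lemma bar_swaps_Cons: "bar_swaps (r # rs) j D = bar_swaps rs j (bar_swap r j D)"
  and bar_swaps_Nil: "bar_swaps [] j D = D"
  by (simp_all add: bar_swaps_def)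

lemma bar_swaps_words:
  assumes "D \<in> words n k" "set rs \<subseteq> {1..<j}" "j \<le> k"
  shows "bar_swaps rs j D \<in> words n k"
  using assms
proof (induction rs arbitrary: D)
  case (Cons r rs)
  then show ?case using bar_swap_words[of D n k r j] by (simp add: bar_swaps_Cons)
qed (simp add: bar_swaps_Nil)

section \<open>Descending bar swaps and weakly decreasing rows\<close>

fun descending :: "nat list \<Rightarrow> nat \<Rightarrow> int list \<Rightarrow> bool" where
  "descending [] j D = True"
| "descending (r # rs) j D = (- entry D j \<prec> entry D r \<and> descending rs j (bar_swap r j D))"

definition swap_rows :: "nat \<Rightarrow> nat \<Rightarrow> int list \<Rightarrow> nat list set" where
  "swap_rows q j D = {rs. sorted_wrt (<) rs \<and> set rs \<subseteq> {q<..<j} \<and> descending rs j D}"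

lemma finite_swap_rows: "finite (swap_rows q j D)"
proof (rule finite_subset)
  show "swap_rows q j D \<subseteq> {rs. set rs \<subseteq> {q<..<j} \<and> length rs \<le> j}"
  proof
    fix rs assume "rs \<in> swap_rows q j D"
    then have "sorted_wrt (<) rs" "set rs \<subseteq> {q<..<j}" by (auto simp: swap_rows_def)
    then have "length rs = card (set rs)" using distinct_card[of rs] by (simp add: strict_sorted_iff)
    also have "\<dots> \<le> card {q<..<j}" using \<open>set rs \<subseteq> {q<..<j}\<close> by (intro card_mono) auto
    finally show "rs \<in> {rs. set rs \<subseteq> {q<..<j} \<and> length rs \<le> j}" using \<open>set rs \<subseteq> _\<close> by simp
  qed
qed (simp add: finite_lists_length_le)

lemma swap_rows_empty: "j \<le> Suc q \<Longrightarrow> swap_rows q j D = {[]}"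
proof -
  assume "j \<le> Suc q"
  then have e: "{q<..<j} = {}" by auto
  have "rs = []" if "set rs \<subseteq> {}" for rs :: "nat list" using that by simp
  then show ?thesis unfolding swap_rows_def e by auto
qed

lemma swap_rows_step:
  assumes "Suc q < j"
  shows "swap_rows q j D = swap_rows (Suc q) j D \<union>
    (if - entry D j \<prec> entry D (Suc q) then (#) (Suc q) ` swap_rows (Suc q) j (bar_swap (Suc q) j D) else {})"
proof (intro equalityI subsetI)
  fix rs assume rs: "rs \<in> swap_rows q j D"
  show "rs \<in> swap_rows (Suc q) j D \<union>
    (if - entry D j \<prec> entry D (Suc q) then (#) (Suc q) ` swap_rows (Suc q) j (bar_swap (Suc q) j D) else {})"
  proof (cases "Suc q \<in> set rs")
    case True
    then obtain r rs' where c: "rs = r # rs'" by (cases rs) auto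
    have "r = Suc q"
      using rs True by (auto simp: swap_rows_def c less_Suc_eq_le Suc_le_eq)
    moreover have "set rs' \<subseteq> {Suc q<..<j}" using rs \<open>r = Suc q\<close> by (auto simp: swap_rows_def c)
    ultimately show ?thesis using rs by (auto simp: swap_rows_def c)
  next
    case False
    have "set rs \<subseteq> {Suc q<..<j}"
    proof
      fix x assume "x \<in> set rs"
      then have "q < x" "x < j" "x \<noteq> Suc q" using rs False by (auto simp: swap_rows_def)
      then show "x \<in> {Suc q<..<j}" by simp
    qed
    then show ?thesis using rs by (simp add: swap_rows_def)
  qed
next
  fix rs assume "rs \<in> swap_rows (Suc q) j D \<union>
    (if - entry D j \<prec> entry D (Suc q) then (#) (Suc q) ` swap_rows (Suc q) j (bar_swap (Suc q) j D) else {})"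
  then show "rs \<in> swap_rows q j D"
    using assms by (force simp: swap_rows_def split: if_splits)
qed

lemma N_swaps_Cons: "N_swaps n D (r # rs) j = N_swap n D r j + N_swaps n (bar_swap r j D) rs j"
  by (simp add: N_swaps_def sum.lessThan_Suc_shift bar_swaps_Cons bar_swaps_Nil del: sum.lessThan_Suc)

lemma N_swap_append:
  "N_swap n (P @ a # A @ - c # Z) (Suc (length P)) (Suc (length P + Suc (length A))) = swap_weight n P a A c"
proof -
  define D where "D = P @ a # A @ - c # Z"
  define j where "j = Suc (length P + Suc (length A))"
  have seg: "segment D (Suc (length P) + 1) (j - 1) = A"
  proof (rule nth_equalityI)
    show "length (segment D (Suc (length P) + 1) (j - 1)) = length A" by (simp add: segment_def j_def del: upt_Suc)
    fix i assume "i < length (segment D (Suc (length P) + 1) (j - 1))"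
    then have "i < length A" by (simp add: segment_def j_def del: upt_Suc)
    then show "segment D (Suc (length P) + 1) (j - 1) ! i = A ! i"
      by (simp add: segment_def j_def D_def nth_append del: upt_Suc)
  qed
  have lD: "j \<le> length D" by (simp add: D_def j_def)
  have T: "take j D = P @ a # A @ [- c]" by (simp add: D_def j_def)
  have "(\<Union>i\<in>{1..j}. {entry D i, - entry D i}) = {e. \<bar>e\<bar> \<in> abs ` set (take j D)}"
  proof (intro equalityI subsetI)
    fix e assume "e \<in> (\<Union>i\<in>{1..j}. {entry D i, - entry D i})"
    then obtain i where i: "i \<in> {1..j}" "e = entry D i \<or> e = - entry D i" by auto
    then have "entry D i = take j D ! (i - 1)" "i - 1 < length (take j D)" using lD by auto
    then have "entry D i \<in> set (take j D)" by (metis nth_mem)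
    then show "e \<in> {e. \<bar>e\<bar> \<in> abs ` set (take j D)}" using i(2) by force
  next
    fix e assume "e \<in> {e. \<bar>e\<bar> \<in> abs ` set (take j D)}"
    then obtain x where x: "x \<in> set (take j D)" "\<bar>e\<bar> = \<bar>x\<bar>" by auto
    then obtain i where i: "i < length (take j D)" "x = take j D ! i" by (auto simp: in_set_conv_nth)
    then have "x = entry D (Suc i)" "Suc i \<in> {1..j}" by auto
    moreover from this have "e \<in> {entry D (Suc i), - entry D (Suc i)}" using x(2) by (auto simp: abs_eq_iff)
    ultimately show "e \<in> (\<Union>i\<in>{1..j}. {entry D i, - entry D i})" by blast
  qed
  then have U: "(\<Union>i\<in>{1..j}. {entry D i, - entry D i}) = {e. \<bar>e\<bar> \<in> abs ` set (P @ a # A @ [c])}"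
    unfolding T by (simp add: image_Un)
  have "open_interval n c a - {e. \<bar>e\<bar> \<in> abs ` set (P @ a # A @ [c])} =
      {e \<in> open_interval n c a. \<bar>e\<bar> \<notin> abs ` set (P @ a # A @ [c])}" by blast
  moreover have "entry D (Suc (length P)) = a" "entry D j = - c" by (simp_all add: D_def j_def nth_append)
  ultimately show ?thesis
    unfolding D_def[symmetric] j_def[symmetric] N_swap_def Let_def seg U swap_weight_def by simp
qed

text \<open>The recursion of \<open>swap_sum\<close> decides row by row whether the row belongs to
  the list \<open>rs\<close>; the weights multiply because \<open>N\<close> adds up along a sequence
  of bar swaps.\<close>

lemma swap_sum_eq:
  "swap_sum n t g P A c Z = (\<Sum>rs\<in>swap_rows (length P) (Suc (length P + length A)) (P @ A @ - c # Z).
     (1 - t) ^ length rs * t ^ N_swaps n (P @ A @ - c # Z) rs (Suc (length P + length A))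
       * g (bar_swaps rs (Suc (length P + length A)) (P @ A @ - c # Z)))"
proof (induction A arbitrary: P c)
  case Nil
  then show ?case by (simp add: swap_rows_empty N_swaps_def bar_swaps_Nil)
next
  case (Cons a A)
  define D where "D = P @ a # A @ - c # Z"
  define j where "j = Suc (length P + Suc (length A))"
  define q where "q = length P"
  define B where "B = bar_swap (Suc q) j D"
  define \<phi> where "\<phi> D rs = (1 - t) ^ length rs * t ^ N_swaps n D rs j * g (bar_swaps rs j D)" for D rs
  have B: "B = (P @ [c]) @ A @ - a # Z" using bar_swap_append[of P A a c Z] by (simp add: B_def q_def j_def D_def)
  have 1: "swap_sum n t g (P @ [a]) A c Z = (\<Sum>rs\<in>swap_rows (Suc q) j D. \<phi> D rs)"
    using Cons.IH[of "P @ [a]" c] by (simp add: \<phi>_def q_def j_def D_def)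
  have 2: "swap_sum n t g (P @ [c]) A a Z = (\<Sum>rs\<in>swap_rows (Suc q) j B. \<phi> B rs)"
    using Cons.IH[of "P @ [c]" a] unfolding B by (simp add: \<phi>_def q_def j_def)
  have e: "entry D j = - c" "entry D (Suc q) = a" by (simp_all add: D_def j_def q_def nth_append)
  have st: "swap_rows q j D = swap_rows (Suc q) j D \<union> (if c \<prec> a then (#) (Suc q) ` swap_rows (Suc q) j B else {})"
    using swap_rows_step[of q j D, folded B_def] unfolding e minus_minus by (simp add: j_def q_def)
  have dj: "swap_rows (Suc q) j D \<inter> (#) (Suc q) ` X = {}" for X by (auto simp: swap_rows_def)
  have "(\<Sum>rs\<in>(#) (Suc q) ` swap_rows (Suc q) j B. \<phi> D rs) = (\<Sum>rs\<in>swap_rows (Suc q) j B. \<phi> D (Suc q # rs))"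
    by (subst sum.reindex) (auto simp: inj_on_def)
  also have "\<dots> = (1 - t) * t ^ swap_weight n P a A c * (\<Sum>rs\<in>swap_rows (Suc q) j B. \<phi> B rs)"
    unfolding sum_distrib_left
    by (rule sum.cong[OF HOL.refl])
      (simp add: \<phi>_def N_swaps_Cons bar_swaps_Cons B_def[symmetric] N_swap_append[of n P a A c Z, folded D_def j_def q_def] power_add algebra_simps)
  finally have 3: "(\<Sum>rs\<in>(#) (Suc q) ` swap_rows (Suc q) j B. \<phi> D rs) =
    (1 - t) * t ^ swap_weight n P a A c * swap_sum n t g (P @ [c]) A a Z" unfolding 2 .
  have "(\<Sum>rs\<in>swap_rows q j D. \<phi> D rs) = swap_sum n t g P (a # A) c Z"
    unfolding st using dj finite_swap_rows[of "Suc q" j]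
    by (cases "c \<prec> a") (simp_all add: sum.union_disjoint 1[symmetric] 3)
  then show ?case by (simp add: \<phi>_def D_def j_def q_def)
qed

text \<open>A row above \<open>j\<close> changes at most once, in the swap that uses it, and then
  carries the negative of the pivot of that moment. So comparing the rows amounts to the descent
  condition of each swap. The pivot decreases too, since negation reverses the order.\<close>

lemma descending_iff:
  assumes "D \<in> words n k" "j \<le> k" "sorted_wrt (<) rs" "set rs \<subseteq> {1..<j}"
  shows "descending rs j D \<longleftrightarrow> (\<forall>r\<in>{1..<j}. entry (bar_swaps rs j D) r \<preceq> entry D r)"
    and "descending rs j D \<Longrightarrow> entry (bar_swaps rs j D) j \<preceq> entry D j"
  using assms
proof (induction rs arbitrary: D)
  case Nil
  { case 1 then show ?case by (simp add: bar_swaps_Nil letter_le_def) }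
  { case 2 then show ?case by (simp add: bar_swaps_Nil letter_le_def) }
next
  case (Cons r rs)
  { case 1
    then have r: "1 \<le> r" "r < j" "j \<le> length D" "length D = k" by (auto simp: words_def)
    define B where "B = bar_swap r j D"
    define C where "C = bar_swaps rs j B"
    have Bw: "B \<in> words n k" unfolding B_def using 1 by (intro bar_swap_words) auto
    have rs: "sorted_wrt (<) rs" "set rs \<subseteq> {1..<j}" "r \<notin> set rs" "distinct rs" using 1 by (auto simp: strict_sorted_iff)
    have lB: "length B = k" using Bw by (simp add: words_def)
    have "entry C r = entry B r"
      using bar_swaps_changed(1)[OF rs(4,2) _ words_distinct_column[OF Bw], of r] r rs(3) lB by (auto simp: C_def)
    then have Cr: "entry C r = - entry D j" using entry_bar_swap[of r j D r] r by (simp add: B_def)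
    have BD: "entry B s = entry D s" if "s \<in> {1..<j}" "s \<noteq> r" for s
      using entry_bar_swap[of r j D s] that r by (simp add: B_def)
    have dj: "entry D r \<noteq> - entry D j"
      using words_distinct_column[OF 1(1)] r unfolding distinct_column_def by auto
    have IH: "descending rs j B \<longleftrightarrow> (\<forall>s\<in>{1..<j}. entry C s \<preceq> entry B s)"
      unfolding C_def using Cons.IH(1)[OF Bw 1(2) rs(1,2)] .
    have "(\<forall>s\<in>{1..<j}. entry C s \<preceq> entry B s) \<longleftrightarrow> (\<forall>s\<in>{1..<j} - {r}. entry C s \<preceq> entry D s)"
      using BD \<open>entry C r = entry B r\<close> by (metis Diff_iff letter_le_def singletonD insertI1)
    moreover have "- entry D j \<prec> entry D r \<longleftrightarrow> entry C r \<preceq> entry D r" unfolding Cr letter_le_def using dj by auto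
    moreover have "r \<in> {1..<j}" using r by simp
    ultimately show ?case unfolding descending.simps bar_swaps_Cons B_def[symmetric] IH C_def[symmetric]
      by (metis Diff_iff singletonD) }
  { case 2
    then have r: "1 \<le> r" "r < j" "j \<le> length D" "length D = k" by (auto simp: words_def)
    define B where "B = bar_swap r j D"
    have Bw: "B \<in> words n k" unfolding B_def using 2 by (intro bar_swap_words) auto
    have rs: "sorted_wrt (<) rs" "set rs \<subseteq> {1..<j}" using 2 by auto
    have le: "entry (bar_swaps rs j B) j \<preceq> entry B j"
      using Cons.IH(2)[OF _ Bw 2(3) rs] 2 by (simp add: B_def)
    have Bj: "entry B j = - entry D r" using entry_bar_swap[of r j D j] r by (simp add: B_def)
    have "entry D r \<in> alphabet n" "entry D j \<in> alphabet n" using 2(2) r by (auto simp: words_def subset_iff)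
    then have nz: "entry D r \<noteq> 0" "entry D j \<noteq> 0" by (simp_all add: alphabet_nonzero)
    have "- entry D j \<prec> entry D r" using 2(1) by simp
    then have "- entry D r \<prec> entry D j" using uminus_letter_less[of "entry D r" "- entry D j"] nz by simp
    then show ?case using le nz letter_less_trans unfolding bar_swaps_Cons B_def[symmetric] Bj letter_le_def by auto }
qed

lemma col_stat_values:
  assumes "col_stat n D (take (length D) C) v d" "distinct_column D"
  shows "N_col n D C = v" "des_col n D C = d"
proof -
  show "N_col n D C = v" unfolding N_col_def
    by (rule the_equality) (use assms col_stat_unique in blast)+
  show "des_col n D C = d" unfolding des_col_def
    by (rule the_equality) (use assms col_stat_unique in blast)+
qed

lemma step_sum_eq:
  assumes D: "D \<in> words n k" and j: "1 \<le> j" "j \<le> k"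
  shows "step_sum n t d j g D = (\<Sum>rs\<in>swap_rows 0 j D.
    (1 - t) ^ length rs * t ^ N_swaps n D rs j * drop_sum n t d g j (bar_swaps rs j D))"
proof -
  have l: "length D = k" using D by (simp add: words_def)
  have A: "length (take (j - 1) D) = j - 1" using l j by simp
  have "take (j - 1) D @ - (- entry D j) # drop j D = D"
    using id_take_nth_drop[of "j - 1" D] l j by simp
  moreover have "Suc (length ([] :: int list) + length (take (j - 1) D)) = j" using A j by simp
  ultimately show ?thesis
    unfolding step_sum_def using swap_sum_eq[of n t "drop_sum n t d g j" "[]" "take (j - 1) D" "- entry D j" "drop j D"]
    by simp
qed

lemma swap_rowsD:
  assumes "rs \<in> swap_rows 0 j D"
  shows "rows_above rs j" "sorted_wrt (<) rs" "distinct rs" "set rs \<subseteq> {1..<j}" "descending rs j D"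
proof -
  show s: "sorted_wrt (<) rs" "set rs \<subseteq> {1..<j}" "descending rs j D"
    using assms by (force simp: swap_rows_def)+
  then show "rows_above rs j" "distinct rs" by (auto simp: rows_above_def strict_sorted_iff)
qed

lemma swap_rowsI: "rows_above rs j \<Longrightarrow> descending rs j D \<Longrightarrow> rs \<in> swap_rows 0 j D"
  by (force simp: swap_rows_def rows_above_def)

lemma entry_bar_swaps_below:
  assumes "set rs \<subseteq> {1..<j}" "j < r" "j \<le> length D"
  shows "entry (bar_swaps rs j D) r = entry D r"
  using assms
proof (induction rs arbitrary: D)
  case (Cons q rs)
  then show ?case using entry_bar_swap[of q j D r] by (simp add: bar_swaps_Cons bar_swap_def)
qed (simp add: bar_swaps_Nil)

text \<open>A row other than \<open>j\<close> changes exactly if it is used in a swap, so the column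
  outside row \<open>j\<close> reveals the list.\<close>

lemma swap_rows_determined:
  assumes D: "D \<in> words n k" "1 \<le> j" "j \<le> k" and rs: "rs \<in> swap_rows 0 j D" "rs' \<in> swap_rows 0 j D"
    and eq: "\<And>r. r \<in> {1..k} - {j} \<Longrightarrow> entry (bar_swaps rs j D) r = entry (bar_swaps rs' j D) r"
  shows "rs = rs'"
proof -
  have l: "length D = k" using D by (simp add: words_def)
  have sub: "set rs \<subseteq> {1..k} - {j}" if "rs \<in> swap_rows 0 j D" for rs
    using swap_rowsD(4)[OF that] D by auto
  have ch: "entry (bar_swaps rs j D) r \<noteq> entry D r \<longleftrightarrow> r \<in> set rs"
    if "rs \<in> swap_rows 0 j D" "r \<in> {1..k} - {j}" for rs r
    by (rule bar_swaps_changed(1)[OF swap_rowsD(3,4)[OF that(1)] _ words_distinct_column[OF D(1)]])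
      (use that l D in simp_all)
  have "r \<in> set rs \<longleftrightarrow> r \<in> set rs'" for r
  proof (cases "r \<in> {1..k} - {j}")
    case True
    show ?thesis using ch[OF rs(1) True] ch[OF rs(2) True] eq[OF True] by simp
  next
    case False
    then show ?thesis using sub[OF rs(1)] sub[OF rs(2)] by blast
  qed
  then have "set rs = set rs'" by blast
  then show ?thesis
    using swap_rowsD(2)[OF rs(1)] swap_rowsD(2)[OF rs(2)]
    by (intro sorted_distinct_set_unique) (auto simp: strict_sorted_iff)
qed

lemma bar_swaps_stat:
  assumes D: "D \<in> words n k" "1 \<le> j" "j \<le> k" and rs: "rows_above rs j"
  shows "col_stat n D (bar_swaps rs j D) (N_swaps n D rs j) (length rs)"
proof (cases "rs = []")
  case True
  then show ?thesis using col_stat.same[of n D] by (simp add: bar_swaps_Nil N_swaps_def)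
next
  case False
  then show ?thesis using D rs by (intro col_stat.swaps) (auto simp: words_def)
qed

lemma row_le_bar_swaps:
  assumes D: "D \<in> words n k" "1 \<le> j" "j \<le> k" and rs: "rows_above rs j"
  shows "row_le D (bar_swaps rs j D) \<longleftrightarrow> descending rs j D"
proof -
  have l: "length D = k" using D by (simp add: words_def)
  have rs': "sorted_wrt (<) rs" "set rs \<subseteq> {1..<j}" using rs by (simp_all add: rows_above_def)
  note d = descending_iff[OF D(1,3) rs']
  show ?thesis
  proof
    assume "row_le D (bar_swaps rs j D)"
    then have "\<forall>r\<in>{1..<j}. entry (bar_swaps rs j D) r \<preceq> entry D r"
      using D l by (auto simp: row_le_def length_bar_swaps)
    then show "descending rs j D" using d(1) by blast
  next
    assume ds: "descending rs j D"
    show "row_le D (bar_swaps rs j D)" unfolding row_le_def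
    proof
      fix r assume "r \<in> {1..min (length D) (length (bar_swaps rs j D))}"
      consider "r < j" | "r = j" | "j < r" by linarith
      then show "entry (bar_swaps rs j D) r \<preceq> entry D r"
      proof cases
        case 1
        then show ?thesis using d(1) ds \<open>r \<in> _\<close> by auto
      next
        case 2
        then show ?thesis using d(2)[OF ds] by simp
      next
        case 3
        then show ?thesis using entry_bar_swaps_below[OF rs'(2) 3] D l by (simp add: letter_le_def)
      qed
    qed
  qed
qed

text \<open>Weakly decreasing rows select the descending lists of swaps, and a list is recovered
  from the column it produces, so the sum over columns becomes a sum over lists.\<close>

lemma primed_sum:
  assumes D: "D \<in> words n k" "1 \<le> j" "j \<le> k"
  shows "(\<Sum>C | C \<in> words n k \<and> step_primed j D C \<and> row_le D C.
      t ^ N_col n D C * (1 - t) ^ des_col n D C * g C) = step_sum n t 0 j g D"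
proof -
  have l: "length D = k" using D by (simp add: words_def)
  have bij: "bij_betw (\<lambda>rs. bar_swaps rs j D) (swap_rows 0 j D) {C. C \<in> words n k \<and> step_primed j D C \<and> row_le D C}"
    unfolding bij_betw_def
  proof
    show "inj_on (\<lambda>rs. bar_swaps rs j D) (swap_rows 0 j D)"
      by (rule inj_onI, rule swap_rows_determined[OF D]) auto
    show "(\<lambda>rs. bar_swaps rs j D) ` swap_rows 0 j D = {C. C \<in> words n k \<and> step_primed j D C \<and> row_le D C}"
    proof (intro equalityI subsetI)
      fix C assume "C \<in> (\<lambda>rs. bar_swaps rs j D) ` swap_rows 0 j D"
      then obtain rs where rs: "rs \<in> swap_rows 0 j D" "C = bar_swaps rs j D" by auto
      then show "C \<in> {C. C \<in> words n k \<and> step_primed j D C \<and> row_le D C}"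
        using swap_rowsD[OF rs(1)] bar_swaps_words[OF D(1) _ D(3)] row_le_bar_swaps[OF D]
        by (auto simp: step_primed_def)
    next
      fix C assume C: "C \<in> {C. C \<in> words n k \<and> step_primed j D C \<and> row_le D C}"
      then obtain rs where rs: "rows_above rs j" "C = bar_swaps rs j D" by (auto simp: step_primed_def)
      then have "rs \<in> swap_rows 0 j D" using C row_le_bar_swaps[OF D rs(1)] by (intro swap_rowsI) auto
      then show "C \<in> (\<lambda>rs. bar_swaps rs j D) ` swap_rows 0 j D" using rs(2) by blast
    qed
  qed
  have "(\<Sum>C | C \<in> words n k \<and> step_primed j D C \<and> row_le D C. t ^ N_col n D C * (1 - t) ^ des_col n D C * g C)
    = (\<Sum>rs\<in>swap_rows 0 j D. t ^ N_col n D (bar_swaps rs j D) * (1 - t) ^ des_col n D (bar_swaps rs j D) * g (bar_swaps rs j D))"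
    by (rule sum.reindex_bij_betw[OF bij, symmetric])
  also have "\<dots> = (\<Sum>rs\<in>swap_rows 0 j D. (1 - t) ^ length rs * t ^ N_swaps n D rs j * drop_sum n t 0 g j (bar_swaps rs j D))"
  proof (rule sum.cong[OF HOL.refl])
    fix rs assume "rs \<in> swap_rows 0 j D"
    then have "col_stat n D (bar_swaps rs j D) (N_swaps n D rs j) (length rs)"
      using bar_swaps_stat[OF D] swap_rowsD(1) by blast
    then have "col_stat n D (take (length D) (bar_swaps rs j D)) (N_swaps n D rs j) (length rs)"
      by (simp add: length_bar_swaps)
    from col_stat_values[OF this words_distinct_column[OF D(1)]]
    show "t ^ N_col n D (bar_swaps rs j D) * (1 - t) ^ des_col n D (bar_swaps rs j D) * g (bar_swaps rs j D) =
      (1 - t) ^ length rs * t ^ N_swaps n D rs j * drop_sum n t 0 g j (bar_swaps rs j D)"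
      by (simp add: drop_sum_def)
  qed
  finally show ?thesis unfolding step_sum_eq[OF D] .
qed

lemma others_iff:
  assumes D: "length D = k" "1 \<le> j" "j \<le> k"
  shows "\<bar>e\<bar> \<notin> abs ` set (take (j - 1) D @ drop j D) \<longleftrightarrow> (\<forall>r\<in>{1..k} - {j}. e \<noteq> entry D r \<and> e \<noteq> - entry D r)"
proof -
  have "set (take (j - 1) D @ drop j D) = entry D ` ({1..k} - {j})"
  proof (intro equalityI subsetI)
    fix x assume "x \<in> set (take (j - 1) D @ drop j D)"
    then consider i where "i < j - 1" "x = D ! i" | i where "i < k - j" "x = D ! (j + i)"
      using D by (fastforce simp: in_set_conv_nth)
    then show "x \<in> entry D ` ({1..k} - {j})"
    proof cases
      case 1
      then show ?thesis using D by (intro image_eqI[of _ _ "Suc i"]) auto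
    next
      case 2
      then show ?thesis using D by (intro image_eqI[of _ _ "Suc (j + i)"]) auto
    qed
  next
    fix x assume "x \<in> entry D ` ({1..k} - {j})"
    then obtain r where "x = entry D r" "r \<in> {1..k} - {j}" by (rule imageE)
    then have r: "1 \<le> r" "r \<le> k" "r \<noteq> j" "x = entry D r" by simp_all
    show "x \<in> set (take (j - 1) D @ drop j D)"
    proof (cases "r < j")
      case True
      then have "take (j - 1) D ! (r - 1) = x" "r - 1 < length (take (j - 1) D)" using r D by auto
      then show ?thesis by (metis Un_iff nth_mem set_append)
    next
      case False
      then have "drop j D ! (r - 1 - j) = x" "r - 1 - j < length (drop j D)" using r D by auto
      then show ?thesis by (metis Un_iff nth_mem set_append)
    qed
  qed
  then show ?thesis by (auto simp: image_image abs_eq_iff)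
qed

lemma letter_le_trans: "a \<preceq> b \<Longrightarrow> b \<preceq> c \<Longrightarrow> c \<noteq> 0 \<Longrightarrow> a \<preceq> c"
  unfolding letter_le_def using letter_less_trans by blast

text \<open>A column is encoded by a list of swaps, read off outside row \<open>j\<close>, and a
  final pivot, read off in row \<open>j\<close>. These two data are independent apart from the
  letters available to the pivot.\<close>

lemma unprimed_sum:
  assumes D: "D \<in> words n k" "1 \<le> j" "j \<le> k"
  shows "(\<Sum>C | C \<in> words n k \<and> step_unprimed j D C \<and> row_le D C.
      t ^ N_col n D C * (1 - t) ^ des_col n D C * g C) = step_sum n t (1 - t) j g D"
proof -
  have l: "length D = k" using D by (simp add: words_def)
  define S where "S = {C. C \<in> words n k \<and> step_unprimed j D C \<and> row_le D C}"
  define B where "B rs = bar_swaps rs j D" for rs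
  define O' where "O' rs = take (j - 1) (B rs) @ drop j (B rs)" for rs
  \<comment> \<open>The possible final pivots: the one left by the swaps, which means no drop, and
    every smaller letter whose absolute value is absent from the other rows.\<close>
  define E where "E rs = insert (entry (B rs) j) (below_set n (O' rs) (entry (B rs) j))" for rs
  define \<phi> where "\<phi> = (\<lambda>(rs, e). (B rs)[j - 1 := e])"
  have Bw: "B rs \<in> words n k" "length (B rs) = k" if "rs \<in> swap_rows 0 j D" for rs
    using bar_swaps_words[OF D(1) swap_rowsD(4)[OF that] D(3)] by (simp_all add: B_def words_def)
  have ent: "entry ((B rs)[j - 1 := e]) r = (if r = j then e else entry (B rs) r)"
    if "rs \<in> swap_rows 0 j D" "r \<in> {1..k}" for rs e r
    using Bw[OF that(1)] that(2) D by (auto simp: nth_list_update)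
  have Eiff: "e \<in> E rs \<longleftrightarrow> e \<in> alphabet n \<and> e \<preceq> entry (B rs) j \<and>
      (\<forall>r\<in>{1..k} - {j}. e \<noteq> entry (B rs) r \<and> e \<noteq> - entry (B rs) r)" if "rs \<in> swap_rows 0 j D" for rs e
  proof -
    have o: "\<bar>x\<bar> \<notin> abs ` set (O' rs) \<longleftrightarrow> (\<forall>r\<in>{1..k} - {j}. x \<noteq> entry (B rs) r \<and> x \<noteq> - entry (B rs) r)" for x
      using others_iff[OF Bw(2)[OF that] D(2,3), of x] by (simp add: O'_def)
    have "entry (B rs) j \<in> set (B rs)" using Bw[OF that] D by (intro nth_mem) auto
    then have "entry (B rs) j \<in> alphabet n" using Bw(1)[OF that] by (auto simp: words_def)
    moreover have "\<forall>r\<in>{1..k} - {j}. entry (B rs) j \<noteq> entry (B rs) r \<and> entry (B rs) j \<noteq> - entry (B rs) r"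
      using words_distinct_column[OF Bw(1)[OF that]] Bw(2)[OF that] D unfolding distinct_column_def by auto
    ultimately show ?thesis unfolding E_def below_set_def letter_le_def using o by auto
  qed
  have bij: "bij_betw \<phi> (Sigma (swap_rows 0 j D) E) S"
    unfolding bij_betw_def
  proof
    show "inj_on \<phi> (Sigma (swap_rows 0 j D) E)"
    proof (rule inj_onI, clarify)
      fix rs e rs' e'
      assume a: "rs \<in> swap_rows 0 j D" "rs' \<in> swap_rows 0 j D" "e \<in> E rs" "e' \<in> E rs'" "\<phi> (rs, e) = \<phi> (rs', e')"
      have eq: "(B rs)[j - 1 := e] = (B rs')[j - 1 := e']" using a(5) by (simp add: \<phi>_def)
      have "rs = rs'"
      proof (rule swap_rows_determined[OF D a(1,2)])
        fix r assume "r \<in> {1..k} - {j}"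
        then show "entry (bar_swaps rs j D) r = entry (bar_swaps rs' j D) r"
          using ent[OF a(1), of r e] ent[OF a(2), of r e'] eq by (simp add: B_def)
      qed
      moreover have "e = e'" using ent[OF a(1), of j e] ent[OF a(2), of j e'] eq D by simp
      ultimately show "rs = rs' \<and> e = e'" by simp
    qed
    show "\<phi> ` Sigma (swap_rows 0 j D) E = S"
    proof (intro equalityI subsetI)
      fix C assume "C \<in> \<phi> ` Sigma (swap_rows 0 j D) E"
      then obtain rs e where rs: "rs \<in> swap_rows 0 j D" "e \<in> E rs" and C: "C = (B rs)[j - 1 := e]"
        by (auto simp: \<phi>_def)
      note e = Eiff[OF rs(1), THEN iffD1, OF rs(2)]
      have lC: "length C = k" using C Bw(2)[OF rs(1)] by simp
      have Cr: "entry C r = (if r = j then e else entry (B rs) r)" if "r \<in> {1..k}" for r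
        using ent[OF rs(1) that] C by simp
      have "distinct_column C"
        unfolding distinct_column_def
      proof (intro ballI impI)
        fix r s assume r: "r \<in> {1..length C}" "s \<in> {1..length C}" "r \<noteq> s"
        have "entry (B rs) r \<noteq> entry (B rs) s \<and> entry (B rs) r \<noteq> - entry (B rs) s"
          using words_distinct_column[OF Bw(1)[OF rs(1)]] Bw(2)[OF rs(1)] r lC unfolding distinct_column_def by auto
        moreover have rk: "r \<in> {1..k}" "s \<in> {1..k}" using r lC by simp_all
        moreover have "x \<noteq> j \<Longrightarrow> x \<in> {1..k} \<Longrightarrow> e \<noteq> entry (B rs) x \<and> e \<noteq> - entry (B rs) x" for x
          using e by blast
        ultimately show "entry C r \<noteq> entry C s \<and> entry C r \<noteq> - entry C s"
          unfolding Cr[OF rk(1)] Cr[OF rk(2)] using r(3)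
          by (cases "r = j"; cases "s = j") (simp_all, metis minus_minus)
      qed
      moreover have "set C \<subseteq> insert e (set (B rs))" unfolding C by (rule set_update_subset_insert)
      then have "set C \<subseteq> alphabet n" using e Bw(1)[OF rs(1)] by (auto simp: words_def)
      ultimately have Cw: "C \<in> words n k" using lC by (intro distinct_column_words)
      have "step_unprimed j D C"
      proof -
        have tk: "take (length D) C = C" using l lC by simp
        have jk: "j \<in> {1..k}" using D by simp
        have 1: "\<forall>r\<in>{1..k} - {j}. entry C r = entry (B rs) r"
        proof
          fix r assume "r \<in> {1..k} - {j}"
          then have "r \<in> {1..k}" "r \<noteq> j" by auto
          then show "entry C r = entry (B rs) r" using Cr[of r] by simp
        qed
        have 2: "(\<forall>r\<in>{1..k} - {j}. entry C j \<noteq> entry (B rs) r \<and> entry C j \<noteq> - entry (B rs) r) \<and> entry C j \<preceq> entry (B rs) j"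
          unfolding Cr[OF jk] using e by simp
        show ?thesis
          unfolding step_unprimed_def Let_def l
          by (rule exI[of _ rs]) (use swap_rowsD(1)[OF rs(1)] 1 2 tk[unfolded l] B_def in simp)
      qed
      moreover have "row_le D C"
        unfolding row_le_def
      proof
        fix r assume "r \<in> {1..min (length D) (length C)}"
        then have r: "r \<in> {1..k}" using l lC by simp
        have "row_le D (B rs)" using row_le_bar_swaps[OF D swap_rowsD(1)[OF rs(1)]] swap_rowsD(5)[OF rs(1)] by (simp add: B_def)
        then have b: "entry (B rs) r \<preceq> entry D r" using r l Bw(2)[OF rs(1)] by (simp add: row_le_def)
        have "entry D r \<in> set D" using r l by (intro nth_mem) auto
        then have "entry D r \<noteq> 0" using D(1) by (auto simp: words_def alphabet_def)
        then show "entry C r \<preceq> entry D r"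
          unfolding Cr[OF r] using b e letter_le_trans[of e "entry (B rs) j" "entry D j"] by (cases "r = j") simp_all
      qed
      ultimately show "C \<in> S" using Cw by (simp add: S_def)
    next
      fix C assume "C \<in> S"
      then have C: "C \<in> words n k" "step_unprimed j D C" "row_le D C" by (auto simp: S_def)
      have lC: "length C = k" using C by (simp add: words_def)
      obtain rs where rs: "rows_above rs j" "\<forall>r\<in>{1..k} - {j}. entry C r = entry (B rs) r"
        "\<forall>r\<in>{1..k} - {j}. entry C j \<noteq> entry (B rs) r \<and> entry C j \<noteq> - entry (B rs) r"
        "entry C j \<preceq> entry (B rs) j"
        using C(2) unfolding step_unprimed_def Let_def B_def l lC by (auto simp: lC)
      have "\<forall>r\<in>{1..<j}. entry (B rs) r \<preceq> entry D r"
      proof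
        fix r assume r: "r \<in> {1..<j}"
        then have rr: "r \<in> {1..k} - {j}" "r \<in> {1..min (length D) (length C)}" using D l lC by auto
        have "entry C r \<preceq> entry D r" using C(3) rr(2) unfolding row_le_def by (rule bspec)
        moreover have "entry C r = entry (B rs) r" by (rule bspec[OF rs(2) rr(1)])
        ultimately show "entry (B rs) r \<preceq> entry D r" by simp
      qed
      then have sr: "rs \<in> swap_rows 0 j D"
        using descending_iff(1)[OF D(1,3), of rs] rs(1) by (intro swap_rowsI) (simp_all add: B_def rows_above_def)
      have "entry C j \<in> set C" using lC D by (intro nth_mem) auto
      then have "entry C j \<in> alphabet n" using C(1) by (auto simp: words_def)
      then have "entry C j \<in> E rs" unfolding Eiff[OF sr] using rs(3,4) by blast
      moreover have "C = (B rs)[j - 1 := entry C j]"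
      proof (rule nth_equalityI)
        show "length C = length ((B rs)[j - 1 := entry C j])" using lC Bw(2)[OF sr] by simp
        fix i assume "i < length C"
        then have i: "Suc i \<in> {1..k}" using lC by simp
        have eq: "entry C (Suc i) = (if Suc i = j then entry C j else entry (B rs) (Suc i))"
        proof (cases "Suc i = j")
          case True
          then show ?thesis by (simp only: if_True HOL.refl)
        next
          case False
          then show ?thesis using bspec[OF rs(2), of "Suc i"] i by simp
        qed
        show "C ! i = (B rs)[j - 1 := entry C j] ! i"
          using eq ent[OF sr i, of "entry C j"] by simp
      qed
      ultimately show "C \<in> \<phi> ` Sigma (swap_rows 0 j D) E"
        using sr unfolding \<phi>_def by (intro image_eqI[of _ _ "(rs, entry C j)"]) auto
    qed
  qed
  define w where "w rs = (1 - t) ^ length rs * t ^ N_swaps n D rs j" for rs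
  have val: "t ^ N_col n D ((B rs)[j - 1 := e]) * (1 - t) ^ des_col n D ((B rs)[j - 1 := e])
      = w rs * (if e = entry (B rs) j then 1 else (1 - t) * t ^ count_between e (entry (B rs) j) (drop j (B rs)))"
    if rs: "rs \<in> swap_rows 0 j D" and e: "e \<in> E rs" for rs e
  proof -
    define C where "C = (B rs)[j - 1 := e]"
    have lC: "length C = k" using Bw(2)[OF rs] by (simp add: C_def)
    note e' = Eiff[OF rs, THEN iffD1, OF e]
    have Cr: "entry C r = (if r = j then e else entry (B rs) r)" if "r \<in> {1..k}" for r
      using ent[OF rs that] C_def by simp
    have "col_stat n D C (N_swaps n D rs j + (if e = entry (B rs) j then 0 else count_between e (entry (B rs) j) (drop j (B rs))))
       (length rs + (if e = entry (B rs) j then 0 else 1))"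
    proof (cases "e = entry (B rs) j")
      case True
      then have "C = B rs" by (simp add: C_def)
      then show ?thesis using True bar_swaps_stat[OF D swap_rowsD(1)[OF rs]] by (simp add: B_def)
    next
      case False
      have jk: "j \<in> {1..k}" using D by simp
      have Cj: "entry C j = e" unfolding Cr[OF jk] by simp
      have less: "entry C j \<prec> entry (B rs) j" unfolding Cj using False e' by (auto simp: letter_le_def)
      have rk: "\<forall>r\<in>{1..length D} - {j}. entry C r = entry (B rs) r"
      proof
        fix r assume "r \<in> {1..length D} - {j}"
        then have "r \<in> {1..k}" "r \<noteq> j" using l by auto
        then show "entry C r = entry (B rs) r" using Cr[of r] by simp
      qed
      have nr: "\<forall>r\<in>{1..length D} - {j}. entry C j \<noteq> entry (B rs) r \<and> entry C j \<noteq> - entry (B rs) r"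
        unfolding Cj l using e' by blast
      have "col_stat n D C (N_swaps n D rs j + count_between (entry C j) (entry (B rs) j) (segment D (j + 1) (length D))) (length rs + 1)"
        by (rule col_stat.drop[OF swap_rowsD(1)[OF rs] D(2) _ _ _ rk nr less]) (use D l lC in \<open>simp_all add: B_def\<close>)
      moreover have "segment D (j + 1) (length D) = drop j (B rs)"
      proof (rule nth_equalityI)
        show "length (segment D (j + 1) (length D)) = length (drop j (B rs))"
          using Bw(2)[OF rs] l by (simp add: segment_def del: upt_Suc)
        fix i assume "i < length (segment D (j + 1) (length D))"
        then have i: "i < k - j" using l by (simp add: segment_def del: upt_Suc)
        have "entry (B rs) (j + 1 + i) = entry D (j + 1 + i)"
          unfolding B_def by (rule entry_bar_swaps_below[OF swap_rowsD(4)[OF rs]]) (use D l in simp_all)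
        then show "segment D (j + 1) (length D) ! i = drop j (B rs) ! i"
          using i l Bw(2)[OF rs] by (simp add: segment_def del: upt_Suc)
      qed
      ultimately show ?thesis using False unfolding Cj by simp
    qed
    then have "col_stat n D (take (length D) C) (N_swaps n D rs j + (if e = entry (B rs) j then 0 else count_between e (entry (B rs) j) (drop j (B rs))))
       (length rs + (if e = entry (B rs) j then 0 else 1))" using lC l by simp
    from col_stat_values[OF this words_distinct_column[OF D(1)]]
    show ?thesis unfolding C_def[symmetric] by (simp add: w_def power_add)
  qed
  have "(\<Sum>C\<in>S. t ^ N_col n D C * (1 - t) ^ des_col n D C * g C)
    = (\<Sum>x\<in>Sigma (swap_rows 0 j D) E. t ^ N_col n D (\<phi> x) * (1 - t) ^ des_col n D (\<phi> x) * g (\<phi> x))"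
    by (rule sum.reindex_bij_betw[OF bij, symmetric])
  also have "\<dots> = (\<Sum>(rs, e)\<in>Sigma (swap_rows 0 j D) E.
      w rs * (if e = entry (B rs) j then 1 else (1 - t) * t ^ count_between e (entry (B rs) j) (drop j (B rs))) * g ((B rs)[j - 1 := e]))"
  proof (rule sum.cong[OF HOL.refl], clarify)
    fix rs e assume "rs \<in> swap_rows 0 j D" "e \<in> E rs"
    from val[OF this] show "t ^ N_col n D (\<phi> (rs, e)) * (1 - t) ^ des_col n D (\<phi> (rs, e)) * g (\<phi> (rs, e)) =
      w rs * (if e = entry (B rs) j then 1 else (1 - t) * t ^ count_between e (entry (B rs) j) (drop j (B rs))) * g ((B rs)[j - 1 := e])"
      by (simp add: \<phi>_def)
  qed
  also have "\<dots> = (\<Sum>rs\<in>swap_rows 0 j D. \<Sum>e\<in>E rs.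
      w rs * (if e = entry (B rs) j then 1 else (1 - t) * t ^ count_between e (entry (B rs) j) (drop j (B rs))) * g ((B rs)[j - 1 := e]))"
    by (rule sum.Sigma[symmetric]) (auto simp: finite_swap_rows E_def)
  also have "\<dots> = (\<Sum>rs\<in>swap_rows 0 j D. w rs * drop_sum n t (1 - t) g j (B rs))"
  proof (rule sum.cong[OF HOL.refl])
    fix rs assume rs: "rs \<in> swap_rows 0 j D"
    have ni: "entry (B rs) j \<notin> below_set n (O' rs) (entry (B rs) j)" by (simp add: below_set_def)
    have c: "(\<Sum>e\<in>below_set n (O' rs) (entry (B rs) j).
      w rs * (if e = entry (B rs) j then 1 else (1 - t) * t ^ count_between e (entry (B rs) j) (drop j (B rs))) * g ((B rs)[j - 1 := e]))
      = (\<Sum>e\<in>below_set n (O' rs) (entry (B rs) j). w rs * ((1 - t) * (t ^ count_between e (entry (B rs) j) (drop j (B rs)) * g ((B rs)[j - 1 := e]))))"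
      by (rule sum.cong[OF HOL.refl]) (use ni in auto)
    show "(\<Sum>e\<in>E rs. w rs * (if e = entry (B rs) j then 1 else (1 - t) * t ^ count_between e (entry (B rs) j) (drop j (B rs))) * g ((B rs)[j - 1 := e]))
      = w rs * drop_sum n t (1 - t) g j (B rs)"
      unfolding E_def drop_sum_def O'_def[symmetric] sum.insert[OF finite_below_set ni] c
      by (simp add: sum_distrib_left distrib_left)
  qed
  finally show ?thesis unfolding step_sum_eq[OF D] S_def w_def B_def .
qed


section \<open>Symmetrization over the missing letters\<close>

definition free_letters :: "nat \<Rightarrow> int list \<Rightarrow> int set" where
  "free_letters n D = {e \<in> alphabet n. \<bar>e\<bar> \<notin> abs ` set D}"

text \<open>If \<open>x^alpha\<close> is \<open>y b / y a\<close>, this is the factor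
  \<open>(1 - t x^-alpha) / (1 - x^-alpha)\<close>, cleared of inverses.\<close>

definition root_factor :: "'k::field \<Rightarrow> (int \<Rightarrow> 'k) \<Rightarrow> int \<Rightarrow> int \<Rightarrow> 'k" where
  "root_factor t y a b = (y b - t * y a) / (y b - y a)"

definition position_weight :: "(nat \<Rightarrow> nat) \<Rightarrow> int list \<Rightarrow> (int \<Rightarrow> 'k::field) \<Rightarrow> 'k" where
  "position_weight \<mu> D y = (\<Prod>p = 1..length D. y (entry D p) ^ \<mu> p)"

text \<open>For \<open>r = n - length D\<close> this is the Hall-Littlewood sum restricted to the
  words that begin with \<open>D\<close>, with only those roots whose smaller index is a new
  position. The letter \<open>- e\<close> in the product accounts for the long root.\<close>

primrec partial_hl :: "nat \<Rightarrow> 'k::field \<Rightarrow> (nat \<Rightarrow> nat) \<Rightarrow> nat \<Rightarrow> int list \<Rightarrow> (int \<Rightarrow> 'k) \<Rightarrow> 'k" where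
  "partial_hl n t \<mu> 0 D y = position_weight \<mu> D y"
| "partial_hl n t \<mu> (Suc r) D y =
     (\<Sum>e\<in>free_letters n D. (\<Prod>a\<in>free_letters n D - {e}. root_factor t y a e) * partial_hl n t \<mu> r (D @ [e]) y)"

lemma finite_free_letters [simp]: "finite (free_letters n D)"
  by (simp add: free_letters_def)

lemma root_factor_reflect: "root_factor t (y \<circ> s) a b = root_factor t y (s a) (s b)"
  by (simp add: root_factor_def)

lemma free_letters_reflect:
  assumes i: "i \<in> {1..int n}"
  shows "free_letters n (map (reflect n i) D) = reflect n i ` free_letters n D"
proof (intro equalityI subsetI)
  fix x assume x: "x \<in> free_letters n (map (reflect n i) D)"
  define e where "e = reflect n i x"
  have xe: "x = reflect n i e" using i by (simp add: e_def)
  then have "e \<in> free_letters n D" using x reflect_abs_image[OF i, of e D] i by (simp add: free_letters_def)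
  then show "x \<in> reflect n i ` free_letters n D" using xe by blast
next
  fix x assume "x \<in> reflect n i ` free_letters n D"
  then obtain e where "x = reflect n i e" "e \<in> free_letters n D" by blast
  then show "x \<in> free_letters n (map (reflect n i) D)"
    using reflect_abs_image[OF i, of e D] i by (simp add: free_letters_def)
qed

lemma position_weight_reflect: "position_weight \<mu> D (y \<circ> s) = position_weight \<mu> (map s D) y"
  unfolding position_weight_def by (rule prod.cong) auto

lemma partial_hl_reflect:
  assumes i: "i \<in> {1..int n}"
  shows "partial_hl n t \<mu> r D (y \<circ> reflect n i) = partial_hl n t \<mu> r (map (reflect n i) D) y"
proof (induction r arbitrary: D)
  case 0
  show ?case unfolding partial_hl.simps by (rule position_weight_reflect)
next
  case (Suc r)
  define s where "s = reflect n i"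
  have inj: "inj s" unfolding s_def by (rule reflect_inj[OF i])
  have fr: "free_letters n (map s D) = s ` free_letters n D" unfolding s_def by (rule free_letters_reflect[OF i])
  have "partial_hl n t \<mu> (Suc r) (map s D) y = (\<Sum>e\<in>free_letters n D.
      (\<Prod>a\<in>s ` free_letters n D - {s e}. root_factor t y a (s e)) * partial_hl n t \<mu> r (map s D @ [s e]) y)"
    unfolding partial_hl.simps fr by (subst sum.reindex) (use inj in \<open>auto simp: inj_on_def\<close>)
  also have "\<dots> = (\<Sum>e\<in>free_letters n D.
      (\<Prod>a\<in>free_letters n D - {e}. root_factor t (y \<circ> s) a e) * partial_hl n t \<mu> r (D @ [e]) (y \<circ> s))"
  proof (rule sum.cong[OF HOL.refl])
    fix e
    have "s ` free_letters n D - {s e} = s ` (free_letters n D - {e})" using inj by (auto simp: inj_on_def)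
    then have "(\<Prod>a\<in>s ` free_letters n D - {s e}. root_factor t y a (s e)) = (\<Prod>a\<in>free_letters n D - {e}. root_factor t (y \<circ> s) a e)"
      unfolding root_factor_reflect
      by (simp only:, subst prod.reindex) (use inj in \<open>auto simp: inj_on_def\<close>)
    moreover have "partial_hl n t \<mu> r (D @ [e]) (y \<circ> s) = partial_hl n t \<mu> r (map s D @ [s e]) y"
      using Suc.IH[of "D @ [e]"] unfolding s_def map_append list.map .
    ultimately show "(\<Prod>a\<in>s ` free_letters n D - {s e}. root_factor t y a (s e)) * partial_hl n t \<mu> r (map s D @ [s e]) y
      = (\<Prod>a\<in>free_letters n D - {e}. root_factor t (y \<circ> s) a e) * partial_hl n t \<mu> r (D @ [e]) (y \<circ> s)"
      by (simp only:)
  qed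
  finally show ?case unfolding s_def partial_hl.simps(2) by (rule sym)
qed

lemma position_weight_mult:
  assumes "\<And>p. 1 \<le> p \<Longrightarrow> \<mu>' p = \<mu> p + (if p \<le> k then 1 else 0)" "k \<le> length D"
  shows "position_weight \<mu>' D y = (\<Prod>p = 1..k. y (entry D p)) * position_weight \<mu> D y"
proof -
  have "position_weight \<mu>' D y = (\<Prod>p = 1..length D. (if p \<le> k then y (entry D p) else 1) * y (entry D p) ^ \<mu> p)"
    unfolding position_weight_def by (rule prod.cong) (use assms(1) in auto)
  also have "\<dots> = (\<Prod>p = 1..length D. if p \<le> k then y (entry D p) else 1) * position_weight \<mu> D y"
    by (simp add: prod.distrib position_weight_def)
  also have "(\<Prod>p = 1..length D. if p \<le> k then y (entry D p) else 1) = (\<Prod>p = 1..k. y (entry D p))"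
    by (rule prod.mono_neutral_cong_right) (use assms(2) in auto)
  finally show ?thesis .
qed

text \<open>The first \<open>k\<close> letters are common to all completions of \<open>D\<close>, so
  their weight comes out of the sum. This is the effect of a block of height \<open>k\<close> at
  \<open>id_word k\<close>.\<close>

lemma partial_hl_mult:
  assumes \<mu>: "\<And>p. 1 \<le> p \<Longrightarrow> \<mu>' p = \<mu> p + (if p \<le> k then 1 else 0)" and k: "k \<le> length D"
  shows "partial_hl n t \<mu>' r D y = (\<Prod>p = 1..k. y (entry D p)) * partial_hl n t \<mu> r D y"
  using k
proof (induction r arbitrary: D)
  case 0
  then show ?case using position_weight_mult[OF \<mu>] by simp
next
  case (Suc r)
  have e: "(\<Prod>p = 1..k. y (entry (D @ [e]) p)) = (\<Prod>p = 1..k. y (entry D p))" for e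
    by (rule prod.cong) (use Suc.prems in \<open>auto simp: nth_append\<close>)
  have "partial_hl n t \<mu>' r (D @ [e]) y = (\<Prod>p = 1..k. y (entry D p)) * partial_hl n t \<mu> r (D @ [e]) y" for e
    using Suc.IH[of "D @ [e]"] Suc.prems e by simp
  then show ?case by (simp add: sum_distrib_left algebra_simps)
qed

text \<open>The operator depends only on the ratio of \<open>y i\<close> to its reflected value, and
  every ascending moved letter \<open>m\<close> has the same ratio: for \<open>m = - (i + 1)\<close>
  numerator and denominator are inverted and also exchanged.\<close>

lemma dl_op_letter:
  assumes i: "i \<in> {1..int n}" and y: "generic n y" and m: "m \<in> alphabet n" "m \<prec> reflect n i m"
  shows "dl_op n t i g y = (1 - t) * y (reflect n i m) / (y m - y (reflect n i m)) * g y
     + root_factor t y m (reflect n i m) * g (y \<circ> reflect n i)"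
proof -
  define Y Z where "Y = y i" and "Z = y (reflect n i i)"
  have YZ: "Y \<noteq> Z" "Y \<noteq> 0" "Z \<noteq> 0" using generic_neq[OF i y] by (auto simp: Y_def Z_def)
  have ia: "i \<in> alphabet n" "reflect n i i \<in> alphabet n" using i by (simp_all add: alphabet_def del: reflect_alphabet) (auto simp: reflect_def)
  have ne: "reflect n i m \<noteq> m" using m by auto
  have dl: "dl_op n t i g y = ((1 - t) * Z * g y + (t * Y - Z) * g (y \<circ> reflect n i)) / (Y - Z)"
    by (simp add: dl_op_def Y_def Z_def)
  show ?thesis
    using i ne
  proof (cases rule: moved_letter_cases)
    case pos
    have "y m = Y" "y (reflect n i m) = Z" using pos by (simp_all add: Y_def Z_def)
    moreover have "(Z - t * Y) / (Z - Y) = (t * Y - Z) / (Y - Z)"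
      by (metis minus_diff_eq minus_divide_divide)
    ultimately show ?thesis unfolding dl root_factor_def by (simp add: add_divide_distrib)
  next
    case neg
    then show ?thesis using m(2) letter_less_asym by blast
  next
    case pos'
    then show ?thesis using m(2) letter_less_asym by blast
  next
    case neg'
    have "m = - reflect n i i" using neg' by simp
    then have ym: "y m = inverse Z" "y (reflect n i m) = inverse Y"
      using neg' generic_uminus[OF y ia(1)] generic_uminus[OF y ia(2)] by (simp_all add: Y_def Z_def)
    have d: "inverse Z - inverse Y = (Y - Z) / (Y * Z)" "inverse Y - inverse Z = (Z - Y) / (Y * Z)"
      "inverse Y - t * inverse Z = (Z - t * Y) / (Y * Z)"
      using YZ by (simp_all add: field_simps)
    have "(1 - t) * inverse Y / (inverse Z - inverse Y) = (1 - t) * Z / (Y - Z)"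
      unfolding d using YZ by simp
    moreover have "(inverse Y - t * inverse Z) / (inverse Y - inverse Z) = (t * Y - Z) / (Y - Z)"
    proof -
      have "(inverse Y - t * inverse Z) / (inverse Y - inverse Z) = (Z - t * Y) / (Z - Y)"
        unfolding d using YZ by simp
      also have "\<dots> = (t * Y - Z) / (Y - Z)" by (metis minus_diff_eq minus_divide_divide)
      finally show ?thesis .
    qed
    ultimately show ?thesis unfolding dl root_factor_def ym by (simp add: add_divide_distrib)
  qed
qed

text \<open>The identity on which the step of \<open>equivariant_partial_sums\<close> rests. The
  left side collects the coefficients of the term of \<open>b\<close> before the segment is
  enlarged, the right side is its new pair of factors.\<close>

lemma root_factor_exchange:
  assumes "y p \<noteq> y m" "y b \<noteq> y p" "y b \<noteq> y m"
  shows "root_factor t y p b + (1 - t) * y m / (y p - y m) * (root_factor t y p b - 1)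
     + root_factor t y p m * (root_factor t y m b - 1) = root_factor t y p b * root_factor t y m b"
    and "1 + (1 - t) * y m / (y p - y m) = root_factor t y m p"
proof -
  have n: "y p - y m \<noteq> 0" "y m - y p \<noteq> 0" "y b - y p \<noteq> 0" "y b - y m \<noteq> 0" using assms by auto
  have e: "root_factor t y p b - 1 = (1 - t) * y p / (y b - y p)" "root_factor t y m b - 1 = (1 - t) * y m / (y b - y m)"
    using n by (simp_all add: root_factor_def field_simps)
  show "1 + (1 - t) * y m / (y p - y m) = root_factor t y m p"
    using n by (simp add: root_factor_def field_simps)
  show "root_factor t y p b + (1 - t) * y m / (y p - y m) * (root_factor t y p b - 1)
     + root_factor t y p m * (root_factor t y m b - 1) = root_factor t y p b * root_factor t y m b"
  proof -
    define P M B where "P = y p" and "M = y m" and "B = y b"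
    have n': "P - M \<noteq> 0" "M - P \<noteq> 0" "B - P \<noteq> 0" "B - M \<noteq> 0" using n by (simp_all add: P_def M_def B_def)
    have "(B - t * P) / (B - P) + (1 - t) * M / (P - M) * ((1 - t) * P / (B - P))
       + (M - t * P) / (M - P) * ((1 - t) * M / (B - M)) = (B - t * P) / (B - P) * ((B - t * M) / (B - M))"
      using n' by (simp add: divide_simps) (simp add: algebra_simps)
    then show ?thesis unfolding e by (simp add: root_factor_def P_def M_def B_def)
  qed
qed

lemma free_letters_id_word: "free_letters n (id_word k) = {e \<in> alphabet n. int k < \<bar>e\<bar>}"
  by (auto simp: free_letters_def set_id_word image_iff alphabet_def)

lemma below_set_id_word: "below_set n (id_word k) m = {e \<in> free_letters n (id_word k). e \<prec> m}"
  by (auto simp: below_set_def free_letters_def)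

lemma reflect_id_word:
  assumes "int k < i" "i \<in> {1..int n}"
  shows "map (reflect n i) (id_word k) = id_word k"
  by (rule map_idI) (use assms in \<open>auto simp: set_id_word reflect_def\<close>)

text \<open>The letters \<open>k + 1, ..., n, - n, ..., - (k + 1)\<close> form a chain in the order
  of the alphabet, and neighbours in it are exchanged by a simple reflection that fixes
  \<open>1, ..., k\<close>.\<close>

lemma free_letter_predecessor:
  assumes m: "m \<in> free_letters n (id_word k)" and ne: "m \<noteq> int (Suc k)"
  obtains i where "i \<in> {1..int n}" "int k < i" "reflect n i m \<prec> m" "reflect n i m \<in> free_letters n (id_word k)"
proof -
  have m': "m \<noteq> 0" "\<bar>m\<bar> \<le> int n" "int k < \<bar>m\<bar>" using m by (auto simp: free_letters_id_word alphabet_def)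
  show thesis
  proof (cases "0 < m")
    case True
    have r: "reflect n (m - 1) m = m - 1" using True m' by (simp add: reflect_def)
    show thesis
      by (rule that[of "m - 1"]) (use True m' ne in \<open>auto simp: r free_letters_id_word alphabet_def letter_less_def\<close>)
  next
    case False
    then have i: "- m \<in> {1..int n}" using m' by auto
    have r: "reflect n (- m) m = (if - m = int n then - m else m - 1)" using False m' by (auto simp: reflect_def)
    show thesis
      by (rule that[of "- m"]) (use False m' i in \<open>auto simp: r free_letters_id_word alphabet_def letter_less_def\<close>)
  qed
qed

definition factor_prod :: "'k::field \<Rightarrow> (int \<Rightarrow> 'k) \<Rightarrow> int set \<Rightarrow> int \<Rightarrow> 'k" where
  "factor_prod t y B b = (\<Prod>a\<in>B - {b}. root_factor t y a b)"

lemma factor_prod_insert: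
  assumes "finite B" "a \<notin> B"
  shows "factor_prod t y (insert a B) b = (if a = b then 1 else root_factor t y a b) * factor_prod t y B b"
proof (cases "a = b")
  case False
  then have "insert a B - {b} = insert a (B - {b})" "a \<notin> B - {b}" using assms by auto
  then show ?thesis using False assms by (simp add: factor_prod_def)
qed (use assms in \<open>simp add: factor_prod_def insert_Diff_if\<close>)

lemma factor_prod_reflect:
  assumes "inj s" "\<And>a. a \<in> B \<Longrightarrow> s a \<in> B" "\<And>a. s (s a) = a"
  shows "factor_prod t (y \<circ> s) B b = factor_prod t y B (s b)"
proof -
  have "s a = b \<longleftrightarrow> a = s b" for a using assms(3) by metis
  then show ?thesis unfolding factor_prod_def root_factor_reflect
    by (intro prod.reindex_bij_witness[of _ s s]) (use assms in \<open>auto dest: injD[OF assms(1)]\<close>)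
qed

text \<open>
  Summing the missing letters up in the order of the alphabet, each new letter is the image of an
  earlier one under a simple reflection fixing \<open>id_word k\<close>, and equivariance expresses the longer
  partial sum through the Demazure--Lusztig operator applied to the shorter ones.
\<close>

lemma equivariant_partial_sums:
  assumes k: "k < n" and F: "equivariant n t (Suc k) F"
    and base: "\<And>y. generic n y \<Longrightarrow> F (id_word (Suc k)) y = partial_hl n t \<mu> r (id_word (Suc k)) y"
    and m: "m \<in> free_letters n (id_word k)"
  defines "Q \<equiv> \<lambda>B. \<forall>y. generic n y \<longrightarrow> (\<Sum>a\<in>B. F (id_word k @ [a]) y) =
      (\<Sum>b\<in>B. factor_prod t y B b * partial_hl n t \<mu> r (id_word k @ [b]) y)"
  shows "Q (below_set n (id_word k) m) \<and> Q (insert m (below_set n (id_word k) m))"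
  using m
proof (induction "card (below_set n (id_word k) m)" arbitrary: m rule: less_induct)
  case less
  show ?case
  proof (cases "m = int (Suc k)")
    case True
    have "below_set n (id_word k) m = {}"
      by (auto simp: below_set_id_word free_letters_id_word True letter_less_def)
    then show ?thesis using base by (simp add: Q_def factor_prod_def True id_word_Suc)
  next
    case False
    obtain i where i: "i \<in> {1..int n}" "int k < i" "reflect n i m \<prec> m" "reflect n i m \<in> free_letters n (id_word k)"
      using free_letter_predecessor[OF less.prems False] .
    define s where "s = reflect n i"
    define p where "p = s m"
    define B where "B = below_set n (id_word k) p"
    have ss: "s (s a) = a" for a using i by (simp add: s_def)
    have sp: "s p = m" by (simp add: p_def ss)
    have fid: "map s (id_word k) = id_word k" unfolding s_def by (rule reflect_id_word[OF i(2,1)])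
    have pa: "p \<in> alphabet n" "\<bar>p\<bar> \<notin> abs ` set (id_word k)" "p \<prec> s p" "p \<in> free_letters n (id_word k)"
      using i(3,4) by (simp_all add: free_letters_def p_def s_def[symmetric] ss)
    have ma: "m \<in> alphabet n" using less.prems by (simp add: free_letters_def)
    have Bm: "below_set n (id_word k) m = insert p B" "p \<notin> B"
      using below_set_reflect_step[OF i(1) pa(1) _ pa(2)] pa(3) fid sp by (simp_all add: B_def s_def)
    have stB: "s a \<in> B" if "a \<in> B" for a
      using below_set_stable[OF i(1) pa(1) _ _ that[unfolded B_def]] pa(3) fid by (simp add: B_def s_def)
    have finB: "finite B" by (simp add: B_def)
    have mB: "m \<notin> insert p B" "m \<noteq> p" using Bm(1)[symmetric] pa(3) sp by (auto simp: below_set_def)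
    have "card B < card (below_set n (id_word k) m)" unfolding Bm(1) using finB Bm(2) by simp
    then have IH: "Q B" "Q (insert p B)"
      using less.hyps[of p] pa(4) by (simp_all add: B_def)
    have Bal: "b \<in> alphabet n" if "b \<in> B" for b using that by (simp add: B_def below_set_def)
    define H where "H y b = partial_hl n t \<mu> r (id_word k @ [b]) y" for y b
    define U where "U y b = factor_prod t y B b" for y b
    have Hs: "H (y \<circ> s) b = H y (s b)" for y b
      unfolding H_def s_def partial_hl_reflect[OF i(1)] by (simp add: fid[unfolded s_def])
    have Us: "U (y \<circ> s) b = U y (s b)" for y b
      unfolding U_def by (rule factor_prod_reflect) (use stB ss reflect_inj[OF i(1)] in \<open>auto simp: s_def\<close>)
    have reindex: "(\<Sum>b\<in>B. f (s b)) = (\<Sum>b\<in>B. f b)" for f :: "int \<Rightarrow> 'a"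
      by (rule sum.reindex_bij_witness[of _ s s]) (use stB ss in auto)
    have "Q (insert m (insert p B))"
      unfolding Q_def
    proof (intro allI impI)
      fix y :: "int \<Rightarrow> 'a" assume y: "generic n y"
      have ys: "generic n (y \<circ> s)" unfolding s_def by (rule generic_reflect[OF i(1) y])
      have S0: "(\<Sum>a\<in>B. F (id_word k @ [a]) y) = (\<Sum>b\<in>B. U y b * H y b)" if "generic n y" for y
        using IH(1) that by (simp add: Q_def U_def H_def)
      have S1: "F (id_word k @ [p]) y + (\<Sum>a\<in>B. F (id_word k @ [a]) y)
          = U y p * H y p + (\<Sum>b\<in>B. root_factor t y p b * (U y b * H y b))" if "generic n y" for y
      proof -
        have "(\<Sum>b\<in>B. factor_prod t y (insert p B) b * H y b) = (\<Sum>b\<in>B. root_factor t y p b * (U y b * H y b))"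
          by (rule sum.cong) (use Bm(2) finB in \<open>auto simp: factor_prod_insert U_def\<close>)
        then show ?thesis using IH(2) that finB Bm(2)
          by (simp add: Q_def factor_prod_insert U_def H_def)
      qed
      \<comment> \<open>The induction controls the partial sums with and without \<open>p\<close>;
        their difference is the single value at \<open>p\<close>.\<close>
      have Fp: "F (id_word k @ [p]) y = U y p * H y p + (\<Sum>b\<in>B. (root_factor t y p b - 1) * (U y b * H y b))" if "generic n y" for y
        using S1[OF that] S0[OF that] by (simp add: left_diff_distrib sum_subtractf algebra_simps)
      \<comment> \<open>The reflection permutes \<open>B\<close> and sends \<open>p\<close> to
        \<open>m\<close>, so at the reflected point the formula for \<open>p\<close> turns into one
        with \<open>m\<close> in its place.\<close>
      have Fps: "F (id_word k @ [p]) (y \<circ> s) = U y m * H y m + (\<Sum>b\<in>B. (root_factor t y m b - 1) * (U y b * H y b))"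
        unfolding Fp[OF ys] Us Hs sp root_factor_reflect
        using reindex[of "\<lambda>b. (root_factor t y m b - 1) * (U y b * H y b)"] by simp
      have wp: "id_word k @ [p] \<in> words n (Suc k)" using id_word_words[of k n] k pa by (simp add: words_snoc)
      have mv: "moved n i (id_word k) = []" using fid unfolding s_def moved_def
        by (auto simp: filter_empty_conv map_idI dest!: map_eq_conv[THEN iffD1, of _ _ id, simplified])
      have "left_act n t i (\<lambda>w. F w y) (id_word k @ [p]) = F (id_word k @ [m]) y"
        using pa(3) sp fid mv by (auto simp: left_act_moved moved_Cons s_def)
      then have "F (id_word k @ [m]) y = dl_op n t i (F (id_word k @ [p])) y"
        using F wp i(1) y by (simp add: equivariant_def)
      also have "\<dots> = (1 - t) * y m / (y p - y m) * F (id_word k @ [p]) y + root_factor t y p m * F (id_word k @ [p]) (y \<circ> s)"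
        using dl_op_letter[OF i(1) y pa(1), of t "F (id_word k @ [p])"] pa(3) sp by (simp add: s_def)
      finally have Fm: "F (id_word k @ [m]) y = \<dots>" .
      have dist: "y p \<noteq> y m" "\<And>b. b \<in> B \<Longrightarrow> y b \<noteq> y p" "\<And>b. b \<in> B \<Longrightarrow> y b \<noteq> y m"
        using y pa(1) ma Bal mB Bm(2) by (auto simp: generic_def inj_on_def)
      have coef: "(\<Sum>b\<in>B. root_factor t y p b * root_factor t y m b * (U y b * H y b)) =
         (\<Sum>b\<in>B. root_factor t y p b * (U y b * H y b))
         + (1 - t) * y m / (y p - y m) * (\<Sum>b\<in>B. (root_factor t y p b - 1) * (U y b * H y b))
         + root_factor t y p m * (\<Sum>b\<in>B. (root_factor t y m b - 1) * (U y b * H y b))"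
        unfolding sum_distrib_left sum.distrib[symmetric]
      proof (rule sum.cong[OF HOL.refl])
        fix b assume b: "b \<in> B"
        show "root_factor t y p b * root_factor t y m b * (U y b * H y b) = root_factor t y p b * (U y b * H y b)
           + (1 - t) * y m / (y p - y m) * ((root_factor t y p b - 1) * (U y b * H y b))
           + root_factor t y p m * ((root_factor t y m b - 1) * (U y b * H y b))"
          unfolding root_factor_exchange(1)[of y p m b t, OF dist(1) dist(2)[OF b] dist(3)[OF b], symmetric]
          by (simp only: distrib_right mult.assoc)
      qed
      have "(\<Sum>a\<in>insert m (insert p B). F (id_word k @ [a]) y)
          = F (id_word k @ [m]) y + (F (id_word k @ [p]) y + (\<Sum>a\<in>B. F (id_word k @ [a]) y))"
        using finB Bm(2) mB by simp
      also have "\<dots> = root_factor t y p m * (U y m * H y m) + (1 + (1 - t) * y m / (y p - y m)) * (U y p * H y p)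
          + (\<Sum>b\<in>B. root_factor t y p b * root_factor t y m b * (U y b * H y b))"
        unfolding S1[OF y] unfolding Fm Fp[OF y] Fps coef by (simp only: distrib_left distrib_right mult_1 add_ac)
      also have "1 + (1 - t) * y m / (y p - y m) = root_factor t y m p"
        using root_factor_exchange(2)[of y p m m t] dist(1) by (simp add: root_factor_def) (simp add: field_simps)
      also have "root_factor t y p m * (U y m * H y m) + root_factor t y m p * (U y p * H y p)
          + (\<Sum>b\<in>B. root_factor t y p b * root_factor t y m b * (U y b * H y b))
          = (\<Sum>b\<in>insert m (insert p B). factor_prod t y (insert m (insert p B)) b * H y b)"
      proof -
        have "(\<Sum>b\<in>B. factor_prod t y (insert m (insert p B)) b * H y b)
          = (\<Sum>b\<in>B. root_factor t y p b * root_factor t y m b * (U y b * H y b))"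
          by (rule sum.cong) (use Bm(2) finB mB in \<open>auto simp: factor_prod_insert U_def\<close>)
        then show ?thesis using finB Bm(2) mB by (simp add: factor_prod_insert U_def)
      qed
      finally show "(\<Sum>a\<in>insert m (insert p B). F (id_word k @ [a]) y) =
        (\<Sum>b\<in>insert m (insert p B). factor_prod t y (insert m (insert p B)) b * partial_hl n t \<mu> r (id_word k @ [b]) y)"
        by (simp add: H_def)
    qed
    then show ?thesis using IH(2) unfolding Bm(1) by blast
  qed
qed

lemma extend_op_id_word:
  assumes k: "k < n" and F: "equivariant n t (Suc k) F"
    and base: "\<And>y. generic n y \<Longrightarrow> F (id_word (Suc k)) y = partial_hl n t \<mu> r (id_word (Suc k)) y"
    and y: "generic n y"
  shows "extend_op n (\<lambda>w. F w y) (id_word k) = partial_hl n t \<mu> (Suc r) (id_word k) y"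
proof -
  \<comment> \<open>This is the largest free letter, so its closed initial segment consists of all
    free letters.\<close>
  define m where "m = - int (Suc k)"
  have m: "m \<in> free_letters n (id_word k)" using k by (simp add: m_def free_letters_id_word alphabet_def)
  have "insert m (below_set n (id_word k) m) = free_letters n (id_word k)"
    using m by (auto simp: below_set_id_word) (auto simp: free_letters_id_word letter_less_def m_def alphabet_def)
  then have "(\<Sum>a\<in>free_letters n (id_word k). F (id_word k @ [a]) y) =
      (\<Sum>b\<in>free_letters n (id_word k). factor_prod t y (free_letters n (id_word k)) b * partial_hl n t \<mu> r (id_word k @ [b]) y)"
    using equivariant_partial_sums[OF k F base m] y by simp
  then show ?thesis by (simp add: extend_op_def factor_prod_def flip: free_letters_def)
qed


section \<open>Sums over fillings\<close>

text \<open>Fillings built column by column from the left, with rows compared only between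
  neighbours; \<open>fillings_eq_fill_set\<close> justifies this.\<close>

fun fill_set :: "nat \<Rightarrow> (label \<Rightarrow> nat) \<Rightarrow> label list \<Rightarrow> int list list set" where
  "fill_set n h [] = {[]}"
| "fill_set n h [l] = (\<lambda>C. [C]) ` words n (h l)"
| "fill_set n h (l # l' # ls) = {C # \<sigma> | C \<sigma>. C \<in> words n (h l) \<and> \<sigma> \<in> fill_set n h (l' # ls) \<and>
     step_ok l C (hd \<sigma>) \<and> row_le C (hd \<sigma>)}"

lemma fill_set_iff:
  "\<sigma> \<in> fill_set n h ls \<longleftrightarrow> length \<sigma> = length ls \<and> (\<forall>q<length \<sigma>. \<sigma> ! q \<in> words n (h (ls ! q))) \<and>
     (\<forall>q. q + 1 < length \<sigma> \<longrightarrow> step_ok (ls ! q) (\<sigma> ! q) (\<sigma> ! (q + 1)) \<and> row_le (\<sigma> ! q) (\<sigma> ! (q + 1)))"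
proof (induction n h ls arbitrary: \<sigma> rule: fill_set.induct[case_names Nil one more])
  case (one n h l)
  show ?case
  proof (cases \<sigma>)
    case (Cons C \<tau>)
    show ?thesis
    proof (cases \<tau>)
      case Nil
      have 1: "[C] \<in> fill_set n h [l] \<longleftrightarrow> C \<in> words n (h l)" by (simp add: image_iff)
      have 2: "(\<forall>q<length [C]. [C] ! q \<in> words n (h ([l] ! q))) \<longleftrightarrow> C \<in> words n (h l)" by simp
      show ?thesis unfolding Cons Nil 1 2 by simp
    next
      case (Cons b \<tau>')
      have "C # b # \<tau>' \<notin> fill_set n h [l]" by (simp add: image_iff)
      then show ?thesis unfolding \<open>\<sigma> = C # \<tau>\<close> Cons by (simp only: list.size) simp
    qed
  next
    case Nil
    have "[] \<notin> fill_set n h [l]" by (simp add: image_iff)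
    then show ?thesis unfolding Nil by (simp only: list.size) simp
  qed
next
  case (more n h l l' ls)
  show ?case
  proof (cases \<sigma>)
    case Nil then show ?thesis by simp
  next
    case (Cons C \<sigma>')
    show ?thesis
    proof (cases \<sigma>')
      case Nil
      have "[] \<notin> fill_set n h (l' # ls)" unfolding more.IH by simp
      then have "[C] \<notin> fill_set n h (l # l' # ls)" by simp
      then show ?thesis unfolding Cons Nil by (simp only: list.size) simp
    next
      case (Cons C' \<sigma>'')
      have hd: "hd \<sigma>' = \<sigma> ! 1" using Cons \<open>\<sigma> = C # \<sigma>'\<close> by simp
      have 1: "(\<forall>q<length \<sigma>. \<sigma> ! q \<in> words n (h ((l # l' # ls) ! q))) \<longleftrightarrow>
        C \<in> words n (h l) \<and> (\<forall>q<length \<sigma>'. \<sigma>' ! q \<in> words n (h ((l' # ls) ! q)))"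
        by (simp add: \<open>\<sigma> = C # \<sigma>'\<close> All_less_Suc2)
      have 2: "(\<forall>q. q + 1 < length \<sigma> \<longrightarrow> P ((l # l' # ls) ! q) (\<sigma> ! q) (\<sigma> ! (q + 1))) \<longleftrightarrow>
        P l C (hd \<sigma>') \<and> (\<forall>q. q + 1 < length \<sigma>' \<longrightarrow> P ((l' # ls) ! q) (\<sigma>' ! q) (\<sigma>' ! (q + 1)))" for P
      proof
        assume a: "\<forall>q. q + 1 < length \<sigma> \<longrightarrow> P ((l # l' # ls) ! q) (\<sigma> ! q) (\<sigma> ! (q + 1))"
        have "P l C (hd \<sigma>')" using a[rule_format, of 0] \<open>\<sigma> = C # \<sigma>'\<close> Cons by simp
        moreover have "P ((l' # ls) ! q) (\<sigma>' ! q) (\<sigma>' ! (q + 1))" if "q + 1 < length \<sigma>'" for q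
          using a[rule_format, of "Suc q"] that \<open>\<sigma> = C # \<sigma>'\<close> by simp
        ultimately show "P l C (hd \<sigma>') \<and> (\<forall>q. q + 1 < length \<sigma>' \<longrightarrow> P ((l' # ls) ! q) (\<sigma>' ! q) (\<sigma>' ! (q + 1)))" by blast
      next
        assume a: "P l C (hd \<sigma>') \<and> (\<forall>q. q + 1 < length \<sigma>' \<longrightarrow> P ((l' # ls) ! q) (\<sigma>' ! q) (\<sigma>' ! (q + 1)))"
        show "\<forall>q. q + 1 < length \<sigma> \<longrightarrow> P ((l # l' # ls) ! q) (\<sigma> ! q) (\<sigma> ! (q + 1))"
        proof (intro allI impI)
          fix q assume "q + 1 < length \<sigma>"
          then show "P ((l # l' # ls) ! q) (\<sigma> ! q) (\<sigma> ! (q + 1))"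
            using a \<open>\<sigma> = C # \<sigma>'\<close> Cons by (cases q) auto
        qed
      qed
      have "\<sigma> \<in> fill_set n h (l # l' # ls) \<longleftrightarrow> C \<in> words n (h l) \<and> \<sigma>' \<in> fill_set n h (l' # ls) \<and> step_ok l C (hd \<sigma>') \<and> row_le C (hd \<sigma>')"
        unfolding \<open>\<sigma> = C # \<sigma>'\<close> fill_set.simps by blast
      also have "\<dots> \<longleftrightarrow> length \<sigma> = length (l # l' # ls) \<and> (\<forall>q<length \<sigma>. \<sigma> ! q \<in> words n (h ((l # l' # ls) ! q))) \<and>
         (\<forall>q. q + 1 < length \<sigma> \<longrightarrow> step_ok ((l # l' # ls) ! q) (\<sigma> ! q) (\<sigma> ! (q + 1)) \<and> row_le (\<sigma> ! q) (\<sigma> ! (q + 1)))"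
      proof -
        have len: "length \<sigma> = length (l # l' # ls) \<longleftrightarrow> length \<sigma>' = length (l' # ls)" using \<open>\<sigma> = C # \<sigma>'\<close> by simp
        show ?thesis unfolding more.IH 1 len 2[of "\<lambda>l C C'. step_ok l C C' \<and> row_le C C'"] by blast
      qed
      finally show ?thesis .
    qed
  qed
next
  case (Nil n h)
  show ?case
  proof (cases \<sigma>)
    case (Cons C \<tau>)
    then show ?thesis by (simp only: list.size fill_set.simps) simp
  qed simp
qed

lemma finite_fill_set: "finite (fill_set n h ls)"
proof (induction n h ls rule: fill_set.induct)
  case (3 n h l l' ls)
  have "fill_set n h (l # l' # ls) \<subseteq> (\<lambda>(C, \<sigma>). C # \<sigma>) ` (words n (h l) \<times> fill_set n h (l' # ls))" by auto
  then show ?case by (rule finite_subset) (simp add: 3)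
qed auto

text \<open>The transfer recursion: the total weight of the fillings of the given labels whose first
  column is \<open>C\<close>; see \<open>sum_fill_set_hd\<close>.\<close>

fun column_sum :: "nat \<Rightarrow> 'k::field \<Rightarrow> (label \<Rightarrow> nat) \<Rightarrow> (label \<Rightarrow> int list \<Rightarrow> 'k) \<Rightarrow> label list \<Rightarrow> int list \<Rightarrow> 'k" where
  "column_sum n t h x [] C = 1"
| "column_sum n t h x [l] C = x l C * t ^ inversions C"
| "column_sum n t h x (l # l' # ls) C = x l C *
     (\<Sum>C' | C' \<in> words n (h l') \<and> step_ok l C C' \<and> row_le C C'.
        t ^ N_col n C C' * (1 - t) ^ des_col n C C' * column_sum n t h x (l' # ls) C')"

definition fill_weight :: "nat \<Rightarrow> 'k::field \<Rightarrow> (label \<Rightarrow> int list \<Rightarrow> 'k) \<Rightarrow> label list \<Rightarrow> int list list \<Rightarrow> 'k" where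
  "fill_weight n t x ls \<sigma> = t ^ N_fill n \<sigma> * (1 - t) ^ des_fill n \<sigma> * prod_list (map2 x ls \<sigma>)"

lemma N_fill_Cons: "\<sigma> \<noteq> [] \<Longrightarrow> N_fill n (C # \<sigma>) = N_col n C (hd \<sigma>) + N_fill n \<sigma>"
  and des_fill_Cons: "\<sigma> \<noteq> [] \<Longrightarrow> des_fill n (C # \<sigma>) = des_col n C (hd \<sigma>) + des_fill n \<sigma>"
  by (cases \<sigma>; simp add: N_fill_def des_fill_def sum.lessThan_Suc_shift del: sum.lessThan_Suc)+

lemma fill_set_hd: "\<sigma> \<in> fill_set n h (l # ls) \<Longrightarrow> \<sigma> \<noteq> [] \<and> hd \<sigma> \<in> words n (h l)"
  by (cases ls) auto

lemma sum_fill_set_hd: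
  assumes "C \<in> words n (h (hd ls))" "ls \<noteq> []"
  shows "(\<Sum>\<sigma> | \<sigma> \<in> fill_set n h ls \<and> hd \<sigma> = C. fill_weight n t x ls \<sigma>) = column_sum n t h x ls C"
  using assms
proof (induction n h ls arbitrary: C rule: fill_set.induct[case_names Nil one more])
  case (one n h l)
  have "{\<sigma>. \<sigma> \<in> fill_set n h [l] \<and> hd \<sigma> = C} = {[C]}" using one.prems by auto
  then show ?case by (simp add: fill_weight_def N_fill_def des_fill_def)
next
  case (more n h l l' ls)
  define S where "S = {\<sigma> \<in> fill_set n h (l' # ls). step_ok l C (hd \<sigma>) \<and> row_le C (hd \<sigma>)}"
  define T where "T = {C' \<in> words n (h l'). step_ok l C C' \<and> row_le C C'}"
  have "{\<sigma>. \<sigma> \<in> fill_set n h (l # l' # ls) \<and> hd \<sigma> = C} = (#) C ` S"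
    using more.prems by (auto simp: S_def)
  then have "(\<Sum>\<sigma> | \<sigma> \<in> fill_set n h (l # l' # ls) \<and> hd \<sigma> = C. fill_weight n t x (l # l' # ls) \<sigma>)
      = (\<Sum>\<sigma>\<in>S. fill_weight n t x (l # l' # ls) (C # \<sigma>))"
    by (simp add: sum.reindex inj_on_def)
  also have "\<dots> = (\<Sum>\<sigma>\<in>S. x l C * (t ^ N_col n C (hd \<sigma>) * (1 - t) ^ des_col n C (hd \<sigma>) * fill_weight n t x (l' # ls) \<sigma>))"
  proof (rule sum.cong[OF HOL.refl])
    fix \<sigma> assume "\<sigma> \<in> S"
    then have "\<sigma> \<noteq> []" using fill_set_hd[of \<sigma> n h l' ls] by (auto simp: S_def)
    then show "fill_weight n t x (l # l' # ls) (C # \<sigma>) =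
        x l C * (t ^ N_col n C (hd \<sigma>) * (1 - t) ^ des_col n C (hd \<sigma>) * fill_weight n t x (l' # ls) \<sigma>)"
      by (simp add: fill_weight_def N_fill_Cons des_fill_Cons power_add algebra_simps)
  qed
  also have "\<dots> = (\<Sum>C'\<in>T. \<Sum>\<sigma> | \<sigma> \<in> S \<and> hd \<sigma> = C'.
      x l C * (t ^ N_col n C (hd \<sigma>) * (1 - t) ^ des_col n C (hd \<sigma>) * fill_weight n t x (l' # ls) \<sigma>))"
    by (rule sum.group[symmetric]) (use finite_fill_set fill_set_hd in \<open>auto simp: S_def T_def\<close>)
  also have "\<dots> = (\<Sum>C'\<in>T. x l C * (t ^ N_col n C C' * (1 - t) ^ des_col n C C' * column_sum n t h x (l' # ls) C'))"
  proof (rule sum.cong[OF HOL.refl])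
    fix C' assume C': "C' \<in> T"
    have "{\<sigma>. \<sigma> \<in> S \<and> hd \<sigma> = C'} = {\<sigma>. \<sigma> \<in> fill_set n h (l' # ls) \<and> hd \<sigma> = C'}"
      using C' by (auto simp: S_def T_def)
    moreover have "(\<Sum>\<sigma> | \<sigma> \<in> fill_set n h (l' # ls) \<and> hd \<sigma> = C'. fill_weight n t x (l' # ls) \<sigma>) = column_sum n t h x (l' # ls) C'"
      using more.IH[of C'] C' by (simp add: T_def)
    ultimately show "(\<Sum>\<sigma> | \<sigma> \<in> S \<and> hd \<sigma> = C'.
      x l C * (t ^ N_col n C (hd \<sigma>) * (1 - t) ^ des_col n C (hd \<sigma>) * fill_weight n t x (l' # ls) \<sigma>))
      = x l C * (t ^ N_col n C C' * (1 - t) ^ des_col n C C' * column_sum n t h x (l' # ls) C')"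
      by (simp add: sum_distrib_left[symmetric])
  qed
  finally show ?case by (simp add: T_def sum_distrib_left)
qed simp

lemma sum_fill_set:
  assumes "ls \<noteq> []"
  shows "(\<Sum>\<sigma>\<in>fill_set n h ls. fill_weight n t x ls \<sigma>) = (\<Sum>C\<in>words n (h (hd ls)). column_sum n t h x ls C)"
proof -
  have "(\<Sum>\<sigma>\<in>fill_set n h ls. fill_weight n t x ls \<sigma>) =
    (\<Sum>C\<in>words n (h (hd ls)). \<Sum>\<sigma> | \<sigma> \<in> fill_set n h ls \<and> hd \<sigma> = C. fill_weight n t x ls \<sigma>)"
    by (rule sum.group[symmetric]) (use finite_fill_set fill_set_hd assms in \<open>auto simp: neq_Nil_conv\<close>)
  also have "\<dots> = (\<Sum>C\<in>words n (h (hd ls)). column_sum n t h x ls C)"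
    by (rule sum.cong[OF HOL.refl]) (use sum_fill_set_hd assms in blast)
  finally show ?thesis .
qed

lemma conj_part_antimono: "i \<le> j \<Longrightarrow> conj_part n lam j \<le> conj_part n lam i"
  unfolding conj_part_def by (rule card_mono) auto

lemma sorted_labels_height:
  "sorted (map (\<lambda>l. conj_part n lam (block_of l)) (labels n lam))"
proof -
  have "sorted (map (\<lambda>l. conj_part n lam (block_of l)) (concat (map (block n lam) xs)))"
    if "sorted_wrt (\<ge>) xs" for xs
    using that
  proof (induction xs)
    case (Cons i xs)
    have "\<forall>l\<in>set (block n lam i). \<forall>l'\<in>set (concat (map (block n lam) xs)).
        conj_part n lam (block_of l) \<le> conj_part n lam (block_of l')"
      using Cons.prems set_block conj_part_antimono by fastforce
    moreover have "map (\<lambda>l. conj_part n lam (block_of l)) (block n lam i) = map (\<lambda>l. conj_part n lam i) (block n lam i)"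
      by (rule map_cong) (use set_block in auto)
    then have "sorted (map (\<lambda>l. conj_part n lam (block_of l)) (block n lam i))" by (simp add: map_replicate_const)
    ultimately show ?case using Cons by (auto simp: sorted_append)
  qed simp
  moreover have "sorted_wrt (\<ge>) (rev [1..<lam 1 + 1])"
    by (simp add: sorted_wrt_rev sorted_upt del: upt_Suc)
  ultimately show ?thesis unfolding labels_def by blast
qed

text \<open>Heights weakly increase from left to right, so a row that meets one column meets all
  columns to its right. The row condition for arbitrary pairs then follows from neighbouring ones by
  transitivity.\<close>

lemma fillings_eq_fill_set:
  "fillings n lam = fill_set n (\<lambda>l. conj_part n lam (block_of l)) (labels n lam)"
proof (intro equalityI subsetI)
  fix \<sigma> assume s: "\<sigma> \<in> fillings n lam"
  have "\<sigma> ! q \<in> words n (conj_part n lam (block_of (labels n lam ! q)))" if "q < length \<sigma>" for q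
  proof (rule distinct_column_words)
    show "distinct_column (\<sigma> ! q)" "set (\<sigma> ! q) \<subseteq> alphabet n"
      "length (\<sigma> ! q) = conj_part n lam (block_of (labels n lam ! q))"
      using s that unfolding fillings_def distinct_column_def by blast+
  qed
  moreover have "row_le (\<sigma> ! q) (\<sigma> ! (q + 1))" if "q + 1 < length \<sigma>" for q
    unfolding row_le_def
  proof
    fix r assume "r \<in> {1..min (length (\<sigma> ! q)) (length (\<sigma> ! (q + 1)))}"
    moreover have "\<forall>p q r. p < q \<and> q < length \<sigma> \<and> 1 \<le> r \<and> r \<le> length (\<sigma> ! p) \<and> r \<le> length (\<sigma> ! q)
        \<longrightarrow> entry (\<sigma> ! q) r \<preceq> entry (\<sigma> ! p) r"
      using s unfolding fillings_def mem_Collect_eq by (elim conjE)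
    ultimately show "entry (\<sigma> ! (q + 1)) r \<preceq> entry (\<sigma> ! q) r" using that by simp
  qed
  ultimately show "\<sigma> \<in> fill_set n (\<lambda>l. conj_part n lam (block_of l)) (labels n lam)"
    unfolding fill_set_iff using s by (simp add: fillings_def)
next
  fix \<sigma> assume "\<sigma> \<in> fill_set n (\<lambda>l. conj_part n lam (block_of l)) (labels n lam)"
  then have len: "length \<sigma> = length (labels n lam)"
    and w: "\<And>q. q < length \<sigma> \<Longrightarrow> \<sigma> ! q \<in> words n (conj_part n lam (block_of (labels n lam ! q)))"
    and st: "\<And>q. q + 1 < length \<sigma> \<Longrightarrow> step_ok (labels n lam ! q) (\<sigma> ! q) (\<sigma> ! (q + 1)) \<and> row_le (\<sigma> ! q) (\<sigma> ! (q + 1))"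
    unfolding fill_set_iff by auto
  have h: "length (\<sigma> ! q) = conj_part n lam (block_of (labels n lam ! q))" "set (\<sigma> ! q) \<subseteq> alphabet n" if "q < length \<sigma>" for q
    using w[OF that] by (simp_all add: words_def)
  have mono: "length (\<sigma> ! p) \<le> length (\<sigma> ! q)" if "p \<le> q" "q < length \<sigma>" for p q
    using sorted_nth_mono[OF sorted_labels_height[of n lam] that(1)] that len h by simp
  have rows: "entry (\<sigma> ! q) r \<preceq> entry (\<sigma> ! p) r"
    if "p \<le> q" "q < length \<sigma>" "1 \<le> r" "r \<le> length (\<sigma> ! p)" for p q r
    using that(1,2)
  proof (induction q rule: dec_induct)
    case base then show ?case by (simp add: letter_le_def)
  next
    case (step q)
    have q: "q < length \<sigma>" "q + 1 < length \<sigma>" using step.prems by simp_all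
    have "r \<le> length (\<sigma> ! q)" "r \<le> length (\<sigma> ! (q + 1))"
      using mono[of p q] mono[of p "q + 1"] step q that(4) by linarith+
    then have "entry (\<sigma> ! (q + 1)) r \<preceq> entry (\<sigma> ! q) r" using st[OF q(2)] that(3) by (simp add: row_le_def)
    moreover have "entry (\<sigma> ! q) r \<preceq> entry (\<sigma> ! p) r" using step.IH q by simp
    moreover have "entry (\<sigma> ! p) r \<in> set (\<sigma> ! p)" using that(3,4) by (intro nth_mem) simp
    then have "entry (\<sigma> ! p) r \<noteq> 0" using h(2)[of p] step q by (auto simp: alphabet_def)
    ultimately show ?case using letter_le_trans by simp
  qed
  have "distinct_column (\<sigma> ! q)" if "q < length \<sigma>" for q using words_distinct_column[OF w[OF that]] .
  then show "\<sigma> \<in> fillings n lam"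
    unfolding fillings_def distinct_column_def using len h rows st by auto
qed

section \<open>Runs of columns as iterated column steps\<close>

lemma words_replace:
  "X @ a # Z \<in> words n k \<Longrightarrow> e \<in> alphabet n \<Longrightarrow> \<bar>e\<bar> \<notin> abs ` set (X @ Z) \<Longrightarrow> X @ e # Z \<in> words n k"
  by (auto simp: words_def)

lemma step_sum_cong:
  assumes D: "D \<in> words n k" and j: "1 \<le> j" "j \<le> k" and fg: "\<And>C. C \<in> words n k \<Longrightarrow> f C = g C"
  shows "step_sum n t d j f D = step_sum n t d j g D"
  unfolding step_sum_eq[OF D j]
proof (rule sum.cong[OF HOL.refl])
  fix rs assume rs: "rs \<in> swap_rows 0 j D"
  define B where "B = bar_swaps rs j D"
  have B: "B \<in> words n k" "length B = k"
    using bar_swaps_words[OF D swap_rowsD(4)[OF rs] j(2)] by (simp_all add: B_def words_def)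
  have Beq: "take (j - 1) B @ entry B j # drop j B \<in> words n k"
    using id_take_nth_drop[of "j - 1" B] B j by simp
  have upd: "B[j - 1 := e] = take (j - 1) B @ e # drop j B" for e
    using B j upd_conv_take_nth_drop[of "j - 1" B e] by simp
  have "B[j - 1 := e] \<in> words n k" if "e \<in> below_set n (take (j - 1) B @ drop j B) v" for e v
    unfolding upd using words_replace[OF Beq, of e] that by (simp add: below_set_def)
  then have "drop_sum n t d f j B = drop_sum n t d g j B"
    unfolding drop_sum_def using fg[OF B(1)] fg by (simp cong: sum.cong)
  then show "(1 - t) ^ length rs * t ^ N_swaps n D rs j * drop_sum n t d f j (bar_swaps rs j D) =
      (1 - t) ^ length rs * t ^ N_swaps n D rs j * drop_sum n t d g j (bar_swaps rs j D)"
    by (simp add: B_def)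
qed

lemma steps_sum_cong:
  assumes "D \<in> words n k" "r \<le> k" "\<And>C. C \<in> words n k \<Longrightarrow> f C = g C"
  shows "steps_sum n t d k r f D = steps_sum n t d k r g D"
  using assms(1,2)
proof (induction r arbitrary: D)
  case (Suc r)
  show ?case unfolding steps_sum.simps
    by (rule step_sum_cong[OF Suc.prems(1)]) (use Suc in auto)
qed (use assms(3) in simp)

text \<open>There is no row above the first one, and with \<open>d = 0\<close> the pivot cannot
  drop. This supplies the trivial step for \<open>j = 1\<close>, for which a block has no primed
  column.\<close>

lemma step_sum_first:
  assumes "D \<in> words n k" "1 \<le> k"
  shows "step_sum n t 0 (Suc 0) f D = f D"
proof -
  have "D \<noteq> []" using assms by (auto simp: words_def)
  then obtain a Z where "D = a # Z" by (cases D) auto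
  then show ?thesis by (simp add: step_sum_def drop_sum_def)
qed

text \<open>The step condition and the statistics see only the first \<open>k\<close> entries of the
  new column. Its last entry ranges over all free letters, which is the sum in
  \<open>extend_op\<close>.\<close>

lemma unprimed_sum_taller:
  assumes D: "D \<in> words n k" "1 \<le> j" "j \<le> k"
  shows "(\<Sum>C | C \<in> words n (Suc k) \<and> step_unprimed j D C \<and> row_le D C.
      t ^ N_col n D C * (1 - t) ^ des_col n D C * g C) = step_sum n t (1 - t) j (extend_op n g) D"
proof -
  have l: "length D = k" using D by (simp add: words_def)
  define S where "S = {C. C \<in> words n k \<and> step_unprimed j D C \<and> row_le D C}"
  define E where "E C = {e. e \<in> alphabet n \<and> \<bar>e\<bar> \<notin> abs ` set C}" for C :: "int list"
  define S' where "S' = {C. C \<in> words n (Suc k) \<and> step_unprimed j D C \<and> row_le D C}"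
  have tk: "take (length D) (C @ [e]) = C" if "C \<in> words n k" for C e using that l by (simp add: words_def)
  have tk': "take (length D) C = C" if "C \<in> words n k" for C using that l by (simp add: words_def)
  have st: "step_unprimed j D (C @ [e]) \<longleftrightarrow> step_unprimed j D C" if "C \<in> words n k" for C e
    unfolding step_unprimed_def tk[OF that] tk'[OF that] ..
  have rl: "row_le D (C @ [e]) \<longleftrightarrow> row_le D C" if "C \<in> words n k" for C e
  proof -
    have "length C = k" using that by (simp add: words_def)
    then have "entry (C @ [e]) r = entry C r" if "r \<in> {1..k}" for r using that by (auto simp: nth_append)
    then show ?thesis using \<open>length C = k\<close> l by (simp add: row_le_def min_def)
  qed
  have bij: "bij_betw (\<lambda>(C, e). C @ [e]) (Sigma S E) S'"
  proof (rule bij_betw_byWitness[where f'="\<lambda>C. (butlast C, last C)"])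
    show "(\<lambda>(C, e). C @ [e]) ` Sigma S E \<subseteq> S'"
      using st rl by (auto simp: S_def E_def S'_def words_snoc)
    show "(\<lambda>C. (butlast C, last C)) ` S' \<subseteq> Sigma S E"
    proof
      fix p assume "p \<in> (\<lambda>C. (butlast C, last C)) ` S'"
      then obtain C where C: "p = (butlast C, last C)" "C \<in> S'" by auto
      then have "C \<noteq> []" by (auto simp: S'_def words_def)
      then have eq: "C = butlast C @ [last C]" by simp
      then have w: "butlast C \<in> words n k" "last C \<in> alphabet n" "\<bar>last C\<bar> \<notin> abs ` set (butlast C)"
        using C(2) words_snoc[of "butlast C" "last C" n k] by (auto simp: S'_def)
      have "step_unprimed j D (butlast C)" "row_le D (butlast C)"
        using C(2) st[OF w(1), of "last C"] rl[OF w(1), of "last C"] eq by (auto simp: S'_def)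
      then show "p \<in> Sigma S E" using C(1) w by (simp add: S_def E_def)
    qed
    show "\<forall>C\<in>S'. (\<lambda>(C, e). C @ [e]) (butlast C, last C) = C"
    proof
      fix C assume "C \<in> S'"
      then have "C \<noteq> []" by (auto simp: S'_def words_def)
      then show "(\<lambda>(C, e). C @ [e]) (butlast C, last C) = C" by simp
    qed
  qed auto
  have "(\<Sum>C\<in>S'. t ^ N_col n D C * (1 - t) ^ des_col n D C * g C)
    = (\<Sum>(C, e)\<in>Sigma S E. t ^ N_col n D (C @ [e]) * (1 - t) ^ des_col n D (C @ [e]) * g (C @ [e]))"
    by (subst sum.reindex_bij_betw[OF bij, symmetric]) (simp add: case_prod_unfold)
  also have "\<dots> = (\<Sum>C\<in>S. \<Sum>e\<in>E C. t ^ N_col n D (C @ [e]) * (1 - t) ^ des_col n D (C @ [e]) * g (C @ [e]))"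
    by (rule sum.Sigma[symmetric]) (auto simp: S_def E_def)
  also have "\<dots> = (\<Sum>C\<in>S. t ^ N_col n D C * (1 - t) ^ des_col n D C * extend_op n g C)"
  proof (rule sum.cong[OF HOL.refl])
    fix C assume "C \<in> S"
    then have C: "C \<in> words n k" by (simp add: S_def)
    have "N_col n D (C @ [e]) = N_col n D C" "des_col n D (C @ [e]) = des_col n D C" for e
      unfolding N_col_def des_col_def tk[OF C] tk'[OF C] by (rule HOL.refl)+
    then show "(\<Sum>e\<in>E C. t ^ N_col n D (C @ [e]) * (1 - t) ^ des_col n D (C @ [e]) * g (C @ [e]))
       = t ^ N_col n D C * (1 - t) ^ des_col n D C * extend_op n g C"
      by (simp add: extend_op_def E_def sum_distrib_left)
  qed
  also have "\<dots> = step_sum n t (1 - t) j (extend_op n g) D"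
    unfolding S_def by (rule unprimed_sum[OF D])
  finally show ?thesis by (simp add: S'_def)
qed

lemma column_sum_Cons:
  "ls \<noteq> [] \<Longrightarrow> column_sum n t h x (l # ls) C = x l C *
     (\<Sum>C' | C' \<in> words n (h (hd ls)) \<and> step_ok l C C' \<and> row_le C C'.
        t ^ N_col n C C' * (1 - t) ^ des_col n C C' * column_sum n t h x ls C')"
  by (cases ls) simp_all

text \<open>The alternative for \<open>R\<close> covers the two ways in which a run of unprimed
  columns can end, before a block of the same height or before one that is taller by one
  row.\<close>

lemma column_sum_unprimed:
  assumes k: "1 \<le> r" "r \<le> k" and rest: "rest \<noteq> []" and i: "1 < i"
    and hk: "\<And>j. h (Unprimed i j) = k"
    and x: "\<And>j C. j \<noteq> 1 \<Longrightarrow> x (Unprimed i j) C = 1"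
    and R: "(h (hd rest) = k \<and> R = column_sum n t h x rest) \<or>
      (h (hd rest) = Suc k \<and> R = extend_op n (column_sum n t h x rest))"
    and D: "D \<in> words n k"
  shows "column_sum n t h x (map (Unprimed i) [k + 1 - r..<k + 1] @ rest) D =
    x (Unprimed i (k + 1 - r)) D * steps_sum n t (1 - t) k r R D"
  using k D
proof (induction r arbitrary: D)
  case (Suc r)
  have up: "[k - r..<k + 1] = (k - r) # [k + 1 - r..<k + 1]"
    using Suc.prems by (subst upt_conv_Cons) (auto simp: Suc_diff_le)
  have kr: "1 \<le> k - r" "k - r \<le> k" using Suc.prems by auto
  show ?case
  proof (cases "r = 0")
    case True
    have "column_sum n t h x (Unprimed i k # rest) D = x (Unprimed i k) D * step_sum n t (1 - t) k R D"
      unfolding column_sum_Cons[OF rest] using R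
    proof
      assume "h (hd rest) = k \<and> R = column_sum n t h x rest"
      then show "x (Unprimed i k) D * (\<Sum>C' | C' \<in> words n (h (hd rest)) \<and> step_ok (Unprimed i k) D C' \<and> row_le D C'.
        t ^ N_col n D C' * (1 - t) ^ des_col n D C' * column_sum n t h x rest C') = x (Unprimed i k) D * step_sum n t (1 - t) k R D"
        using unprimed_sum[OF Suc.prems(3), of k t "column_sum n t h x rest"] Suc.prems i by simp
    next
      assume "h (hd rest) = Suc k \<and> R = extend_op n (column_sum n t h x rest)"
      then show "x (Unprimed i k) D * (\<Sum>C' | C' \<in> words n (h (hd rest)) \<and> step_ok (Unprimed i k) D C' \<and> row_le D C'.
        t ^ N_col n D C' * (1 - t) ^ des_col n D C' * column_sum n t h x rest C') = x (Unprimed i k) D * step_sum n t (1 - t) k R D"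
        using unprimed_sum_taller[OF Suc.prems(3), of k t "column_sum n t h x rest"] Suc.prems i by simp
    qed
    then show ?thesis using True up by simp
  next
    case False
    define rest' where "rest' = map (Unprimed i) [k + 1 - r..<k + 1] @ rest"
    have ne: "rest' \<noteq> []" using rest by (simp add: rest'_def)
    have "h (hd rest') = k" 
    proof -
      have "[k + 1 - r..<k + 1] = (k + 1 - r) # [Suc (k + 1 - r)..<k + 1]"
        by (rule upt_conv_Cons) (use False in simp)
      then show ?thesis using hk by (simp only: rest'_def list.map append_Cons list.sel)
    qed
    then have "column_sum n t h x (Unprimed i (k - r) # rest') D = x (Unprimed i (k - r)) D *
       step_sum n t (1 - t) (k - r) (column_sum n t h x rest') D"
      unfolding column_sum_Cons[OF ne] using unprimed_sum[OF Suc.prems(3) kr, of t "column_sum n t h x rest'"] i by simp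
    also have "step_sum n t (1 - t) (k - r) (column_sum n t h x rest') D = step_sum n t (1 - t) (k - r) (steps_sum n t (1 - t) k r R) D"
    proof (rule step_sum_cong[OF Suc.prems(3) kr])
      fix C assume C: "C \<in> words n k"
      have "k + 1 - r \<noteq> 1" using Suc.prems by simp
      then show "column_sum n t h x rest' C = steps_sum n t (1 - t) k r R C"
        unfolding rest'_def using Suc.IH[OF _ _ C] False Suc.prems x[of "k + 1 - r" C] by simp
    qed
    finally show ?thesis using up by (simp add: rest'_def)
  qed
qed simp

lemma column_sum_primed:
  assumes k: "r < k" and rest: "rest \<noteq> []" "h (hd rest) = k"
    and hk: "\<And>j. h (Primed i j) = k"
    and x: "\<And>j C. j \<noteq> 2 \<Longrightarrow> x (Primed i j) C = 1"
    and D: "D \<in> words n k"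
  shows "column_sum n t h x (map (Primed i) [k + 1 - r..<k + 1] @ rest) D =
    (if r = 0 then 1 else x (Primed i (k + 1 - r)) D) * steps_sum n t 0 k r (column_sum n t h x rest) D"
  using k D
proof (induction r arbitrary: D)
  case (Suc r)
  have up: "[k - r..<k + 1] = (k - r) # [k + 1 - r..<k + 1]"
    using Suc.prems by (subst upt_conv_Cons) (auto simp: Suc_diff_le)
  have kr: "1 \<le> k - r" "k - r \<le> k" using Suc.prems by auto
  define rest' where "rest' = map (Primed i) [k + 1 - r..<k + 1] @ rest"
  have ne: "rest' \<noteq> []" using rest by (simp add: rest'_def)
  have "h (hd rest') = k"
  proof (cases "r = 0")
    case True
    then show ?thesis using rest by (simp add: rest'_def)
  next
    case False
    then have "[k + 1 - r..<k + 1] = (k + 1 - r) # [Suc (k + 1 - r)..<k + 1]"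
      by (intro upt_conv_Cons) simp
    then show ?thesis using hk by (simp only: rest'_def list.map append_Cons list.sel)
  qed
  then have "column_sum n t h x (Primed i (k - r) # rest') D = x (Primed i (k - r)) D *
     step_sum n t 0 (k - r) (column_sum n t h x rest') D"
    unfolding column_sum_Cons[OF ne] using primed_sum[OF Suc.prems(2) kr, of t "column_sum n t h x rest'"] by simp
  also have "step_sum n t 0 (k - r) (column_sum n t h x rest') D
      = step_sum n t 0 (k - r) (steps_sum n t 0 k r (column_sum n t h x rest)) D"
  proof (rule step_sum_cong[OF Suc.prems(2) kr])
    fix C assume C: "C \<in> words n k"
    have "k + 1 - r \<noteq> 2" using Suc.prems by simp
    then show "column_sum n t h x rest' C = steps_sum n t 0 k r (column_sum n t h x rest) C"
      unfolding rest'_def using Suc.IH[OF _ C] Suc.prems x[of "k + 1 - r" C] by simp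
  qed
  finally show ?case using up by (simp add: rest'_def)
qed simp


section \<open>Sums over blocks\<close>

text \<open>The content, distributed over a block: negative letters are read at its first column and
  positive letters at the first unprimed column. In a block of height one these are the same
  column.\<close>

definition label_weight :: "nat \<Rightarrow> (nat \<Rightarrow> nat) \<Rightarrow> (int \<Rightarrow> 'k::field) \<Rightarrow> label \<Rightarrow> int list \<Rightarrow> 'k" where
  "label_weight n lam y l C = (case l of
      Unprimed i j \<Rightarrow> if j = 1 then (if conj_part n lam i = 1 then neg_part C y else 1) * pos_part C y else 1
    | Primed i j \<Rightarrow> if j = 2 then neg_part C y else 1)"

definition block_labels :: "nat \<Rightarrow> (nat \<Rightarrow> nat) \<Rightarrow> nat \<Rightarrow> label list" where
  "block_labels n lam i = concat (map (block n lam) (rev [1..<i + 1]))"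

definition block_sum :: "nat \<Rightarrow> (nat \<Rightarrow> nat) \<Rightarrow> 'k::field \<Rightarrow> nat \<Rightarrow> int list \<Rightarrow> (int \<Rightarrow> 'k) \<Rightarrow> 'k" where
  "block_sum n lam t i D y = column_sum n t (\<lambda>l. conj_part n lam (block_of l)) (label_weight n lam y) (block_labels n lam i) D"

lemma block_labels_Suc: "block_labels n lam (Suc i) = block n lam (Suc i) @ block_labels n lam i"
  by (simp add: block_labels_def)

lemma hd_block:
  assumes "1 \<le> conj_part n lam i"
  shows "block n lam i \<noteq> []" "block_of (hd (block n lam i)) = i"
proof -
  have "Unprimed i 1 \<in> set (block n lam i)" using assms by (auto simp: block_def)
  then show ne: "block n lam i \<noteq> []" by auto
  then show "block_of (hd (block n lam i)) = i" using set_block hd_in_set by metis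
qed

lemma hd_block_labels:
  assumes "1 \<le> i" "1 \<le> conj_part n lam i"
  shows "block_labels n lam i \<noteq> []" "block_of (hd (block_labels n lam i)) = i"
proof -
  obtain i' where "i = Suc i'" using assms(1) by (cases i) auto
  then show "block_labels n lam i \<noteq> []" "block_of (hd (block_labels n lam i)) = i"
    using hd_block[OF assms(2)] by (simp_all add: block_labels_Suc)
qed

lemma translate_sum_column_sum:
  assumes k: "1 \<le> k" "k \<le> n" and ki: "conj_part n lam i = k" and D: "D \<in> words n k"
    and rest: "rest \<noteq> []" "block_of (hd rest) = i"
    and U: "\<And>C. C \<in> words n k \<Longrightarrow> column_sum n t (\<lambda>l. conj_part n lam (block_of l)) (label_weight n lam y) rest C
       = (if k = 1 then neg_part C y else 1) * (pos_part C y * A C y)"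
  shows "column_sum n t (\<lambda>l. conj_part n lam (block_of l)) (label_weight n lam y) (map (Primed i) [2..<k + 1] @ rest) D
     = translate_sum n t k A D y"
proof -
  define h where "h = (\<lambda>l. conj_part n lam (block_of l))"
  define r where "r = k - 1"
  have r: "r < k" "k + 1 - r = 2" "Suc r = k" using k by (simp_all add: r_def)
  have "column_sum n t h (label_weight n lam y) (map (Primed i) [k + 1 - r..<k + 1] @ rest) D =
    (if r = 0 then 1 else label_weight n lam y (Primed i (k + 1 - r)) D) * steps_sum n t 0 k r (column_sum n t h (label_weight n lam y) rest) D"
    by (rule column_sum_primed[OF r(1) rest(1) _ _ _ D]) (simp_all add: h_def ki rest label_weight_def)
  also have "steps_sum n t 0 k r (column_sum n t h (label_weight n lam y) rest) D =
      steps_sum n t 0 k r (\<lambda>C. (if k = 1 then neg_part C y else 1) * (pos_part C y * A C y)) D"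
    by (rule steps_sum_cong[OF D]) (use r U in \<open>simp_all add: h_def\<close>)
  also have "(if r = 0 then 1 else label_weight n lam y (Primed i (k + 1 - r)) D) * \<dots> =
     neg_part D y * steps_sum n t 0 k r (\<lambda>C. pos_part C y * A C y) D"
    using r k by (cases "k = 1") (auto simp: label_weight_def r_def)
  \<comment> \<open>The primed run has \<open>k - 1\<close> columns, numbered from 2; the step for
    row 1 that completes \<open>translate_sum\<close> is trivial by
    \<open>step_sum_first\<close>.\<close>
  also have "steps_sum n t 0 k r (\<lambda>C. pos_part C y * A C y) D = steps_sum n t 0 k k (\<lambda>C. pos_part C y * A C y) D"
  proof -
    define G where "G = steps_sum n t 0 k r (\<lambda>C. pos_part C y * A C y)"
    have "k - r = 1" using r by simp
    then have "steps_sum n t 0 k (Suc r) (\<lambda>C. pos_part C y * A C y) D = step_sum n t 0 1 G D"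
      by (simp only: steps_sum.simps G_def)
    also have "\<dots> = G D" unfolding One_nat_def by (rule step_sum_first[OF D k(1)])
    finally show ?thesis unfolding r(3) G_def by (rule sym)
  qed
  finally show ?thesis unfolding r(2) by (simp add: translate_sum_def h_def)
qed

lemma block_sum_1:
  assumes n: "2 \<le> n" and c: "conj_part n lam 1 = n" and D: "D \<in> words n n"
  shows "block_sum n lam t 1 D y = translate_sum n t n (\<lambda>D y. t ^ inversions D) D y"
proof -
  have b: "block_labels n lam 1 = map (Primed 1) [2..<n + 1] @ [Unprimed 1 1]"
  proof -
    have "[1..<1 + 1] = [1::nat]" by simp
    then show ?thesis by (simp only: block_labels_def block_def c list.map rev.simps append_Nil concat.simps append_Nil2 if_True simp_thms)
  qed
  show ?thesis unfolding block_sum_def b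
    by (rule translate_sum_column_sum[OF _ _ c D]) (use n c in \<open>auto simp: label_weight_def\<close>)
qed

lemma block_sum_Suc:
  assumes i: "1 \<le> i" and k: "1 \<le> k" "k \<le> n" and ki: "conj_part n lam (Suc i) = k"
    and R: "(conj_part n lam i = k \<and> R = block_sum n lam t i) \<or>
      (conj_part n lam i = Suc k \<and> R = (\<lambda>D y. extend_op n (\<lambda>w. block_sum n lam t i w y) D))"
    and D: "D \<in> words n k"
  shows "block_sum n lam t (Suc i) D y = translate_sum n t k (\<lambda>D y. steps_sum n t (1 - t) k k (\<lambda>w. R w y) D) D y"
proof -
  define h where "h = (\<lambda>l. conj_part n lam (block_of l))"
  define tl where "tl = block_labels n lam i"
  have ci: "1 \<le> conj_part n lam i" using R k by auto
  have tl: "tl \<noteq> []" "h (hd tl) = conj_part n lam i" using hd_block_labels[OF i ci] by (simp_all add: tl_def h_def)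
  define rest where "rest = map (Unprimed (Suc i)) [1..<k + 1] @ tl"
  have b: "block_labels n lam (Suc i) = map (Primed (Suc i)) [2..<k + 1] @ rest"
    using i by (simp add: block_labels_Suc block_def ki rest_def tl_def del: upt_Suc)
  have hr: "rest \<noteq> []" "block_of (hd rest) = Suc i"
  proof -
    have "[1..<k + 1] = 1 # [Suc 1..<k + 1]" by (rule upt_conv_Cons) (use k in simp)
    then have "rest = Unprimed (Suc i) 1 # map (Unprimed (Suc i)) [Suc 1..<k + 1] @ tl"
      by (simp only: rest_def list.map append_Cons)
    then show "rest \<noteq> []" "block_of (hd rest) = Suc i" by simp_all
  qed
  have U: "column_sum n t h (label_weight n lam y) rest C =
      (if k = 1 then neg_part C y else 1) * (pos_part C y * steps_sum n t (1 - t) k k (\<lambda>w. R w y) C)"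
    if C: "C \<in> words n k" for C
  proof -
    have R': "(h (hd tl) = k \<and> (\<lambda>w. R w y) = column_sum n t h (label_weight n lam y) tl) \<or>
      (h (hd tl) = Suc k \<and> (\<lambda>w. R w y) = extend_op n (column_sum n t h (label_weight n lam y) tl))"
      using R
    proof (elim disjE conjE)
      assume a: "conj_part n lam i = k" "R = block_sum n lam t i"
      have "(\<lambda>w. R w y) = column_sum n t h (label_weight n lam y) tl"
        unfolding a(2) block_sum_def tl_def h_def by (rule HOL.refl)
      then show ?thesis using a(1) tl(2) by blast
    next
      assume a: "conj_part n lam i = Suc k" "R = (\<lambda>D y. extend_op n (\<lambda>w. block_sum n lam t i w y) D)"
      have "(\<lambda>w. R w y) = extend_op n (column_sum n t h (label_weight n lam y) tl)"
        unfolding a(2) block_sum_def tl_def h_def by (rule HOL.refl)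
      then show ?thesis using a(1) tl(2) by auto
    qed
    have "column_sum n t h (label_weight n lam y) (map (Unprimed (Suc i)) [k + 1 - k..<k + 1] @ tl) C =
      label_weight n lam y (Unprimed (Suc i) (k + 1 - k)) C * steps_sum n t (1 - t) k k (\<lambda>w. R w y) C"
      by (rule column_sum_unprimed[OF k(1) order.refl tl(1) _ _ _ R' C]) (use i in \<open>simp_all add: h_def ki label_weight_def\<close>)
    then show ?thesis by (simp add: rest_def label_weight_def ki del: upt_Suc)
  qed
  show ?thesis unfolding block_sum_def b
    by (rule translate_sum_column_sum[OF k ki D hr]) (use U in \<open>simp add: h_def\<close>)
qed

lemma conj_part_iff:
  assumes dec: "\<And>i j. 1 \<le> i \<Longrightarrow> i < j \<Longrightarrow> j \<le> n \<Longrightarrow> lam j < lam i" and p: "1 \<le> p" "p \<le> n"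
  shows "p \<le> conj_part n lam i \<longleftrightarrow> i \<le> lam p"
proof
  assume "i \<le> lam p"
  have "{1..p} \<subseteq> {k \<in> {1..n}. i \<le> lam k}"
  proof
    fix k assume k: "k \<in> {1..p}"
    then have "lam p \<le> lam k" using dec[of k p] p by (cases "k = p") auto
    then show "k \<in> {k \<in> {1..n}. i \<le> lam k}" using k p \<open>i \<le> lam p\<close> by simp
  qed
  then have "card {1..p} \<le> conj_part n lam i" unfolding conj_part_def by (intro card_mono) auto
  then show "p \<le> conj_part n lam i" by simp
next
  assume le: "p \<le> conj_part n lam i"
  show "i \<le> lam p"
  proof (rule ccontr)
    assume ni: "\<not> i \<le> lam p"
    have "{k \<in> {1..n}. i \<le> lam k} \<subseteq> {1..p - 1}"
    proof
      fix k assume k: "k \<in> {k \<in> {1..n}. i \<le> lam k}"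
      have "\<not> p \<le> k"
      proof
        assume "p \<le> k"
        then have "lam k \<le> lam p" using dec[of p k] p(1) k by (cases "p = k") auto
        then show False using ni k by simp
      qed
      then show "k \<in> {1..p - 1}" using k by auto
    qed
    then have "conj_part n lam i \<le> card {1..p - 1}" unfolding conj_part_def by (intro card_mono) auto
    then show False using le p by simp
  qed
qed

lemma conj_part_le: "conj_part n lam i \<le> n"
proof -
  have "{k \<in> {1..n}. i \<le> lam k} \<subseteq> {1..n}" by auto
  then have "card {k \<in> {1..n}. i \<le> lam k} \<le> card {1..n}" by (rule card_mono[rotated]) simp
  then show ?thesis by (simp add: conj_part_def)
qed

text \<open>If the height dropped by two or more from \<open>i\<close> to \<open>Suc i\<close>, two
  neighbouring parts would both equal \<open>i\<close>. This is where the regularity of the weight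
  enters.\<close>

lemma conj_part_step:
  assumes dec: "\<And>i j. 1 \<le> i \<Longrightarrow> i < j \<Longrightarrow> j \<le> n \<Longrightarrow> lam j < lam i"
  shows "conj_part n lam i = conj_part n lam (Suc i) \<or> conj_part n lam i = Suc (conj_part n lam (Suc i))"
proof -
  have le: "conj_part n lam (Suc i) \<le> conj_part n lam i" by (rule conj_part_antimono) simp
  have "conj_part n lam i \<le> Suc (conj_part n lam (Suc i))"
  proof (rule ccontr)
    assume a: "\<not> conj_part n lam i \<le> Suc (conj_part n lam (Suc i))"
    define p where "p = Suc (conj_part n lam (Suc i))"
    have p: "1 \<le> p" "Suc p \<le> n" "p \<le> n" "Suc p \<le> conj_part n lam i" "\<not> p \<le> conj_part n lam (Suc i)"
      using a conj_part_le[of n lam i] by (auto simp: p_def)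
    have "i \<le> lam (Suc p)" using conj_part_iff[of n lam "Suc p" i] dec p by auto
    moreover have "lam (Suc p) < lam p" using dec[of p "Suc p"] p by simp
    moreover have "\<not> Suc i \<le> lam p" using conj_part_iff[of n lam p "Suc i"] dec p by auto
    ultimately show False by simp
  qed
  then show ?thesis using le by linarith
qed

text \<open>The exponents contributed by the blocks with numbers up to \<open>i\<close>, which stand
  rightmost. The value 0 beyond \<open>n\<close> makes the hypothesis of
  \<open>partial_hl_mult\<close> hold at every position.\<close>

definition capped_part :: "nat \<Rightarrow> (nat \<Rightarrow> nat) \<Rightarrow> nat \<Rightarrow> nat \<Rightarrow> nat" where
  "capped_part n lam i p = (if p \<le> n then min (lam p) i else 0)"

lemma inversions_id_word: "inversions (id_word k) = 0"
proof -
  have "{(a, b). 1 \<le> a \<and> a < b \<and> b \<le> length (id_word k) \<and> entry (id_word k) b \<prec> entry (id_word k) a} = {}"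
  proof (clarsimp)
    fix a b assume "Suc 0 \<le> a" "a < b" "b \<le> k" "id_word k ! (b - Suc 0) \<prec> id_word k ! (a - Suc 0)"
    then show False by (auto simp: nth_id_word letter_less_def)
  qed
  then show ?thesis unfolding inversions_def by (simp only: card.empty)
qed

text \<open>Both claims have to be carried along together: when the height drops, the sum over the
  lost entry is determined by the single value at \<open>id_word\<close> only because the family is
  equivariant, and the new block preserves equivariance while multiplying that value by
  \<open>y 1 ... y k\<close>.\<close>

lemma block_sum_main:
  assumes n: "2 \<le> n" and dec: "\<And>i j. 1 \<le> i \<Longrightarrow> i < j \<Longrightarrow> j \<le> n \<Longrightarrow> lam j < lam i" and pos: "0 < lam n"
    and t: "(t :: 'k::field) \<noteq> 0" and i: "1 \<le> i" "i \<le> lam 1"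
  shows "equivariant n t (conj_part n lam i) (block_sum n lam t i) \<and>
    (\<forall>y. generic n y \<longrightarrow> block_sum n lam t i (id_word (conj_part n lam i)) y =
      partial_hl n t (capped_part n lam i) (n - conj_part n lam i) (id_word (conj_part n lam i)) y)"
  using i
proof (induction i rule: nat_induct_at_least)
  case base
  have posp: "1 \<le> lam p" if "1 \<le> p" "p \<le> n" for p
    using dec[of p n] pos that by (cases "p = n") auto
  have "{k \<in> {1..n}. 1 \<le> lam k} = {1..n}" using posp by auto
  then have c: "conj_part n lam 1 = n" unfolding conj_part_def by simp
  have eq: "block_sum n lam t 1 D = translate_sum n t n (\<lambda>D y. t ^ inversions D) D" if "D \<in> words n n" for D
    by (rule ext) (rule block_sum_1[OF n c that])
  have "equivariant n t n (translate_sum n t n (\<lambda>D y. t ^ inversions D))"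
    by (rule equivariant_translate_sum[OF t equivariant_word_len]) (rule steps_sum_word_len[OF t])
  then have 1: "equivariant n t n (block_sum n lam t 1)"
    by (rule equivariant_cong[THEN iffD1, rotated]) (simp only: eq)
  have 2: "block_sum n lam t 1 (id_word n) y = partial_hl n t (capped_part n lam 1) 0 (id_word n) y" for y
  proof -
    have "(\<Prod>p = 1..n. y (int p)) = position_weight (capped_part n lam 1) (id_word n) y"
      unfolding position_weight_def
    proof (rule prod.cong)
      fix p assume "p \<in> {1..length (id_word n)}"
      then have p: "1 \<le> p" "p \<le> n" by auto
      then have "capped_part n lam 1 p = 1" using posp[of p] by (simp add: capped_part_def)
      moreover have "entry (id_word n) p = int p" using p by (simp add: nth_id_word)
      ultimately show "y (int p) = y (entry (id_word n) p) ^ capped_part n lam 1 p" by simp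
    qed simp
    then show ?thesis
      unfolding eq[OF id_word_words[OF order.refl]]
      by (simp add: translate_sum_id_word inversions_id_word)
  qed
  show ?case unfolding c using 1 2 by simp
next
  case (Suc i)
  define k where "k = conj_part n lam (Suc i)"
  have iff: "p \<le> conj_part n lam j \<longleftrightarrow> j \<le> lam p" if "1 \<le> p" "p \<le> n" for p j
    using conj_part_iff[of n lam p j] dec that by blast
  have k: "1 \<le> k" "k \<le> n" using iff[of 1 "Suc i"] Suc.prems n conj_part_le by (auto simp: k_def)
  have IH: "equivariant n t (conj_part n lam i) (block_sum n lam t i)"
    "\<And>y. generic n y \<Longrightarrow> block_sum n lam t i (id_word (conj_part n lam i)) y =
      partial_hl n t (capped_part n lam i) (n - conj_part n lam i) (id_word (conj_part n lam i)) y"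
    using Suc.IH Suc.prems by auto
  define R where "R = (if conj_part n lam i = k then block_sum n lam t i
      else (\<lambda>D y. extend_op n (\<lambda>w. block_sum n lam t i w y) D))"
  have step: "conj_part n lam i = k \<or> conj_part n lam i = Suc k"
    unfolding k_def by (rule conj_part_step) (rule dec)
  have R': "(conj_part n lam i = k \<and> R = block_sum n lam t i) \<or>
      (conj_part n lam i = Suc k \<and> R = (\<lambda>D y. extend_op n (\<lambda>w. block_sum n lam t i w y) D))"
    using step by (auto simp: R_def)
  have Req: "equivariant n t k R"
    using R'
  proof (elim disjE conjE)
    assume "conj_part n lam i = Suc k" and R: "R = (\<lambda>D y. extend_op n (\<lambda>w. block_sum n lam t i w y) D)"
    then have "equivariant n t (Suc k) (block_sum n lam t i)" using IH(1) by simp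
    then show ?thesis unfolding R by (rule equivariant_extend_op)
  qed (use IH(1) in simp)
  have Rid: "R (id_word k) y = partial_hl n t (capped_part n lam i) (n - k) (id_word k) y" if y: "generic n y" for y
    using R'
  proof (elim disjE conjE)
    assume ck: "conj_part n lam i = Suc k" and R: "R = (\<lambda>D y. extend_op n (\<lambda>w. block_sum n lam t i w y) D)"
    have kn: "k < n" using conj_part_le[of n lam i] ck by simp
    have "extend_op n (\<lambda>w. block_sum n lam t i w y) (id_word k) =
        partial_hl n t (capped_part n lam i) (Suc (n - Suc k)) (id_word k) y"
      by (rule extend_op_id_word[OF kn _ _ y]) (use IH ck in auto)
    then show ?thesis using kn by (simp add: R Suc_diff_Suc del: partial_hl.simps)
  qed (use IH(2)[OF y] in simp)
  define A where "A = (\<lambda>D y. steps_sum n t (1 - t) k k (\<lambda>w. R w y) D)"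
  have eq: "block_sum n lam t (Suc i) D = translate_sum n t k A D" if "D \<in> words n k" for D
    using block_sum_Suc[OF _ k k_def[symmetric] R' that] Suc.hyps by (simp add: fun_eq_iff A_def)
  have "equivariant n t k (translate_sum n t k A)"
    by (rule equivariant_translate_sum[OF t Req]) (simp add: A_def)
  then have 1: "equivariant n t k (block_sum n lam t (Suc i))"
    by (rule equivariant_cong[THEN iffD1, rotated]) (simp add: eq)
  \<comment> \<open>Block \<open>Suc i\<close> has \<open>k\<close> rows, exactly those whose part
    is at least \<open>Suc i\<close>, so one more block raises the first \<open>k\<close> exponents
    by one.\<close>
  have cap: "capped_part n lam (Suc i) p = capped_part n lam i p + (if p \<le> k then 1 else 0)" if "1 \<le> p" for p
    using iff[of p "Suc i"] that k(2) by (auto simp: capped_part_def k_def)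
  have 2: "block_sum n lam t (Suc i) (id_word k) y = partial_hl n t (capped_part n lam (Suc i)) (n - k) (id_word k) y"
    if y: "generic n y" for y
  proof -
    have "(\<Prod>p = 1..k. y (entry (id_word k) p)) = (\<Prod>p = 1..k. y (int p))"
      by (rule prod.cong) (auto simp: nth_id_word)
    moreover have "partial_hl n t (capped_part n lam (Suc i)) (n - k) (id_word k) y =
        (\<Prod>p = 1..k. y (entry (id_word k) p)) * partial_hl n t (capped_part n lam i) (n - k) (id_word k) y"
      by (rule partial_hl_mult) (use cap in simp_all)
    ultimately show ?thesis
      unfolding eq[OF id_word_words[OF k(2)]]
      by (simp add: translate_sum_id_word A_def steps_sum_id_word[OF order.refl] Rid[OF y])
  qed
  show ?case unfolding k_def[symmetric] using 1 2 by blast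
qed


section \<open>Content\<close>

lemma pos_part_signed_var:
  assumes "set C \<subseteq> alphabet n"
  shows "pos_part C (signed_var x) = (\<Prod>v = 1..n. x v ^ count_list C (int v))"
  using assms
proof (induction C)
  case (Cons a C)
  have IH: "pos_part C (signed_var x) = (\<Prod>v = 1..n. x v ^ count_list C (int v))" using Cons by simp
  have "(\<Prod>v = 1..n. if int v = a then x v else 1) = (if 0 < a then signed_var x a else 1)"
  proof (cases "0 < a")
    case True
    have "(\<Prod>v = 1..n. if int v = a then x v else 1) = (\<Prod>v = 1..n. if v = nat a then x v else 1)"
      by (rule prod.cong) (use True in auto)
    also have "\<dots> = x (nat a)" using True Cons.prems by (subst prod.delta) (auto simp: alphabet_def)
    finally show ?thesis using True by (simp add: signed_var_def)
  qed (auto intro!: prod.neutral)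
  moreover have "(\<Prod>v = 1..n. x v ^ count_list (a # C) (int v)) =
      (\<Prod>v = 1..n. if int v = a then x v else 1) * (\<Prod>v = 1..n. x v ^ count_list C (int v))"
    unfolding prod.distrib[symmetric] by (rule prod.cong) auto
  ultimately show ?case using IH by (simp add: pos_part_def)
qed (simp add: pos_part_def)

lemma neg_part_signed_var:
  assumes "set C \<subseteq> alphabet n"
  shows "neg_part C (signed_var x) = (\<Prod>v = 1..n. inverse (x v) ^ count_list C (- int v))"
  using assms
proof (induction C)
  case (Cons a C)
  have IH: "neg_part C (signed_var x) = (\<Prod>v = 1..n. inverse (x v) ^ count_list C (- int v))" using Cons by simp
  have "(\<Prod>v = 1..n. if - int v = a then inverse (x v) else 1) = (if a < 0 then signed_var x a else 1)"
  proof (cases "a < 0")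
    case True
    have "(\<Prod>v = 1..n. if - int v = a then inverse (x v) else 1) = (\<Prod>v = 1..n. if v = nat (- a) then inverse (x v) else 1)"
      by (rule prod.cong) (use True in auto)
    also have "\<dots> = inverse (x (nat (- a)))" using True Cons.prems by (subst prod.delta) (auto simp: alphabet_def)
    finally show ?thesis using True by (simp add: signed_var_def)
  qed (auto intro!: prod.neutral)
  moreover have "(\<Prod>v = 1..n. inverse (x v) ^ count_list (a # C) (- int v)) =
      (\<Prod>v = 1..n. if - int v = a then inverse (x v) else 1) * (\<Prod>v = 1..n. inverse (x v) ^ count_list C (- int v))"
    unfolding prod.distrib[symmetric] by (rule prod.cong) auto
  ultimately show ?case using IH by (simp add: neg_part_def)
qed (simp add: neg_part_def)

lemma neg_part_pos_part_signed_var: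
  assumes "set B \<subseteq> alphabet n" "set C \<subseteq> alphabet n" "\<And>v. x v \<noteq> 0"
  shows "neg_part B (signed_var x) * pos_part C (signed_var x) =
    monomial n x (\<lambda>v. int (count_list C (int v)) - int (count_list B (- int v)))"
  unfolding pos_part_signed_var[OF assms(2)] neg_part_signed_var[OF assms(1)] monomial_def prod.distrib[symmetric]
  by (rule prod.cong) (simp_all add: power_int_diff assms(3) power_inverse field_simps)

lemma prod_list_monomial:
  assumes "\<And>v. x v \<noteq> 0"
  shows "prod_list (map (\<lambda>i. monomial n x (\<mu> i)) is) = monomial n x (\<lambda>v. \<Sum>i\<leftarrow>is. \<mu> i v)"
  by (induction "is") (simp_all add: monomial_def prod.distrib[symmetric] power_int_add assms)

lemma prod_list_label_weight_block:
  assumes "1 \<le> conj_part n lam i"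
  shows "prod_list (map (\<lambda>l. label_weight n lam y l (f l)) (block n lam i)) =
    neg_part (f (if conj_part n lam i = 1 then Unprimed i 1 else Primed i 2)) y * pos_part (f (Unprimed i 1)) y"
proof -
  define c where "c = conj_part n lam i"
  have c: "1 \<le> c" using assms by (simp add: c_def)
  have P: "prod_list (map (\<lambda>j. label_weight n lam y (Primed i j) (f (Primed i j))) [2..<c + 1]) =
      (if c = 1 then 1 else neg_part (f (Primed i 2)) y)"
  proof -
    have "prod_list (map (\<lambda>j. label_weight n lam y (Primed i j) (f (Primed i j))) [2..<c + 1]) =
        (\<Prod>j\<in>{2..<c + 1}. if j = 2 then neg_part (f (Primed i 2)) y else 1)"
      unfolding prod.distinct_set_conv_list[OF distinct_upt, symmetric] set_upt
      by (rule prod.cong) (simp_all add: label_weight_def)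
    also have "\<dots> = (if c = 1 then 1 else neg_part (f (Primed i 2)) y)"
      using c by (subst prod.delta) auto
    finally show ?thesis .
  qed
  have U: "prod_list (map (\<lambda>j. label_weight n lam y (Unprimed i j) (f (Unprimed i j))) [1..<m + 1]) =
      (if c = 1 then neg_part (f (Unprimed i 1)) y else 1) * pos_part (f (Unprimed i 1)) y" if "1 \<le> m" for m
  proof -
    have "prod_list (map (\<lambda>j. label_weight n lam y (Unprimed i j) (f (Unprimed i j))) [1..<m + 1]) =
        (\<Prod>j\<in>{1..<m + 1}. if j = 1 then (if c = 1 then neg_part (f (Unprimed i 1)) y else 1) * pos_part (f (Unprimed i 1)) y else 1)"
      unfolding prod.distinct_set_conv_list[OF distinct_upt, symmetric] set_upt
      by (rule prod.cong) (simp_all add: label_weight_def c_def)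
    also have "\<dots> = (if c = 1 then neg_part (f (Unprimed i 1)) y else 1) * pos_part (f (Unprimed i 1)) y"
      using that by (subst prod.delta) auto
    finally show ?thesis .
  qed
  have "prod_list (map (\<lambda>l. label_weight n lam y l (f l)) (block n lam i)) =
     prod_list (map (\<lambda>j. label_weight n lam y (Primed i j) (f (Primed i j))) [2..<c + 1]) *
     prod_list (map (\<lambda>j. label_weight n lam y (Unprimed i j) (f (Unprimed i j))) [1..<(if i = 1 then 1 else c) + 1])"
    by (simp only: block_def c_def map_append prod_list.append map_map o_def)
  also have "\<dots> = (if c = 1 then 1 else neg_part (f (Primed i 2)) y) *
     ((if c = 1 then neg_part (f (Unprimed i 1)) y else 1) * pos_part (f (Unprimed i 1)) y)"
    unfolding P using c by (subst U) simp_all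
  finally show ?thesis by (simp add: c_def)
qed

lemma prod_list_map_concat: "prod_list (map f (concat xss)) = prod_list (map (\<lambda>xs. prod_list (map f xs)) xss)"
  for f :: "'a \<Rightarrow> 'b::monoid_mult"
  by (induction xss) simp_all

lemma prod_list_label_weight:
  assumes n: "1 \<le> n" and \<sigma>: "\<sigma> \<in> fillings n lam" and x: "\<And>v. x v \<noteq> 0"
  shows "prod_list (map2 (label_weight n lam (signed_var x)) (labels n lam) \<sigma>) = monomial n x (ct n lam \<sigma>)"
proof -
  define f where "f b = column n lam \<sigma> (if conj_part n lam b = 1 then Unprimed b 1 else Primed b 2)" for b
  define g where "g b = column n lam \<sigma> (Unprimed b 1)" for b
  define bs where "bs = rev [1..<lam 1 + 1]"
  have len: "length \<sigma> = length (labels n lam)" using \<sigma> by (simp add: fillings_def)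
  have c1: "1 \<le> conj_part n lam b" if "b \<in> set bs" for b
  proof -
    have b: "1 \<le> b" "b \<le> lam 1" using that by (auto simp: bs_def)
    then have "1 \<in> {k \<in> {1..n}. b \<le> lam k}" using n by auto
    then have "conj_part n lam b \<noteq> 0" unfolding conj_part_def by (subst card_0_eq) auto
    then show ?thesis by simp
  qed
  have sub: "set (column n lam \<sigma> l) \<subseteq> alphabet n" if l: "l \<in> set (labels n lam)" for l
  proof -
    obtain q where q: "q < length (labels n lam)" "l = labels n lam ! q" using l by (auto simp: in_set_conv_nth)
    then have "column n lam \<sigma> l = \<sigma> ! q" using column_nth[OF len] len by simp
    moreover have "\<forall>q < length \<sigma>. set (\<sigma> ! q) \<subseteq> alphabet n" using \<sigma> unfolding fillings_def by simp
    ultimately show ?thesis using q(1) len by simp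
  qed
  have lab: "set (block n lam b) \<subseteq> set (labels n lam)" if "b \<in> set bs" for b
    using that by (auto simp: labels_def bs_def)
  have inb: "Unprimed b 1 \<in> set (block n lam b)" "(if conj_part n lam b = 1 then Unprimed b 1 else Primed b 2) \<in> set (block n lam b)"
    if "b \<in> set bs" for b
    using c1[OF that] by (auto simp: block_def)
  have fg: "set (f b) \<subseteq> alphabet n" "set (g b) \<subseteq> alphabet n" if "b \<in> set bs" for b
    unfolding f_def g_def using inb[OF that] lab[OF that] by (blast intro!: sub)+
  have "map2 (label_weight n lam (signed_var x)) (labels n lam) \<sigma> =
      map (\<lambda>l. label_weight n lam (signed_var x) l (column n lam \<sigma> l)) (labels n lam)"
    by (rule nth_equalityI) (use len column_nth[OF len] in simp_all)
  then have "prod_list (map2 (label_weight n lam (signed_var x)) (labels n lam) \<sigma>) =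
      prod_list (map (\<lambda>l. label_weight n lam (signed_var x) l (column n lam \<sigma> l)) (labels n lam))"
    by (rule arg_cong)
  also have "\<dots> = prod_list (map (\<lambda>b. prod_list (map (\<lambda>l. label_weight n lam (signed_var x) l (column n lam \<sigma> l)) (block n lam b))) bs)"
    unfolding labels_def bs_def prod_list_map_concat map_map o_def by (rule HOL.refl)
  also have "map (\<lambda>b. prod_list (map (\<lambda>l. label_weight n lam (signed_var x) l (column n lam \<sigma> l)) (block n lam b))) bs =
      map (\<lambda>b. monomial n x (\<lambda>v. int (count_list (g b) (int v)) - int (count_list (f b) (- int v)))) bs"
  proof (rule map_cong[OF HOL.refl])
    fix b assume b: "b \<in> set bs"
    show "prod_list (map (\<lambda>l. label_weight n lam (signed_var x) l (column n lam \<sigma> l)) (block n lam b)) =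
        monomial n x (\<lambda>v. int (count_list (g b) (int v)) - int (count_list (f b) (- int v)))"
      unfolding prod_list_label_weight_block[OF c1[OF b]] f_def[symmetric] g_def[symmetric]
      by (rule neg_part_pos_part_signed_var[OF fg[OF b] x])
  qed
  also have "prod_list \<dots> = monomial n x (\<lambda>v. \<Sum>b\<leftarrow>bs. int (count_list (g b) (int v)) - int (count_list (f b) (- int v)))"
    by (rule prod_list_monomial[OF x])
  also have "\<dots> = monomial n x (ct n lam \<sigma>)"
    unfolding monomial_def
  proof (rule prod.cong[OF HOL.refl])
    fix v assume v: "v \<in> {1..n}"
    \<comment> \<open>Equality of the absolute values converts half of the joint content of
      \<open>f b\<close> and \<open>g b\<close> into the positive letters of \<open>g b\<close>
      minus the negative letters of \<open>f b\<close>.\<close>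
    have eq: "count_list (f b) (int v) + count_list (f b) (- int v) = count_list (g b) (int v) + count_list (g b) (- int v)"
      if b: "b \<in> set bs" for b
    proof -
      have b': "1 \<le> b" "b \<le> lam 1" using b by (auto simp: bs_def)
      have "mset (map abs (f b)) = mset (map abs (g b))"
        using mset_abs_compressed[OF \<sigma> b'] c1[OF b] by (cases "conj_part n lam b = 1") (auto simp: f_def g_def)
      then have "count_list (map abs (f b)) (int v) = count_list (map abs (g b)) (int v)" by (metis count_mset)
      then show ?thesis using v by (simp add: count_list_map_abs)
    qed
    have "(\<Sum>b\<leftarrow>bs. int (count_list (f b) (int v) + count_list (g b) (int v)))
       - (\<Sum>b\<leftarrow>bs. int (count_list (f b) (- int v) + count_list (g b) (- int v))) =
       2 * (\<Sum>b\<leftarrow>bs. int (count_list (g b) (int v)) - int (count_list (f b) (- int v)))"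
      using eq
    proof (induction bs)
      case (Cons b bs)
      have "int (count_list (f b) (int v)) + int (count_list (f b) (- int v)) =
          int (count_list (g b) (int v)) + int (count_list (g b) (- int v))"
        using Cons.prems[of b] by (simp flip: of_nat_add)
      then show ?case using Cons by simp
    qed simp
    moreover have "2 * ct n lam \<sigma> v = (\<Sum>b\<leftarrow>bs. int (count_list (f b) (int v) + count_list (g b) (int v)))
       - (\<Sum>b\<leftarrow>bs. int (count_list (f b) (- int v) + count_list (g b) (- int v)))"
      unfolding two_ct[OF n \<sigma>] double_ct_def compressed_def count_list_concat_pairs int_sum_list_map f_def g_def bs_def
      by (rule HOL.refl)
    ultimately show "x v powi (\<Sum>b\<leftarrow>bs. int (count_list (g b) (int v)) - int (count_list (f b) (- int v))) = x v powi ct n lam \<sigma> v"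
      by simp
  qed
  finally show ?thesis .
qed


section \<open>Hall--Littlewood polynomials as sums over words\<close>

lemma partial_hl_expand:
  assumes "D \<in> words n k"
  shows "partial_hl n t \<mu> r D y = (\<Sum>w | w \<in> words n (k + r) \<and> take k w = D.
    position_weight \<mu> w y * (\<Prod>p\<in>{k + 1..k + r}. \<Prod>a\<in>free_letters n (take (p - 1) w) - {entry w p}. root_factor t y a (entry w p)))"
  using assms
proof (induction r arbitrary: D k)
  case 0
  then have "{w. w \<in> words n (k + 0) \<and> take k w = D} = {D}" by (auto simp: words_def)
  then show ?case by simp
next
  case (Suc r)
  define S where "S = (\<lambda>e. {w. w \<in> words n (Suc k + r) \<and> take (Suc k) w = D @ [e]})"
  define Q where "Q = (\<lambda>w p. \<Prod>a\<in>free_letters n (take (p - 1) w) - {entry w p}. root_factor t y a (entry w p))"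
  have lD: "length D = k" using Suc.prems by (simp add: words_def)
  have Un: "{w. w \<in> words n (k + Suc r) \<and> take k w = D} = (\<Union>e\<in>free_letters n D. S e)"
  proof (intro equalityI subsetI)
    fix w assume w: "w \<in> {w. w \<in> words n (k + Suc r) \<and> take k w = D}"
    then have lw: "length w = k + Suc r" and wd: "set w \<subseteq> alphabet n" "distinct (map abs w)" and tk: "take k w = D"
      by (simp_all add: words_def)
    have tS: "take (Suc k) w = D @ [w ! k]" using lw tk by (simp add: take_Suc_conv_app_nth)
    have "w = D @ w ! k # drop (Suc k) w" using id_take_nth_drop[of k w] lw tk by simp
    then have "w ! k \<in> free_letters n D" using wd
      by (metis (no_types, lifting) distinct_append list.simps(9) map_append distinct.simps(2) free_letters_def in_set_conv_decomp mem_Collect_eq not_distinct_conv_prefix set_map subset_iff)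
    then show "w \<in> (\<Union>e\<in>free_letters n D. S e)" using w tS by (auto simp: S_def)
  next
    fix w assume "w \<in> (\<Union>e\<in>free_letters n D. S e)"
    then obtain e where e: "w \<in> words n (Suc k + r)" "take (Suc k) w = D @ [e]" by (auto simp: S_def)
    have "take k w = take k (take (Suc k) w)" by simp
    also have "\<dots> = D" unfolding e(2) using lD by simp
    finally show "w \<in> {w. w \<in> words n (k + Suc r) \<and> take k w = D}" using e by simp
  qed
  have fin: "finite (S e)" for e by (rule finite_subset[OF _ finite_words[of n "Suc k + r"]]) (auto simp: S_def)
  have "partial_hl n t \<mu> (Suc r) D y = (\<Sum>e\<in>free_letters n D. \<Sum>w\<in>S e. position_weight \<mu> w y * (\<Prod>p\<in>{k + 1..k + Suc r}. Q w p))"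
    unfolding partial_hl.simps
  proof (rule sum.cong[OF HOL.refl])
    fix e assume e: "e \<in> free_letters n D"
    have "D @ [e] \<in> words n (Suc k)" using e Suc.prems by (simp add: words_snoc free_letters_def)
    then have "partial_hl n t \<mu> r (D @ [e]) y = (\<Sum>w\<in>S e. position_weight \<mu> w y * (\<Prod>p\<in>{Suc k + 1..Suc k + r}. Q w p))"
      unfolding S_def Q_def by (rule Suc.IH)
    moreover have "(\<Prod>p\<in>{k + 1..k + Suc r}. Q w p) =
        (\<Prod>a\<in>free_letters n D - {e}. root_factor t y a e) * (\<Prod>p\<in>{Suc k + 1..Suc k + r}. Q w p)" if w: "w \<in> S e" for w
    proof -
      have tw: "take (Suc k) w = D @ [e]" using w by (simp add: S_def)
      have "take k w = take k (take (Suc k) w)" "w ! k = take (Suc k) w ! k" by simp_all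
      then have "take k w = D" "w ! k = e" unfolding tw using lD by (simp_all add: nth_append)
      then have "Q w (k + 1) = (\<Prod>a\<in>free_letters n D - {e}. root_factor t y a e)" by (simp add: Q_def)
      moreover have "{k + 1..k + Suc r} = insert (k + 1) {Suc k + 1..Suc k + r}" by auto
      ultimately show ?thesis by (simp only:) (subst prod.insert, auto)
    qed
    ultimately show "(\<Prod>a\<in>free_letters n D - {e}. root_factor t y a e) * partial_hl n t \<mu> r (D @ [e]) y =
        (\<Sum>w\<in>S e. position_weight \<mu> w y * (\<Prod>p\<in>{k + 1..k + Suc r}. Q w p))"
      by (simp add: sum_distrib_left algebra_simps)
  qed
  also have "\<dots> = (\<Sum>w\<in>(\<Union>e\<in>free_letters n D. S e). position_weight \<mu> w y * (\<Prod>p\<in>{k + 1..k + Suc r}. Q w p))"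
    by (rule sum.UNION_disjoint[symmetric]) (use fin in \<open>auto simp: S_def\<close>)
  finally show ?case unfolding Un[symmetric] Q_def .
qed

text \<open>A word of full height contains each absolute value once. So the letters free at position
  \<open>p\<close> are the entries from \<open>p\<close> on, with both signs.\<close>

lemma prod_free_letters:
  assumes w: "w \<in> words n n" and p: "p \<in> {1..n}"
  shows "(\<Prod>a\<in>free_letters n (take (p - 1) w) - {entry w p}. F a) =
    F (- entry w p) * (\<Prod>q\<in>{p + 1..n}. F (entry w q) * F (- entry w q))"
proof -
  have len: "length w = n" and dist: "distinct (map abs w)" and sub: "set w \<subseteq> alphabet n" using w by (simp_all add: words_def)
  have inj: "a = b" if "\<bar>entry w a\<bar> = \<bar>entry w b\<bar>" "a \<in> {1..n}" "b \<in> {1..n}" for a b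
  proof -
    have ab: "a - 1 < length (map abs w)" "b - 1 < length (map abs w)" using that(2,3) len by auto
    then have "map abs w ! (a - 1) = map abs w ! (b - 1)" using that(1) len by (simp add: nth_map)
    then have "a - 1 = b - 1" using nth_eq_iff_index_eq[OF dist ab] by blast
    then show ?thesis using that(2,3) by auto
  qed
  have mem: "entry w q \<in> alphabet n" if "q \<in> {1..n}" for q using sub len that by (auto simp: subset_iff)
  have nz: "entry w q \<noteq> 0" if "q \<in> {1..n}" for q using mem[OF that] by (simp add: alphabet_def)
  have taken: "e \<in> abs ` set (take (p - 1) w) \<longleftrightarrow> (\<exists>q\<in>{1..<p}. e = \<bar>entry w q\<bar>)" for e
  proof
    assume "e \<in> abs ` set (take (p - 1) w)"
    then obtain k where "k < p - 1" "e = \<bar>w ! k\<bar>" using len by (auto simp: in_set_conv_nth)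
    then have "Suc k \<in> {1..<p}" "e = \<bar>entry w (Suc k)\<bar>" by auto
    then show "\<exists>q\<in>{1..<p}. e = \<bar>entry w q\<bar>" by blast
  next
    assume "\<exists>q\<in>{1..<p}. e = \<bar>entry w q\<bar>"
    then obtain q where q: "1 \<le> q" "q < p" "e = \<bar>entry w q\<bar>" by auto
    then have "q - 1 < length (take (p - 1) w)" "take (p - 1) w ! (q - 1) = entry w q" using p len by simp_all
    then have "entry w q \<in> set (take (p - 1) w)" by (metis nth_mem)
    then show "e \<in> abs ` set (take (p - 1) w)" using q(3) by blast
  qed
  define B where "B = (\<lambda>q. {entry w q, - entry w q})"
  have eq: "free_letters n (take (p - 1) w) - {entry w p} = insert (- entry w p) (\<Union>q\<in>{p + 1..n}. B q)"
  proof (intro equalityI subsetI)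
    fix a assume a: "a \<in> free_letters n (take (p - 1) w) - {entry w p}"
    then have "a \<in> alphabet n" by (simp add: free_letters_def)
    then have "\<bar>a\<bar> \<in> abs ` set w" unfolding abs_set_words[OF w] by (auto simp: alphabet_def)
    then obtain k where k: "k < n" "\<bar>a\<bar> = \<bar>w ! k\<bar>" using len by (auto simp: in_set_conv_nth)
    then have q: "Suc k \<in> {1..n}" "\<bar>a\<bar> = \<bar>entry w (Suc k)\<bar>" by auto
    have "\<not> Suc k < p"
    proof
      assume "Suc k < p"
      then have "Suc k \<in> {1..<p}" by simp
      then have "\<bar>a\<bar> \<in> abs ` set (take (p - 1) w)" unfolding taken using q(2) by blast
      then show False using a by (simp add: free_letters_def)
    qed
    moreover have "a = entry w (Suc k) \<or> a = - entry w (Suc k)" using q(2) by (auto simp: abs_eq_iff)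
    ultimately show "a \<in> insert (- entry w p) (\<Union>q\<in>{p + 1..n}. B q)"
      using a q(1) by (cases "Suc k = p") (auto simp: B_def intro!: bexI[of _ "Suc k"])
  next
    fix a assume "a \<in> insert (- entry w p) (\<Union>q\<in>{p + 1..n}. B q)"
    then consider "a = - entry w p" | q where "q \<in> {p + 1..n}" "a = entry w q \<or> a = - entry w q" by (auto simp: B_def)
    then show "a \<in> free_letters n (take (p - 1) w) - {entry w p}"
    proof cases
      case 1
      have "\<bar>a\<bar> \<notin> abs ` set (take (p - 1) w)" unfolding taken using 1 p inj[of p] by fastforce
      then show ?thesis using 1 mem[OF p] nz[OF p] by (simp add: free_letters_def)
    next
      case (2 q)
      then have q: "q \<in> {1..n}" "\<bar>a\<bar> = \<bar>entry w q\<bar>" by auto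
      have "\<bar>a\<bar> \<notin> abs ` set (take (p - 1) w)" unfolding taken q(2) using 2(1) p inj[of q] q(1) by fastforce
      moreover have "a \<noteq> entry w p" using inj[of q p] q p 2(1) by auto
      moreover have "a \<in> alphabet n" using 2(2) mem[OF q(1)] by auto
      ultimately show ?thesis by (simp add: free_letters_def)
    qed
  qed
  have out: "- entry w p \<notin> (\<Union>q\<in>{p + 1..n}. B q)"
  proof
    assume "- entry w p \<in> (\<Union>q\<in>{p + 1..n}. B q)"
    then obtain q where q: "q \<in> {p + 1..n}" "- entry w p = entry w q \<or> - entry w p = - entry w q" by (auto simp: B_def)
    then have "\<bar>entry w p\<bar> = \<bar>entry w q\<bar>" by auto
    then show False using inj[of p q] q(1) p by auto
  qed
  have "(\<Prod>a\<in>(\<Union>q\<in>{p + 1..n}. B q). F a) = (\<Prod>q\<in>{p + 1..n}. \<Prod>a\<in>B q. F a)"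
  proof (rule prod.UNION_disjoint)
    show "\<forall>i\<in>{p + 1..n}. \<forall>j\<in>{p + 1..n}. i \<noteq> j \<longrightarrow> B i \<inter> B j = {}"
    proof (intro ballI impI)
      fix i j assume ij: "i \<in> {p + 1..n}" "j \<in> {p + 1..n}" "i \<noteq> j"
      have B: "\<bar>a\<bar> = \<bar>entry w q\<bar>" if "a \<in> B q" for a q using that by (auto simp: B_def)
      have False if "a \<in> B i" "a \<in> B j" for a
        using B[OF that(1)] B[OF that(2)] inj[of i j] ij by simp
      then show "B i \<inter> B j = {}" by blast
    qed
  qed (simp_all add: B_def)
  also have "\<dots> = (\<Prod>q\<in>{p + 1..n}. F (entry w q) * F (- entry w q))"
  proof (rule prod.cong[OF HOL.refl])
    fix q assume "q \<in> {p + 1..n}"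
    then have "entry w q \<noteq> - entry w q" using nz[of q] by simp
    then show "(\<Prod>a\<in>B q. F a) = F (entry w q) * F (- entry w q)" by (simp add: B_def)
  qed
  finally show ?thesis unfolding eq by (subst prod.insert[OF _ out]) (simp_all add: B_def)
qed

lemma monomial_eps:
  assumes z: "\<And>i. i \<in> {1..n} \<Longrightarrow> z i \<noteq> 0"
  shows "monomial n z (\<lambda>i. - (eps p i + eps q i)) = (if p \<in> {1..n} then inverse (z p) else 1) * (if q \<in> {1..n} then inverse (z q) else 1)"
    and "monomial n z (\<lambda>i. - (eps p i - eps q i)) = (if p \<in> {1..n} then inverse (z p) else 1) * (if q \<in> {1..n} then z q else 1)"
    and "monomial n z (\<lambda>i. - (2 * eps p i)) = (if p \<in> {1..n} then inverse (z p) * inverse (z p) else 1)"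
proof -
  have d: "(\<Prod>i = 1..n. if p = i then c i else 1) = (if p \<in> {1..n} then c p else 1)" for c :: "nat \<Rightarrow> 'a" and p
    by (subst prod.delta') simp_all
  have e: "z i powi (- (eps p i + eps q i)) = (if p = i then inverse (z i) else 1) * (if q = i then inverse (z i) else 1)"
    "z i powi (- (eps p i - eps q i)) = (if p = i then inverse (z i) else 1) * (if q = i then z i else 1)"
    "z i powi (- (2 * eps p i)) = (if p = i then inverse (z i) * inverse (z i) else 1)" if "i \<in> {1..n}" for i
    using z[OF that] by (auto simp: eps_def power_int_minus power2_eq_square)
  show "monomial n z (\<lambda>i. - (eps p i + eps q i)) = (if p \<in> {1..n} then inverse (z p) else 1) * (if q \<in> {1..n} then inverse (z q) else 1)"
    unfolding monomial_def by (simp only: e prod.distrib d cong: prod.cong)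
  show "monomial n z (\<lambda>i. - (eps p i - eps q i)) = (if p \<in> {1..n} then inverse (z p) else 1) * (if q \<in> {1..n} then z q else 1)"
    unfolding monomial_def by (simp only: e prod.distrib d cong: prod.cong)
  show "monomial n z (\<lambda>i. - (2 * eps p i)) = (if p \<in> {1..n} then inverse (z p) * inverse (z p) else 1)"
    unfolding monomial_def by (simp only: e d cong: prod.cong)
qed

text \<open>Grouping the roots by their first index matches the order in which letters are appended
  to a word. As the product runs over a set of functions, no root may be listed twice: differences
  are recognized by a value \<open>- 1\<close>, long roots by a value \<open>2\<close>.\<close>

lemma prod_pos_roots:
  "(\<Prod>\<alpha>\<in>pos_roots n. F \<alpha>) = (\<Prod>p = 1..n. F (\<lambda>k. 2 * eps p k) *
     (\<Prod>q\<in>{p + 1..n}. F (\<lambda>k. eps p k - eps q k) * F (\<lambda>k. eps p k + eps q k)))"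
proof -
  define P where "P = (SIGMA p:{1..n}. {p + 1..n})"
  define f g where "f = (\<lambda>(p, q) k. eps p k + eps q k)" and "g = (\<lambda>(p, q) k. eps p k - eps q k)"
  define h where "h = (\<lambda>p k. 2 * eps p k)"
  have roots: "pos_roots n = f ` P \<union> (g ` P \<union> h ` {1..n})"
  proof -
    have im: "{G i j | i j. 1 \<le> i \<and> i < j \<and> j \<le> n} = (\<lambda>(i, j). G i j) ` P" for G :: "nat \<Rightarrow> nat \<Rightarrow> nat \<Rightarrow> int"
    proof -
      have "P = {(i, j). 1 \<le> i \<and> i < j \<and> j \<le> n}" by (auto simp: P_def)
      then show ?thesis by auto
    qed
    have "{(\<lambda>k. eps i k + eps j k) | i j. 1 \<le> i \<and> i < j \<and> j \<le> n} = f ` P" unfolding im f_def by (rule HOL.refl)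
    moreover have "{(\<lambda>k. eps i k - eps j k) | i j. 1 \<le> i \<and> i < j \<and> j \<le> n} = g ` P" unfolding im g_def by (rule HOL.refl)
    moreover have "{(\<lambda>k. 2 * eps i k) | i. 1 \<le> i \<and> i \<le> n} = h ` {1..n}"
      by (auto simp: h_def image_iff)
    ultimately show ?thesis unfolding pos_roots_def by (simp only: Un_assoc)
  qed
  have fv: "f (p, q) k = (if k = p \<or> k = q then 1 else 0)" if "(p, q) \<in> P" for p q k
    using that by (auto simp: f_def eps_def P_def)
  have gv: "g (p, q) k = (if k = p then 1 else if k = q then - 1 else 0)" if "(p, q) \<in> P" for p q k
    using that by (auto simp: g_def eps_def P_def)
  have hv: "h p k = (if k = p then 2 else 0)" for p k by (simp add: h_def eps_def)
  have less: "p < q" if "(p, q) \<in> P" for p q using that by (auto simp: P_def)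
  have f: "inj_on f P"
  proof (rule inj_onI)
    fix a b assume a: "a \<in> P" and b: "b \<in> P" and eq: "f a = f b"
    obtain p q r s where ab: "a = (p, q)" "b = (r, s)" by (cases a, cases b)
    have P: "(p, q) \<in> P" "(r, s) \<in> P" using a b ab by simp_all
    have "k = p \<or> k = q \<longleftrightarrow> k = r \<or> k = s" for k
    proof -
      have "f (p, q) k = f (r, s) k" using eq ab by simp
      then show ?thesis unfolding fv[OF P(1)] fv[OF P(2)] by (simp split: if_splits)
    qed
    from this[of p] this[of q] have "(p = r \<or> p = s) \<and> (q = r \<or> q = s)" by simp
    then have "p = r \<and> q = s" using less[OF P(1)] less[OF P(2)] by linarith
    then show "a = b" using ab by simp
  qed
  have g: "inj_on g P"
  proof (rule inj_onI)
    fix a b assume a: "a \<in> P" and b: "b \<in> P" and eq: "g a = g b"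
    obtain p q r s where ab: "a = (p, q)" "b = (r, s)" by (cases a, cases b)
    have P: "(p, q) \<in> P" "(r, s) \<in> P" using a b ab by simp_all
    have "g (r, s) = g (p, q)" using eq ab by simp
    then have "g (r, s) p = 1" "g (r, s) q = - 1" using gv[OF P(1)] less[OF P(1)] by simp_all
    then have "p = r \<and> q = s" unfolding gv[OF P(2)] by (simp split: if_splits)
    then show "a = b" using ab by simp
  qed
  have h: "inj_on h {1..n}"
  proof (rule inj_onI)
    fix p q assume "h p = h q"
    then have "h q p = 2" using hv[of p p] by simp
    then show "p = q" by (simp add: hv split: if_splits)
  qed
  have fin: "finite P" by (simp add: P_def)
  have neg: "\<exists>k. \<alpha> k = - 1" if \<alpha>: "\<alpha> \<in> g ` P" for \<alpha>
  proof -
    obtain p q where pq: "(p, q) \<in> P" "\<alpha> = g (p, q)" using \<alpha> by fast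
    have "g (p, q) q = - 1" using gv[OF pq(1)] less[OF pq(1)] by simp
    then show ?thesis unfolding pq(2) by blast
  qed
  have two: "\<exists>k. \<alpha> k = 2" "\<alpha> k \<noteq> - 1" if \<alpha>: "\<alpha> \<in> h ` {1..n}" for \<alpha> k
  proof -
    obtain p where p: "\<alpha> = h p" using \<alpha> by blast
    have "h p p = 2" by (simp add: hv)
    then show "\<exists>k. \<alpha> k = 2" unfolding p by blast
    show "\<alpha> k \<noteq> - 1" unfolding p hv by simp
  qed
  have f01: "\<alpha> k = 0 \<or> \<alpha> k = 1" if \<alpha>: "\<alpha> \<in> f ` P" for \<alpha> k
  proof -
    obtain p q where pq: "(p, q) \<in> P" "\<alpha> = f (p, q)" using \<alpha> by fast
    then show ?thesis unfolding pq(2) fv[OF pq(1)] by simp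
  qed
  have disj1: "f ` P \<inter> (g ` P \<union> h ` {1..n}) = {}"
  proof -
    have False if \<alpha>: "\<alpha> \<in> f ` P" "\<alpha> \<in> g ` P" for \<alpha>
    proof -
      obtain k where "\<alpha> k = - 1" using neg[OF \<alpha>(2)] by blast
      then show False using f01[OF \<alpha>(1), of k] by simp
    qed
    moreover have False if \<alpha>: "\<alpha> \<in> f ` P" "\<alpha> \<in> h ` {1..n}" for \<alpha>
    proof -
      obtain k where "\<alpha> k = 2" using two(1)[OF \<alpha>(2)] by blast
      then show False using f01[OF \<alpha>(1), of k] by simp
    qed
    ultimately show ?thesis by blast
  qed
  have disj2: "g ` P \<inter> h ` {1..n} = {}" using neg two(2) by blast
  have "(\<Prod>\<alpha>\<in>pos_roots n. F \<alpha>) = (\<Prod>\<alpha>\<in>f ` P. F \<alpha>) * ((\<Prod>\<alpha>\<in>g ` P. F \<alpha>) * (\<Prod>\<alpha>\<in>h ` {1..n}. F \<alpha>))"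
  proof -
    have "(\<Prod>\<alpha>\<in>f ` P \<union> (g ` P \<union> h ` {1..n}). F \<alpha>) = (\<Prod>\<alpha>\<in>f ` P. F \<alpha>) * (\<Prod>\<alpha>\<in>g ` P \<union> h ` {1..n}. F \<alpha>)"
      by (rule prod.union_disjoint[OF _ _ disj1]) (use fin in simp_all)
    moreover have "(\<Prod>\<alpha>\<in>g ` P \<union> h ` {1..n}. F \<alpha>) = (\<Prod>\<alpha>\<in>g ` P. F \<alpha>) * (\<Prod>\<alpha>\<in>h ` {1..n}. F \<alpha>)"
      by (rule prod.union_disjoint[OF _ _ disj2]) (use fin in simp_all)
    ultimately show ?thesis unfolding roots by (simp only:)
  qed
  also have "\<dots> = (\<Prod>a\<in>P. F (f a)) * ((\<Prod>a\<in>P. F (g a)) * (\<Prod>p\<in>{1..n}. F (h p)))"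
    by (simp only: prod.reindex[OF f] prod.reindex[OF g] prod.reindex[OF h] o_def)
  also have "\<dots> = (\<Prod>p\<in>{1..n}. F (h p)) * (\<Prod>a\<in>P. F (g a) * F (f a))"
    by (simp only: prod.distrib mult_ac)
  also have "(\<Prod>a\<in>P. F (g a) * F (f a)) = (\<Prod>p\<in>{1..n}. \<Prod>q\<in>{p + 1..n}. F (g (p, q)) * F (f (p, q)))"
  proof -
    have "(\<Prod>a\<in>P. F (g a) * F (f a)) = (\<Prod>(p, q)\<in>P. F (g (p, q)) * F (f (p, q)))" by (rule prod.cong) auto
    also have "\<dots> = (\<Prod>p\<in>{1..n}. \<Prod>q\<in>{p + 1..n}. F (g (p, q)) * F (f (p, q)))"
      unfolding P_def by (rule prod.Sigma[symmetric]) simp_all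
    finally show ?thesis .
  qed
  finally show ?thesis unfolding prod.distrib[of _ _ "{1..n}", symmetric] f_def g_def h_def prod.case .
qed

lemma hl_term_cong: "(\<And>i. i \<in> {1..n} \<Longrightarrow> z i = z' i) \<Longrightarrow> hl_term n lam z t = hl_term n lam z' t"
proof -
  assume "\<And>i. i \<in> {1..n} \<Longrightarrow> z i = z' i"
  then have "monomial n z \<mu> = monomial n z' \<mu>" for \<mu> unfolding monomial_def by (intro prod.cong) simp_all
  then show ?thesis unfolding hl_term_def by (simp only:)
qed

text \<open>Among the letters free at position \<open>p\<close>, the negative of the entry gives the
  long root at \<open>p\<close>, and the entry at a later position \<open>q\<close> and its negative
  give the two short roots at \<open>p\<close> and \<open>q\<close>.\<close>

lemma hl_term_word:
  assumes y: "generic n y" and w: "w \<in> words n n" and \<mu>: "\<And>p. p \<in> {1..n} \<Longrightarrow> \<mu> p = lam p"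
  shows "hl_term n lam (\<lambda>p. y (entry w p)) t = position_weight \<mu> w y *
    (\<Prod>p = 1..n. \<Prod>a\<in>free_letters n (take (p - 1) w) - {entry w p}. root_factor t y a (entry w p))"
proof -
  define z where "z = (\<lambda>p. y (entry w p))"
  have mem: "entry w p \<in> alphabet n" if "p \<in> {1..n}" for p
    using w that by (auto simp: words_def subset_iff)
  have z: "z p \<noteq> 0" "y (- entry w p) = inverse (z p)" if "p \<in> {1..n}" for p
    using y mem[OF that] by (simp_all add: generic_def z_def)
  have rf: "(1 - t * (inverse a * b)) / (1 - inverse a * b) = (a - t * b) / (a - b)" if "a \<noteq> 0" for a b :: 'a
  proof -
    have "1 - t * (inverse a * b) = inverse a * (a - t * b)" "1 - inverse a * b = inverse a * (a - b)"
      using that by (simp_all add: algebra_simps)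
    then show ?thesis using that by simp
  qed
  define F where "F = (\<lambda>\<alpha>. (1 - t * monomial n z (\<lambda>i. - \<alpha> i)) / (1 - monomial n z (\<lambda>i. - \<alpha> i)))"
  have m: "monomial n z (\<lambda>i. - (2 * eps p i)) = inverse (z p) * inverse (z p)" if "p \<in> {1..n}" for p
    using monomial_eps(3)[of n z p] z(1) that by simp
  have m': "monomial n z (\<lambda>i. - (eps p i - eps q i)) = inverse (z p) * z q"
    "monomial n z (\<lambda>i. - (eps p i + eps q i)) = inverse (z p) * inverse (z q)" if "p \<in> {1..n}" "q \<in> {1..n}" for p q
    using monomial_eps(1,2)[of n z p q] z(1) that by simp_all
  have F: "F (\<lambda>k. 2 * eps p k) = root_factor t y (- entry w p) (entry w p)" if "p \<in> {1..n}" for p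
    unfolding F_def m[OF that] rf[OF z(1)[OF that]] root_factor_def z(2)[OF that]
    by (simp add: z_def)
  have F': "F (\<lambda>k. eps p k - eps q k) * F (\<lambda>k. eps p k + eps q k) =
      root_factor t y (entry w q) (entry w p) * root_factor t y (- entry w q) (entry w p)"
    if p: "p \<in> {1..n}" and q: "q \<in> {1..n}" for p q
    unfolding F_def m'[OF p q] rf[OF z(1)[OF p]] root_factor_def z(2)[OF q]
    by (simp add: z_def)
  have "monomial n z (\<lambda>i. int (lam i)) = position_weight \<mu> w y"
    unfolding monomial_def position_weight_def z_def
    by (rule prod.cong) (use w \<mu> in \<open>auto simp: words_def\<close>)
  moreover have "(\<Prod>\<alpha>\<in>pos_roots n. F \<alpha>) =
      (\<Prod>p = 1..n. \<Prod>a\<in>free_letters n (take (p - 1) w) - {entry w p}. root_factor t y a (entry w p))"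
    unfolding prod_pos_roots
  proof (rule prod.cong[OF HOL.refl])
    fix p assume p: "p \<in> {1..n}"
    have "(\<Prod>q\<in>{p + 1..n}. F (\<lambda>k. eps p k - eps q k) * F (\<lambda>k. eps p k + eps q k)) =
        (\<Prod>q\<in>{p + 1..n}. root_factor t y (entry w q) (entry w p) * root_factor t y (- entry w q) (entry w p))"
      by (rule prod.cong[OF HOL.refl], rule F'[OF p]) auto
    then show "F (\<lambda>k. 2 * eps p k) * (\<Prod>q\<in>{p + 1..n}. F (\<lambda>k. eps p k - eps q k) * F (\<lambda>k. eps p k + eps q k)) =
        (\<Prod>a\<in>free_letters n (take (p - 1) w) - {entry w p}. root_factor t y a (entry w p))"
      unfolding prod_free_letters[OF w p] F[OF p] by (rule arg_cong)
  qed
  ultimately show ?thesis unfolding hl_term_def z_def[symmetric] F_def by (rule arg_cong2)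
qed

lemma bij_betw_signed_perms_words:
  "bij_betw (\<lambda>w. map (\<lambda>i. w (int i)) [1..<n + 1]) (signed_perms n) (words n n)"
  unfolding bij_betw_def
proof (intro conjI inj_onI equalityI subsetI)
  fix v w assume v: "v \<in> signed_perms n" and w: "w \<in> signed_perms n"
    and eq: "map (\<lambda>i. v (int i)) [1..<n + 1] = map (\<lambda>i. w (int i)) [1..<n + 1]"
  have pos: "v (int i) = w (int i)" if "i \<in> {1..n}" for i
  proof -
    have "i \<in> set [1..<n + 1]" using that by (simp del: upt_Suc)
    then show ?thesis using eq unfolding map_eq_conv by blast
  qed
  show "v = w"
  proof
    fix a
    show "v a = w a"
    proof (cases "a \<in> alphabet n")
      case True
      show ?thesis
      proof (cases "0 < a")
        case True
        then have "nat a \<in> {1..n}" using \<open>a \<in> alphabet n\<close> by (simp add: alphabet_def) linarith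
        then show ?thesis using pos[of "nat a"] True by simp
      next
        case False
        then have "nat (- a) \<in> {1..n}" using True by (simp add: alphabet_def) linarith
        then have "v (- a) = w (- a)" using pos[of "nat (- a)"] False by simp
        moreover have "v (- a) = - v a" "w (- a) = - w a" using v w True by (simp_all add: signed_perms_def)
        ultimately show ?thesis by simp
      qed
    next
      case False
      moreover have "v permutes alphabet n" "w permutes alphabet n" using v w by (simp_all add: signed_perms_def)
      ultimately show ?thesis by (simp add: permutes_not_in[where S="alphabet n"])
    qed
  qed
next
  fix u assume "u \<in> (\<lambda>w. map (\<lambda>i. w (int i)) [1..<n + 1]) ` signed_perms n"
  then obtain w where w: "w \<in> signed_perms n" and u: "u = map (\<lambda>i. w (int i)) [1..<n + 1]" by blast
  have pw: "w permutes alphabet n" and uw: "\<And>a. a \<in> alphabet n \<Longrightarrow> w (- a) = - w a" using w by (simp_all add: signed_perms_def)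
  have mem: "int i \<in> alphabet n" if "i \<in> {1..n}" for i using that by (auto simp: alphabet_def)
  have "inj_on (\<lambda>i. \<bar>w (int i)\<bar>) (set [1..<n + 1])"
  proof (rule inj_onI)
    fix i j assume ij: "i \<in> set [1..<n + 1]" "j \<in> set [1..<n + 1]" and eq: "\<bar>w (int i)\<bar> = \<bar>w (int j)\<bar>"
    have "w (- int j) = - w (int j)" by (rule uw[OF mem]) (use ij in auto)
    then have "w (int i) = w (int j) \<or> w (int i) = w (- int j)" using eq by linarith
    then have "int i = int j \<or> int i = - int j" unfolding inj_eq[OF permutes_inj[OF pw]] .
    then show "i = j" using ij by auto
  qed
  then have "distinct (map abs u)" unfolding u map_map o_def distinct_map by simp
  moreover have "set u \<subseteq> alphabet n"
  proof
    fix a assume "a \<in> set u"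
    then obtain i where "i \<in> set [1..<n + 1]" "a = w (int i)" unfolding u set_map by blast
    then have "i \<in> {1..n}" "a = w (int i)" by auto
    then show "a \<in> alphabet n" using permutes_in_image[OF pw] mem by simp
  qed
  ultimately show "u \<in> words n n" by (simp add: words_def u)
next
  fix u assume u: "u \<in> words n n"
  have len: "length u = n" and dist: "distinct (map abs u)" and sub: "set u \<subseteq> alphabet n" using u by (simp_all add: words_def)
  define w where "w = (\<lambda>a. if a \<in> alphabet n then (if 0 < a then entry u (nat a) else - entry u (nat (- a))) else a)"
  have idx: "1 \<le> nat \<bar>a\<bar>" "nat \<bar>a\<bar> \<le> n" if "a \<in> alphabet n" for a using that by (auto simp: alphabet_def)
  have wabs: "\<bar>w a\<bar> = \<bar>entry u (nat \<bar>a\<bar>)\<bar>" if "a \<in> alphabet n" for a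
    using that by (simp add: w_def)
  have mem: "w a \<in> alphabet n" if a: "a \<in> alphabet n" for a
  proof -
    have "nat \<bar>a\<bar> - 1 < length u" using idx[OF a] len by simp
    then have "entry u (nat \<bar>a\<bar>) \<in> alphabet n" using sub nth_mem by blast
    then show ?thesis using wabs[OF a] by (auto simp: alphabet_def)
  qed
  have neg: "w (- a) = - w a" if "a \<in> alphabet n" for a
    using that by (auto simp: w_def alphabet_def)
  have inj: "inj_on w (alphabet n)"
  proof (rule inj_onI)
    fix a b assume a: "a \<in> alphabet n" and b: "b \<in> alphabet n" and eq: "w a = w b"
    have lt: "nat \<bar>a\<bar> - 1 < length (map abs u)" "nat \<bar>b\<bar> - 1 < length (map abs u)"
      using idx[OF a] idx[OF b] len unfolding length_map by linarith+
    have "\<bar>entry u (nat \<bar>a\<bar>)\<bar> = \<bar>entry u (nat \<bar>b\<bar>)\<bar>" using wabs[OF a] wabs[OF b] eq by simp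
    then have "map abs u ! (nat \<bar>a\<bar> - 1) = map abs u ! (nat \<bar>b\<bar> - 1)" using lt by (simp add: nth_map)
    then have "nat \<bar>a\<bar> - 1 = nat \<bar>b\<bar> - 1" using nth_eq_iff_index_eq[OF dist lt] by blast
    then have "\<bar>a\<bar> = \<bar>b\<bar>" using idx[OF a] idx[OF b] by linarith
    then have "b = a \<or> b = - a" by linarith
    moreover have "w a \<noteq> - w a" using mem[OF a] by (simp add: alphabet_def)
    ultimately show "a = b" using eq neg[OF a] by auto
  qed
  have "w permutes alphabet n"
  proof (rule bij_imp_permutes)
    have "w ` alphabet n = alphabet n" by (rule endo_inj_surj[OF finite_alphabet _ inj]) (use mem in blast)
    then show "bij_betw w (alphabet n) (alphabet n)" using inj by (simp add: bij_betw_def)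
    show "w a = a" if "a \<notin> alphabet n" for a using that by (simp add: w_def)
  qed
  then have "w \<in> signed_perms n" using neg by (simp add: signed_perms_def)
  moreover have "u = map (\<lambda>i. w (int i)) [1..<n + 1]"
    by (rule nth_equalityI) (simp_all add: len w_def alphabet_def nat_add_distrib del: upt_Suc)
  ultimately show "u \<in> (\<lambda>w. map (\<lambda>i. w (int i)) [1..<n + 1]) ` signed_perms n" by blast
qed

lemma hall_littlewood_partial_hl:
  assumes y: "generic n (signed_var x)" and \<mu>: "\<And>p. p \<in> {1..n} \<Longrightarrow> \<mu> p = lam p"
  shows "hall_littlewood n lam x t = partial_hl n t \<mu> n [] (signed_var x)"
proof -
  have "hall_littlewood n lam x t = (\<Sum>w\<in>signed_perms n.
      hl_term n lam (\<lambda>p. signed_var x (entry (map (\<lambda>i. w (int i)) [1..<n + 1]) p)) t)"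
    unfolding hall_littlewood_def
  proof (rule sum.cong[OF HOL.refl], rule hl_term_cong)
    fix w :: "int \<Rightarrow> int" and i assume "i \<in> {1..n}"
    then show "signed_var x (w (int i)) = signed_var x (entry (map (\<lambda>i. w (int i)) [1..<n + 1]) i)"
      by (subst nth_map) (auto simp del: upt_Suc)
  qed
  also have "\<dots> = (\<Sum>u\<in>words n n. hl_term n lam (\<lambda>p. signed_var x (entry u p)) t)"
    by (rule sum.reindex_bij_betw[OF bij_betw_signed_perms_words])
  also have "\<dots> = (\<Sum>u\<in>words n n. position_weight \<mu> u (signed_var x) *
    (\<Prod>p = 1..n. \<Prod>a\<in>free_letters n (take (p - 1) u) - {entry u p}. root_factor t (signed_var x) a (entry u p)))"
    by (rule sum.cong[OF HOL.refl], rule hl_term_word[OF y _ \<mu>])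
  also have "\<dots> = partial_hl n t \<mu> n [] (signed_var x)"
    using partial_hl_expand[of "[]" n 0 t \<mu> n "signed_var x"] by (simp add: words_def)
  finally show ?thesis .
qed


section \<open>The generic point\<close>

text \<open>The inverse of a variable is again a Laurent monomial, so the letters have distinct
  monomials as values. This is what makes the variables a generic point.\<close>

lemma signed_var_var_x:
  assumes "a \<noteq> 0"
  shows "signed_var var_x a = Fract (Poly_Mapping.single (Poly_Mapping.single (nat \<bar>a\<bar>) (sgn a)) 1) 1"
proof -
  define m :: "nat \<Rightarrow> int \<Rightarrow> laurent" where "m = (\<lambda>i s. Poly_Mapping.single (Poly_Mapping.single i s) 1)"
  have mm: "m i 1 * m i (- 1) = 1" for i by (simp add: m_def mult_single single_add[symmetric] del: single_one flip: single_one)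
  have nz: "m i s \<noteq> 0" for i s by (simp add: m_def flip: keys_eq_empty)
  show ?thesis
  proof (cases "0 < a")
    case True
    then show ?thesis by (simp add: signed_var_def var_x_def)
  next
    case False
    then have "signed_var var_x a = inverse (Fract (m (nat (- a)) 1) 1)" by (simp add: signed_var_def var_x_def m_def)
    also have "\<dots> = Fract 1 (m (nat (- a)) 1)" by simp
    also have "\<dots> = Fract (m (nat (- a)) (- 1)) 1" using mm[of "nat (- a)"] nz by (simp add: eq_fract mult.commute)
    finally show ?thesis using False assms by (simp add: m_def)
  qed
qed

lemma single_eq_single_iff:
  "Poly_Mapping.single i a = Poly_Mapping.single j b \<longleftrightarrow> (i = j \<and> a = b) \<or> (a = 0 \<and> b = 0)"
proof
  assume eq: "Poly_Mapping.single i a = Poly_Mapping.single j b"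
  have "Poly_Mapping.lookup (Poly_Mapping.single i a) k = Poly_Mapping.lookup (Poly_Mapping.single j b) k" for k
    using eq by simp
  from this[of i] this[of j] show "(i = j \<and> a = b) \<or> (a = 0 \<and> b = 0)"
    by (auto simp: lookup_single when_def split: if_splits)
qed auto

lemma var_x_nonzero: "var_x i \<noteq> 0"
proof -
  have "Poly_Mapping.single (Poly_Mapping.single i 1) 1 \<noteq> (0 :: laurent)" by (simp flip: keys_eq_empty)
  then show ?thesis unfolding var_x_def by (simp add: Zero_fract_def eq_fract)
qed

lemma generic_var_x: "generic n (signed_var var_x)"
  unfolding generic_def
proof (intro conjI ballI inj_onI)
  fix a assume a: "a \<in> alphabet n"
  then have a0: "a \<noteq> 0" by (simp add: alphabet_def)
  have "Poly_Mapping.single (Poly_Mapping.single (nat \<bar>a\<bar>) (sgn a)) 1 \<noteq> (0 :: laurent)" by (simp flip: keys_eq_empty)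
  then show "signed_var var_x a \<noteq> 0"
    unfolding signed_var_var_x[OF a0] by (simp add: Zero_fract_def eq_fract)
  show "signed_var var_x (- a) = inverse (signed_var var_x a)" using a0 by (auto simp: signed_var_def)
next
  fix a b assume ab: "a \<in> alphabet n" "b \<in> alphabet n" and eq: "signed_var var_x a = signed_var var_x b"
  have nz: "a \<noteq> 0" "b \<noteq> 0" using ab by (simp_all add: alphabet_def)
  have "Poly_Mapping.single (Poly_Mapping.single (nat \<bar>a\<bar>) (sgn a)) 1 =
      (Poly_Mapping.single (Poly_Mapping.single (nat \<bar>b\<bar>) (sgn b)) 1 :: laurent)"
    using eq unfolding signed_var_var_x[OF nz(1)] signed_var_var_x[OF nz(2)] by (simp add: eq_fract)
  then have "nat \<bar>a\<bar> = nat \<bar>b\<bar>" "sgn a = sgn b" using nz unfolding single_eq_single_iff sgn_eq_0_iff by simp_all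
  then show "a = b" by (metis abs_ge_zero eq_nat_nat_iff mult_sgn_abs)
qed

lemma var_t_nonzero: "var_t \<noteq> 0"
proof -
  have "Poly_Mapping.single 0 [:0, 1:] \<noteq> (0 :: laurent)" by (simp flip: keys_eq_empty)
  then show ?thesis unfolding var_t_def by (simp add: Zero_fract_def eq_fract)
qed

theorem theorem2p1:
  fixes n :: nat and lam :: "nat \<Rightarrow> nat"
  assumes "2 \<le> n"
    and "\<And>i j. 1 \<le> i \<Longrightarrow> i < j \<Longrightarrow> j \<le> n \<Longrightarrow> lam j < lam i"
    and "0 < lam n"
  shows "hall_littlewood n lam var_x var_t =
    (\<Sum>\<sigma> \<in> fillings n lam.
       var_t ^ N_fill n \<sigma> * (1 - var_t) ^ des_fill n \<sigma> * monomial n var_x (ct n lam \<sigma>))"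
proof -
  define y :: "int \<Rightarrow> laurent fract" where "y = signed_var var_x"
  define t where "t = var_t"
  have y: "generic n y" unfolding y_def by (rule generic_var_x)
  have t: "t \<noteq> 0" unfolding t_def by (rule var_t_nonzero)
  have x: "var_x v \<noteq> 0" for v
    by (rule var_x_nonzero)
  define L where "L = lam 1"
  have lamL: "lam p \<le> L" if "p \<in> {1..n}" for p
    using assms(2)[of 1 p] that by (cases "p = 1") (auto simp: L_def)
  have L1: "1 \<le> L" using lamL[of n] assms by simp
  have iff: "p \<le> conj_part n lam i \<longleftrightarrow> i \<le> lam p" if "1 \<le> p" "p \<le> n" for p i
    using conj_part_iff[of n lam p i] assms(2) that by blast
  \<comment> \<open>The first part is strictly larger than the second, so the leftmost block has
    height one.\<close>
  have c: "conj_part n lam L = 1"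
    using iff[of 1 L] iff[of 2 L] assms(1) assms(2)[of 1 2] by (simp add: L_def)
  have main: "equivariant n t 1 (block_sum n lam t L)"
    "\<And>y. generic n y \<Longrightarrow> block_sum n lam t L (id_word 1) y = partial_hl n t (capped_part n lam L) (n - 1) (id_word 1) y"
  proof -
    have "equivariant n t (conj_part n lam L) (block_sum n lam t L) \<and>
      (\<forall>y. generic n y \<longrightarrow> block_sum n lam t L (id_word (conj_part n lam L)) y =
        partial_hl n t (capped_part n lam L) (n - conj_part n lam L) (id_word (conj_part n lam L)) y)"
      by (rule block_sum_main) (use assms t L1 L_def in simp_all)
    then show "equivariant n t 1 (block_sum n lam t L)"
      "\<And>y. generic n y \<Longrightarrow> block_sum n lam t L (id_word 1) y = partial_hl n t (capped_part n lam L) (n - 1) (id_word 1) y"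
      unfolding c by blast+
  qed
  have lab: "labels n lam = block_labels n lam L" by (simp add: labels_def block_labels_def L_def)
  have "(\<Sum>\<sigma> \<in> fillings n lam. t ^ N_fill n \<sigma> * (1 - t) ^ des_fill n \<sigma> * monomial n var_x (ct n lam \<sigma>)) =
      (\<Sum>\<sigma> \<in> fillings n lam. fill_weight n t (label_weight n lam y) (labels n lam) \<sigma>)"
    unfolding fill_weight_def y_def
    by (rule sum.cong[OF HOL.refl]) (use prod_list_label_weight[of n _ lam var_x] x assms(1) in simp)
  also have "\<dots> = (\<Sum>C\<in>words n (conj_part n lam (block_of (hd (labels n lam)))). block_sum n lam t L C y)"
    unfolding fillings_eq_fill_set block_sum_def lab[symmetric]
    by (rule sum_fill_set) (use hd_block_labels(1)[OF L1, of n lam] c lab in simp)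
  also have "\<dots> = (\<Sum>C\<in>words n 1. block_sum n lam t L C y)"
    unfolding lab using hd_block_labels(2)[OF L1, of n lam] c by simp
  \<comment> \<open>The empty word is \<open>id_word 0\<close>, so summing over the first column of
    the filling is one more loss of an entry.\<close>
  also have "\<dots> = extend_op n (\<lambda>w. block_sum n lam t L w y) (id_word 0)"
  proof -
    have "words n 1 = (\<lambda>e. [e]) ` alphabet n" by (auto simp: words_def length_Suc_conv)
    then have "(\<Sum>C\<in>words n 1. block_sum n lam t L C y) = (\<Sum>e\<in>alphabet n. block_sum n lam t L [e] y)"
      by (simp add: sum.reindex inj_on_def)
    then show ?thesis by (simp add: extend_op_def id_word_def)
  qed
  also have "\<dots> = partial_hl n t (capped_part n lam L) (Suc (n - 1)) (id_word 0) y"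
    by (rule extend_op_id_word[OF _ _ _ y]) (use main assms(1) in auto)
  also have "\<dots> = partial_hl n t (capped_part n lam L) n [] y"
    using assms(1) by (simp add: id_word_def del: partial_hl.simps)
  \<comment> \<open>No part exceeds \<open>L\<close>, so the capped exponents are the parts
    themselves.\<close>
  also have "\<dots> = hall_littlewood n lam var_x t"
    unfolding y_def by (rule hall_littlewood_partial_hl[symmetric, OF generic_var_x])
      (use lamL in \<open>simp add: capped_part_def\<close>)
  finally show ?thesis unfolding t_def by (rule sym)
qed

end
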